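(* Let $\mathcal{M}$ be a moon polyomino with $m$ columns, $\mathbf{s}$ an $m$-tuple of nonnegative integers and $A$ a subset of the rows of $\mathcal{M}$. Let $\mathcal{N}$ be the left-aligned stack polyomino obtained from $\mathcal{M}$ by the algorithm $\alpha$, let $\mathbf{s}'$ be the corresponding rearrangement of $\mathbf{s}$, let $f,g:\mathbf{F}(\mathcal{M},\mathbf{s};A)\to\mathbf{F}(\mathcal{N},\mathbf{s}';A)$ be the maps defined in the context, and let $\phi:\mathbf{F}(\mathcal{N},\mathbf{s}';A)\to\mathbf{F}(\mathcal{N},\mathbf{s}';A)$ be the Foata-type map defined in the context. Then $$\psi=g^{-1}\circ\phi\circ f:\mathbf{F}(\mathcal{M},\mathbf{s};A)\to\mathbf{F}(\mathcal{M},\mathbf{s};A)$$ is a bijection with the property $$\mathrm{maj}(M)=\mathrm{ne}(\psi(M))\quad\text{for all } M\in\mathbf{F}(\mathcal{M},\mathbf{s};A).$$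
   Context: **Polyominoes.** A polyomino is a finite subset of $\mathbb{Z}^2$ whose elements are drawn as square cells. It is convex if its intersection with any row or column is connected, and intersection-free if any two of its columns are comparable, i.e. the set of row-coordinates of one is contained in that of the other (equivalently, any two rows are comparable). A moon polyomino is a convex intersection-free polyomino. A moon polyomino whose rows are left-aligned is a left-aligned stack polyomino; a moon polyomino whose rows are left-aligned and columns are top-aligned is a Ferrers diagram. Columns are labelled $c_1,\dots,c_m$ from left to right. **Fillings.** A filling of a moon polyomino $\mathcal{M}$ assigns $0$ or $1$ to each cell with at most one $1$ in each row; a 1-cell is a cell assigned $1$; a row is empty if it contains no 1-cell. $\mathbf{F}(\mathcal{M},\mathbf{s};A)$ is the set of fillings of $\mathcal{M}$ whose empty rows are exactly those in $A$ and in which column $c_i$ has exactly $s_i$ 1's for each $i$. An NE chain is a pair of 1-cells, one strictly above and strictly to the right of the other, such that the smallest rectangle containing them is contained in $\mathcal{M}$; $\mathrm{ne}(M)$ is the number of NE chains. **Major index.** For a filling $R$ of a rectangle with nonempty rows $r_1,\dots,r_n$ from top to bottom, $\mathrm{des}(R)$ is the number of $i$ such that the 1-cells of $r_i$ and $r_{i+1}$ form an NE chain; $R(r_i)$ is the restriction of $R$ to the row $r_i$ and all rows above it; $\mathrm{maj}(R)=\sum_{i=1}^n\mathrm{des}(R(r_i))$. For a filling $M$ of a moon polyomino $\mathcal{M}$, let $\mathcal{R}_1,\dots,\mathcal{R}_r$ be all the maximal rectangles contained in $\mathcal{M}$, ordered increasingly by height, and $R_i$ the restriction of $M$ to $\mathcal{R}_i$.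 Then $\mathrm{maj}(M)=\sum_{i=1}^r\mathrm{maj}(R_i)-\sum_{i=1}^{r-1}\mathrm{maj}(R_i\cap R_{i+1})$. **Algorithm $\alpha$.** Set $\mathcal{M}'=\mathcal{M}$. While $\mathcal{M}'$ is not left-aligned, let $\mathcal{R}$ be the largest rectangle contained in $\mathcal{M}'$ that contains the leftmost column of $\mathcal{M}'$, and replace $\mathcal{M}'$ by the polyomino obtained by moving this leftmost column (keeping its row-coordinates) to the right end of $\mathcal{R}$. The final $\mathcal{M}'$ is $\mathcal{N}$, the left-aligned stack polyomino with the same row lengths as $\mathcal{M}$ from top to bottom. $\mathbf{s}'$ is $\mathbf{s}$ rearranged in the same way as the columns. **The transformation $\tau$ on a filling $R$ of a rectangle.** Let the 1-cells of the first column be $C_1,\dots,C_k$ from top to bottom. An ascent is a pair of 1's in two consecutive nonempty rows that does not form an NE chain; a descent is such a pair that forms an NE chain. (1) Let $R^*$ be $R$ with one empty column added on the right. (2) For $r=k,k-1,\dots,1$: let $D_a$ be the lowest 1-cell above $C_r$ in $R^*$ and $D_b$ the highest 1-cell below $C_r$ in $R^*$. (a) If $D_a$ does not exist or $D_a=C_{r-1}$, and $D_b$ does not exist, move $C_r$ horizontally to the last column of $R^*$. (b) If ($D_a$ does not exist or $D_a=C_{r-1}$, but $D_b$ exists), or (both exist and $D_a$ is strictly to the right of $D_b$): let $D_1=C_r,D_2=D_b,D_3,\dots,D_p$ be the maximal chain of consecutive ascents in $R^*$ going down from $C_r$; move $D_i$ horizontally to the column of $D_{i+1}$ for $i=1,\dots,p-1$,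 and $D_p$ horizontally to the last column of $R^*$ (it stays if already there). (c) If $D_a$ exists, $D_a\neq C_{r-1}$, and ($D_a$ is weakly to the left of $D_b$ or $D_b$ does not exist): let $D_1=C_r,D_2=D_a,D_3,\dots,D_p$ be the maximal chain of consecutive descents in $R^*$ going up from $C_r$; move $D_i$ horizontally to the column of $D_{i+1}$ for $i=1,\dots,p-1$, and $D_p$ horizontally to the last column of $R^*$. (3) Delete the first column of $R^*$. **The map $f$.** Perform $\alpha$ on $\mathcal{M}$ together with the filling; at each step, replace the filling $R$ of $\mathcal{R}$ by $\tau(R)$ on the rectangle obtained after moving the column, leaving 1's outside $\mathcal{R}$ in their (relabelled) rows and columns. $f(M)$ is the resulting filling of $\mathcal{N}$. **The map $g$.** Perform $\alpha$; at each step, change the filling $R$ of $\mathcal{R}$ as follows, leaving 1's outside $\mathcal{R}$ in their rows and columns. Let $C_1,\dots,C_k$ be the 1-cells of the first column of $R$ from top to bottom. Shade the empty rows of $R$ and the cells of $R$ to the right of $C_1,\dots,C_k$. Let $l_i$ be the number of empty white (unshaded) cells in the first column above $C_i$. On the rectangle $\mathcal{R}'$ obtained by moving the first column to the last place, define $R'$: the rows that were empty remain empty and are shaded; write $k$ 1's in the last column, in unshaded rows, so that there are $l_i$ white empty cells of that column below the $i$-th 1 counted from the bottom, $1\le i\le k$; shade the cells to the left of these 1's; fill the remaining unshaded rows so that the unshaded part of $R'$ to the left of the last column equals the unshaded part of $R$ to the right of the first column. $g(M)$ is the resulting filling of $\mathcal{N}$. **Swapping.** Swapping 1-cells at (row,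 column) positions $(i_1,j_1)$ and $(i_2,j_2)$ means deleting these two 1's and writing 1's at $(i_1,j_2)$ and $(i_2,j_1)$. $col(D)$ is the column of a cell $D$, $|col(D)|$ its length. **The algorithm $\gamma_r$.** Let $G$ be a filling without empty rows of a Ferrers diagram, and $r$ a row (left-aligned, at least as long as the top row of $G$) placed on top of $G$, with 1-cell $C$. Let $\mathcal{R}$ be the set of rows of $G$ that intersect the column of $C$. 1-cells in $\mathcal{R}$ strictly to the left of $C$ are called left; those weakly to the right of $C$ are called right. Let $CLC$ be the topmost left 1-cell and $CRC$ the leftmost right 1-cell above $CLC$ (the lowest such if there are several). $\mathcal{R}_1$ is the set of rows weakly below the row of $CRC$ that intersect the column of $CRC$; $\mathcal{R}_2$ is the set of rows in $\mathcal{R}$ that do not intersect the column of $CRC$. If $CLC$ does not exist, $\mathcal{R}_1=\mathcal{R}_2=\emptyset$; if $CLC$ exists but $CRC$ does not, $\mathcal{R}_1=\emptyset$ and $\mathcal{R}_2$ is the set of rows in $\mathcal{R}$ weakly below $CLC$. First perform $\gamma_r^1$ on $\mathcal{R}_1$, then $\gamma_r^2$ on $\mathcal{R}_2$ (each does nothing if its set of rows is empty). $\gamma_r^1$: (A) Set $ptr_1$ on the highest row of $\mathcal{R}_1$ and $ptr_2$ on the next row of $\mathcal{R}_1$ below. (B) If $ptr_2$ is null, stop. Otherwise let $C_1,C_2$ be the 1-cells in the rows of $ptr_1,ptr_2$. (B1) If $C_2$ is left, swap $C_1$ and $C_2$ and move $ptr_1$ to the row of $ptr_2$. (B2) If $C_2$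 is right: (B2.1) if $|col(C_1)|=|col(C_2)|$, move $ptr_1$ to the row of $ptr_2$; (B2.2) if $C_1$ is to the left of $C_2$ and $|col(C_1)|>|col(C_2)|$, do nothing; (B2.3) if $C_1$ is to the right of $C_2$ and $|col(C_1)|<|col(C_2)|$, let $L$ be the lowest left 1-cell above $C_1$; if $L,C_1,C_2$ are at $(i_1,j_1),(i_2,j_2),(i_3,j_3)$, delete these three 1's and write 1's at $(i_1,j_3),(i_2,j_1),(i_3,j_2)$; move $ptr_1$ to the row of $ptr_2$. (C) Move $ptr_2$ to the next row of $\mathcal{R}_1$ below and go to (B). $\gamma_r^2$: (A$'$) Set $ptr_1$ on the highest row of $\mathcal{R}_2$ and $ptr_2$ on the next row of $\mathcal{R}_2$ below. (B$'$) (Borrowing) If $ptr_1$ points to a right 1-cell, find the lowest left 1-cell above it and swap them. (C$'$) If $ptr_2$ is null, stop. Otherwise let $C_1,C_2$ be the 1-cells in the rows of $ptr_1,ptr_2$; if $C_2$ is right, swap $C_1$ and $C_2$; if $C_2$ is left, do nothing. (D$'$) Move $ptr_1$ to the row of $ptr_2$ and $ptr_2$ to the next row of $\mathcal{R}_2$ below; go to (C$'$). **The map $\phi$ on fillings of left-aligned stack polyominoes.** Empty rows are deleted first and reinserted at the end. For a filling $M$ without empty rows: if $M$ has one row, $\phi(M)=M$. Otherwise let $r$ be the top row of $M$, $\mathcal{F}$ the maximal Ferrers diagram contained in the shape that contains the top row, and $\mathcal{F}_1$ be $\mathcal{F}$ without its top row. Let $M_1=M\setminus r$ and $M_1'=\phi(M_1)$;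 apply $\gamma_r$ to $M_1'\cap\mathcal{F}_1$ (ignoring rows of $\mathcal{F}_1$ containing no 1 of $M_1'\cap\mathcal{F}_1$), leaving the rest of $M_1'$ unchanged, to get $M_2$; $\phi(M)$ is $M_2$ with the row $r$ added back on top. *)

theory Defs
  imports Main "HOL-Library.While_Combinator"
begin

text \<open>
  Matrix coordinates: the cell \<open>(i, j)\<close> is in row \<open>i\<close> and column \<open>j\<close>, rows are numbered from top to
  bottom and columns from left to right. A \<open>0\<close>-\<open>1\<close> filling is represented by the set of its 1-cells.
\<close>

type_synonym cell = "int \<times> int"

section \<open>Moon polyominoes\<close>

definition rows :: "cell set \<Rightarrow> int set" where
  "rows P = fst ` P"

definition cols :: "cell set \<Rightarrow> int set" where
  "cols P = snd ` P"

definition row :: "cell set \<Rightarrow> int \<Rightarrow> int set" where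
  "row P i = P `` {i}"

definition column :: "cell set \<Rightarrow> int \<Rightarrow> int set" where
  "column P j = P\<inverse> `` {j}"

definition contiguous :: "int set \<Rightarrow> bool" where
  "contiguous S \<longleftrightarrow> (\<forall>a\<in>S. \<forall>b\<in>S. {a..b} \<subseteq> S)"

definition convex_polyomino :: "cell set \<Rightarrow> bool" where
  "convex_polyomino P \<longleftrightarrow>
     (\<forall>i\<in>rows P. contiguous (row P i)) \<and> (\<forall>j\<in>cols P. contiguous (column P j))"

definition intersection_free :: "cell set \<Rightarrow> bool" where
  "intersection_free P \<longleftrightarrow>
     (\<forall>j\<in>cols P. \<forall>j'\<in>cols P. column P j \<subseteq> column P j' \<or> column P j' \<subseteq> column P j)"

definition moon_polyomino :: "cell set \<Rightarrow> bool" where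
  "moon_polyomino P \<longleftrightarrow> finite P \<and> convex_polyomino P \<and> intersection_free P"

definition left_aligned :: "cell set \<Rightarrow> bool" where
  "left_aligned P \<longleftrightarrow> (\<forall>i\<in>rows P. Min (row P i) = Min (cols P))"

definition rectangle :: "cell set \<Rightarrow> bool" where
  "rectangle Q \<longleftrightarrow> Q \<noteq> {} \<and> (\<exists>a b c d. Q = {a..b} \<times> {c..d})"

section \<open>Fillings, NE chains and the major index\<close>

definition filling :: "cell set \<Rightarrow> cell set \<Rightarrow> bool" where
  "filling P M \<longleftrightarrow> M \<subseteq> P \<and> (\<forall>i\<in>rows P. card (row M i) \<le> 1)"

definition fillings :: "cell set \<Rightarrow> nat list \<Rightarrow> int set \<Rightarrow> cell set set" where
  "fillings P s A = {M. filling P M \<and> rows P - rows M = A \<and>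
     (\<forall>k<length s. card (column M (sorted_list_of_set (cols P) ! k)) = s ! k)}"

text \<open>The column of the 1-cell in a nonempty row; 1-cells are often referred to by their rows below.\<close>

definition col_at :: "cell set \<Rightarrow> int \<Rightarrow> int" where
  "col_at M i = the_elem (row M i)"

text \<open>The first argument of \<open>ne_chain P\<close> is the upper 1-cell, so each chain is one ordered pair.\<close>

definition ne_chain :: "cell set \<Rightarrow> cell \<Rightarrow> cell \<Rightarrow> bool" where
  "ne_chain P C D \<longleftrightarrow> fst C < fst D \<and> snd D < snd C \<and> {fst C..fst D} \<times> {snd D..snd C} \<subseteq> P"

definition ne :: "cell set \<Rightarrow> cell set \<Rightarrow> nat" where
  "ne P M = card {(C, D) \<in> M \<times> M. ne_chain P C D}"

definition des :: "cell set \<Rightarrow> cell set \<Rightarrow> nat" where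
  "des Q R = card {(C, D) \<in> R \<times> R. ne_chain Q C D \<and> rows R \<inter> {fst C<..<fst D} = {}}"

definition maj_rect :: "cell set \<Rightarrow> cell set \<Rightarrow> nat" where
  "maj_rect Q R = (\<Sum>i\<in>rows R. des Q {C \<in> R. fst C \<le> i})"

definition max_rectangles :: "cell set \<Rightarrow> cell set set" where
  "max_rectangles P = {Q. rectangle Q \<and> Q \<subseteq> P \<and>
     (\<forall>Q'. rectangle Q' \<and> Q' \<subseteq> P \<and> Q \<subseteq> Q' \<longrightarrow> Q' = Q)}"

text \<open>In a moon polyomino distinct maximal rectangles have distinct heights.\<close>

definition max_rectangle_list :: "cell set \<Rightarrow> cell set list" where
  "max_rectangle_list P = sorted_key_list_of_set (\<lambda>Q. card (rows Q)) (max_rectangles P)"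

definition maj :: "cell set \<Rightarrow> cell set \<Rightarrow> int" where
  "maj P M = (let Q = max_rectangle_list P; r = length Q in
     (\<Sum>i<r. int (maj_rect (Q ! i) (M \<inter> Q ! i)))
     - (\<Sum>i<r - 1. int (maj_rect (Q ! i \<inter> Q ! Suc i) (M \<inter> (Q ! i \<inter> Q ! Suc i)))))"

section \<open>The algorithm \<open>\<alpha>\<close>\<close>

definition first_col :: "cell set \<Rightarrow> int" where
  "first_col P = Min (cols P)"

definition lead_rect :: "cell set \<Rightarrow> cell set" where
  "lead_rect P =
     (GREATEST Q. rectangle Q \<and> Q \<subseteq> P \<and> column P (first_col P) \<times> {first_col P} \<subseteq> Q)"

definition last_col :: "cell set \<Rightarrow> int" where
  "last_col P = Max (cols (lead_rect P))"

text \<open>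
  Moving column \<open>l\<close> to the right end of a rectangle with columns \<open>l, \<dots>, z\<close>: it becomes column \<open>z\<close> and the
  columns \<open>l + 1, \<dots>, z\<close> are relabelled \<open>l, \<dots>, z - 1\<close>.
\<close>

definition move_cell :: "int \<Rightarrow> int \<Rightarrow> cell \<Rightarrow> cell" where
  "move_cell l z = (\<lambda>(i, j). (i, if j = l then z else if l < j \<and> j \<le> z then j - 1 else j))"

definition move_column :: "cell set \<Rightarrow> cell set" where
  "move_column P = move_cell (first_col P) (last_col P) ` P"

definition move_entry :: "cell set \<Rightarrow> 'a list \<Rightarrow> 'a list" where
  "move_entry P s = (let w = card (cols (lead_rect P)) in
     take (w - 1) (tl s) @ [hd s] @ drop w s)"

text \<open>\<open>\<alpha>\<close> carrying along data that is updated at each step.\<close>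

definition run_alpha :: "(cell set \<Rightarrow> 'a \<Rightarrow> 'a) \<Rightarrow> cell set \<Rightarrow> 'a \<Rightarrow> cell set \<times> 'a" where
  "run_alpha upd P x =
     while (\<lambda>(P', _). \<not> left_aligned P') (\<lambda>(P', y). (move_column P', upd P' y)) (P, x)"

definition alpha :: "cell set \<Rightarrow> nat list \<Rightarrow> cell set \<times> nat list" where
  "alpha P s = run_alpha move_entry P s"

text \<open>
  \<open>T l z R\<close> is the new filling, on the columns \<open>l, \<dots>, z\<close>, that replaces the filling \<open>R\<close> of the
  rectangle with columns \<open>l, \<dots>, z\<close>.
\<close>

definition replace_rect :: "(int \<Rightarrow> int \<Rightarrow> cell set \<Rightarrow> cell set) \<Rightarrow> cell set \<Rightarrow> cell set \<Rightarrow> cell set" where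
  "replace_rect T P M = (let l = first_col P; z = last_col P; Q = lead_rect P in
     move_cell l z ` (M - Q) \<union> T l z (M \<inter> Q))"

section \<open>The transformation \<open>\<tau>\<close> and the map \<open>f\<close>\<close>

definition row_above :: "cell set \<Rightarrow> int \<Rightarrow> int option" where
  "row_above R c = (let U = {i \<in> rows R. i < c} in if U = {} then None else Some (Max U))"

definition row_below :: "cell set \<Rightarrow> int \<Rightarrow> int option" where
  "row_below R c = (let U = {i \<in> rows R. c < i} in if U = {} then None else Some (Min U))"

text \<open>The longest prefix of a list whose successive elements are related.\<close>

fun chain_prefix :: "('a \<Rightarrow> 'a \<Rightarrow> bool) \<Rightarrow> 'a list \<Rightarrow> 'a list" where
  "chain_prefix r [] = []"
| "chain_prefix r [x] = [x]"
| "chain_prefix r (x # y # xs) = (if r x y then x # chain_prefix r (y # xs) else [x])"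

text \<open>
  In a rectangle, 1-cells in two rows form an NE chain iff the upper one is strictly to the right of
  the lower one.
\<close>

definition ascents_down :: "cell set \<Rightarrow> int \<Rightarrow> int list" where
  "ascents_down R c = chain_prefix (\<lambda>x y. col_at R x \<le> col_at R y)
     (sorted_list_of_set {i \<in> rows R. c \<le> i})"

definition descents_up :: "cell set \<Rightarrow> int \<Rightarrow> int list" where
  "descents_up R c = chain_prefix (\<lambda>x y. col_at R x < col_at R y)
     (rev (sorted_list_of_set {i \<in> rows R. i \<le> c}))"

text \<open>
  \<open>D\<^sub>1, \<dots>, D\<^sub>p\<close> are the 1-cells in the rows \<open>ds\<close>; each \<open>D\<^sub>i\<close> moves to the column of \<open>D\<^sub>i\<^sub>+\<^sub>1\<close>, and \<open>D\<^sub>p\<close> to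
  column \<open>z\<close>.
\<close>

definition push_along :: "int \<Rightarrow> int list \<Rightarrow> cell set \<Rightarrow> cell set" where
  "push_along z ds R =
     {C \<in> R. fst C \<notin> set ds} \<union> set (zip ds (tl (map (col_at R) ds) @ [z]))"

text \<open>\<open>c\<close> is the row of \<open>C\<^sub>r\<close>, \<open>c'\<close> that of \<open>C\<^sub>r\<^sub>-\<^sub>1\<close> (if \<open>r > 1\<close>), \<open>z\<close> the last column of \<open>R\<^sup>*\<close>.\<close>

definition tau_step :: "int \<Rightarrow> int option \<Rightarrow> int \<Rightarrow> cell set \<Rightarrow> cell set" where
  "tau_step z c' c R = (let a = row_above R c; b = row_below R c in
     if (a = None \<or> a = c') \<and> b = None
       then push_along z [c] R
     else if (a = None \<or> a = c') \<and> b \<noteq> None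
          \<or> a \<noteq> None \<and> b \<noteq> None \<and> col_at R (the b) < col_at R (the a)
       then push_along z (ascents_down R c) R
     else push_along z (descents_up R c) R)"

text \<open>
  \<open>R\<^sup>*\<close> has the columns \<open>l, \<dots>, z + 1\<close>; once its first column is deleted, the remaining columns
  are relabelled \<open>l, \<dots>, z\<close>.
\<close>

definition tau :: "int \<Rightarrow> int \<Rightarrow> cell set \<Rightarrow> cell set" where
  "tau l z R = (let cs = sorted_list_of_set (column R l);
       R' = fold (\<lambda>r. tau_step (z + 1) (if r = 0 then None else Some (cs ! (r - 1))) (cs ! r))
              (rev [0..<length cs]) R
     in (\<lambda>(i, j). (i, j - 1)) ` {C \<in> R'. snd C \<noteq> l})"

definition f_map :: "cell set \<Rightarrow> cell set \<Rightarrow> cell set" where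
  "f_map P M = snd (run_alpha (replace_rect tau) P M)"

section \<open>The map \<open>g\<close>\<close>

text \<open>
  The white cells of the first column are those in nonempty rows; \<open>K\<close> and \<open>K'\<close> are the sets of rows
  of the 1-cells in the first column of \<open>R\<close> and in the last column of \<open>R'\<close>.
\<close>

definition g_last_rows :: "int set \<Rightarrow> int set \<Rightarrow> int set" where
  "g_last_rows W K = (THE K'. K' \<subseteq> W \<and> card K' = card K \<and>
     (\<forall>i<card K. card {x \<in> W - K'. rev (sorted_list_of_set K') ! i < x}
                = card {x \<in> W - K. x < sorted_list_of_set K ! i}))"

definition g_rect :: "int \<Rightarrow> int \<Rightarrow> cell set \<Rightarrow> cell set" where
  "g_rect l z R = (let W = rows R; K = column R l; K' = g_last_rows W K in
     K' \<times> {z} \<union>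
     set (zip (sorted_list_of_set (W - K'))
              (map (\<lambda>i. col_at R i - 1) (sorted_list_of_set (W - K)))))"

definition g_map :: "cell set \<Rightarrow> cell set \<Rightarrow> cell set" where
  "g_map P M = snd (run_alpha (replace_rect g_rect) P M)"

section \<open>The algorithm \<open>\<gamma>\<^sub>r\<close>\<close>

text \<open>
  \<open>H\<close> is the Ferrers diagram of the filling \<open>G\<close> without empty rows, and \<open>c\<close> is the column of the
  1-cell \<open>C\<close> of \<open>r\<close>. Thus \<open>column H c\<close> is the set of rows \<open>\<R>\<close>, and a 1-cell in one of these rows is left
  or right according to whether its column is \<open>< c\<close> or \<open>\<ge> c\<close>.

  Rows removed from a polyomino here and below are not renumbered, so the row labels of \<open>H\<close> may have gaps;
  ``next row'' always refers to the rows that remain.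
\<close>

definition swap :: "int \<Rightarrow> int \<Rightarrow> cell set \<Rightarrow> cell set" where
  "swap p q G = {D \<in> G. fst D \<noteq> p \<and> fst D \<noteq> q} \<union> {(p, col_at G q), (q, col_at G p)}"

definition lowest_left_above :: "cell set \<Rightarrow> int \<Rightarrow> cell set \<Rightarrow> int \<Rightarrow> int" where
  "lowest_left_above H c G x = Max {i \<in> column H c. i < x \<and> col_at G i < c}"

text \<open>Returns \<open>(\<R>\<^sub>1, \<R>\<^sub>2)\<close>; \<open>clc\<close> and \<open>crc\<close> are the rows of \<open>CLC\<close> and \<open>CRC\<close>, and \<open>j\<close> is the column of \<open>CRC\<close>.\<close>

definition gamma_rows :: "cell set \<Rightarrow> int \<Rightarrow> cell set \<Rightarrow> int set \<times> int set" where
  "gamma_rows H c G = (let L = {i \<in> column H c. col_at G i < c} in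
     if L = {} then ({}, {})
     else let clc = Min L; U = {i \<in> column H c. c \<le> col_at G i \<and> i < clc} in
       if U = {} then ({}, {i \<in> column H c. clc \<le> i})
       else let j = Min (col_at G ` U); crc = Max {i \<in> U. col_at G i = j} in
         ({i \<in> column H j. crc \<le> i}, column H c - column H j))"

text \<open>
  The second last argument is \<open>ptr\<^sub>1\<close>; the list contains the rows from \<open>ptr\<^sub>2\<close> downwards. As the
  column lengths of a Ferrers diagram decrease weakly to the right, the last case is the one where
  \<open>j2 < j1\<close> and \<open>h1 < h2\<close>.
\<close>

fun gamma1_loop :: "cell set \<Rightarrow> int \<Rightarrow> cell set \<Rightarrow> int \<Rightarrow> int list \<Rightarrow> cell set" where
  "gamma1_loop H c G p [] = G"
| "gamma1_loop H c G p (q # qs) =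
    (let j1 = col_at G p; j2 = col_at G q;
         h1 = card (column H j1); h2 = card (column H j2) in
     if j2 < c then gamma1_loop H c (swap p q G) q qs
     else if h1 = h2 then gamma1_loop H c G q qs
     else if j1 < j2 \<and> h1 > h2 then gamma1_loop H c G p qs
     else let x = lowest_left_above H c G p in
       gamma1_loop H c ({D \<in> G. fst D \<notin> {x, p, q}} \<union> {(x, j2), (p, col_at G x), (q, j1)}) q qs)"

fun gamma1 :: "cell set \<Rightarrow> int \<Rightarrow> int list \<Rightarrow> cell set \<Rightarrow> cell set" where
  "gamma1 H c [] G = G"
| "gamma1 H c (p # qs) G = gamma1_loop H c G p qs"

fun gamma2_loop :: "int \<Rightarrow> cell set \<Rightarrow> int \<Rightarrow> int list \<Rightarrow> cell set" where
  "gamma2_loop c G p [] = G"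
| "gamma2_loop c G p (q # qs) =
    gamma2_loop c (if c \<le> col_at G q then swap p q G else G) q qs"

fun gamma2 :: "cell set \<Rightarrow> int \<Rightarrow> int list \<Rightarrow> cell set \<Rightarrow> cell set" where
  "gamma2 H c [] G = G"
| "gamma2 H c (p # qs) G =
    gamma2_loop c (if c \<le> col_at G p then swap (lowest_left_above H c G p) p G else G) p qs"

definition gamma :: "cell set \<Rightarrow> int \<Rightarrow> cell set \<Rightarrow> cell set" where
  "gamma H c G = (let (R1, R2) = gamma_rows H c G in
     gamma2 H c (sorted_list_of_set R2) (gamma1 H c (sorted_list_of_set R1) G))"

section \<open>The map \<open>\<phi>\<close>\<close>

text \<open>
  The maximal Ferrers diagram in a left-aligned stack polyomino that contains the top row: the cells
  above which no cell is missing, up to the top row.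
\<close>

definition ferrers_part :: "cell set \<Rightarrow> cell set" where
  "ferrers_part P = {(i, j) \<in> P. \<forall>i'\<in>rows P. i' \<le> i \<longrightarrow> (i', j) \<in> P}"

text \<open>The list contains the rows of \<open>P\<close>, all of them nonempty in \<open>M\<close>, from top to bottom.\<close>

fun phi_rows :: "int list \<Rightarrow> cell set \<Rightarrow> cell set \<Rightarrow> cell set" where
  "phi_rows [] P M = M"
| "phi_rows [r] P M = M"
| "phi_rows (r # r' # rs) P M =
    (let M1 = phi_rows (r' # rs) {D \<in> P. fst D \<noteq> r} {D \<in> M. fst D \<noteq> r};
         F1 = {D \<in> ferrers_part P. fst D \<noteq> r};
         G = M1 \<inter> F1;
         H = {D \<in> F1. fst D \<in> rows G}
     in (M1 - F1) \<union> gamma H (col_at M r) G \<union> {D \<in> M. fst D = r})"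

definition phi :: "cell set \<Rightarrow> cell set \<Rightarrow> cell set" where
  "phi P M = phi_rows (sorted_list_of_set (rows M)) {D \<in> P. fst D \<in> rows M} M"

end

(*
  Write a filling as a word: w i is the column of the 1-cell in row i.  The maximal rectangles of a moon
  polyomino, ordered by height, have increasing sets of rows and decreasing sets of columns, so maj telescopes
  into a number of pairs of rows r < e, just as ne is one.  Such a pair requires both corners (e, w r) and (r, w e) to lie in the polyomino; it counts for ne if w e < w r,
  and for maj if the first entry after w r that lies in the columns common to rows r and e is smaller than w r.

  On the leading rectangle both tau and g keep the subword of the entries that are not in the first
  column; the entries in the first column become entries in the last column and change their rows.  Hence
  the pairs that involve a row outside the rectangle correspond to each other under the monotone bijection
  between the kept entries.  For pairs inside the rectangle, tau keeps every descent in place, and g reverses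
  the set of rows of the entries in question, which keeps the number of inversions.  So f is injective and
  preserves maj, and g is bijective and preserves ne.

  For phi one adds the rows from bottom to top.  The new top row raises maj by the number of rows in R_2
  and ne by the number of left entries, so gamma_r has to change ne by the difference of the two numbers:
  a step of gamma^1 at a left entry changes it by -1 and any other step of gamma^1 by 0, while a swap of
  gamma^2 and the borrowing change it by +1.  Each step can be undone, and where R_1 ends can be read off
  the result, so phi is injective.  Then psi is an injective map of a finite set to itself.
*)

theory Submission
  imports Defs
begin

text \<open>Equality of maj and ne is too weak an induction hypothesis for \<open>phi\<close>. A new
  top row raises maj by an amount read off the original word, whereas \<open>gamma\<close> acts on
  the word that \<open>phi\<close> has already produced below it. In a left-aligned shape the
  columns common to two rows form an initial segment. So the raise depends on the lower word in two
  ways only: through the topmost entry that is at most u, for each bound u, and through the number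
  of entries that stick out beyond the new row. Hence \<open>istop\<close> and \<open>counts\<close>
  are carried along as invariants of \<open>phi\<close>. The set R_1 starts at CRC. The proof lets
  gamma^1 run over the whole column K of CRC instead: down to CRC its steps change nothing, the map
  then depends on the word and K alone, and K can be recovered from the result. Surjectivity is
  proved separately for g, because its inverse enters psi; for f and \<open>phi\<close> injectivity
  suffices.\<close>

definition graph :: "int set \<Rightarrow> (int \<Rightarrow> int) \<Rightarrow> cell set" where
  "graph W w = (\<lambda>i. (i, w i)) ` W"

lemma mem_graph [simp]: "(i, j) \<in> graph W w \<longleftrightarrow> i \<in> W \<and> j = w i"
  by (auto simp: graph_def)

lemma rows_graph [simp]: "rows (graph W w) = W"
  by (force simp: rows_def graph_def)

lemma row_graph: "row (graph W w) i = (if i \<in> W then {w i} else {})"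
  by (auto simp: row_def)

lemma col_at_graph [simp]: "i \<in> W \<Longrightarrow> col_at (graph W w) i = w i"
  by (simp add: col_at_def row_graph)

lemma column_graph: "column (graph W w) j = {i \<in> W. w i = j}"
  by (auto simp: column_def)

lemma graph_cong: "W = W' \<Longrightarrow> (\<And>i. i \<in> W' \<Longrightarrow> w i = w' i) \<Longrightarrow> graph W w = graph W' w'"
  by (simp add: graph_def)

lemma graph_eq_iff: "graph W w = graph W' w' \<longleftrightarrow> W = W' \<and> (\<forall>i\<in>W. w i = w' i)"
  by (metis col_at_graph graph_cong rows_graph)

lemma single_valued_graph: "single_valued M \<Longrightarrow> M = graph (rows M) (col_at M)"
proof -
  assume sv: "single_valued M"
  have "col_at M i = j" if "(i, j) \<in> M" for i j
  proof -
    have "row M i = {j}" using that sv by (auto simp: row_def single_valued_def)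
    then show ?thesis by (simp add: col_at_def)
  qed
  then show ?thesis by (force simp: graph_def rows_def)
qed

lemma mem_row [simp]: "j \<in> row P i \<longleftrightarrow> (i, j) \<in> P"
  by (simp add: row_def)

lemma mem_column [simp]: "i \<in> column P j \<longleftrightarrow> (i, j) \<in> P"
  by (simp add: column_def)

lemma mem_rows: "i \<in> rows P \<longleftrightarrow> (\<exists>j. (i, j) \<in> P)"
  by (force simp: rows_def)

lemma mem_cols: "j \<in> cols P \<longleftrightarrow> (\<exists>i. (i, j) \<in> P)"
  by (force simp: cols_def)

lemma finite_rows [intro]: "finite P \<Longrightarrow> finite (rows P)"
  by (simp add: rows_def)

lemma finite_cols [intro]: "finite P \<Longrightarrow> finite (cols P)"
  by (simp add: cols_def)

lemma finite_row [intro]: "finite P \<Longrightarrow> finite (row P i)"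
  by (rule finite_subset[of _ "snd ` P"]) force+

lemma finite_column [intro]: "finite P \<Longrightarrow> finite (column P i)"
  by (rule finite_subset[of _ "fst ` P"]) force+

lemma filling_graph_iff:
  assumes "finite P"
  shows "filling P M \<longleftrightarrow> (\<exists>W w. M = graph W w \<and> (\<forall>i\<in>W. (i, w i) \<in> P))"
proof
  assume f: "filling P M"
  have "single_valued M"
    unfolding single_valued_def
  proof (intro allI impI)
    fix i j k assume jk: "(i, j) \<in> M" "(i, k) \<in> M"
    then have "i \<in> rows P" using f by (auto simp: filling_def mem_rows)
    then have "card (row M i) \<le> 1" using f by (auto simp: filling_def)
    \<comment> \<open>An infinite set has \<open>card\<close> 0, so the bound on the cardinality
      says something only once the row is known to be finite.\<close>
    moreover have "finite (row M i)" using f assms by (meson filling_def finite_row finite_subset)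
    ultimately show "j = k" using jk by (auto simp: card_le_Suc0_iff_eq)
  qed
  then have "M = graph (rows M) (col_at M)" by (rule single_valued_graph)
  then show "\<exists>W w. M = graph W w \<and> (\<forall>i\<in>W. (i, w i) \<in> P)"
    using f by (metis filling_def mem_graph subsetD)
next
  assume "\<exists>W w. M = graph W w \<and> (\<forall>i\<in>W. (i, w i) \<in> P)"
  then show "filling P M" by (auto simp: filling_def row_graph)
qed

section \<open>Moon polyominoes\<close>

lemma contiguous_eq_interval:
  assumes "finite S" "S \<noteq> {}" "contiguous S"
  shows "S = {Min S..Max S}"
  using assms unfolding contiguous_def by (auto dest: Min_in Max_in)

locale moon =
  fixes P :: "cell set"
  assumes moon: "moon_polyomino P"
begin

lemma fin: "finite P" using moon by (simp add: moon_polyomino_def)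

lemma column_convex: "(a, j) \<in> P \<Longrightarrow> (b, j) \<in> P \<Longrightarrow> a \<le> i \<Longrightarrow> i \<le> b \<Longrightarrow> (i, j) \<in> P"
proof -
  assume a: "(a, j) \<in> P" "(b, j) \<in> P" "a \<le> i" "i \<le> b"
  then have "contiguous (column P j)"
    using moon by (auto simp: moon_polyomino_def convex_polyomino_def mem_cols)
  then show ?thesis using a unfolding contiguous_def by (metis atLeastAtMost_iff mem_column subsetD)
qed

lemma row_convex: "(i, a) \<in> P \<Longrightarrow> (i, b) \<in> P \<Longrightarrow> a \<le> j \<Longrightarrow> j \<le> b \<Longrightarrow> (i, j) \<in> P"
proof -
  assume a: "(i, a) \<in> P" "(i, b) \<in> P" "a \<le> j" "j \<le> b"
  then have "contiguous (row P i)"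
    using moon by (auto simp: moon_polyomino_def convex_polyomino_def mem_rows)
  then show ?thesis using a unfolding contiguous_def by (metis atLeastAtMost_iff mem_row subsetD)
qed

lemma column_comparable: "column P j \<subseteq> column P j' \<or> column P j' \<subseteq> column P j"
proof (cases "j \<in> cols P \<and> j' \<in> cols P")
  case True
  then show ?thesis using moon by (auto simp: moon_polyomino_def intersection_free_def)
next
  case False
  then show ?thesis by (auto simp: mem_cols)
qed

text \<open>Two incomparable rows would each contain a column missing from the other, and these two
  columns would be incomparable.\<close>

lemma row_comparable: "row P i \<subseteq> row P i' \<or> row P i' \<subseteq> row P i"
  using column_comparable by (fastforce simp: subset_iff)

lemma row_interval: "i \<in> rows P \<Longrightarrow> row P i = {Min (row P i)..Max (row P i)}"
  using moon fin by (intro contiguous_eq_interval)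
    (auto simp: moon_polyomino_def convex_polyomino_def mem_rows)

end

lemma moonI:
  assumes "finite P"
    and "\<And>i a b j. (i, a) \<in> P \<Longrightarrow> (i, b) \<in> P \<Longrightarrow> a \<le> j \<Longrightarrow> j \<le> b \<Longrightarrow> (i, j) \<in> P"
    and "\<And>i a b j. (a, j) \<in> P \<Longrightarrow> (b, j) \<in> P \<Longrightarrow> a \<le> i \<Longrightarrow> i \<le> b \<Longrightarrow> (i, j) \<in> P"
    and "\<And>j j'. column P j \<subseteq> column P j' \<or> column P j' \<subseteq> column P j"
  shows "moon_polyomino P"
  unfolding moon_polyomino_def convex_polyomino_def intersection_free_def contiguous_def
proof (intro conjI ballI subsetI)
  fix i a b j assume "a \<in> row P i" "b \<in> row P i" "j \<in> {a..b}"
  then show "j \<in> row P i" using assms(2)[of i a b j] by simp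
next
  fix i a b j assume "a \<in> column P j" "b \<in> column P j" "i \<in> {a..b}"
  then show "i \<in> column P j" using assms(3)[of a j b i] by simp
qed (use assms(1,4) in blast)+

text \<open>\<open>rect_of P r\<close> is the maximal rectangle through row \<open>r\<close> whose width is that of row \<open>r\<close>.\<close>

definition rect_rows :: "cell set \<Rightarrow> int \<Rightarrow> int set" where
  "rect_rows P r = {i. row P r \<subseteq> row P i}"

definition rect_of :: "cell set \<Rightarrow> int \<Rightarrow> cell set" where
  "rect_of P r = rect_rows P r \<times> row P r"

context moon
begin

lemma rect_rows_subset: "r \<in> rows P \<Longrightarrow> rect_rows P r \<subseteq> rows P"
proof
  fix i assume r: "r \<in> rows P" and i: "i \<in> rect_rows P r"
  then obtain j where "j \<in> row P r" by (auto simp: mem_rows)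
  then have "j \<in> row P i" using i by (auto simp: rect_rows_def)
  then show "i \<in> rows P" by (auto simp: mem_rows)
qed

lemma rect_rows_convex:
  assumes "r \<in> rows P" "a \<in> rect_rows P r" "b \<in> rect_rows P r" "a \<le> i" "i \<le> b"
  shows "i \<in> rect_rows P r"
proof -
  have "(i, j) \<in> P" if "(r, j) \<in> P" for j
    using assms that column_convex[of a j b i] by (auto simp: rect_rows_def subset_iff)
  then show ?thesis by (auto simp: rect_rows_def)
qed

lemma rect_rows_interval:
  assumes "r \<in> rows P"
  shows "rect_rows P r = {Min (rect_rows P r)..Max (rect_rows P r)}"
proof (rule contiguous_eq_interval)
  show "finite (rect_rows P r)" using rect_rows_subset[OF assms] fin finite_subset[OF _ finite_rows] by simp
  show "rect_rows P r \<noteq> {}" by (auto simp: rect_rows_def)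
  show "contiguous (rect_rows P r)"
    unfolding contiguous_def using rect_rows_convex[OF assms] by (meson atLeastAtMost_iff subsetI)
qed

lemma rectangle_rect_of: "r \<in> rows P \<Longrightarrow> rectangle (rect_of P r)"
proof -
  assume r: "r \<in> rows P"
  then obtain j where "(r, j) \<in> P" by (auto simp: mem_rows)
  then have "(r, j) \<in> rect_of P r" by (simp add: rect_of_def rect_rows_def)
  moreover have "rect_of P r = {Min (rect_rows P r)..Max (rect_rows P r)} \<times> {Min (row P r)..Max (row P r)}"
    unfolding rect_of_def using row_interval[OF r] rect_rows_interval[OF r] by simp
  ultimately show ?thesis unfolding rectangle_def by blast
qed

lemma rect_of_subset: "rect_of P r \<subseteq> P"
  by (auto simp: rect_of_def rect_rows_def)

text \<open>Rows form a chain under inclusion. The shortest row bounds the width of every rectangle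
  through the given rows.\<close>

lemma smallest_row:
  assumes "finite I" "I \<noteq> {}"
  shows "\<exists>r\<in>I. \<forall>i\<in>I. row P r \<subseteq> row P i"
  using assms
proof (induction rule: finite_ne_induct)
  case (insert x F)
  then obtain r where r: "r \<in> F" "\<forall>i\<in>F. row P r \<subseteq> row P i" by blast
  show ?case
  proof (cases "row P r \<subseteq> row P x")
    case False
    then have "row P x \<subseteq> row P r" using row_comparable by blast
    then show ?thesis using r by blast
  qed (use r in blast)
qed auto

text \<open>The shortest row r of a rectangle limits its width, so the rectangle lies in
  \<open>rect_of P r\<close>. Conversely, a rectangle around \<open>rect_of P r\<close> contains
  cells of row r, so it is no wider and therefore no taller.\<close>

lemma max_rectangles_eq: "max_rectangles P = rect_of P ` rows P"
proof (intro equalityI subsetI)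
  fix Q assume Q: "Q \<in> max_rectangles P"
  then have "rectangle Q" "Q \<subseteq> P" by (simp_all add: max_rectangles_def)
  then obtain a b c d where abcd: "Q = {a..b} \<times> {c..d}" "Q \<noteq> {}" "Q \<subseteq> P"
    unfolding rectangle_def by blast
  then obtain r where r: "r \<in> {a..b}" "\<forall>i\<in>{a..b}. row P r \<subseteq> row P i"
    using smallest_row[of "{a..b}"] by auto
  have "(r, c) \<in> P" using abcd r by auto
  then have rP: "r \<in> rows P" by (auto simp: mem_rows)
  have "(i, j) \<in> rect_of P r" if "(i, j) \<in> Q" for i j
  proof -
    have "(r, j) \<in> P" using abcd that r by auto
    then show ?thesis using abcd that r by (auto simp: rect_of_def rect_rows_def)
  qed
  then have "Q \<subseteq> rect_of P r" by auto
  then have "Q = rect_of P r"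
    using Q rectangle_rect_of[OF rP] rect_of_subset unfolding max_rectangles_def by blast
  then show "Q \<in> rect_of P ` rows P" using rP by blast
next
  fix Q assume "Q \<in> rect_of P ` rows P"
  then obtain r where r: "r \<in> rows P" "Q = rect_of P r" by blast
  have "Q' = Q" if Q': "rectangle Q'" "Q' \<subseteq> P" "Q \<subseteq> Q'" for Q'
  proof -
    obtain a b c d where Q'': "Q' = {a..b} \<times> {c..d}" using Q'(1) by (auto simp: rectangle_def)
    obtain j where j: "(r, j) \<in> P" using r by (auto simp: mem_rows)
    have jQ: "(r, j) \<in> Q'" using Q' r j by (auto simp: rect_of_def rect_rows_def)
    have "{c..d} = row P r"
    proof
      show "{c..d} \<subseteq> row P r"
      proof
        fix x assume "x \<in> {c..d}"
        then have "(r, x) \<in> Q'" using jQ Q'' by auto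
        then show "x \<in> row P r" using Q'(2) by auto
      qed
      show "row P r \<subseteq> {c..d}"
      proof
        fix x assume "x \<in> row P r"
        then have "(r, x) \<in> Q'" using Q' r by (auto simp: rect_of_def rect_rows_def)
        then show "x \<in> {c..d}" using Q'' by auto
      qed
    qed
    moreover from this have "{a..b} \<subseteq> rect_rows P r" using Q' Q'' by (auto simp: rect_rows_def)
    ultimately show ?thesis using Q' r Q'' by (auto simp: rect_of_def)
  qed
  then show "Q \<in> max_rectangles P"
    using r rectangle_rect_of rect_of_subset by (auto simp: max_rectangles_def)
qed

lemma rect_rows_mono: "row P r \<subseteq> row P r' \<Longrightarrow> rect_rows P r' \<subseteq> rect_rows P r"
  by (auto simp: rect_rows_def)

lemma rect_rows_psubset: "row P r \<subset> row P r' \<Longrightarrow> rect_rows P r' \<subset> rect_rows P r"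
  by (auto simp: rect_rows_def)

lemma rows_rect_of: "r \<in> rows P \<Longrightarrow> rows (rect_of P r) = rect_rows P r"
  by (auto simp: rect_of_def mem_rows)

text \<open>Among these rectangles strictly lower means strictly wider; in particular the heights of
  distinct maximal rectangles differ.\<close>

lemma card_rect_rows_less_iff:
  assumes "r \<in> rows P" "r' \<in> rows P"
  shows "card (rect_rows P r) < card (rect_rows P r') \<longleftrightarrow> row P r' \<subset> row P r"
proof -
  have "finite (rect_rows P r)" "finite (rect_rows P r')"
    using assms rect_rows_subset fin finite_rows finite_subset by blast+
  then show ?thesis
    using row_comparable[of r r'] rect_rows_psubset[of r' r] rect_rows_mono[of r r']
    by (metis card_mono linorder_not_less order_less_le psubset_card_mono)
qed

end

section \<open>The major index as a number of pairs\<close>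

definition starts_descent :: "int set \<Rightarrow> (int \<Rightarrow> int) \<Rightarrow> int set \<Rightarrow> int \<Rightarrow> bool" where
  "starts_descent W w J r \<longleftrightarrow> (\<exists>d\<in>W. r < d \<and> w d \<in> J \<and> w d < w r \<and> (\<forall>x\<in>W. r < x \<and> x < d \<longrightarrow> w x \<notin> J))"

definition maj_pairs :: "cell set \<Rightarrow> int set \<Rightarrow> (int \<Rightarrow> int) \<Rightarrow> (int \<times> int) set" where
  "maj_pairs P W w = {(r, e). r \<in> W \<and> e \<in> W \<and> r < e \<and> (e, w r) \<in> P \<and> (r, w e) \<in> P
     \<and> starts_descent W w (row P r \<inter> row P e) r}"

definition ne_pairs :: "cell set \<Rightarrow> int set \<Rightarrow> (int \<Rightarrow> int) \<Rightarrow> (int \<times> int) set" where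
  "ne_pairs P W w = {(r, e). r \<in> W \<and> e \<in> W \<and> r < e \<and> (e, w r) \<in> P \<and> (r, w e) \<in> P \<and> w e < w r}"

definition maj_rect_pairs :: "int set \<Rightarrow> int set \<Rightarrow> int set \<Rightarrow> (int \<Rightarrow> int) \<Rightarrow> (int \<times> int) set" where
  "maj_rect_pairs I J W w = {(r, e). r \<in> W \<inter> I \<and> e \<in> W \<inter> I \<and> r < e \<and> w r \<in> J \<and> w e \<in> J \<and> starts_descent W w J r}"

text \<open>A descent with ends r and d is counted in the restriction to the rows down to e, for
  every nonempty row e from d on. No entry of the rectangle lies strictly between r and d, so these
  e are exactly the nonempty rows below r.\<close>

lemma maj_rect_eq:
  assumes "finite W"
  shows "maj_rect ({a..b} \<times> {c..d}) (graph W w \<inter> {a..b} \<times> {c..d}) = card (maj_rect_pairs {a..b} {c..d} W w)"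
proof -
  let ?Q = "{a..b} \<times> {c..d}"
  define V where "V = {i \<in> W. i \<in> {a..b} \<and> w i \<in> {c..d}}"
  have R: "graph W w \<inter> ?Q = graph V w" by (auto simp: V_def graph_def)
  have finV: "finite V" using assms by (simp add: V_def)
  define S where "S e = {(x, y). x \<in> V \<and> y \<in> V \<and> x < y \<and> y \<le> e \<and> w y < w x \<and> V \<inter> {x<..<y} = {}}" for e
  have des: "des ?Q {C \<in> graph V w. fst C \<le> e} = card (S e)" for e
  proof -
    have 1: "{C \<in> graph V w. fst C \<le> e} = graph {i \<in> V. i \<le> e} w" by (auto simp: graph_def)
    have "bij_betw (\<lambda>(x, y). ((x, w x), (y, w y))) (S e)
      {(C, D) \<in> graph {i \<in> V. i \<le> e} w \<times> graph {i \<in> V. i \<le> e} w.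
         ne_chain ?Q C D \<and> {i \<in> V. i \<le> e} \<inter> {fst C<..<fst D} = {}}"
    proof (rule bij_betw_imageI)
      show "inj_on (\<lambda>(x, y). ((x, w x), (y, w y))) (S e)" by (auto simp: inj_on_def)
      have "ne_chain ?Q (x, w x) (y, w y) \<longleftrightarrow> x < y \<and> w y < w x" if "x \<in> V" "y \<in> V" for x y
        using that by (auto simp: ne_chain_def V_def)
      then show "(\<lambda>(x, y). ((x, w x), (y, w y))) ` S e = {(C, D) \<in> graph {i \<in> V. i \<le> e} w \<times> graph {i \<in> V. i \<le> e} w.
         ne_chain ?Q C D \<and> {i \<in> V. i \<le> e} \<inter> {fst C<..<fst D} = {}}"
        by (force simp: S_def image_iff graph_def)
    qed
    then show ?thesis unfolding des_def 1 rows_graph by (simp add: bij_betw_same_card)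
  qed
  have "S e \<subseteq> V \<times> V" for e by (auto simp: S_def)
  then have finS: "finite (S e)" for e using finV by (meson finite_SigmaI finite_subset)
  have "maj_rect ?Q (graph W w \<inter> ?Q) = card (SIGMA e:V. S e)"
    unfolding R maj_rect_def rows_graph des using finV finS by simp
  also have "\<dots> = card (maj_rect_pairs {a..b} {c..d} W w)"
  proof (rule bij_betw_same_card[where f = "\<lambda>(e, (x, y)). (x, e)"], rule bij_betw_imageI)
    show "inj_on (\<lambda>(e, (x, y)). (x, e)) (SIGMA e:V. S e)"
    proof (rule inj_onI, clarsimp)
      fix e x y y' assume a: "(x, y) \<in> S e" "(x, y') \<in> S e"
      then have "\<not> y < y'" "\<not> y' < y" by (auto simp: S_def)
      then show "y = y'" by simp
    qed
    show "(\<lambda>(e, (x, y)). (x, e)) ` (SIGMA e:V. S e) = maj_rect_pairs {a..b} {c..d} W w"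
    proof (intro equalityI subsetI)
      fix t assume "t \<in> (\<lambda>(e, (x, y)). (x, e)) ` (SIGMA e:V. S e)"
      then obtain e x y where t: "t = (x, e)" "e \<in> V" "(x, y) \<in> S e" by auto
      moreover have "starts_descent W w {c..d} x"
        unfolding starts_descent_def
      proof (intro bexI conjI ballI impI)
        fix u assume "u \<in> W" "x < u \<and> u < y"
        moreover have "u \<notin> V" using t(3) \<open>x < u \<and> u < y\<close> by (auto simp: S_def)
        ultimately show "w u \<notin> {c..d}" using t by (auto simp: S_def V_def)
      qed (use t in \<open>auto simp: S_def V_def\<close>)
      ultimately show "t \<in> maj_rect_pairs {a..b} {c..d} W w" by (auto simp: maj_rect_pairs_def S_def V_def)
    next
      fix t assume "t \<in> maj_rect_pairs {a..b} {c..d} W w"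
      then obtain r e where t: "t = (r, e)" "r \<in> V" "e \<in> V" "r < e" "starts_descent W w {c..d} r"
        by (auto simp: maj_rect_pairs_def V_def)
      then obtain y where y: "y \<in> W" "r < y" "w y \<in> {c..d}" "w y < w r"
        "\<forall>x\<in>W. r < x \<and> x < y \<longrightarrow> w x \<notin> {c..d}" by (auto simp: starts_descent_def)
      \<comment> \<open>\<open>starts_descent\<close> does not ask y to be a row of the rectangle;
        it is one because it lies between r and e.\<close>
      then have "y \<le> e" using t by (force simp: V_def)
      then have "(r, y) \<in> S e" using t y by (auto simp: S_def V_def)
      then show "t \<in> (\<lambda>(e, (x, y)). (x, e)) ` (SIGMA e:V. S e)" using t by force
    qed
  qed
  finally show ?thesis .
qed

text \<open>Given the two 1-cells, the two other corners force the whole rectangle: column convexity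
  fills its outer columns, and row convexity fills the rows between them.\<close>

lemma (in moon) ne_eq:
  assumes "\<And>i. i \<in> W \<Longrightarrow> (i, w i) \<in> P"
  shows "ne P (graph W w) = card (ne_pairs P W w)"
  unfolding ne_def
proof (rule sym, rule bij_betw_same_card[where f = "\<lambda>(x, y). ((x, w x), (y, w y))"], rule bij_betw_imageI)
  show "inj_on (\<lambda>(x, y). ((x, w x), (y, w y))) (ne_pairs P W w)" by (auto simp: inj_on_def)
  have "ne_chain P (x, w x) (y, w y) \<longleftrightarrow> x < y \<and> w y < w x \<and> (y, w x) \<in> P \<and> (x, w y) \<in> P"
    if "x \<in> W" "y \<in> W" for x y
  proof
    assume "x < y \<and> w y < w x \<and> (y, w x) \<in> P \<and> (x, w y) \<in> P"
    then have h: "x < y" "w y < w x" "(y, w x) \<in> P" "(x, w y) \<in> P" "(x, w x) \<in> P" "(y, w y) \<in> P"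
      using assms that by auto
    have "(i, j) \<in> P" if "x \<le> i" "i \<le> y" "w y \<le> j" "j \<le> w x" for i j
      using h that column_convex[of x "w y" y i] column_convex[of x "w x" y i] row_convex[of i "w y" "w x" j]
      by auto
    then show "ne_chain P (x, w x) (y, w y)" using h by (auto simp: ne_chain_def)
  qed (auto simp: ne_chain_def subset_iff)
  then show "(\<lambda>(x, y). ((x, w x), (y, w y))) ` ne_pairs P W w
      = {(C, D) \<in> graph W w \<times> graph W w. ne_chain P C D}"
    by (force simp: ne_pairs_def image_iff graph_def)
qed

text \<open>The interpretation of \<open>folding_insort_key\<close> yields facts about the constant
  of the locale \<open>linorder\<close>, while \<open>max_rectangle_list\<close> uses the one of the
  type class.\<close>

lemma linorder_sorted_key_list_of_set:
  "linorder.sorted_key_list_of_set (\<le>) = (sorted_key_list_of_set :: ('b \<Rightarrow> 'a::linorder) \<Rightarrow> _)"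
  unfolding sorted_key_list_of_set_def linorder.sorted_key_list_of_set_def[OF linorder_class.linorder_axioms]
    linorder.insort_key_def[OF linorder_class.linorder_axioms] insort_key_def
  by simp

context moon
begin

text \<open>For a fixed pair of rows the sum telescopes to the term of the first rectangle that meets both; its
  columns are those common to the two rows.\<close>

lemma maj_eq:
  assumes W: "\<And>i. i \<in> W \<Longrightarrow> (i, w i) \<in> P"
  shows "maj P (graph W w) = int (card (maj_pairs P W w))"
proof -
  define key where "key Q = card (rows Q)" for Q :: "cell set"
  have key: "key (rect_of P r) = card (rect_rows P r)" if "r \<in> rows P" for r
    using that by (simp add: key_def rows_rect_of)
  have inj: "inj_on key (rect_of P ` rows P)"
  proof (rule inj_onI, clarify)
    fix r r' assume r: "r \<in> rows P" "r' \<in> rows P" "key (rect_of P r) = key (rect_of P r')"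
    then have "row P r = row P r'"
      using card_rect_rows_less_iff[of r r'] card_rect_rows_less_iff[of r' r] row_comparable[of r r'] key by auto
    then show "rect_of P r = rect_of P r'" by (simp add: rect_of_def rect_rows_def)
  qed
  interpret sk: folding_insort_key "(\<le>)" "(<)" "rect_of P ` rows P" key
    by unfold_locales (rule inj)
  define Q where "Q = max_rectangle_list P"
  have Q_def': "Q = sorted_key_list_of_set key (rect_of P ` rows P)"
    unfolding Q_def max_rectangle_list_def max_rectangles_eq key_def[abs_def] ..
  have finR: "finite (rect_of P ` rows P)" using fin by auto
  have setQ: "set Q = rect_of P ` rows P"
    unfolding Q_def' using sk.set_sorted_key_list_of_set[OF order_refl finR]
    by (simp add: linorder_sorted_key_list_of_set)
  have sortQ: "sorted_wrt (<) (map key Q)"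
    unfolding Q_def' using sk.strict_sorted_key_list_of_set[OF order_refl]
    by (simp add: linorder_sorted_key_list_of_set)
  define n where "n = length Q"
  define \<rho> where "\<rho> i = (SOME r. r \<in> rows P \<and> Q ! i = rect_of P r)" for i
  have \<rho>: "\<rho> i \<in> rows P" "Q ! i = rect_of P (\<rho> i)" if "i < n" for i
  proof -
    have "Q ! i \<in> set Q" using that by (simp add: n_def)
    then have "\<exists>r. r \<in> rows P \<and> Q ! i = rect_of P r" unfolding setQ by blast
    then show "\<rho> i \<in> rows P" "Q ! i = rect_of P (\<rho> i)" unfolding \<rho>_def by (metis (mono_tags, lifting) someI_ex)+
  qed
  define J where "J i = row P (\<rho> i)" for i
  define I where "I i = rect_rows P (\<rho> i)" for i
  have QIJ: "Q ! i = I i \<times> J i" if "i < n" for i using \<rho>[OF that] by (simp add: rect_of_def I_def J_def)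
  have J_less: "J k \<subset> J i" if "i < k" "k < n" for i k
  proof -
    have "key (Q ! i) < key (Q ! k)"
      using sortQ that by (simp add: sorted_wrt_iff_nth_less n_def)
    then show ?thesis
      using that \<rho>[of i] \<rho>[of k] key card_rect_rows_less_iff by (simp add: J_def)
  qed
  have J_le_iff: "J i \<subseteq> J k \<longleftrightarrow> k \<le> i" if "i < n" "k < n" for i k
  proof (cases i k rule: linorder_cases)
    case less
    then show ?thesis using J_less[of i k] that by auto
  next
    case greater
    then show ?thesis using J_less[of k i] that by auto
  qed auto
  have I_le: "I i \<subseteq> I k" if "i \<le> k" "k < n" for i k
    unfolding I_def using that J_le_iff[of k i] by (intro rect_rows_mono) (auto simp: J_def)
  have I_mem: "e \<in> I i \<longleftrightarrow> J i \<subseteq> row P e" for e i by (simp add: I_def J_def rect_rows_def)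
  have ex_k: "\<exists>k<n. J k = row P r \<inter> row P e" if re: "r \<in> rows P" "e \<in> rows P" for r e
  proof -
    obtain q where q: "q \<in> rows P" "row P q = row P r \<inter> row P e"
      using row_comparable[of r e] re by (metis inf.absorb1 inf.absorb2)
    then have "rect_of P q \<in> set Q" using setQ by auto
    then obtain k where k: "k < n" "Q ! k = rect_of P q" by (auto simp: in_set_conv_nth n_def)
    then have "rect_of P (\<rho> k) = rect_of P q" using \<rho> by simp
    then have "I k \<times> J k = rect_rows P q \<times> row P q" by (simp add: I_def J_def rect_of_def)
    moreover have "rect_rows P q \<noteq> {}" "row P q \<noteq> {}" using q by (auto simp: rect_rows_def mem_rows)
    ultimately have "J k = row P q" by (auto simp: times_eq_iff)
    then show ?thesis using k q by auto
  qed
  \<comment> \<open>The pairs seen by rectangle i but not by its intersection with the previous one,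
    which has the rows of rectangle i - 1 and the columns of rectangle i.\<close>
  define S where "S i = maj_rect_pairs (I i) (J i) W w - (if i = 0 then {} else maj_rect_pairs (I (i - 1)) (J i) W w)" for i
  have S_iff: "(r, e) \<in> S i \<longleftrightarrow> (r, e) \<in> maj_pairs P W w \<and> J i = row P r \<inter> row P e" if i: "i < n" for r e i
  proof (cases "r \<in> W \<and> e \<in> W")
    case True
    then have re: "r \<in> rows P" "e \<in> rows P" using W by (auto simp: mem_rows)
    then obtain k where k: "k < n" "J k = row P r \<inter> row P e" using ex_k by blast
    \<comment> \<open>Rectangle j contains both rows iff its columns lie in both of them. Columns
      shrink as j grows, so this holds from k on.\<close>
    have *: "r \<in> I j \<and> e \<in> I j \<longleftrightarrow> k \<le> j" if "j < n" for j
      using J_le_iff[of j k] k that by (auto simp: I_mem)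
    have "(r, e) \<in> S i \<longleftrightarrow> i = k \<and> r < e \<and> w r \<in> J i \<and> w e \<in> J i \<and> starts_descent W w (J i) r"
    proof (cases "i = 0")
      case True
      then show ?thesis using \<open>r \<in> W \<and> e \<in> W\<close> *[OF i] by (auto simp: S_def maj_rect_pairs_def)
    next
      case False
      have "i = k \<longleftrightarrow> k \<le> i \<and> \<not> k \<le> i - 1" "i - 1 < n" using False i by auto
      then show ?thesis using \<open>r \<in> W \<and> e \<in> W\<close> False *[OF i] *[of "i - 1"] i
        unfolding S_def maj_rect_pairs_def by auto
    qed
    moreover have "J i = row P r \<inter> row P e \<longleftrightarrow> i = k"
      using k J_le_iff[of i k] J_le_iff[of k i] i by auto
    moreover have "w r \<in> J k \<longleftrightarrow> (e, w r) \<in> P" "w e \<in> J k \<longleftrightarrow> (r, w e) \<in> P"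
      using k W True by auto
    moreover have "(r, e) \<in> maj_pairs P W w \<longleftrightarrow> r < e \<and> (e, w r) \<in> P \<and> (r, w e) \<in> P \<and> starts_descent W w (J k) r"
      using True k by (auto simp: maj_pairs_def)
    ultimately show ?thesis by metis
  next
    case False
    then show ?thesis by (auto simp: S_def maj_rect_pairs_def maj_pairs_def)
  qed
  have UnS: "maj_pairs P W w = (\<Union>i<n. S i)"
  proof (intro equalityI subsetI)
    fix t assume t: "t \<in> maj_pairs P W w"
    obtain r e where re: "t = (r, e)" by (cases t)
    then have "r \<in> W" "e \<in> W" using t by (auto simp: maj_pairs_def)
    then obtain k where "k < n" "J k = row P r \<inter> row P e"
      using ex_k[of r e] W by (auto simp: mem_rows)
    then show "t \<in> (\<Union>i<n. S i)" using t re S_iff by auto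
  next
    fix t assume "t \<in> (\<Union>i<n. S i)"
    then show "t \<in> maj_pairs P W w" using S_iff by (cases t) auto
  qed
  have finW: "finite W"
  proof (rule finite_subset)
    show "W \<subseteq> rows P" using W mem_rows by blast
  qed (use fin in auto)
  have fin_rmaj: "finite (maj_rect_pairs A B W w)" for A B
    by (rule finite_subset[of _ "W \<times> W"]) (use finW in \<open>auto simp: maj_rect_pairs_def\<close>)
  have disj: "S i \<inter> S j = {}" if "i < n" "j < n" "i \<noteq> j" for i j
    using S_iff that J_le_iff[of i j] J_le_iff[of j i] by (auto simp: set_eq_iff)
  have "card (maj_pairs P W w) = (\<Sum>i<n. card (S i))"
    unfolding UnS by (rule card_UN_disjoint) (use disj fin_rmaj in \<open>auto simp: S_def\<close>)
  moreover have "int (card (S i)) = int (card (maj_rect_pairs (I i) (J i) W w))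
      - (if i = 0 then 0 else int (card (maj_rect_pairs (I (i - 1)) (J i) W w)))" if "i < n" for i
  proof (cases "i = 0")
    case False
    have "maj_rect_pairs (I (i - 1)) (J i) W w \<subseteq> maj_rect_pairs (I i) (J i) W w"
      using I_le[of "i - 1" i] that by (auto simp: maj_rect_pairs_def)
    then show ?thesis using False fin_rmaj
      by (simp add: S_def card_Diff_subset card_mono of_nat_diff)
  qed (simp add: S_def)
  ultimately have A: "int (card (maj_pairs P W w)) = (\<Sum>i<n. int (card (maj_rect_pairs (I i) (J i) W w)))
      - (\<Sum>i<n. if i = 0 then 0 else int (card (maj_rect_pairs (I (i - 1)) (J i) W w)))"
    by (simp add: sum_subtractf)
  \<comment> \<open>In \<open>maj\<close> the intersection of rectangles i and i + 1 has index i;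
    here it is indexed by the later rectangle, whence the zero term at i = 0.\<close>
  have B: "(\<Sum>i<n. if i = 0 then 0 else int (card (maj_rect_pairs (I (i - 1)) (J i) W w)))
      = (\<Sum>i<n - 1. int (card (maj_rect_pairs (I i) (J (Suc i)) W w)))"
  proof (cases n)
    case (Suc m)
    then show ?thesis by (simp add: sum.lessThan_Suc_shift del: sum.lessThan_Suc)
  qed simp
  have mr: "maj_rect (I i \<times> J k) (graph W w \<inter> I i \<times> J k) = card (maj_rect_pairs (I i) (J k) W w)" if ik: "i < n" "k < n" for i k
  proof -
    obtain a b where "I i = {a..b}" using rect_rows_interval \<rho>[OF ik(1)] unfolding I_def by metis
    moreover obtain c d where "J k = {c..d}" using row_interval \<rho>[OF ik(2)] unfolding J_def by metis
    ultimately show ?thesis using maj_rect_eq[OF finW] by simp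
  qed
  have 1: "maj_rect (Q ! i) (graph W w \<inter> Q ! i) = card (maj_rect_pairs (I i) (J i) W w)" if "i < n" for i
    using mr[OF that that] QIJ[OF that] by simp
  have 2: "maj_rect (Q ! i \<inter> Q ! Suc i) (graph W w \<inter> (Q ! i \<inter> Q ! Suc i)) = card (maj_rect_pairs (I i) (J (Suc i)) W w)"
    if "i < n - 1" for i
  proof -
    have i: "i < n" "Suc i < n" using that by auto
    have "I i \<times> J i \<inter> I (Suc i) \<times> J (Suc i) = I i \<times> J (Suc i)"
      using I_le[of i "Suc i"] J_less[of i "Suc i"] i by auto
    then have "Q ! i \<inter> Q ! Suc i = I i \<times> J (Suc i)" using QIJ i by simp
    then show ?thesis using mr[OF i] by simp
  qed
  have "maj P (graph W w) = (\<Sum>i<n. int (card (maj_rect_pairs (I i) (J i) W w)))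
      - (\<Sum>i<n - 1. int (card (maj_rect_pairs (I i) (J (Suc i)) W w)))"
    unfolding maj_def Q_def[symmetric] Let_def n_def[symmetric]
    using 1 2 by simp
  then show ?thesis using A B by simp
qed

end

section \<open>The algorithm gamma\<close>

definition exchange :: "int \<Rightarrow> int \<Rightarrow> (int \<Rightarrow> int) \<Rightarrow> int \<Rightarrow> int" where
  "exchange p q w = w(p := w q, q := w p)"

lemma exchange_simps [simp]: "exchange p q w p = w q" "exchange p q w q = w p" "i \<noteq> p \<Longrightarrow> i \<noteq> q \<Longrightarrow> exchange p q w i = w i"
  by (auto simp: exchange_def)

lemma exchange_sw [simp]: "exchange p q (exchange p q w) = w" "exchange q p (exchange p q w) = w"
  by (auto simp: exchange_def fun_eq_iff)

lemma swap_graph: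
  assumes "p \<in> W" "q \<in> W"
  shows "swap p q (graph W w) = graph W (exchange p q w)"
proof (intro set_eqI)
  fix x
  show "x \<in> swap p q (graph W w) \<longleftrightarrow> x \<in> graph W (exchange p q w)"
    using assms by (cases x) (auto simp: swap_def exchange_def)
qed

text \<open>The topmost entry that is at most u. It governs maj: in a left-aligned shape the columns
  common to two rows are those up to some u, so this entry decides whether a new top row starts a
  descent in these columns.\<close>

definition istop :: "int set \<Rightarrow> (int \<Rightarrow> int) \<Rightarrow> int \<Rightarrow> int \<Rightarrow> bool" where
  "istop W w u a \<longleftrightarrow> a \<le> u \<and> (\<exists>i\<in>W. w i = a \<and> (\<forall>x\<in>W. x < i \<longrightarrow> u < w x))"

text \<open>Of the entries in rows p to q only the one in q can be at most u, so moving it up to p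
  passes no other such entry.\<close>

lemma istop_sw_imp:
  assumes "p \<in> W" "q \<in> W" "p < q" "u < w p" "\<And>i. i \<in> W \<Longrightarrow> p < i \<Longrightarrow> i < q \<Longrightarrow> u < w i" "istop W w u a"
  shows "istop W (exchange p q w) u a"
proof -
  obtain i where i: "a \<le> u" "i \<in> W" "w i = a" "\<And>x. x \<in> W \<Longrightarrow> x < i \<Longrightarrow> u < w x"
    using assms(6) unfolding istop_def by blast
  have ip: "i \<noteq> p" "\<not> (p < i \<and> i < q)" using assms(4,5) i by force+
  show ?thesis
  proof (cases "i = q")
    case True
    have "\<forall>x\<in>W. x < p \<longrightarrow> u < exchange p q w x" using i True assms by (auto simp: exchange_def)
    then show ?thesis using i True assms unfolding istop_def by (intro conjI bexI[of _ p]) auto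
  next
    case False
    have "\<forall>x\<in>W. x < i \<longrightarrow> u < exchange p q w x"
      using i ip False assms by (auto simp: exchange_def)
    then show ?thesis using i ip False assms unfolding istop_def by (intro conjI bexI[of _ i]) auto
  qed
qed

lemma istop_sw_imp':
  assumes "p \<in> W" "q \<in> W" "p < q" "u < w p" "\<And>i. i \<in> W \<Longrightarrow> p < i \<Longrightarrow> i < q \<Longrightarrow> u < w i"
    "istop W (exchange p q w) u a"
  shows "istop W w u a"
proof -
  obtain i where i: "a \<le> u" "i \<in> W" "exchange p q w i = a" "\<And>x. x \<in> W \<Longrightarrow> x < i \<Longrightarrow> u < exchange p q w x"
    using assms(6) unfolding istop_def by blast
  have iq: "i \<noteq> q" using i assms by auto
  have ip: "\<not> (p < i \<and> i < q)" using assms(5)[of i] i by auto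
  show ?thesis
  proof (cases "i = p")
    case True
    have "u < w x" if "x \<in> W" "x < q" for x
      using i(4)[of x] that True assms by (cases x p rule: linorder_cases) auto
    then show ?thesis using i True assms unfolding istop_def by (intro conjI bexI[of _ q]) auto
  next
    case False
    have "u < w x" if "x \<in> W" "x < i" for x
    proof -
      consider "x = p" | "x = q" | "x \<noteq> p" "x \<noteq> q" by blast
      then show ?thesis
      proof cases
        case 2
        then have "p < i" using that assms by simp
        then show ?thesis using i(4)[of p] that 2 assms by auto
      qed (use i(4)[of x] that assms in auto)
    qed
    then show ?thesis using i iq False unfolding istop_def by (intro conjI bexI[of _ i]) auto
  qed
qed

lemma istop_sw:
  assumes "p \<in> W" "q \<in> W" "p < q" "u < w p" "\<And>i. i \<in> W \<Longrightarrow> p < i \<Longrightarrow> i < q \<Longrightarrow> u < w i"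
  shows "istop W (exchange p q w) u a \<longleftrightarrow> istop W w u a"
  using istop_sw_imp[of p W q u w a] istop_sw_imp'[of p W q u w a] assms by blast

text \<open>\<open>c\<close> is the column of the 1-cell of the row placed on top of \<open>H\<close>.\<close>

locale ferrers =
  fixes H :: "cell set" and W :: "int set" and lo c :: int
  assumes finW: "finite W"
    and HW: "(i, j) \<in> H \<Longrightarrow> i \<in> W \<and> lo \<le> j"
    and Hdown: "(i, j) \<in> H \<Longrightarrow> i' \<in> W \<Longrightarrow> i' \<le> i \<Longrightarrow> (i', j) \<in> H"
    and Hleft: "(i, j) \<in> H \<Longrightarrow> lo \<le> j' \<Longrightarrow> j' \<le> j \<Longrightarrow> (i, j') \<in> H"
    and lo_c: "lo \<le> c"
begin

definition valid :: "(int \<Rightarrow> int) \<Rightarrow> bool" where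
  "valid w \<longleftrightarrow> (\<forall>i\<in>W. (i, w i) \<in> H)"

lemma validD: "valid w \<Longrightarrow> i \<in> W \<Longrightarrow> (i, w i) \<in> H"
  by (simp add: valid_def)

lemma valid_sw:
  assumes "valid w" "p \<in> W" "q \<in> W" "p < q" "(q, w p) \<in> H"
  shows "valid (exchange p q w)"
  using assms Hdown[of q "w q" p] by (auto simp: valid_def exchange_def)

text \<open>An invariant of gamma. It shows in the result whether there were left entries, and it
  feeds the invariant \<open>counts\<close> of \<open>phi\<close>.\<close>

definition col_count :: "(int \<Rightarrow> int) \<Rightarrow> int \<Rightarrow> nat" where
  "col_count w j = card {i \<in> column H c. w i = j}"

lemma col_count_sw:
  assumes "p \<in> column H c" "q \<in> column H c"
  shows "col_count (exchange p q w) = col_count w"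
proof
  fix j
  have "bij_betw (\<lambda>i. if i = p then q else if i = q then p else i)
    {i \<in> column H c. exchange p q w i = j} {i \<in> column H c. w i = j}"
    by (rule bij_betw_byWitness[where f' = "\<lambda>i. if i = p then q else if i = q then p else i"])
      (use assms in \<open>auto simp: exchange_def split: if_splits\<close>)
  then show "col_count (exchange p q w) j = col_count w j" unfolding col_count_def by (rule bij_betw_same_card)
qed

text \<open>In a Ferrers shape the upper left corner of the pair is always present.\<close>

lemma ne_pairs_iff: "valid w \<Longrightarrow> (r, e) \<in> ne_pairs H W w \<longleftrightarrow> r \<in> W \<and> e \<in> W \<and> r < e \<and> (e, w r) \<in> H \<and> w e < w r"
  using Hdown[of e "w e" r] by (auto simp: ne_pairs_def valid_def)

lemma finite_nep: "finite (ne_pairs H W w)"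
  by (rule finite_subset[of _ "W \<times> W"]) (use finW in \<open>auto simp: ne_pairs_def\<close>)

text \<open>Above \<open>p\<close>, an entry between the two swapped ones forms a chain with exactly one of them.\<close>

lemma card_nep_sw:
  assumes v: "valid w" and pq: "p \<in> W" "q \<in> W" "p < q" "w q < w p" "(q, w p) \<in> H"
    and bet: "\<And>i. i \<in> W \<Longrightarrow> p < i \<Longrightarrow> i < q \<Longrightarrow> w p < w i"
  shows "card (ne_pairs H W w) = Suc (card (ne_pairs H W (exchange p q w)))"
proof -
  let ?w = "exchange p q w"
  have v': "valid ?w" using valid_sw v pq by blast
  define \<sigma> where "\<sigma> x = (if x = p then q else p)" for x
  \<comment> \<open>A pair that ends below q follows its upper entry to the other row. A pair that
    starts above p with an entry at most \<open>w p\<close> follows the smaller of the two exchanged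
    entries, the only one it can form a chain with. All other pairs stay, and (p, q)
    disappears.\<close>
  define F where "F = (\<lambda>(r, e). if (e = p \<or> e = q) \<and> r < p \<and> w r \<le> w p then (r, \<sigma> e)
     else if (r = p \<or> r = q) \<and> q < e then (\<sigma> r, e) else (r, e))"
  have FF: "F (F x) = x" if "x \<in> ne_pairs H W w - {(p, q)} \<or> x \<in> ne_pairs H W ?w" for x
    using that pq by (cases x) (auto simp: F_def \<sigma>_def ne_pairs_def)
  have to: "F (r, e) \<in> ne_pairs H W ?w" if "(r, e) \<in> ne_pairs H W w" "(r, e) \<noteq> (p, q)" for r e
  proof -
    have re: "r \<in> W" "e \<in> W" "r < e" "(e, w r) \<in> H" "w e < w r" using that ne_pairs_iff[OF v] by auto
    consider "r < p" | "r = p" | "p < r" "r < q" | "r = q" | "q < r" by linarith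
    then show ?thesis
    proof cases
      case 1
      consider "e = p" | "e = q" | "e \<noteq> p" "e \<noteq> q" by blast
      then show ?thesis
      proof cases
        case 2
        then show ?thesis using 1 re pq Hdown[of q "w r" p] by (auto simp: F_def \<sigma>_def ne_pairs_iff[OF v'])
      qed (use 1 re pq in \<open>auto simp: F_def \<sigma>_def ne_pairs_iff[OF v']\<close>)
    next
      case 2
      then have "q < e" using re that bet[of e] by (cases e q rule: linorder_cases) auto
      then show ?thesis using 2 re pq by (auto simp: F_def \<sigma>_def ne_pairs_iff[OF v'])
    next
      case 3
      then have "w p < w r" using bet re by blast
      then show ?thesis using 3 re pq by (cases "e = q") (auto simp: F_def \<sigma>_def ne_pairs_iff[OF v'])
    qed (use re pq in \<open>auto simp: F_def \<sigma>_def ne_pairs_iff[OF v']\<close>)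
  qed
  have bck: "F (r, e) \<in> ne_pairs H W w - {(p, q)}" if "(r, e) \<in> ne_pairs H W ?w" for r e
  proof -
    have re: "r \<in> W" "e \<in> W" "r < e" "(e, ?w r) \<in> H" "?w e < ?w r" using that ne_pairs_iff[OF v'] by auto
    consider "r < p" | "r = p" | "p < r" "r < q" | "r = q" | "q < r" by linarith
    then show ?thesis
    proof cases
      case 1
      consider "e = p" | "e = q" | "e \<noteq> p" "e \<noteq> q" by blast
      then show ?thesis
      proof cases
        case e: 1
        have "(q, w r) \<in> H" if "w r \<le> w p"
          using Hleft[OF pq(5)] that v re 1 HW validD by blast
        then show ?thesis using 1 e re pq by (auto simp: F_def \<sigma>_def ne_pairs_iff[OF v])
      qed (use 1 re pq in \<open>auto simp: F_def \<sigma>_def ne_pairs_iff[OF v]\<close>)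
    next
      case 2
      then have "q < e" using re bet[of e] pq by (cases e q rule: linorder_cases) auto
      then show ?thesis using 2 re pq by (auto simp: F_def \<sigma>_def ne_pairs_iff[OF v])
    next
      case 3
      then have "w p < w r" using bet re by blast
      then show ?thesis using 3 re pq by (cases "e = q") (auto simp: F_def \<sigma>_def ne_pairs_iff[OF v])
    qed (use re pq in \<open>auto simp: F_def \<sigma>_def ne_pairs_iff[OF v]\<close>)
  qed
  have "bij_betw F (ne_pairs H W w - {(p, q)}) (ne_pairs H W ?w)"
  proof (rule bij_betw_byWitness[where f' = F])
    show "\<forall>x\<in>ne_pairs H W w - {(p, q)}. F (F x) = x" "\<forall>x\<in>ne_pairs H W ?w. F (F x) = x" using FF by blast+
    show "F ` (ne_pairs H W w - {(p, q)}) \<subseteq> ne_pairs H W ?w"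
      using to by (fastforce intro!: image_subsetI)
    show "F ` ne_pairs H W ?w \<subseteq> ne_pairs H W w - {(p, q)}"
      using bck by (fastforce intro!: image_subsetI)
  qed
  then have "card (ne_pairs H W w - {(p, q)}) = card (ne_pairs H W ?w)" by (rule bij_betw_same_card)
  moreover have "(p, q) \<in> ne_pairs H W w" using pq ne_pairs_iff[OF v] by auto
  ultimately show ?thesis using finite_nep card_Suc_Diff1 by metis
qed

lemma column_subset: "lo \<le> j' \<Longrightarrow> j' \<le> j \<Longrightarrow> column H j \<subseteq> column H j'"
  using Hleft by auto

lemma column_sub: "column H j \<subseteq> W"
  using HW by auto

lemma column_comparable:
  "column H j \<subseteq> column H j' \<or> column H j' \<subseteq> column H j"
proof -
  have "column H x = {}" if "x < lo" for x using that HW by (force simp: set_eq_iff)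
  then show ?thesis
    by (metis column_subset empty_subsetI linorder_le_less_linear linorder_linear)
qed

lemma column_less: "lo \<le> j' \<Longrightarrow> column H j' \<subset> column H j \<Longrightarrow> j < j'"
  using column_subset[of j' j] by force

lemma column_down: "i \<in> column H j \<Longrightarrow> i' \<in> W \<Longrightarrow> i' \<le> i \<Longrightarrow> i' \<in> column H j"
  using Hdown by auto

lemma valid_lo: "valid w \<Longrightarrow> i \<in> W \<Longrightarrow> lo \<le> w i"
  using HW validD by blast

lemma right_row: "valid w \<Longrightarrow> i \<in> W \<Longrightarrow> c \<le> w i \<Longrightarrow> i \<in> column H c"
  using Hleft[of i "w i" c] validD lo_c by auto

end

section \<open>The loop gamma^1 on words\<close>

locale ferrersK = ferrers +
  fixes K :: "int set"
  assumes K: "K = {} \<or> (\<exists>j\<ge>c. K = column H j)"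
begin

lemma K_sub: "K \<subseteq> column H c"
  using K column_subset lo_c by auto

lemma K_down: "i \<in> K \<Longrightarrow> i' \<in> W \<Longrightarrow> i' \<le> i \<Longrightarrow> i' \<in> K"
  using K column_down by blast

lemma K_comparable: "column H j \<subset> K \<or> column H j = K \<or> K \<subset> column H j"
  using K column_comparable by blast

text \<open>K stands for the column of CRC and is empty if there is no CRC. Right entries are
  classified by the length of their column; as columns get shorter to the right,
  \<open>small\<close>, \<open>eqv\<close>, \<open>big\<close> is also their numerical order. With K
  empty every right entry of a valid word is small.\<close>

definition eqv :: "int \<Rightarrow> bool" where "eqv a \<longleftrightarrow> c \<le> a \<and> column H a = K"
definition big :: "int \<Rightarrow> bool" where "big a \<longleftrightarrow> c \<le> a \<and> column H a \<subset> K"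
definition small :: "int \<Rightarrow> bool" where "small a \<longleftrightarrow> c \<le> a \<and> K \<subset> column H a"

lemma class_cases: obtains "a < c" | "eqv a" | "big a" | "small a"
  using K_comparable[of a] unfolding eqv_def big_def small_def by force

lemma class_excl:
  "a < c \<Longrightarrow> \<not> eqv a" "a < c \<Longrightarrow> \<not> big a" "a < c \<Longrightarrow> \<not> small a"
  "eqv a \<Longrightarrow> \<not> big a" "eqv a \<Longrightarrow> \<not> small a" "big a \<Longrightarrow> \<not> small a"
  "eqv a \<Longrightarrow> \<not> a < c" "big a \<Longrightarrow> \<not> a < c" "small a \<Longrightarrow> \<not> a < c"
  by (auto simp: eqv_def big_def small_def)

lemma eqv_less_big: "eqv a \<Longrightarrow> big b \<Longrightarrow> a < b"
  using column_less[of b a] lo_c by (auto simp: eqv_def big_def)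

lemma small_less_eqv: "small a \<Longrightarrow> eqv b \<Longrightarrow> a < b"
  using column_less[of b a] lo_c by (auto simp: eqv_def small_def)

lemma small_less_big: "small a \<Longrightarrow> big b \<Longrightarrow> a < b"
  using column_less[of b a] lo_c by (auto simp: big_def small_def)

definition lastE :: "(int \<Rightarrow> int) \<Rightarrow> int \<Rightarrow> int" where
  "lastE w q = Max {i \<in> W. i < q \<and> eqv (w i)}"

definition lastL :: "(int \<Rightarrow> int) \<Rightarrow> int \<Rightarrow> int" where
  "lastL w q = Max {i \<in> W. i < q \<and> w i < c}"

lemma lastE:
  assumes "\<exists>i\<in>W. i < q \<and> eqv (w i)"
  shows "lastE w q \<in> W" "lastE w q < q" "eqv (w (lastE w q))"
    "\<And>i. i \<in> W \<Longrightarrow> lastE w q < i \<Longrightarrow> i < q \<Longrightarrow> \<not> eqv (w i)"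
proof -
  let ?S = "{i \<in> W. i < q \<and> eqv (w i)}"
  have S: "finite ?S" "?S \<noteq> {}" using finW assms by auto
  have "lastE w q \<in> ?S" unfolding lastE_def using Max_in[OF S] .
  then show "lastE w q \<in> W" "lastE w q < q" "eqv (w (lastE w q))" by auto
  show "\<not> eqv (w i)" if "i \<in> W" "lastE w q < i" "i < q" for i
    using Max_ge[OF S(1), of i] that unfolding lastE_def by auto
qed

lemma lastL:
  assumes "\<exists>i\<in>W. i < q \<and> w i < c"
  shows "lastL w q \<in> W" "lastL w q < q" "w (lastL w q) < c"
    "\<And>i. i \<in> W \<Longrightarrow> lastL w q < i \<Longrightarrow> i < q \<Longrightarrow> c \<le> w i"
proof -
  let ?S = "{i \<in> W. i < q \<and> w i < c}"
  have S: "finite ?S" "?S \<noteq> {}" using finW assms by auto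
  have "lastL w q \<in> ?S" unfolding lastL_def using Max_in[OF S] .
  then show "lastL w q \<in> W" "lastL w q < q" "w (lastL w q) < c" by auto
  show "c \<le> w i" if "i \<in> W" "lastL w q < i" "i < q" for i
    using Max_ge[OF S(1), of i] that unfolding lastL_def by force
qed

text \<open>\<open>lastE w q\<close> plays the role of \<open>ptr_1\<close>. The three-cycle
  performed at a small entry is written as two exchanges, so that facts about a single exchange
  apply twice.\<close>

definition step1 :: "int \<Rightarrow> (int \<Rightarrow> int) \<Rightarrow> int \<Rightarrow> int" where
  "step1 q w = (let p = lastE w q in
     if w q < c then exchange p q w else if small (w q) then exchange (lastL w p) p (exchange p q w) else w)"

text \<open>Holds when \<open>\<gamma>\<^sup>1\<close> has processed the rows above \<open>q\<close>; \<open>ptr\<^sub>1\<close> is then the last row above \<open>q\<close> whose entry is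
  \<open>eqv\<close>, since the entry at \<open>ptr\<^sub>1\<close> always has a column of the same length.\<close>

definition inv1 :: "int \<Rightarrow> (int \<Rightarrow> int) \<Rightarrow> bool" where
  "inv1 q w \<longleftrightarrow> valid w
     \<and> (\<forall>i\<in>W. i < q \<and> \<not> big (w i) \<longrightarrow> (\<exists>x\<in>W. i \<le> x \<and> x < q \<and> eqv (w x)))
     \<and> (\<forall>i\<in>W. i < q \<and> small (w i) \<longrightarrow> (\<exists>x\<in>W. i < x \<and> x < q \<and> w x < c))
     \<and> (\<forall>i\<in>W. q \<le> i \<and> small (w i) \<longrightarrow> (\<exists>x\<in>W. x < i \<and> w x < c))
     \<and> (\<forall>i\<in>K. q \<le> i \<and> (w i < c \<or> small (w i)) \<longrightarrow> (\<exists>x\<in>W. x < i \<and> eqv (w x)))"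

lemma inv1_valid: "inv1 q w \<Longrightarrow> valid w"
  by (simp add: inv1_def)

text \<open>No row of \<open>W\<close> lies from q on above q', so the clauses about the rows above
  the bound are the same for both.\<close>

lemma inv1_mono:
  assumes "inv1 q w" "q \<le> q'" "\<And>i. i \<in> W \<Longrightarrow> i < q' \<Longrightarrow> i < q"
  shows "inv1 q' w"
proof -
  have eq: "i < q' \<longleftrightarrow> i < q" if "i \<in> W" for i using assms that by force
  have K': "i \<in> W" if "i \<in> K" for i using that K_sub column_sub by blast
  show ?thesis
    using assms(1) eq K' assms(2) unfolding inv1_def
    by (smt (verit, best))
qed

text \<open>The last clause of \<open>inv1\<close> provides \<open>ptr_1\<close>. The second makes
  all entries between it and q big: any other would have an \<open>eqv\<close> entry at or below it,
  still above q.\<close>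

lemma step1_left:
  assumes inv: "inv1 q w" and q: "q \<in> K" "w q < c"
  obtains p where "p \<in> W" "p < q" "eqv (w p)" "\<And>i. i \<in> W \<Longrightarrow> p < i \<Longrightarrow> i < q \<Longrightarrow> big (w i)"
    "step1 q w = exchange p q w" "lastE w q = p"
proof -
  have ex: "\<exists>i\<in>W. i < q \<and> eqv (w i)" using inv q by (auto simp: inv1_def)
  show ?thesis
  proof (rule that[of "lastE w q"])
    show "big (w i)" if "i \<in> W" "lastE w q < i" "i < q" for i
      using inv that lastE(4)[OF ex] unfolding inv1_def by (metis order_less_le_trans)
  qed (use lastE[OF ex] q in \<open>auto simp: step1_def\<close>)
qed

text \<open>The fourth clause of \<open>inv1\<close> provides a left entry above q, and it lies
  above \<open>ptr_1\<close>, since only big entries follow there. By the third clause a small entry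
  between the lowest such left entry and p would have a further left entry below it.\<close>

lemma step1_small:
  assumes inv: "inv1 q w" and q: "q \<in> K" "small (w q)"
  obtains p x where "p \<in> W" "p < q" "eqv (w p)" "\<And>i. i \<in> W \<Longrightarrow> p < i \<Longrightarrow> i < q \<Longrightarrow> big (w i)"
    "x \<in> W" "x < p" "w x < c" "\<And>i. i \<in> W \<Longrightarrow> x < i \<Longrightarrow> i < p \<Longrightarrow> eqv (w i) \<or> big (w i)"
    "step1 q w = exchange x p (exchange p q w)" "lastE w q = p" "lastL w p = x"
proof -
  have ex: "\<exists>i\<in>W. i < q \<and> eqv (w i)" using inv q by (auto simp: inv1_def)
  define p where "p = lastE w q"
  have p: "p \<in> W" "p < q" "eqv (w p)" using lastE[OF ex] by (auto simp: p_def)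
  have big: "big (w i)" if "i \<in> W" "p < i" "i < q" for i
    using inv that lastE(4)[OF ex] unfolding inv1_def p_def by (metis order_less_le_trans)
  have below_p: "i < p" if "i \<in> W" "i < q" "w i < c" for i
    using that p big class_excl by (metis linorder_less_linear)
  have "\<exists>i\<in>W. i < q \<and> w i < c" using inv q K_sub column_sub unfolding inv1_def by (metis order_refl subsetD)
  then have exL: "\<exists>i\<in>W. i < p \<and> w i < c" using below_p by blast
  define x where "x = lastL w p"
  have x: "x \<in> W" "x < p" "w x < c" using lastL(1-3)[OF exL] by (auto simp: x_def)
  have mid: "eqv (w i) \<or> big (w i)" if i: "i \<in> W" "x < i" "i < p" for i
  proof (rule class_cases[of "w i"])
    assume "w i < c"
    then show ?thesis using lastL(4)[OF exL] i by (force simp: x_def)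
  next
    assume "small (w i)"
    then obtain l where l: "l \<in> W" "i < l" "l < q" "w l < c"
      using inv i p unfolding inv1_def by (meson less_trans)
    then have "c \<le> w l" using lastL(4)[OF exL] i below_p by (auto simp: x_def)
    then show ?thesis using l by simp
  qed auto
  have st: "step1 q w = exchange x p (exchange p q w)"
    unfolding step1_def Let_def p_def x_def using q class_excl(9) by simp
  show ?thesis
    by (rule that[of p x])
      (rule p(1) p(2) p(3) big x(1) x(2) x(3) mid st p_def[symmetric] x_def[symmetric]; assumption)+
qed

lemma K_W: "i \<in> K \<Longrightarrow> i \<in> W"
  using K_sub column_sub by blast

lemma step1_id: "\<not> w q < c \<Longrightarrow> \<not> small (w q) \<Longrightarrow> step1 q w = w"
  by (simp add: step1_def)

lemma eqv_mem: "eqv a \<Longrightarrow> i \<in> K \<Longrightarrow> (i, a) \<in> H"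
  by (auto simp: eqv_def)

lemma step1_inv:
  assumes inv: "inv1 q w" and q: "q \<in> K"
  shows "inv1 (q + 1) (step1 q w)"
proof -
  have v: "valid w" using inv by (rule inv1_valid)
  \<comment> \<open>Both moving cases end alike: a left entry in row p, an \<open>eqv\<close> one in
    row q and big ones in between. This alone yields all clauses, with p and q as witnesses.\<close>
  have main: "inv1 (q + 1) w'" if "valid w'" "eqv (w' q)" "p \<in> W" "p < q" "w' p < c"
    "\<And>i. i \<in> W \<Longrightarrow> p < i \<Longrightarrow> i < q \<Longrightarrow> big (w' i)" for p w'
    unfolding inv1_def
  proof (intro conjI ballI impI)
    fix i assume "i \<in> W" "i < q + 1 \<and> \<not> big (w' i)"
    then show "\<exists>x\<in>W. i \<le> x \<and> x < q + 1 \<and> eqv (w' x)" using that K_W[OF q] by (intro bexI[of _ q]) auto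
  next
    fix i assume "i \<in> W" "q + 1 \<le> i \<and> small (w' i)"
    then show "\<exists>x\<in>W. x < i \<and> w' x < c" using that by (intro bexI[of _ p]) auto
  next
    fix i assume "i \<in> K" "q + 1 \<le> i \<and> (w' i < c \<or> small (w' i))"
    then show "\<exists>x\<in>W. x < i \<and> eqv (w' x)" using that K_W[OF q] by (intro bexI[of _ q]) auto
  next
    fix i assume i: "i \<in> W" "i < q + 1 \<and> small (w' i)"
    then have "i < p" using that class_excl by (metis linorder_less_linear zle_add1_eq_le linorder_not_less)
    then show "\<exists>x\<in>W. i < x \<and> x < q + 1 \<and> w' x < c" using that by force
  qed (rule that(1))
  consider "w q < c" | "small (w q)" | "\<not> w q < c" "\<not> small (w q)" by blast
  then show ?thesis
  proof cases
    case 1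
    obtain p where p: "p \<in> W" "p < q" "eqv (w p)"
      "\<And>i. i \<in> W \<Longrightarrow> p < i \<Longrightarrow> i < q \<Longrightarrow> big (w i)" "step1 q w = exchange p q w"
      by (rule step1_left[OF inv q 1], rule that; blast)
    show ?thesis unfolding p(5)
      by (rule main[of _ p]) (use p 1 v q K_W[OF q] eqv_mem in \<open>auto intro: valid_sw\<close>)
  next
    case 2
    obtain p x where p: "p \<in> W" "p < q" "eqv (w p)"
      "\<And>i. i \<in> W \<Longrightarrow> p < i \<Longrightarrow> i < q \<Longrightarrow> big (w i)"
      "x \<in> W" "x < p" "w x < c" "\<And>i. i \<in> W \<Longrightarrow> x < i \<Longrightarrow> i < p \<Longrightarrow> eqv (w i) \<or> big (w i)"
      "step1 q w = exchange x p (exchange p q w)"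
      by (rule step1_small[OF inv q 2], rule that; blast)
    have v1: "valid (exchange p q w)" using p v q K_W[OF q] eqv_mem by (intro valid_sw) auto
    have "(x, w x) \<in> H" "(p, w q) \<in> H" using v p validD Hdown[of q "w q" p] K_W[OF q] by auto
    moreover have "(p, w x) \<in> H"
      using Hleft[of p c "w x"] p valid_lo[OF v] right_row[OF v p(1)] by (auto simp: eqv_def)
    ultimately have v2: "valid (exchange x p (exchange p q w))"
      using v1 p Hdown[of p "w q" x] unfolding valid_def exchange_def by auto
    show ?thesis unfolding p(9)
      by (rule main[of _ p]) (use p v2 in auto)
  next
    case 3
    then have e: "step1 q w = w" by (rule step1_id)
    have "eqv (w q) \<or> big (w q)" using 3 class_cases by metis
    then have A: "\<exists>x\<in>W. i \<le> x \<and> x < q + 1 \<and> eqv (w x)" if iA: "i \<in> W" "i < q + 1" "\<not> big (w i)" for i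
    proof (cases "i = q")
      case False
      then have "i < q" using iA by simp
      then obtain x where "x \<in> W" "i \<le> x" "x < q" "eqv (w x)"
        using inv iA(1,3) unfolding inv1_def by blast
      then show ?thesis by force
    qed (use iA in force)
    have B: "\<exists>x\<in>W. i < x \<and> x < q + 1 \<and> w x < c" if i: "i \<in> W" "i < q + 1" "small (w i)" for i
    proof -
      have "i < q" using i 3 by (metis zless_add1_eq)
      then obtain x where "x \<in> W" "i < x" "x < q" "w x < c" using inv i unfolding inv1_def by blast
      then show ?thesis by force
    qed
    show ?thesis unfolding e using A B inv unfolding inv1_def by auto
  qed
qed

lemma step1_other:
  assumes "inv1 q w" "q \<in> K" "q < i \<or> i \<notin> W"
  shows "step1 q w i = w i"
proof -
  consider "w q < c" | "small (w q)" | "\<not> w q < c" "\<not> small (w q)" by blast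
  then show ?thesis
  proof cases
    case 1
    obtain p where "p \<in> W" "p < q" "step1 q w = exchange p q w"
      by (rule step1_left[OF assms(1,2) 1], rule that; blast)
    then show ?thesis using assms(3) K_W[OF assms(2)] by (cases "i = p"; cases "i = q") auto
  next
    case 2
    obtain p x where px: "p \<in> W" "x \<in> W" "p < q" "x < p" "step1 q w = exchange x p (exchange p q w)"
      by (rule step1_small[OF assms(1,2) 2], rule that; blast)
    then have "i \<noteq> p" "i \<noteq> q" "i \<noteq> x" using assms(3) K_W[OF assms(2)] by auto
    then show ?thesis using px by simp
  qed (simp add: step1_id)
qed

lemma step1_cnt:
  assumes inv: "inv1 q w" and q: "q \<in> K"
  shows "col_count (step1 q w) = col_count w"
proof -
  have qR: "q \<in> column H c" using q K_sub by blast
  have R: "i \<in> column H c" if "i \<in> W" "i < q" for i using column_down[OF qR] that by simp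
  consider "w q < c" | "small (w q)" | "\<not> w q < c" "\<not> small (w q)" by blast
  then show ?thesis
  proof cases
    case 1
    obtain p where "p \<in> W" "p < q" "step1 q w = exchange p q w"
      by (rule step1_left[OF inv q 1], rule that; blast)
    then show ?thesis using col_count_sw R qR by simp
  next
    case 2
    obtain p x where "p \<in> W" "x \<in> W" "p < q" "x < p" "step1 q w = exchange x p (exchange p q w)"
      by (rule step1_small[OF inv q 2], rule that; blast)
    then show ?thesis using col_count_sw R qR by simp
  qed (simp add: step1_id)
qed

text \<open>Right entries exceed u, and an exchange carries at most one left entry, past right ones
  only. The second exchange of the three-cycle moves the left entry down, so it is treated in
  reverse.\<close>

lemma step1_istop:
  assumes inv: "inv1 q w" and q: "q \<in> K" and u: "u < c"
  shows "istop W (step1 q w) u a \<longleftrightarrow> istop W w u a"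
proof -
  have ge: "u < b" if "eqv b \<or> big b \<or> small b" for b using that u by (auto simp: eqv_def big_def small_def)
  consider "w q < c" | "small (w q)" | "\<not> w q < c" "\<not> small (w q)" by blast
  then show ?thesis
  proof cases
    case 1
    obtain p where p: "p \<in> W" "p < q" "eqv (w p)"
      "\<And>i. i \<in> W \<Longrightarrow> p < i \<Longrightarrow> i < q \<Longrightarrow> big (w i)" "step1 q w = exchange p q w"
      by (rule step1_left[OF inv q 1], rule that; blast)
    show ?thesis unfolding p(5) using p ge K_W[OF q] by (intro istop_sw) auto
  next
    case 2
    obtain p x where p: "p \<in> W" "p < q" "eqv (w p)"
      "\<And>i. i \<in> W \<Longrightarrow> p < i \<Longrightarrow> i < q \<Longrightarrow> big (w i)"
      "x \<in> W" "x < p" "w x < c" "\<And>i. i \<in> W \<Longrightarrow> x < i \<Longrightarrow> i < p \<Longrightarrow> eqv (w i) \<or> big (w i)"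
      "step1 q w = exchange x p (exchange p q w)"
      by (rule step1_small[OF inv q 2], rule that; blast)
    have "istop W (exchange x p (exchange p q w)) u a \<longleftrightarrow> istop W (exchange x p (exchange x p (exchange p q w))) u a"
      using p ge 2 by (intro istop_sw[symmetric]) auto
    also have "\<dots> \<longleftrightarrow> istop W w u a"
      unfolding exchange_sw using p ge K_W[OF q] by (intro istop_sw) auto
    finally show ?thesis unfolding p(9) .
  qed (simp add: step1_id)
qed

text \<open>At a left entry the exchange removes one chain. At a small entry the exchange of p and q
  removes one and the exchange of x and p creates one, because the entries between x and p exceed
  the small entry.\<close>

lemma step1_card:
  assumes inv: "inv1 q w" and q: "q \<in> K"
  shows "card (ne_pairs H W w) = card (ne_pairs H W (step1 q w)) + (if w q < c then 1 else 0)"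
proof -
  have v: "valid w" using inv by (rule inv1_valid)
  have v': "valid (step1 q w)" using step1_inv[OF inv q] by (rule inv1_valid)
  consider "w q < c" | "small (w q)" | "\<not> w q < c" "\<not> small (w q)" by blast
  then show ?thesis
  proof cases
    case 1
    obtain p where p: "p \<in> W" "p < q" "eqv (w p)"
      "\<And>i. i \<in> W \<Longrightarrow> p < i \<Longrightarrow> i < q \<Longrightarrow> big (w i)" "step1 q w = exchange p q w"
      by (rule step1_left[OF inv q 1], rule that; blast)
    have "w q < w p" using 1 p by (auto simp: eqv_def)
    then show ?thesis unfolding p(5) using 1 p v q K_W[OF q] eqv_mem eqv_less_big
      by (subst card_nep_sw[of w p q]) auto
  next
    case 2
    obtain p x where p: "p \<in> W" "p < q" "eqv (w p)"
      "\<And>i. i \<in> W \<Longrightarrow> p < i \<Longrightarrow> i < q \<Longrightarrow> big (w i)"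
      "x \<in> W" "x < p" "w x < c" "\<And>i. i \<in> W \<Longrightarrow> x < i \<Longrightarrow> i < p \<Longrightarrow> eqv (w i) \<or> big (w i)"
      "step1 q w = exchange x p (exchange p q w)"
      by (rule step1_small[OF inv q 2], rule that; blast)
    have "w q < w p" using 2 p small_less_eqv by blast
    then have A: "card (ne_pairs H W w) = Suc (card (ne_pairs H W (exchange p q w)))"
      using p v q K_W[OF q] eqv_mem eqv_less_big by (intro card_nep_sw) auto
    have "card (ne_pairs H W (step1 q w)) = Suc (card (ne_pairs H W (exchange x p (step1 q w))))"
    proof (rule card_nep_sw)
      have "w x < w q" using p 2 by (auto simp: small_def)
      then show "step1 q w p < step1 q w x" unfolding p(9) using p by simp
      have "(p, w q) \<in> H" using v p validD Hdown[of q "w q" p] K_W[OF q] by auto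
      then show "(p, step1 q w x) \<in> H" unfolding p(9) using p by simp
      show "step1 q w x < step1 q w i" if "i \<in> W" "x < i" "i < p" for i
      proof -
        have "step1 q w x = w q" "step1 q w i = w i" unfolding p(9) using that p(2,6) by auto
        then show ?thesis using p(8)[OF that] small_less_eqv[OF 2] small_less_big[OF 2] by auto
      qed
    qed (use p v' in auto)
    moreover have "exchange x p (step1 q w) = exchange p q w" unfolding p(9) by simp
    ultimately show ?thesis using A 2 class_excl(1-6) by auto
  qed (simp add: step1_id)
qed

text \<open>Reads the case off the result. If nothing moved and \<open>w q\<close> is
  \<open>eqv\<close>, the last entry above q that is not big, if any, is \<open>eqv\<close> by
  \<open>inv1\<close>; after a move it is left and sits in row p. Then the last entry above p that
  is neither \<open>big\<close> nor \<open>eqv\<close> is small exactly if the three-cycle was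
  performed.\<close>

definition unstep1 :: "int \<Rightarrow> (int \<Rightarrow> int) \<Rightarrow> int \<Rightarrow> int" where
  "unstep1 q w = (if eqv (w q) then
     (let X = {i \<in> W. i < q \<and> \<not> big (w i)}; p = Max X;
          Y = {i \<in> W. i < p \<and> \<not> big (w i) \<and> \<not> eqv (w i)}; x = Max Y in
      if X \<noteq> {} \<and> w p < c then (if Y \<noteq> {} \<and> small (w x) then exchange p q (exchange x p w) else exchange p q w) else w)
     else w)"

lemma Max_eq:
  assumes "x \<in> X" "finite X" "\<And>y. y \<in> X \<Longrightarrow> \<not> x < (y::int)"
  shows "Max X = x"
  using assms by (intro Max_eqI) (auto simp: not_less)

lemma unstep1:
  assumes inv: "inv1 q w" and q: "q \<in> K"
  shows "unstep1 q (step1 q w) = w"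
proof -
  consider "w q < c" | "small (w q)" | "\<not> w q < c" "\<not> small (w q)" by blast
  then show ?thesis
  proof cases
    case 1
    obtain p where p: "p \<in> W" "p < q" "eqv (w p)"
      "\<And>i. i \<in> W \<Longrightarrow> p < i \<Longrightarrow> i < q \<Longrightarrow> big (w i)" "step1 q w = exchange p q w"
      by (rule step1_left[OF inv q 1], rule that; blast)
    let ?w = "exchange p q w"
    have X: "Max {i \<in> W. i < q \<and> \<not> big (?w i)} = p"
    proof (rule Max_eq)
      fix y assume y: "y \<in> {i \<in> W. i < q \<and> \<not> big (?w i)}"
      show "\<not> p < y"
      proof
        assume "p < y"
        then have "?w y = w y" "big (w y)" using y p(2,4) by auto
        then show False using y by auto
      qed
    qed (use p(1,2) finW 1 class_excl(2) in auto)
    have pX: "p \<in> {i \<in> W. i < q \<and> \<not> big (?w i)}" using p 1 class_excl(1-6) by auto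
    define Y where "Y = {i \<in> W. i < p \<and> \<not> big (?w i) \<and> \<not> eqv (?w i)}"
    \<comment> \<open>By \<open>inv1\<close> a small entry above q has a left one between it and q,
      which is then above p and belongs to \<open>Y\<close>.\<close>
    have "\<not> small (?w (Max Y))" if "Y \<noteq> {}"
    proof
      assume s: "small (?w (Max Y))"
      have finY: "finite Y" using finW by (simp add: Y_def)
      have m: "Max Y \<in> W" "Max Y < p" using Max_in[OF finY that] by (auto simp: Y_def)
      then obtain l where l: "l \<in> W" "Max Y < l" "l < q" "w l < c"
      proof -
        have "small (w (Max Y))" "Max Y < q" using s m p(2) by auto
        then show thesis using inv m(1) that unfolding inv1_def by blast
      qed
      have "l < p" using l p class_excl by (metis linorder_less_linear)
      then have "l \<in> Y" using l p class_excl(1-6) by (auto simp: Y_def)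
      then show False using Max_ge[OF finY] l by force
    qed
    then show ?thesis
      unfolding unstep1_def Let_def p(5) X Y_def[symmetric] using p 1 pX by auto
  next
    case 2
    obtain p x where p: "p \<in> W" "p < q" "eqv (w p)"
      "\<And>i. i \<in> W \<Longrightarrow> p < i \<Longrightarrow> i < q \<Longrightarrow> big (w i)"
      "x \<in> W" "x < p" "w x < c" "\<And>i. i \<in> W \<Longrightarrow> x < i \<Longrightarrow> i < p \<Longrightarrow> eqv (w i) \<or> big (w i)"
      "step1 q w = exchange x p (exchange p q w)"
      by (rule step1_small[OF inv q 2], rule that; blast)
    let ?w = "exchange x p (exchange p q w)"
    have w: "?w q = w p" "?w p = w x" "?w x = w q" "\<And>i. i \<noteq> p \<Longrightarrow> i \<noteq> q \<Longrightarrow> i \<noteq> x \<Longrightarrow> ?w i = w i"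
      using p by auto
    have X: "Max {i \<in> W. i < q \<and> \<not> big (?w i)} = p"
    proof (rule Max_eq)
      fix y assume y: "y \<in> {i \<in> W. i < q \<and> \<not> big (?w i)}"
      show "\<not> p < y"
      proof
        assume "p < y"
        then have "?w y = w y" "big (w y)" using y p(2,4,6) by auto
        then show False using y by auto
      qed
    qed (use p(1,2,7) finW class_excl(2) w in auto)
    have pX: "p \<in> {i \<in> W. i < q \<and> \<not> big (?w i)}" using p class_excl(1-6) w by auto
    have Y: "Max {i \<in> W. i < p \<and> \<not> big (?w i) \<and> \<not> eqv (?w i)} = x"
    proof (rule Max_eq)
      fix y assume y: "y \<in> {i \<in> W. i < p \<and> \<not> big (?w i) \<and> \<not> eqv (?w i)}"
      show "\<not> x < y"
      proof
        assume "x < y"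
        then have "?w y = w y" "eqv (w y) \<or> big (w y)" using y p(2,8) by auto
        then show False using y by auto
      qed
    qed (use p finW 2 class_excl(1-6) w in auto)
    have xY: "x \<in> {i \<in> W. i < p \<and> \<not> big (?w i) \<and> \<not> eqv (?w i)}" using p 2 class_excl(1-6) w by auto
    show ?thesis
      unfolding unstep1_def Let_def p(9) X Y using p 2 pX xY by auto
  next
    case 3
    define X where "X = {i \<in> W. i < q \<and> \<not> big (w i)}"
    have "\<not> w (Max X) < c" if "X \<noteq> {}"
    proof -
      have finX: "finite X" using finW by (simp add: X_def)
      have m: "Max X \<in> W" "Max X < q" "\<not> big (w (Max X))" using Max_in[OF finX that] by (auto simp: X_def)
      then obtain x where x: "x \<in> W" "Max X \<le> x" "x < q" "eqv (w x)" using inv unfolding inv1_def by meson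
      then have "x \<in> X" using class_excl(1-6) by (auto simp: X_def)
      then have "x = Max X" using Max_ge[OF finX] x by force
      then show ?thesis using x class_excl(1-6) by auto
    qed
    moreover have e: "step1 q w = w" using 3 by (rule step1_id)
    ultimately show ?thesis unfolding e unstep1_def Let_def X_def[symmetric] by auto
  qed
qed

text \<open>\<open>q0\<close> marks how far the loop has come and \<open>q1\<close> the end of K.
  The lost chains can be counted with the initial word, because a step at q leaves the rows below q
  alone.\<close>

lemma run1:
  assumes "sorted_wrt (<) xs" "set xs = {i \<in> K. q0 \<le> i}" "inv1 q0 w"
    and q1: "q0 \<le> q1" "\<And>i. i \<in> W \<Longrightarrow> i < q1 \<longleftrightarrow> i \<in> K"
  shows "inv1 q1 (fold step1 xs w)
    \<and> card (ne_pairs H W w) = card (ne_pairs H W (fold step1 xs w)) + length (filter (\<lambda>i. w i < c) xs)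
    \<and> (\<forall>u a. u < c \<longrightarrow> istop W (fold step1 xs w) u a \<longleftrightarrow> istop W w u a)
    \<and> col_count (fold step1 xs w) = col_count w
    \<and> (\<forall>i. i \<notin> K \<longrightarrow> fold step1 xs w i = w i)
    \<and> (\<forall>v. inv1 q0 v \<longrightarrow> fold step1 xs v = fold step1 xs w \<longrightarrow> v = w)"
  using assms(1,2,3) q1(1)
proof (induction xs arbitrary: q0 w)
  case Nil
  have "i < q0" if "i \<in> W" "i < q1" for i using that q1(2) Nil(2) by force
  then show ?case using inv1_mono[OF Nil(3,4)] by simp
next
  case (Cons q qs)
  have q: "q \<in> K" "q0 \<le> q" using Cons.prems by auto
  have less: "i < q0" if "i \<in> W" "i < q" for i
  proof (rule ccontr)
    assume "\<not> i < q0"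
    moreover have "i \<in> K" using K_down[OF q(1)] that by simp
    ultimately have "i \<in> set (q # qs)" using Cons.prems(2) by auto
    then show False using Cons.prems(1) that by auto
  qed
  have inv: "inv1 q w'" if "inv1 q0 w'" for w' using inv1_mono[OF that q(2)] less by auto
  have setqs: "set qs = {i \<in> K. q + 1 \<le> i}"
  proof (intro set_eqI iffI)
    fix i assume "i \<in> {i \<in> K. q + 1 \<le> i}"
    then have "i \<in> set (q # qs)" unfolding Cons.prems(2) using q by auto
    then show "i \<in> set qs" using \<open>i \<in> {i \<in> K. q + 1 \<le> i}\<close> by auto
  next
    fix i assume i: "i \<in> set qs"
    then have "i \<in> {i \<in> K. q0 \<le> i}" using Cons.prems(2) by (metis list.set_intros(2))
    then show "i \<in> {i \<in> K. q + 1 \<le> i}" using i Cons.prems(1) by auto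
  qed
  have "q < q1" using q1(2)[OF K_W[OF q(1)]] q by auto
  then have IH: "inv1 q1 (fold step1 qs (step1 q w))"
    "card (ne_pairs H W (step1 q w)) = card (ne_pairs H W (fold step1 qs (step1 q w))) + length (filter (\<lambda>i. step1 q w i < c) qs)"
    "\<forall>u a. u < c \<longrightarrow> istop W (fold step1 qs (step1 q w)) u a \<longleftrightarrow> istop W (step1 q w) u a"
    "\<forall>i. i \<notin> K \<longrightarrow> fold step1 qs (step1 q w) i = step1 q w i"
    "\<forall>v. inv1 (q + 1) v \<longrightarrow> fold step1 qs v = fold step1 qs (step1 q w) \<longrightarrow> v = step1 q w"
    "col_count (fold step1 qs (step1 q w)) = col_count (step1 q w)"
    using Cons.IH[OF _ setqs step1_inv[OF inv[OF Cons.prems(3)] q(1)]] Cons.prems(1) by auto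
  have starts_descent: "filter (\<lambda>i. step1 q w i < c) qs = filter (\<lambda>i. w i < c) qs"
    using setqs step1_other[OF inv[OF Cons.prems(3)] q(1)] by (intro filter_cong) auto
  have "fold step1 (q # qs) w i = w i" if "i \<notin> K" for i
  proof -
    have "q < i \<or> i \<notin> W" using K_down[OF q(1)] that by force
    then show ?thesis using IH(4) that step1_other[OF inv[OF Cons.prems(3)] q(1)] by auto
  qed
  moreover have "v = w" if "inv1 q0 v" "fold step1 (q # qs) v = fold step1 (q # qs) w" for v
  proof -
    have "step1 q v = step1 q w" using IH(5) step1_inv[OF inv[OF that(1)] q(1)] that(2) by simp
    then show ?thesis
      using unstep1[OF inv[OF that(1)] q(1)] unstep1[OF inv[OF Cons.prems(3)] q(1)] by metis
  qed
  ultimately show ?case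
    using IH step1_card[OF inv[OF Cons.prems(3)] q(1)] step1_istop[OF inv[OF Cons.prems(3)] q(1)] starts_descent
      step1_cnt[OF inv[OF Cons.prems(3)] q(1)] by auto
qed

section \<open>The loop gamma^2 and the borrowing\<close>

fun run2 :: "int \<Rightarrow> int list \<Rightarrow> (int \<Rightarrow> int) \<Rightarrow> int \<Rightarrow> int" where
  "run2 p [] w = w"
| "run2 p (q # qs) w = run2 q qs (if c \<le> w q then exchange p q w else w)"

text \<open>The pointer always rests on a left entry, so a right entry met in the next row q moves
  up by one row and gains one chain. Its column still reaches q, below its new row; this is the
  trace by which rows of R_2 are told from the last row of K.\<close>

lemma run2:
  assumes "sorted_wrt (<) (p # qs)" "set (p # qs) = {i \<in> column H c. p \<le> i}" "valid w" "w p < c"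
  shows "valid (run2 p qs w)
    \<and> card (ne_pairs H W (run2 p qs w)) = card (ne_pairs H W w) + length (filter (\<lambda>i. c \<le> w i) qs)
    \<and> (\<forall>u a. u < c \<longrightarrow> istop W (run2 p qs w) u a \<longleftrightarrow> istop W w u a)
    \<and> col_count (run2 p qs w) = col_count w
    \<and> (\<forall>i. i < p \<or> i \<notin> column H c \<longrightarrow> run2 p qs w i = w i)
    \<and> (\<forall>i\<in>column H c. p \<le> i \<and> c \<le> run2 p qs w i \<longrightarrow> (\<exists>x\<in>W. i < x \<and> (x, run2 p qs w i) \<in> H))
    \<and> (\<forall>v. valid v \<and> v p < c \<and> run2 p qs v = run2 p qs w \<longrightarrow> v = w)"
  using assms
proof (induction qs arbitrary: p w)
  case Nil
  then have "i = p" if "i \<in> column H c" "p \<le> i" for i using that by auto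
  then have "\<not> c \<le> w i" if "i \<in> column H c" "p \<le> i" for i using that Nil(4) by force
  then show ?case using Nil(3) by auto
next
  case (Cons q qs)
  have pq: "p < q" "p \<in> W" "q \<in> W" "(q, c) \<in> H" "(p, c) \<in> H"
  proof -
    have "p \<in> column H c" "q \<in> column H c" using Cons.prems(2) by auto
    then show "p \<in> W" "q \<in> W" "(q, c) \<in> H" "(p, c) \<in> H" using HW by auto
    show "p < q" using Cons.prems(1) by simp
  qed
  have no: "\<not> (p < i \<and> i < q)" if "i \<in> W" for i
  proof
    assume i: "p < i \<and> i < q"
    then have "i \<in> set (p # q # qs)" unfolding Cons.prems(2) using that pq Hdown[of q c i] by auto
    then show False using i Cons.prems(1) by auto
  qed
  have setqs: "set (q # qs) = {i \<in> column H c. q \<le> i}"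
  proof (intro set_eqI iffI)
    fix i assume i: "i \<in> {i \<in> column H c. q \<le> i}"
    then have "i \<in> set (p # q # qs)" unfolding Cons.prems(2) using pq by auto
    then show "i \<in> set (q # qs)" using i pq by auto
  next
    fix i assume i: "i \<in> set (q # qs)"
    then have "i \<in> {i \<in> column H c. p \<le> i}" using Cons.prems(2) by (metis list.set_intros(2))
    then show "i \<in> {i \<in> column H c. q \<le> i}" using i Cons.prems(1) by auto
  qed
  define st where "st v = (if c \<le> v q then exchange p q v else v)" for v :: "int \<Rightarrow> int"
  have st: "valid (st v)" "st v q < c" "card (ne_pairs H W (st v)) = card (ne_pairs H W v) + (if c \<le> v q then 1 else 0)"
    "u < c \<Longrightarrow> istop W (st v) u a \<longleftrightarrow> istop W v u a" "v = (if c \<le> st v p then exchange p q (st v) else st v)"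
    if v: "valid v" "v p < c" for v u a
  proof -
    have "(q, v p) \<in> H" using Hleft[OF pq(4)] valid_lo v pq by auto
    then have vs: "valid (exchange p q v)" using valid_sw v pq by blast
    then show "valid (st v)" using v by (simp add: st_def)
    show "st v q < c" using v by (simp add: st_def)
    show "v = (if c \<le> st v p then exchange p q (st v) else st v)" using v pq by (auto simp: st_def)
    show "card (ne_pairs H W (st v)) = card (ne_pairs H W v) + (if c \<le> v q then 1 else 0)"
    proof (cases "c \<le> v q")
      case True
      then have "card (ne_pairs H W (exchange p q v)) = Suc (card (ne_pairs H W (exchange p q (exchange p q v))))"
        using vs v pq no validD[OF v(1)] by (intro card_nep_sw) auto
      then show ?thesis using True by (simp add: st_def)
    qed (simp add: st_def)
    show "istop W (st v) u a \<longleftrightarrow> istop W v u a" if "u < c"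
    proof (cases "c \<le> v q")
      case True
      then have "istop W (exchange p q (exchange p q v)) u a \<longleftrightarrow> istop W (exchange p q v) u a"
        using pq no that by (intro istop_sw) auto
      then show ?thesis using True by (simp add: st_def)
    qed (simp add: st_def)
  qed
  have run: "run2 p (q # qs) v = run2 q qs (st v)" for v by (simp add: st_def)
  note v = Cons.prems(3,4)
  have IH: "valid (run2 q qs (st w))"
    "card (ne_pairs H W (run2 q qs (st w))) = card (ne_pairs H W (st w)) + length (filter (\<lambda>i. c \<le> st w i) qs)"
    "\<forall>u a. u < c \<longrightarrow> istop W (run2 q qs (st w)) u a \<longleftrightarrow> istop W (st w) u a"
    "\<forall>i. i < q \<or> i \<notin> column H c \<longrightarrow> run2 q qs (st w) i = st w i"
    "\<forall>i\<in>column H c. q \<le> i \<and> c \<le> run2 q qs (st w) i \<longrightarrow> (\<exists>x\<in>W. i < x \<and> (x, run2 q qs (st w) i) \<in> H)"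
    "\<forall>v. valid v \<and> v q < c \<and> run2 q qs v = run2 q qs (st w) \<longrightarrow> v = st w"
    "col_count (run2 q qs (st w)) = col_count (st w)"
    using Cons.IH[OF _ setqs st(1)[OF v] st(2)[OF v]] Cons.prems(1) by simp_all
  have other: "st w i = w i" if "i \<noteq> p" "i \<noteq> q" for i using that by (simp add: st_def)
  have "filter (\<lambda>i. c \<le> st w i) qs = filter (\<lambda>i. c \<le> w i) qs"
    using Cons.prems(1) pq other by (intro filter_cong) auto
  then have c1: "card (ne_pairs H W (run2 p (q # qs) w)) = card (ne_pairs H W w) + length (filter (\<lambda>i. c \<le> w i) (q # qs))"
    unfolding run using IH(2) st(3)[OF v] by simp
  have "col_count (st w) = col_count w" using col_count_sw pq by (simp add: st_def)
  then have c0: "col_count (run2 q qs (st w)) = col_count w" using IH(7) by simp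
  have c2: "run2 p (q # qs) w i = w i" if "i < p \<or> i \<notin> column H c" for i
  proof -
    have "i \<noteq> p" "i \<noteq> q" using that pq by auto
    then show ?thesis unfolding run using that IH(4) other[of i] pq by auto
  qed
  have c3: "\<exists>x\<in>W. i < x \<and> (x, run2 p (q # qs) w i) \<in> H"
    if i: "i \<in> column H c" "p \<le> i" "c \<le> run2 p (q # qs) w i" for i
  proof (cases "i = p")
    case True
    then have eq: "run2 p (q # qs) w i = st w p" unfolding run using IH(4) pq by auto
    then have "c \<le> w q" using i v(2) True by (cases "c \<le> w q") (auto simp: st_def)
    then have "run2 p (q # qs) w i = w q" using eq by (simp add: st_def)
    then show ?thesis using True pq validD[OF v(1) pq(3)] by auto
  next
    case False
    then have "q \<le> i" using no[of i] i column_sub by force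
    then show ?thesis using IH(5) i unfolding run by auto
  qed
  have c4: "v' = w" if "valid v'" "v' p < c" "run2 p (q # qs) v' = run2 p (q # qs) w" for v'
  proof -
    have "st v' = st w" using IH(6) st(1,2)[OF that(1,2)] that(3) unfolding run by blast
    then show ?thesis using st(5)[OF that(1,2)] st(5)[OF v] by metis
  qed
  show ?case
    using IH(1,3) st(4)[OF v] c0 c1 c2 c3 c4 unfolding run by blast
qed

definition borrow :: "int \<Rightarrow> (int \<Rightarrow> int) \<Rightarrow> int \<Rightarrow> int" where
  "borrow p w = (if c \<le> w p then exchange (lastL w p) p w else w)"

text \<open>Without borrowing the last entry above p that is left or small is not small, since every
  small one has a left one below it. After borrowing it is the small entry received from row
  p.\<close>

definition unborrow :: "int \<Rightarrow> (int \<Rightarrow> int) \<Rightarrow> int \<Rightarrow> int" where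
  "unborrow p w = (let Y = {i \<in> W. i < p \<and> \<not> big (w i) \<and> \<not> eqv (w i)} in
     if Y \<noteq> {} \<and> small (w (Max Y)) then exchange (Max Y) p w else w)"

text \<open>Row p lies outside K, so the column of a right entry in it is longer than K. The entry
  is therefore small, and \<open>inv1\<close> provides a left entry above it.\<close>

lemma borrow:
  assumes inv: "inv1 p w" and p: "p \<in> column H c" "p \<notin> K"
  shows "valid (borrow p w) \<and> borrow p w p < c
    \<and> card (ne_pairs H W (borrow p w)) = card (ne_pairs H W w) + (if c \<le> w p then 1 else 0)
    \<and> (\<forall>u a. u < c \<longrightarrow> istop W (borrow p w) u a \<longleftrightarrow> istop W w u a)
    \<and> col_count (borrow p w) = col_count w
    \<and> (\<forall>i. p < i \<or> i \<notin> W \<or> (i \<noteq> p \<and> c \<le> w i) \<longrightarrow> borrow p w i = w i) \<and> unborrow p (borrow p w) = w"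
proof -
  have v: "valid w" using inv by (rule inv1_valid)
  have pW: "p \<in> W" "(p, c) \<in> H" using p HW by auto
  define Y where "Y v = {i \<in> W. i < p \<and> \<not> big (v i) \<and> \<not> eqv (v i)}" for v
  have finY: "finite (Y v)" for v using finW by (simp add: Y_def)
  have left_below: "\<exists>l\<in>W. i < l \<and> l < p \<and> w l < c" if "i \<in> W" "i < p" "small (w i)" for i
    using inv that unfolding inv1_def by blast
  show ?thesis
  proof (cases "c \<le> w p")
    case False
    have "\<not> small (w (Max (Y w)))" if "Y w \<noteq> {}"
    proof
      assume s: "small (w (Max (Y w)))"
      have "Max (Y w) \<in> W" "Max (Y w) < p" using Max_in[OF finY that] by (auto simp: Y_def)
      then obtain l where l: "l \<in> W" "Max (Y w) < l" "l < p" "w l < c" using left_below s by blast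
      then have "l \<in> Y w" using class_excl(1-6) by (auto simp: Y_def)
      then show False using Max_ge[OF finY] l by force
    qed
    then have "unborrow p w = w" unfolding unborrow_def Let_def Y_def[symmetric] by auto
    then show ?thesis using False v by (simp add: borrow_def)
  next
    case True
    have s: "small (w p)"
      using K_comparable[of "w p"] True p validD[OF v pW(1)] unfolding small_def
      by (metis mem_column psubsetD)
    then have ex: "\<exists>i\<in>W. i < p \<and> w i < c" using inv pW unfolding inv1_def by blast
    define x where "x = lastL w p"
    have x: "x \<in> W" "x < p" "w x < c" using lastL(1-3)[OF ex] by (auto simp: x_def)
    have mid: "eqv (w i) \<or> big (w i)" if i: "i \<in> W" "x < i" "i < p" for i
    proof (rule class_cases[of "w i"])
      assume "w i < c"
      then show ?thesis using lastL(4)[OF ex] i by (force simp: x_def)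
    next
      assume "small (w i)"
      then obtain l where l: "l \<in> W" "i < l" "l < p" "w l < c" using left_below i by blast
      then have "c \<le> w l" using lastL(4)[OF ex] i by (auto simp: x_def)
      then show ?thesis using l by simp
    qed auto
    have b: "borrow p w = exchange x p w" unfolding borrow_def x_def using True by simp
    have "(p, w x) \<in> H" using Hleft[OF pW(2)] valid_lo[OF v x(1)] x by auto
    then have v': "valid (exchange x p w)" using valid_sw[OF v x(1) pW(1) x(2)] by blast
    have "col_count (exchange x p w) = col_count w" using col_count_sw column_down[OF p(1) x(1)] x(2) p(1) by simp
    moreover have bet: "w p < w i" if "i \<in> W" "x < i" "i < p" for i
      using mid[OF that] small_less_eqv[OF s] small_less_big[OF s] by blast
    moreover have "card (ne_pairs H W (exchange x p w)) = Suc (card (ne_pairs H W (exchange x p (exchange x p w))))"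
      using v' x pW True bet validD[OF v pW(1)] by (intro card_nep_sw) auto
    moreover have "istop W (exchange x p (exchange x p w)) u a \<longleftrightarrow> istop W (exchange x p w) u a" if "u < c" for u a
      using x pW True that bet by (intro istop_sw) force+
    moreover have "Max (Y (exchange x p w)) = x"
    proof (rule Max_eq)
      fix y assume y: "y \<in> Y (exchange x p w)"
      show "\<not> x < y"
      proof
        assume "x < y"
        then have "exchange x p w y = w y" "eqv (w y) \<or> big (w y)" using y mid by (auto simp: Y_def)
        then show False using y by (auto simp: Y_def)
      qed
    qed (use x finY s class_excl(1-6) in \<open>auto simp: Y_def\<close>)
    moreover have "x \<in> Y (exchange x p w)" using x s class_excl(1-6) by (auto simp: Y_def)
    moreover have "exchange x p w i = w i" if "p < i \<or> i \<notin> W \<or> (i \<noteq> p \<and> c \<le> w i)" for i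
    proof -
      have "i \<noteq> x" "i \<noteq> p" using that x pW by auto
      then show ?thesis by simp
    qed
    ultimately show ?thesis
      using True v' x s unfolding b unborrow_def Let_def Y_def[symmetric] by auto
  qed
qed

section \<open>The whole of gamma on words\<close>

definition D :: "int set" where "D = column H c - K"

text \<open>The fold runs over all of K and not only from CRC downwards, so that the map depends on
  the word and K alone.\<close>

definition full :: "(int \<Rightarrow> int) \<Rightarrow> int \<Rightarrow> int" where
  "full w = (let w' = fold step1 (sorted_list_of_set K) w in
     case sorted_list_of_set D of [] \<Rightarrow> w' | p # qs \<Rightarrow> run2 p qs (borrow p w'))"

text \<open>\<open>clc\<close> is the row of CLC. That the columns of all entries above it lie in K
  expresses that CRC is the leftmost of them.\<close>

definition start :: "(int \<Rightarrow> int) \<Rightarrow> bool" where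
  "start w \<longleftrightarrow> valid w \<and> (\<exists>clc\<in>column H c. w clc < c
     \<and> (\<forall>i\<in>W. i < clc \<longrightarrow> c \<le> w i \<and> column H (w i) \<subseteq> K)
     \<and> (K \<noteq> {} \<longrightarrow> (\<exists>i\<in>W. i < clc \<and> eqv (w i))))"

text \<open>No row lies above \<open>q0\<close>. Left entries occur from CLC on and small ones
  strictly below it, so CLC and CRC are the witnesses for the remaining clauses.\<close>

lemma start_inv1:
  assumes "start w" "\<And>i. i \<in> W \<Longrightarrow> q0 \<le> i"
  shows "inv1 q0 w"
proof -
  obtain clc where clc: "clc \<in> W" "w clc < c" "\<And>i. i \<in> W \<Longrightarrow> i < clc \<Longrightarrow> c \<le> w i \<and> column H (w i) \<subseteq> K"
    "K \<noteq> {} \<Longrightarrow> \<exists>i\<in>W. i < clc \<and> eqv (w i)"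
    using assms(1) column_sub unfolding start_def by blast
  have small: "clc < i" if "i \<in> W" "small (w i)" for i
    using that clc(1,2) clc(3)[of i] by (cases i clc rule: linorder_cases) (auto simp: small_def)
  have left: "clc \<le> i" if "i \<in> W" "w i < c" for i using that clc(3)[of i] by force
  have "\<exists>x\<in>W. x < i \<and> eqv (w x)" if i: "i \<in> K" "w i < c \<or> small (w i)" for i
  proof -
    have "clc \<le> i" using i small[of i] left[of i] K_W by force
    then show ?thesis using clc(4) i by force
  qed
  moreover have "\<not> i < q0" if "i \<in> W" for i using assms(2)[OF that] by simp
  ultimately show ?thesis
    unfolding inv1_def using assms(1) small clc(1,2) unfolding start_def by blast
qed

lemma finite_sub: "X \<subseteq> W \<Longrightarrow> finite X"
  using finW finite_subset by blast

lemma D_sub: "D \<subseteq> W" "D \<subseteq> column H c"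
  using column_sub by (auto simp: D_def HW)

lemma filter_length: "finite X \<Longrightarrow> length (filter Q (sorted_list_of_set X)) = card {i \<in> X. Q i}"
  by (subst distinct_length_filter) (auto simp: Int_def conj_commute)

text \<open>The chain count: gamma^1 loses one chain per left entry in K, gamma^2 together with the
  borrowing gains one per right entry in D, and D consists of its left and its right entries. The
  claims about \<open>D\<close> and \<open>Max K\<close> serve to recover K from the result.\<close>

lemma full:
  assumes st: "start w"
  shows "valid (full w)"
    and "card (ne_pairs H W (full w)) + card {i \<in> column H c. w i < c} = card (ne_pairs H W w) + card D"
    and "u < c \<Longrightarrow> istop W (full w) u a \<longleftrightarrow> istop W w u a"
    and "i \<notin> column H c \<Longrightarrow> full w i = w i"
    and "i \<in> D \<Longrightarrow> c \<le> full w i \<Longrightarrow> \<exists>x\<in>W. i < x \<and> (x, full w i) \<in> H"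
    and "K \<noteq> {} \<Longrightarrow> eqv (full w (Max K))"
    and "start v \<Longrightarrow> full v = full w \<Longrightarrow> v = w"
    and "col_count (full w) = col_count w"
proof -
  define q0 where "q0 = Min W"
  have q0: "q0 \<le> i" if "i \<in> W" for i using that finW by (simp add: q0_def)
  have Wne: "W \<noteq> {}" using st column_sub by (auto simp: start_def)
  let ?xs = "sorted_list_of_set K"
  \<comment> \<open>The border between the rows of K and those of D; if D is nonempty it is its
    first row, where borrowing takes place.\<close>
  define q1 where "q1 = (if D = {} then Max K + 1 else Min D)"
  have finK: "finite K" and finD: "finite D" using finite_sub K_W D_sub by (auto intro: finite_sub)
  have cne: "column H c \<noteq> {}" using st by (auto simp: start_def)
  have q1: "i < q1 \<longleftrightarrow> i \<in> K" if i: "i \<in> W" for i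
  proof (cases "D = {}")
    case True
    then have "K = column H c" using K_sub by (auto simp: D_def)
    then have m: "Max K \<in> K" using Max_in[OF finK] cne by blast
    then have "i < Max K + 1 \<longleftrightarrow> i \<in> K" using K_down[OF m i] Max_ge[OF finK] by force
    then show ?thesis using True by (simp add: q1_def)
  next
    case False
    then have m: "Min D \<in> D" using Min_in[OF finD] by blast
    have "i < Min D \<longleftrightarrow> i \<in> K"
    proof
      assume "i < Min D"
      then have "i \<notin> D" using Min_le[OF finD] by force
      moreover have "i \<in> column H c" using m \<open>i < Min D\<close> column_down[OF _ i] by (auto simp: D_def)
      ultimately show "i \<in> K" by (auto simp: D_def)
    next
      assume "i \<in> K"
      then show "i < Min D" using K_down[of i "Min D"] m D_sub by (force simp: D_def)
    qed
    then show ?thesis using False by (simp add: q1_def)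
  qed
  have q01: "q0 \<le> q1"
  proof (cases "D = {}")
    case True
    then have "Max K \<in> K" using Max_in[OF finK] cne K_sub by (auto simp: D_def)
    then show ?thesis using True q0 K_W by (force simp: q1_def)
  next
    case False
    then show ?thesis using Min_in[OF finD False] q0 D_sub by (auto simp: q1_def)
  qed
  let ?w = "fold step1 ?xs w"
  have xs: "sorted_wrt (<) ?xs" "set ?xs = {i \<in> K. q0 \<le> i}"
    using finK q0 K_W by auto
  note R1 = run1[OF xs start_inv1[OF st q0] q01 q1]
  have inj1: "v' = w" if "start v'" "fold step1 ?xs v' = ?w" for v'
    using R1 start_inv1[OF that(1) q0] that(2) by blast
  have inv: "inv1 q1 ?w" using R1 by blast
  have out1: "?w i = w i" if "i \<notin> K" for i using R1 that by blast
  have card1: "card (ne_pairs H W w) = card (ne_pairs H W ?w) + card {i \<in> K. w i < c}"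
    using R1 filter_length[OF finK] by simp
  have top1: "istop W ?w u a \<longleftrightarrow> istop W w u a" if "u < c" for u a using R1 that by blast
  have cnt1: "col_count ?w = col_count w" using R1 by blast
  \<comment> \<open>The entry in the last row of K has a column reaching that row, hence containing
    K, so it is not big. By \<open>inv1\<close> some \<open>eqv\<close> entry stands at or below it
    within K, and this can only be the entry itself.\<close>
  have eqvK: "eqv (?w (Max K))" if "K \<noteq> {}"
  proof -
    have m: "Max K \<in> K" using Max_in[OF finK that] .
    have "Max K \<in> column H (?w (Max K))" using validD[OF inv1_valid[OF inv] K_W[OF m]] by simp
    then have "K \<subseteq> column H (?w (Max K))" using column_down Max_ge[OF finK] K_W by blast
    then have "\<not> big (?w (Max K))" by (auto simp: big_def)
    then obtain x where x: "x \<in> W" "Max K \<le> x" "x < q1" "eqv (?w x)"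
      using inv m K_W q1 unfolding inv1_def by meson
    then have "x = Max K" using q1 Max_ge[OF finK, of x] by force
    then show ?thesis using x by simp
  qed
  have split: "card {i \<in> column H c. w i < c} + card {i \<in> D. c \<le> w i} = card {i \<in> K. w i < c} + card D"
  proof -
    have "{i \<in> column H c. w i < c} = {i \<in> K. w i < c} \<union> {i \<in> D. w i < c}"
      using K_sub by (auto simp: D_def)
    moreover have disj: "{i \<in> K. w i < c} \<inter> {i \<in> D. w i < c} = {}" by (auto simp: D_def)
    ultimately have "card {i \<in> column H c. w i < c} = card {i \<in> K. w i < c} + card {i \<in> D. w i < c}"
      using finK finD card_Un_disjoint[OF _ _ disj] by simp
    moreover have "D = {i \<in> D. w i < c} \<union> {i \<in> D. c \<le> w i}" by auto
    then have "card D = card {i \<in> D. w i < c} + card {i \<in> D. c \<le> w i}"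
      using finD card_Un_disjoint[of "{i \<in> D. w i < c}" "{i \<in> D. c \<le> w i}"] by force
    ultimately show ?thesis by simp
  qed
  have G: "valid (full w) \<and>
      card (ne_pairs H W (full w)) + card {i \<in> column H c. w i < c} = card (ne_pairs H W w) + card D \<and>
      (\<forall>u a. u < c \<longrightarrow> istop W (full w) u a = istop W w u a) \<and>
      (\<forall>i. i \<notin> column H c \<longrightarrow> full w i = w i) \<and>
      (\<forall>i. i \<in> D \<longrightarrow> c \<le> full w i \<longrightarrow> (\<exists>x\<in>W. i < x \<and> (x, full w i) \<in> H)) \<and>
      (K \<noteq> {} \<longrightarrow> eqv (full w (Max K))) \<and> col_count (full w) = col_count w \<and> (\<forall>v. start v \<longrightarrow> full v = full w \<longrightarrow> v = w)"
  proof (cases "D = {}")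
    case True
    then have f: "full v' = fold step1 ?xs v'" for v' by (simp add: full_def)
    have "K = column H c" using True K_sub by (auto simp: D_def)
    then show ?thesis
      unfolding f using inv1_valid[OF inv] card1 split top1 out1 eqvK inj1 cnt1 True by simp
  next
    case False
    define p where "p = Min D"
    obtain qs where qs: "sorted_list_of_set D = p # qs"
      using sorted_list_of_set_nonempty[OF finD False] by (auto simp: p_def)
    have pD: "p \<in> D" using Min_in[OF finD False] by (simp add: p_def)
    have p: "p \<in> column H c" "p \<notin> K" "p \<in> W" using pD D_sub by (auto simp: D_def)
    have q1p: "q1 = p" using False by (simp add: q1_def p_def)
    have f: "full v' = run2 p qs (borrow p (fold step1 ?xs v'))" for v' by (simp add: full_def qs)
    have sorted: "sorted_wrt (<) (p # qs)" using finD unfolding qs[symmetric] by simp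
    have Dset: "set (p # qs) = D" using finD unfolding qs[symmetric] by simp
    have setp: "set (p # qs) = {i \<in> column H c. p \<le> i}"
      unfolding Dset using Min_le[OF finD] K_down[of _ p] p q1[unfolded q1p] column_sub
      by (auto simp: D_def p_def linorder_not_less[symmetric])
    have b: "valid (borrow p v') \<and> borrow p v' p < c
        \<and> card (ne_pairs H W (borrow p v')) = card (ne_pairs H W v') + (if c \<le> v' p then 1 else 0)
        \<and> (\<forall>u a. u < c \<longrightarrow> istop W (borrow p v') u a \<longleftrightarrow> istop W v' u a)
        \<and> col_count (borrow p v') = col_count v'
        \<and> (\<forall>i. p < i \<or> i \<notin> W \<or> (i \<noteq> p \<and> c \<le> v' i) \<longrightarrow> borrow p v' i = v' i) \<and> unborrow p (borrow p v') = v'"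
      if "inv1 q1 v'" for v' using borrow[OF _ p(1,2)] that unfolding q1p by blast
    note B = b[OF inv]
    have bv: "valid (borrow p ?w)" "borrow p ?w p < c" using B by blast+
    note R2 = run2[OF sorted setp bv]
    have "c \<le> ?w i \<longleftrightarrow> c \<le> w i" if "i \<in> D" for i using out1 that D_sub by (auto simp: D_def)
    moreover have "borrow p ?w i = ?w i" if "i \<in> set qs" for i using B sorted that by auto
    ultimately have "c \<le> borrow p ?w i \<longleftrightarrow> c \<le> w i" if "i \<in> set qs" for i using that Dset by auto
    then have "filter (\<lambda>i. c \<le> borrow p ?w i) qs = filter (\<lambda>i. c \<le> w i) qs" by (intro filter_cong) auto
    moreover have "c \<le> ?w p \<longleftrightarrow> c \<le> w p" using out1 p by auto
    ultimately have "length (filter (\<lambda>i. c \<le> borrow p ?w i) qs) + (if c \<le> ?w p then 1 else 0)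
      = length (filter (\<lambda>i. c \<le> w i) (p # qs))" by simp
    then have c2: "card (ne_pairs H W (full w)) = card (ne_pairs H W ?w) + card {i \<in> D. c \<le> w i}"
      unfolding f using R2 B filter_length[OF finD, of "\<lambda>i. c \<le> w i"] unfolding qs by linarith
    have out: "full w i = w i" if "i \<notin> column H c" for i
    proof -
      have "p < i \<or> i \<notin> W" using that p column_down[OF p(1), of i] by force
      then have "borrow p ?w i = ?w i" using B by blast
      moreover have "full w i = borrow p ?w i" unfolding f using R2 that by blast
      moreover have "?w i = w i" using out1 that K_sub by blast
      ultimately show ?thesis by simp
    qed
    have e: "eqv (full w (Max K))" if "K \<noteq> {}"
    proof -
      have m: "Max K \<in> K" "c \<le> ?w (Max K)" "Max K < p"
        using Max_in[OF finK that] eqvK[OF that] q1[unfolded q1p] K_W by (auto simp: eqv_def)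
      then have "borrow p ?w (Max K) = ?w (Max K)" using B by auto
      then show ?thesis unfolding f using R2 m eqvK[OF that] by auto
    qed
    have D5: "\<exists>x\<in>W. i < x \<and> (x, full w i) \<in> H" if "i \<in> D" "c \<le> full w i" for i
    proof -
      have "i \<in> column H c" "p \<le> i" using that setp Dset by auto
      then show ?thesis using R2 that unfolding f by blast
    qed
    have inj: "v = w" if "start v" "full v = full w" for v
    proof -
      have "inv1 q1 (fold step1 ?xs v)" using run1[OF xs start_inv1[OF that(1) q0] q01 q1] by blast
      note b' = b[OF this]
      then have "borrow p (fold step1 ?xs v) = borrow p ?w" using R2 that(2) unfolding f by blast
      then have "fold step1 ?xs v = ?w" using b' B by metis
      then show ?thesis using inj1 that by blast
    qed
    show ?thesis
    proof (intro conjI allI impI)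
      show "valid (full w)" using R2 unfolding f by blast
      show "col_count (full w) = col_count w" using R2 B cnt1 unfolding f by simp
      show "istop W (full w) u a = istop W w u a" if "u < c" for u a
        using R2 B top1 that unfolding f by blast
      show "card (ne_pairs H W (full w)) + card {i \<in> column H c. w i < c} = card (ne_pairs H W w) + card D"
        using c2 card1 split by linarith
    qed (use out e D5 inj in blast)+
  qed
  show "valid (full w)"
    "card (ne_pairs H W (full w)) + card {i \<in> column H c. w i < c} = card (ne_pairs H W w) + card D"
    "u < c \<Longrightarrow> istop W (full w) u a \<longleftrightarrow> istop W w u a"
    "i \<notin> column H c \<Longrightarrow> full w i = w i"
    "i \<in> D \<Longrightarrow> c \<le> full w i \<Longrightarrow> \<exists>x\<in>W. i < x \<and> (x, full w i) \<in> H"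
    "K \<noteq> {} \<Longrightarrow> eqv (full w (Max K))"
    "start v \<Longrightarrow> full v = full w \<Longrightarrow> v = w"
    "col_count (full w) = col_count w"
    using G by blast+
qed

end

section \<open>Agreement of the word version with the algorithm\<close>

lemma sorted_list_of_set_split:
  assumes "finite X" "a \<in> X"
  shows "sorted_list_of_set X = sorted_list_of_set {i \<in> X. i < a} @ a # sorted_list_of_set {i \<in> X. a < i}"
  using assms by (intro strict_sorted_equal) (auto simp: sorted_wrt_append)

context ferrersK
begin

text \<open>The loop carries \<open>ptr_1\<close> along while \<open>step1\<close> searches for it.
  They agree because the pointer moves to the row just processed exactly when that row then holds an
  \<open>eqv\<close> entry.\<close>

lemma gamma1_loop_eq:
  assumes "sorted_wrt (<) qs" "set qs = {i \<in> K. q0 \<le> i}" "inv1 q0 w"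
    and "p \<in> W" "p < q0" "eqv (w p)" "\<And>i. i \<in> W \<Longrightarrow> p < i \<Longrightarrow> i < q0 \<Longrightarrow> big (w i)"
  shows "gamma1_loop H c (graph W w) p qs = graph W (fold step1 qs w)"
  using assms
proof (induction qs arbitrary: q0 w p)
  case (Cons q qs)
  have q: "q \<in> K" "q0 \<le> q" using Cons.prems by auto
  note qW = K_W[OF q(1)]
  have less: "i < q0" if "i \<in> W" "i < q" for i
  proof (rule ccontr)
    assume "\<not> i < q0"
    moreover have "i \<in> K" using K_down[OF q(1)] that by simp
    ultimately have "i \<in> set (q # qs)" using Cons.prems(2) by auto
    then show False using Cons.prems(1) that by auto
  qed
  have inv: "inv1 q w" using inv1_mono[OF Cons.prems(3) q(2)] less by auto
  have setqs: "set qs = {i \<in> K. q + 1 \<le> i}"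
  proof (intro set_eqI iffI)
    fix i assume "i \<in> {i \<in> K. q + 1 \<le> i}"
    then have "i \<in> set (q # qs)" unfolding Cons.prems(2) using q by auto
    then show "i \<in> set qs" using \<open>i \<in> {i \<in> K. q + 1 \<le> i}\<close> by auto
  next
    fix i assume i: "i \<in> set qs"
    then have "i \<in> {i \<in> K. q0 \<le> i}" using Cons.prems(2) by (metis list.set_intros(2))
    then show "i \<in> {i \<in> K. q + 1 \<le> i}" using i Cons.prems(1) by auto
  qed
  note p = Cons.prems(4,6)
  have pq: "p < q" using Cons.prems(5) q by simp
  have bigs: "big (w i)" if "i \<in> W" "p < i" "i < q" for i
    using Cons.prems(7)[OF that(1,2) less[OF that(1,3)]] .
  have lE: "lastE w q = p"
    unfolding lastE_def
  proof (rule Max_eq)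
    show "\<not> p < y" if "y \<in> {i \<in> W. i < q \<and> eqv (w i)}" for y
      using bigs[of y] that class_excl(4) by auto
  qed (use p pq finW in auto)
  have sqs: "sorted_wrt (<) qs" using Cons.prems(1) by simp
  note IH = Cons.IH[OF sqs setqs step1_inv[OF inv q(1)]]
  have fold: "fold step1 (q # qs) w = fold step1 qs (step1 q w)" by simp
  have none: "big (v i)" if "q < i" "i < q + 1" for i v using that by auto
  show ?case
  proof (rule class_cases[of "w q"])
    assume l: "w q < c"
    have s: "step1 q w = exchange p q w" using l by (simp add: step1_def lE)
    have "gamma1_loop H c (graph W (exchange p q w)) q qs = graph W (fold step1 qs (exchange p q w))"
      using IH[of q] none qW p unfolding s by auto
    then show ?thesis using l qW p by (simp add: swap_graph s)
  next
    assume e: "eqv (w q)"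
    then have s: "step1 q w = w" using class_excl(7,8) class_excl(5,6) by (intro step1_id) blast+
    have "gamma1_loop H c (graph W w) q qs = graph W (fold step1 qs w)"
      using IH[of q] none qW e unfolding s by auto
    then show ?thesis using e p(2) qW p(1) s by (simp add: eqv_def Let_def)
  next
    assume b: "big (w q)"
    then have s: "step1 q w = w" using class_excl(7,8) class_excl(5,6) by (intro step1_id) blast+
    have "gamma1_loop H c (graph W w) p qs = graph W (fold step1 qs w)"
    proof (rule IH[of p, unfolded s])
      show "big (w i)" if "i \<in> W" "p < i" "i < q + 1" for i
        using that bigs b by (cases "i = q") auto
    qed (use p pq in auto)
    moreover have "card (column H (w q)) < card (column H (w p))"
      using b p finite_subset[OF K_sub[THEN order_trans, OF column_sub] finW]
      by (auto simp: big_def eqv_def intro: psubset_card_mono)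
    moreover have "w p < w q" using eqv_less_big p b by blast
    moreover have "\<not> w q < c" using b by (simp add: big_def)
    ultimately show ?thesis using qW p s by (simp add: Let_def)
  next
    assume sm: "small (w q)"
    obtain x where x: "x \<in> W" "x < p" "w x < c" "step1 q w = exchange x p (exchange p q w)" "lastL w p = x"
    proof (rule step1_small[OF inv q(1) sm])
      fix p' x assume h: "lastE w q = p'" "x \<in> W" "x < p'" "w x < c"
        "step1 q w = exchange x p' (exchange p' q w)" "lastL w p' = x"
      then show thesis using that[of x] lE by simp
    qed
    have "card (column H (w p)) < card (column H (w q))"
      using sm p finite_subset[OF column_sub finW]
      by (auto simp: small_def eqv_def intro: psubset_card_mono)
    moreover have "\<not> w q < c" using sm by (simp add: small_def)
    moreover have "lowest_left_above H c (graph W w) p = x"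
    proof -
      have "{i \<in> column H c. i < p \<and> col_at (graph W w) i < c} = {i \<in> W. i < p \<and> w i < c}"
        using column_down[of p c] column_sub[of c] right_row[OF inv1_valid[OF inv] p(1)] p(2)
        by (auto simp: eqv_def HW)
      then show ?thesis using x(5) by (simp add: lowest_left_above_def lastL_def)
    qed
    moreover have "{D \<in> graph W w. fst D \<notin> {x, p, q}} \<union> {(x, w q), (p, w x), (q, w p)} = graph W (step1 q w)"
      unfolding x(4) using x p qW pq by (auto simp: exchange_def)
    moreover have "gamma1_loop H c (graph W (step1 q w)) q qs = graph W (fold step1 qs (step1 q w))"
    proof (rule IH[of q])
      show "eqv (step1 q w q)" unfolding x(4) using x pq p by simp
    qed (use none qW in auto)
    ultimately show ?thesis using qW p x(1) by (simp add: Let_def)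
  qed
qed simp

lemma fold_step1_id:
  "(\<And>i. i \<in> set xs \<Longrightarrow> eqv (w i) \<or> big (w i)) \<Longrightarrow> fold step1 xs w = w"
  using class_excl(5-8) by (induction xs) (force simp: step1_id)+

lemma gamma2_loop_eq:
  "p \<in> W \<Longrightarrow> set qs \<subseteq> W \<Longrightarrow> gamma2_loop c (graph W w) p qs = graph W (run2 p qs w)"
proof (induction qs arbitrary: p w)
  case (Cons q qs)
  then have "gamma2_loop c (graph W w) p (q # qs) = gamma2_loop c (graph W (if c \<le> w q then exchange p q w else w)) q qs"
    by (simp add: swap_graph)
  then show ?case using Cons by simp
qed simp

lemma gamma2_eq:
  assumes "inv1 p w" "p \<in> column H c" "p \<notin> K" "set qs \<subseteq> W"
  shows "gamma2 H c (p # qs) (graph W w) = graph W (run2 p qs (borrow p w))"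
proof -
  have pW: "p \<in> W" using assms(2) column_sub by blast
  have "lowest_left_above H c (graph W w) p = lastL w p"
  proof -
    have "{i \<in> column H c. i < p \<and> col_at (graph W w) i < c} = {i \<in> W. i < p \<and> w i < c}"
      using column_down[OF assms(2)] column_sub[of c] by (auto simp: HW)
    then show ?thesis by (simp add: lowest_left_above_def lastL_def)
  qed
  moreover have "lastL w p \<in> W" if "c \<le> w p"
  proof -
    have "small (w p)" using K_comparable[of "w p"] that assms(3) validD[OF inv1_valid[OF assms(1)] pW]
      unfolding small_def by (metis mem_column psubsetD)
    then have "\<exists>i\<in>W. i < p \<and> w i < c" using assms(1) pW unfolding inv1_def by blast
    then show ?thesis by (rule lastL)
  qed
  ultimately have "gamma2 H c (p # qs) (graph W w) = gamma2_loop c (graph W (borrow p w)) p qs"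
    using pW by (simp add: borrow_def swap_graph)
  then show ?thesis using gamma2_loop_eq pW assms(4) by simp
qed

end

context ferrers
begin

text \<open>The number of pairs that the new top row contributes to the major index.\<close>

definition delta :: "(int \<Rightarrow> int) \<Rightarrow> int set" where
  "delta w = {i \<in> column H c. \<exists>d\<in>W. (i, w d) \<in> H \<and> w d < c \<and> (\<forall>x\<in>W. x < d \<longrightarrow> (i, w x) \<notin> H)}"

lemma delta_no_left:
  assumes "valid w" "{i \<in> column H c. w i < c} = {}"
  shows "delta w = {}"
proof (rule ccontr)
  assume "delta w \<noteq> {}"
  then obtain i d where d: "i \<in> column H c" "d \<in> W" "(i, w d) \<in> H" "w d < c" "\<forall>x\<in>W. x < d \<longrightarrow> (i, w x) \<notin> H"
    by (auto simp: delta_def)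
  have "i \<in> W" using d column_sub by blast
  then have "d \<le> i" using d(5) validD[OF assms(1)] by force
  then have "d \<in> column H c" using column_down d by blast
  then show False using assms(2) d by blast
qed

text \<open>How \<open>gamma_rows\<close> fits the abstract description, with \<open>\<R>\<^sub>1\<close> cut out of \<open>K\<close> and \<open>\<R>\<^sub>2\<close> the rest.\<close>

lemma gamma_full:
  assumes v: "valid w" and L: "{i \<in> column H c. w i < c} \<noteq> {}"
  shows "\<exists>K. ferrersK H W lo c K \<and> ferrersK.start H W c K w \<and> gamma H c (graph W w) = graph W (ferrersK.full H W c K w)
    \<and> delta w = ferrersK.D H c K"
proof -
  define clc where "clc = Min {i \<in> column H c. w i < c}"
  have finR: "finite (column H c)" using finite_subset[OF column_sub finW] .
  have finL: "finite {i \<in> column H c. w i < c}" using finR by (rule rev_finite_subset) auto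
  have clc: "clc \<in> column H c" "w clc < c" "\<And>i. i \<in> column H c \<Longrightarrow> w i < c \<Longrightarrow> clc \<le> i"
    using Min_in[OF finL L] Min_le[OF finL] unfolding clc_def by auto
  have clcW: "clc \<in> W" using clc column_sub by blast
  have above: "c \<le> w i" "i \<in> column H c" if "i \<in> W" "i < clc" for i
    using that clc column_down[OF clc(1) that(1)] by force+
  have LG: "{i \<in> column H c. col_at (graph W w) i < c} = {i \<in> column H c. w i < c}"
    using column_sub by (auto simp: HW)
  define U where "U = {i \<in> column H c. c \<le> w i \<and> i < clc}"
  have UG: "{i \<in> column H c. c \<le> col_at (graph W w) i \<and> i < Min {i \<in> column H c. w i < c}} = U"
    unfolding U_def clc_def[symmetric] using column_sub by (auto simp: HW)
  show ?thesis
  proof (cases "U = {}")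
    case True
    \<comment> \<open>An entry above CLC would be right and in a row meeting column c, hence in
      \<open>U\<close>.\<close>
    then have none: "\<not> i < clc" if "i \<in> W" for i using above[OF that] unfolding U_def by blast
    interpret ferrersK H W lo c "{}" by unfold_locales simp
    have st: "start w" unfolding start_def using v clc none by blast
    have "{i \<in> column H c. clc \<le> i} = column H c" using none column_sub by (auto simp: HW not_less)
    then have gr: "gamma_rows H c (graph W w) = ({}, column H c)"
      unfolding gamma_rows_def LG UG Let_def clc_def by (simp only: L True if_False if_True refl)
    obtain p qs where pq: "sorted_list_of_set (column H c) = p # qs"
      using clc finR by (metis list.exhaust set_sorted_list_of_set empty_iff empty_set)
    have set: "set (p # qs) = column H c" using finR unfolding pq[symmetric] by simp
    have "p \<le> i" if "i \<in> W" for i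
    proof -
      have "p = Min (column H c)"
        using pq finR clc sorted_list_of_set_nonempty[OF finR] by (metis empty_iff list.inject)
      then have "p \<le> clc" using finR clc by simp
      then show ?thesis using none[OF that] by simp
    qed
    then have "inv1 p w" using start_inv1[OF st] by blast
    then have "gamma2 H c (p # qs) (graph W w) = graph W (run2 p qs (borrow p w))"
      using gamma2_eq set column_sub by (metis empty_iff list.set_intros(1) set_subset_Cons subset_trans)
    then have "gamma H c (graph W w) = graph W (full w)"
      unfolding gamma_def gr full_def D_def by (simp add: pq)
    moreover have "i \<in> delta w" if "(i, c) \<in> H" for i
    proof -
      have "(i, w clc) \<in> H" using Hleft[OF that valid_lo[OF v clcW]] clc by simp
      then show ?thesis using that clc(2) clcW none unfolding delta_def by auto
    qed
    then have "delta w = D" unfolding D_def by (auto simp: delta_def)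
    ultimately show ?thesis using st ferrersK_axioms by (intro exI[of _ "{}"]) blast
  next
    case False
    have finU: "finite U" using finR unfolding U_def by (rule rev_finite_subset) auto
    \<comment> \<open>The leftmost entry above CLC has the longest column, which contains the
      columns of all the other entries above CLC.\<close>
    define j where "j = Min (w ` U)"
    have j_le: "j \<le> w i" if "i \<in> W" "i < clc" for i
      unfolding j_def using above[OF that] that finU by (auto simp: U_def)
    have "j \<in> w ` U" unfolding j_def using Min_in[of "w ` U"] finU False by simp
    then have exj: "{i \<in> U. w i = j} \<noteq> {}" by auto
    define crc where "crc = Max {i \<in> U. w i = j}"
    have "crc \<in> {i \<in> U. w i = j}" unfolding crc_def using Max_in[OF _ exj] finU by simp
    then have crc: "crc \<in> W" "crc < clc" "w crc = j" "c \<le> j" using column_sub by (auto simp: U_def HW)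
    interpret ferrersK H W lo c "column H j" using crc(4) by unfold_locales blast
    have crcK: "crc \<in> column H j" using validD[OF v crc(1)] crc by simp
    have ab: "column H (w i) \<subseteq> column H j" if "i \<in> W" "i < clc" for i
      using column_subset[OF _ j_le[OF that]] crc lo_c by simp
    have eqvc: "eqv (w crc)" using crc by (simp add: eqv_def)
    have st: "start w" unfolding start_def using v clc above ab crc eqvc by blast
    have colU: "col_at (graph W w) ` U = w ` U" "{i \<in> U. col_at (graph W w) i = j} = {i \<in> U. w i = j}"
    proof -
      have "col_at (graph W w) i = w i" if "i \<in> U" for i using that by (auto simp: U_def dest: HW)
      then show "col_at (graph W w) ` U = w ` U" "{i \<in> U. col_at (graph W w) i = j} = {i \<in> U. w i = j}"
        by (auto intro: image_cong)
    qed
    have gr: "gamma_rows H c (graph W w) = ({i \<in> column H j. crc \<le> i}, D)"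
      unfolding gamma_rows_def LG UG Let_def colU j_def[symmetric] crc_def[symmetric] D_def
      by (simp only: L False if_False refl)
    have finK: "finite (column H j)" using finite_subset[OF column_sub finW] .
    let ?lo = "sorted_list_of_set {i \<in> column H j. i < crc}"
    let ?hi = "sorted_list_of_set {i \<in> column H j. crc < i}"
    have fin': "finite {i \<in> column H j. crc \<le> i}" using finK by (rule rev_finite_subset) auto
    have "sorted_list_of_set {i \<in> column H j. crc \<le> i}
        = sorted_list_of_set {i \<in> {i \<in> column H j. crc \<le> i}. i < crc} @ crc #
          sorted_list_of_set {i \<in> {i \<in> column H j. crc \<le> i}. crc < i}"
      by (rule sorted_list_of_set_split[OF fin']) (use crcK in simp)
    moreover have "{i \<in> {i \<in> column H j. crc \<le> i}. i < crc} = {}"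
      "{i \<in> {i \<in> column H j. crc \<le> i}. crc < i} = {i \<in> column H j. crc < i}" by auto
    ultimately have R1: "sorted_list_of_set {i \<in> column H j. crc \<le> i} = crc # ?hi" by simp
    have Kl: "sorted_list_of_set (column H j) = ?lo @ crc # ?hi"
      by (rule sorted_list_of_set_split[OF finK crcK])
    have flo: "finite {i \<in> column H j. i < crc}" using finK by (rule rev_finite_subset) auto
    have fhi: "finite {i \<in> column H j. crc < i}" using finK by (rule rev_finite_subset) auto
    have upto: "eqv (w i) \<or> big (w i)" if "i \<in> W" "i < clc" for i
      using ab[OF that] above[OF that] by (auto simp: eqv_def big_def)
    \<comment> \<open>\<open>gamma1\<close> starts with \<open>ptr_1\<close> at CRC,
      \<open>full\<close> at the top of K. Down to CRC all entries are \<open>eqv\<close> or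
      \<open>big\<close>, and there \<open>step1\<close> does nothing.\<close>
    have fid: "fold step1 (?lo @ [crc]) w = w"
    proof (rule fold_step1_id)
      fix i assume "i \<in> set (?lo @ [crc])"
      then have "i \<in> W" "i < clc" using flo K_W crc(1,2) by auto
      then show "eqv (w i) \<or> big (w i)" by (rule upto)
    qed
    have inv: "inv1 (crc + 1) w"
    proof -
      have inv0: "inv1 (Min W) w" using start_inv1[OF st] finW by simp
      have nsm: "\<not> small (w i)" if "i \<in> W" "i < crc + 1" for i
        using upto[OF that(1)] that(2) crc(2) class_excl(5,6) by force
      have "\<exists>x\<in>W. x < i \<and> w x < c" if "i \<in> W" "small (w i)" for i
        using inv0 that finW unfolding inv1_def by (meson Min_le)
      then show ?thesis
        unfolding inv1_def using v nsm crc(1) eqvc by (auto intro!: bexI[of _ crc])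
    qed
    have "gamma1 H c (crc # ?hi) (graph W w) = graph W (fold step1 ?hi w)"
    proof -
      have "set ?hi = {i \<in> column H j. crc + 1 \<le> i}" using fhi by auto
      then show ?thesis
        using gamma1_loop_eq[OF _ _ inv crc(1) _ eqvc, of ?hi] fhi by simp
    qed
    moreover have "fold step1 ?hi w = fold step1 (sorted_list_of_set (column H j)) w"
      unfolding Kl using fid by simp
    ultimately have g1: "gamma1 H c (sorted_list_of_set {i \<in> column H j. crc \<le> i}) (graph W w)
      = graph W (fold step1 (sorted_list_of_set (column H j)) w)" unfolding R1 by simp
    have finD: "finite D" using finite_sub D_sub by blast
    have "gamma H c (graph W w) = graph W (full w)"
    proof (cases "sorted_list_of_set D")
      case Nil
      then show ?thesis unfolding gamma_def gr using g1 by (simp add: full_def)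
    next
      case (Cons p qs)
      have set: "set (p # qs) = D" using finD unfolding Cons[symmetric] by simp
      then have p: "p \<in> column H c" "p \<notin> column H j" by (auto simp: D_def)
      have pW: "p \<in> W" using p column_sub by blast
      have pmin: "p = Min D"
        using Cons finD sorted_list_of_set_nonempty[OF finD] by (metis list.inject list.simps(3) sorted_list_of_set_empty)
      have q1: "i < p \<longleftrightarrow> i \<in> column H j" if "i \<in> W" for i
      proof
        assume "i < p"
        then have "i \<notin> D" using Min_le[OF finD, of i] pmin by auto
        then show "i \<in> column H j" using column_down[OF p(1) that] \<open>i < p\<close> by (auto simp: D_def)
      next
        assume "i \<in> column H j"
        then show "i < p" using column_down[of i j p] pW p by force
      qed
      have "inv1 p (fold step1 (sorted_list_of_set (column H j)) w)"
      proof -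
        have m: "Min W \<le> i" if "i \<in> W" for i using finW that by simp
        have s: "set (sorted_list_of_set (column H j)) = {i \<in> column H j. Min W \<le> i}"
          using finK m K_W by auto
        show ?thesis
          using run1[OF _ s start_inv1[OF st m] m[OF pW] q1] finK by simp
      qed
      moreover have "set qs \<subseteq> W" using set D_sub by auto
      ultimately have
        "gamma2 H c (p # qs) (graph W (fold step1 (sorted_list_of_set (column H j)) w))
          = graph W (run2 p qs (borrow p (fold step1 (sorted_list_of_set (column H j)) w)))"
        by (intro gamma2_eq p)
      then show ?thesis
        unfolding gamma_def gr full_def Let_def prod.case Cons list.case g1 .
    qed
    \<comment> \<open>A row of K is reached by the column of CRC, which precedes every left entry. A
      row of D is reached by no entry above CLC, but by CLC itself.\<close>
    moreover have "delta w = D"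
    proof (intro set_eqI iffI)
      fix i assume "i \<in> delta w"
      then obtain d where d: "i \<in> column H c" "d \<in> W" "(i, w d) \<in> H" "w d < c" "\<forall>x\<in>W. x < d \<longrightarrow> (i, w x) \<notin> H"
        by (auto simp: delta_def)
      have "clc \<le> d" using above(1)[OF d(2)] d(4) by force
      then have "(i, j) \<notin> H" using d(5) crc by force
      then show "i \<in> D" using d by (simp add: D_def)
    next
      fix i assume i: "i \<in> D"
      have "(i, w clc) \<in> H" using i Hleft[of i c "w clc"] valid_lo[OF v clcW] clc by (auto simp: D_def)
      moreover have "(i, w x) \<notin> H" if "x \<in> W" "x < clc" for x using ab[OF that] i by (auto simp: D_def)
      ultimately show "i \<in> delta w" using i clc clcW by (auto simp: delta_def D_def)
    qed
    ultimately show ?thesis using st ferrersK_axioms by blast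
  qed
qed

lemma gamma_no_left:
  assumes "{i \<in> column H c. w i < c} = {}"
  shows "gamma H c (graph W w) = graph W w"
proof -
  have "{i \<in> column H c. col_at (graph W w) i < c} = {i \<in> column H c. w i < c}"
    using column_sub by (auto simp: HW)
  then show ?thesis using assms by (simp add: gamma_def gamma_rows_def)
qed

lemma gamma_props:
  assumes v: "valid w"
  shows "\<exists>w'. gamma H c (graph W w) = graph W w' \<and> valid w' \<and> (\<forall>i. i \<notin> column H c \<longrightarrow> w' i = w i)
    \<and> card (ne_pairs H W w') + card {i \<in> column H c. w i < c} = card (ne_pairs H W w) + card (delta w)
    \<and> (\<forall>u a. u < c \<longrightarrow> istop W w' u a \<longleftrightarrow> istop W w u a) \<and> col_count w' = col_count w"
proof (cases "{i \<in> column H c. w i < c} = {}")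
  case True
  show ?thesis
    unfolding True using gamma_no_left[OF True] delta_no_left[OF v True] v by (intro exI[of _ w]) simp
next
  case False
  from gamma_full[OF v False] obtain K where KK: "ferrersK H W lo c K" "ferrersK.start H W c K w"
    "gamma H c (graph W w) = graph W (ferrersK.full H W c K w)" "delta w = ferrersK.D H c K" by blast
  interpret ferrersK H W lo c K by (rule KK(1))
  show ?thesis
    unfolding KK(3,4) using full[OF KK(2)] by (intro exI[of _ "full w"]) blast
qed

lemma ex_left_cnt: "{i \<in> column H c. w i < c} \<noteq> {} \<longleftrightarrow> (\<exists>j<c. col_count w j \<noteq> 0)"
proof -
  have "finite {i \<in> column H c. w i = j}" for j
    using finite_subset[OF column_sub finW] by (rule rev_finite_subset) auto
  then show ?thesis by (auto simp: col_count_def)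
qed

end

context ferrersK
begin

end

section \<open>Injectivity of gamma\<close>

text \<open>\<open>K\<close> can be read off the result: its last row holds an entry whose column ends exactly there, which
  never happens below.\<close>

lemma full_K_unique:
  assumes "ferrersK H W lo c K" "ferrersK H W lo c K'" "ferrersK.start H W c K w" "ferrersK.start H W c K' w'"
    and eq: "ferrersK.full H W c K w = ferrersK.full H W c K' w'"
  shows "\<not> K \<subset> K'"
proof
  assume sub: "K \<subset> K'"
  interpret a: ferrersK H W lo c K by fact
  interpret b: ferrersK H W lo c K' by fact
  have fin: "finite K'" using a.finite_sub b.K_W by blast
  have m: "Max K' \<in> K'" using Max_in[OF fin] sub by blast
  have "Max K' \<notin> K" using a.K_down[of "Max K'"] b.K_W Max_ge[OF fin] sub by blast
  then have D: "Max K' \<in> a.D" using m b.K_sub by (auto simp: a.D_def)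
  have e: "b.eqv (a.full w (Max K'))" using b.full(6)[OF assms(4)] sub eq by auto
  then have "c \<le> a.full w (Max K')" unfolding b.eqv_def by blast
  from a.full(5)[OF assms(3) D this] obtain x where "x \<in> W" "Max K' < x" "(x, a.full w (Max K')) \<in> H"
    by blast
  then have "x \<in> K'" using e unfolding b.eqv_def by (metis mem_column)
  then show False using Max_ge[OF fin] \<open>Max K' < x\<close> by force
qed

text \<open>The column counts show whether there were left entries. If so, K can be recovered, and
  for fixed K the map \<open>full\<close> is injective.\<close>

lemma (in ferrers) gamma_inj:
  assumes v: "valid w" "valid w'" and out: "\<And>i. i \<notin> W \<Longrightarrow> w i = w' i"
    and eq: "gamma H c (graph W w) = gamma H c (graph W w')"
  shows "w = w'"
proof -
  have eqI: "x = y" if "graph W x = graph W y" "\<And>i. i \<notin> W \<Longrightarrow> x i = y i" for x y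
    using that by (auto simp: graph_eq_iff fun_eq_iff)
  from gamma_props[OF v(1)] obtain x where x: "gamma H c (graph W w) = graph W x"
    "\<And>i. i \<notin> column H c \<Longrightarrow> x i = w i" "col_count x = col_count w" by blast
  from gamma_props[OF v(2)] obtain y where y: "gamma H c (graph W w') = graph W y"
    "\<And>i. i \<notin> column H c \<Longrightarrow> y i = w' i" "col_count y = col_count w'" by blast
  have nR: "i \<notin> column H c" if "i \<notin> W" for i using that HW by auto
  have "x = y"
  proof (rule eqI)
    show "x i = y i" if "i \<notin> W" for i using x(2)[OF nR[OF that]] y(2)[OF nR[OF that]] out[OF that] by simp
  qed (use x y eq in simp)
  then have col_count: "col_count w = col_count w'" using x y by simp
  show ?thesis
  proof (cases "{i \<in> column H c. w i < c} = {}")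
    case True
    then have "{i \<in> column H c. w' i < c} = {}" using ex_left_cnt[of w] ex_left_cnt[of w'] col_count by auto
    then show ?thesis using gamma_no_left True eq out by (intro eqI) auto
  next
    case False
    then have False': "{i \<in> column H c. w' i < c} \<noteq> {}" using ex_left_cnt[of w] ex_left_cnt[of w'] col_count by auto
    from gamma_full[OF v(1) False] obtain K where K: "ferrersK H W lo c K" "ferrersK.start H W c K w"
      "gamma H c (graph W w) = graph W (ferrersK.full H W c K w)" by blast
    from gamma_full[OF v(2) False'] obtain K' where K': "ferrersK H W lo c K'" "ferrersK.start H W c K' w'"
      "gamma H c (graph W w') = graph W (ferrersK.full H W c K' w')" by blast
    interpret a: ferrersK H W lo c K by (rule K(1))
    interpret b: ferrersK H W lo c K' by (rule K'(1))
    have full_eq: "a.full w = b.full w'"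
    proof (rule eqI)
      show "a.full w i = b.full w' i" if "i \<notin> W" for i
        using a.full(4)[OF K(2) nR[OF that]] b.full(4)[OF K'(2) nR[OF that]] out[OF that] by simp
    qed (use K(3) K'(3) eq in simp)
    \<comment> \<open>Both sets are closed under passing to higher rows of \<open>W\<close>, so they
      are comparable.\<close>
    have "K \<subseteq> K' \<or> K' \<subseteq> K" using a.K_down b.K_down a.K_W b.K_W by (metis linorder_linear subsetI)
    then have "K = K'" using full_K_unique[OF K(1) K'(1) K(2) K'(2) full_eq]
        full_K_unique[OF K'(1) K(1) K'(2) K(2) full_eq[symmetric]] by blast
    then show ?thesis using a.full(7)[OF K(2), of w'] K'(2) full_eq by simp
  qed
qed

section \<open>The map phi\<close>

definition counts :: "int set \<Rightarrow> (int \<Rightarrow> int) \<Rightarrow> int \<Rightarrow> nat" where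
  "counts W w j = card {i \<in> W. w i = j}"

lemma counts_mono:
  assumes "finite W" "R \<subseteq> W" "\<And>i. i \<in> W \<Longrightarrow> i \<notin> R \<Longrightarrow> w i = v i" "counts R w = counts R v"
  shows "counts W w = counts W v"
proof
  fix j
  have fin: "finite R" using assms finite_subset by blast
  have *: "counts W x j = counts R x j + card {i \<in> W - R. x i = j}" for x
  proof -
    have "{i \<in> W. x i = j} = {i \<in> R. x i = j} \<union> {i \<in> W - R. x i = j}" using assms(2) by auto
    moreover have "card ({i \<in> R. x i = j} \<union> {i \<in> W - R. x i = j})
      = card {i \<in> R. x i = j} + card {i \<in> W - R. x i = j}"
      by (rule card_Un_disjoint) (use assms(1) fin in auto)
    ultimately show ?thesis by (simp add: counts_def)
  qed
  have "{i \<in> W - R. w i = j} = {i \<in> W - R. v i = j}" using assms(3) by auto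
  then show "counts W w j = counts W v j" using assms(4) by (simp add: *)
qed

lemma counts_Collect:
  assumes "finite W" "counts W w = counts W v"
  shows "card {i \<in> W. Q (w i)} = card {i \<in> W. Q (v i)}"
proof -
  let ?S = "w ` W \<union> v ` W"
  have *: "card {i \<in> W. Q (x i)} = (\<Sum>j\<in>{j \<in> ?S. Q j}. counts W x j)" if "x ` W \<subseteq> ?S" for x
  proof -
    have "{i \<in> W. Q (x i)} = (\<Union>j\<in>{j \<in> ?S. Q j}. {i \<in> W. x i = j})" using that by auto
    also have "card \<dots> = (\<Sum>j\<in>{j \<in> ?S. Q j}. card {i \<in> W. x i = j})"
      by (rule card_UN_disjoint) (use assms(1) in auto)
    finally show ?thesis by (simp add: counts_def)
  qed
  show ?thesis using *[of w] *[of v] assms(2) by simp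
qed

lemma istop_mono_set:
  assumes "V \<subseteq> W" "\<And>i. i \<in> W \<Longrightarrow> i \<notin> V \<Longrightarrow> u < w i"
  shows "istop W w u a \<longleftrightarrow> istop V w u a"
  using assms unfolding istop_def by (smt (verit, best) subsetD)

section \<open>Adding a top row to a left-aligned stack\<close>

text \<open>A left-aligned stack from which rows may have been removed.\<close>

locale stack =
  fixes P :: "cell set" and W :: "int set" and lo :: int
  assumes finW: "finite W"
    and finP: "finite P"
    and PW: "(i, j) \<in> P \<Longrightarrow> i \<in> W \<and> lo \<le> j"
    and Pleft: "(i, j) \<in> P \<Longrightarrow> lo \<le> j' \<Longrightarrow> j' \<le> j \<Longrightarrow> (i, j') \<in> P"
    and Pconv: "(a, j) \<in> P \<Longrightarrow> (b, j) \<in> P \<Longrightarrow> a \<le> i \<Longrightarrow> i \<le> b \<Longrightarrow> i \<in> W \<Longrightarrow> (i, j) \<in> P"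

locale stack_top = stack +
  fixes r :: int and W1 P1
  assumes W: "W = insert r W1" and r: "\<And>i. i \<in> W1 \<Longrightarrow> r < i"
    and P1: "P1 = {D \<in> P. fst D \<noteq> r}"
begin

lemma r_notin: "r \<notin> W1" using r by blast

lemma mem_P1: "(i, j) \<in> P1 \<longleftrightarrow> (i, j) \<in> P \<and> i \<noteq> r"
  by (auto simp: P1)

lemma mem_P1': "i \<in> W1 \<Longrightarrow> (i, j) \<in> P1 \<longleftrightarrow> (i, j) \<in> P"
  using r_notin by (auto simp: P1)

lemma W1W: "W1 \<subseteq> W" and finW1: "finite W1"
  using W finW by auto

lemma stack1: "stack P1 W1 lo"
proof
  show "finite W1" "finite P1" using finW1 finP by (auto simp: P1)
  show "i \<in> W1 \<and> lo \<le> j" if "(i, j) \<in> P1" for i j using PW[of i j] that W by (auto simp: mem_P1)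
  show "(i, j') \<in> P1" if "(i, j) \<in> P1" "lo \<le> j'" "j' \<le> j" for i j j'
    using Pleft that by (auto simp: mem_P1)
  show "(i, j) \<in> P1" if "(a, j) \<in> P1" "(b, j) \<in> P1" "a \<le> i" "i \<le> b" "i \<in> W1" for a b i j
    using Pconv[of a j b i] that r_notin W1W by (auto simp: mem_P1)
qed

definition F1 :: "cell set" where "F1 = {D \<in> ferrers_part P. fst D \<noteq> r}"

text \<open>By convexity a column that meets the top row has no gap above any of its cells.\<close>

lemma mem_F1:
  assumes "r \<in> rows P"
  shows "(i, j) \<in> F1 \<longleftrightarrow> (i, j) \<in> P \<and> i \<noteq> r \<and> (r, j) \<in> P"
proof -
  have rle: "r \<le> i" if "i \<in> rows P" for i using that PW W r by (force simp: mem_rows)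
  have "(i', j) \<in> P" if "(i, j) \<in> P" "(r, j) \<in> P" "i' \<in> rows P" "i' \<le> i" for i'
    using Pconv[OF that(2,1) rle[OF that(3)] that(4)] that(3) PW by (auto simp: mem_rows)
  moreover have "(r, j) \<in> P" if "(i, j) \<in> ferrers_part P"
  proof -
    have "i \<in> rows P" using that by (auto simp: ferrers_part_def mem_rows)
    then show ?thesis using that rle assms by (auto simp: ferrers_part_def)
  qed
  ultimately show ?thesis by (auto simp: F1_def ferrers_part_def)
qed

end

context stack_top
begin

context
  fixes w w1 :: "int \<Rightarrow> int"
  assumes v: "\<And>i. i \<in> W \<Longrightarrow> (i, w i) \<in> P"
    and v1: "\<And>i. i \<in> W1 \<Longrightarrow> (i, w1 i) \<in> P"
    and out1: "\<And>i. i \<notin> W1 \<Longrightarrow> w1 i = w i"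
    and top1: "\<And>u a. istop W1 w1 u a \<longleftrightarrow> istop W1 w u a"
    and counts1: "counts W1 w1 = counts W1 w"
begin

text \<open>Here \<open>w\<close> is the given word and \<open>w1\<close> what \<open>phi\<close>
  makes of it below r. gamma ignores the rows without a 1-cell in the Ferrers part; \<open>V\<close>
  consists of the others, and \<open>H\<close> is the Ferrers part restricted to them.\<close>

definition V :: "int set" where "V = {i \<in> W1. (r, w1 i) \<in> P}"
definition H :: "cell set" where "H = {(i, j). i \<in> V \<and> (i, j) \<in> P \<and> (r, j) \<in> P}"

lemma mem_V: "i \<in> V \<longleftrightarrow> i \<in> W1 \<and> (r, w1 i) \<in> P"
  by (simp add: V_def)

lemma mem_H: "(i, j) \<in> H \<longleftrightarrow> i \<in> V \<and> (i, j) \<in> P \<and> (r, j) \<in> P"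
  by (simp add: H_def)

lemma vr: "(r, w r) \<in> P" using v W by simp

lemma r_rows: "r \<in> rows P" using vr by (auto simp: mem_rows)

lemma VW: "V \<subseteq> W1" by (auto simp: V_def)

lemma ferr: "ferrers H V lo (w r)"
proof
  show "finite V" using finW1 VW finite_subset by blast
  show "i \<in> V \<and> lo \<le> j" if "(i, j) \<in> H" for i j using that PW by (auto simp: H_def)
  show "(i', j) \<in> H" if "(i, j) \<in> H" "i' \<in> V" "i' \<le> i" for i j i'
    using that Pconv[of r j i i'] r VW W1W by (force simp: H_def)
  show "(i, j') \<in> H" if "(i, j) \<in> H" "lo \<le> j'" "j' \<le> j" for i j j'
    using that Pleft by (auto simp: H_def)
  show "lo \<le> w r" using PW[OF vr] by simp
qed

interpretation ferrers H V lo "w r" by (rule ferr)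

lemma valid1: "valid w1"
  unfolding valid_def using v1 by (auto simp: H_def V_def)

lemma col_c: "column H (w r) = {i \<in> V. (i, w r) \<in> P}"
  using vr by (auto simp: H_def)

lemma G_eq: "graph W1 w1 \<inter> F1 = graph V w1"
  using mem_F1[OF r_rows] v1 r_notin by (auto simp: V_def graph_def)

lemma H_eq: "{D \<in> F1. fst D \<in> V} = H"
  using mem_F1[OF r_rows] VW r_notin by (auto simp: H_def)

text \<open>An entry up to \<open>w r\<close> is in a column of the top row, so gamma sees every
  left entry.\<close>

lemma in_V: "i \<in> W1 \<Longrightarrow> w1 i \<le> w r \<Longrightarrow> i \<in> V"
  using Pleft[OF vr, of "w1 i"] PW v1 by (auto simp: V_def)

text \<open>The lower ends of the pairs that row r contributes to \<open>maj_pairs\<close>.\<close>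

definition tops :: "(int \<Rightarrow> int) \<Rightarrow> int set" where
  "tops x = {e \<in> W1. (e, w r) \<in> P \<and> (r, x e) \<in> P
     \<and> (\<exists>d\<in>W1. x d \<in> row P r \<inter> row P e \<and> x d < w r \<and> (\<forall>y\<in>W1. y < d \<longrightarrow> x y \<notin> row P r \<inter> row P e))}"

text \<open>Entries of rows outside \<open>V\<close> do not lie in columns of row r, so leaving out
  these rows does not change which entry comes first.\<close>

lemma delta_eq: "delta w1 = tops w1"
proof -
  have mem: "(e, w1 d) \<in> H \<longleftrightarrow> w1 d \<in> row P r \<inter> row P e" if "e \<in> V" for e d
    using that by (auto simp: H_def)
  have inV: "d \<in> V \<longleftrightarrow> d \<in> W1 \<and> (r, w1 d) \<in> P" for d by (simp add: V_def)
  have "(\<exists>d\<in>V. (e, w1 d) \<in> H \<and> w1 d < w r \<and> (\<forall>x\<in>V. x < d \<longrightarrow> (e, w1 x) \<notin> H))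
    \<longleftrightarrow> (\<exists>d\<in>W1. w1 d \<in> row P r \<inter> row P e \<and> w1 d < w r
      \<and> (\<forall>y\<in>W1. y < d \<longrightarrow> w1 y \<notin> row P r \<inter> row P e))" if "e \<in> V" for e
    unfolding mem[OF that] Bex_def Ball_def inV by (simp; blast)
  then show ?thesis unfolding delta_def tops_def col_c using inV by blast
qed

lemma starts_descent_iff: "starts_descent W w J r \<longleftrightarrow> (\<exists>d\<in>W1. w d \<in> J \<and> w d < w r \<and> (\<forall>y\<in>W1. y < d \<longrightarrow> w y \<notin> J))"
  unfolding starts_descent_def W using r by (auto 4 3)

text \<open>Left alignment turns membership in the common columns into an upper bound, namely their
  maximum.\<close>

lemma tops_iff_istop:
  assumes x: "\<And>i. i \<in> W1 \<Longrightarrow> (i, x i) \<in> P" and e: "e \<in> W1" "(e, w r) \<in> P"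
  shows "(\<exists>d\<in>W1. x d \<in> row P r \<inter> row P e \<and> x d < w r \<and> (\<forall>y\<in>W1. y < d \<longrightarrow> x y \<notin> row P r \<inter> row P e))
    \<longleftrightarrow> (\<exists>a<w r. istop W1 x (Max (row P r \<inter> row P e)) a)"
proof -
  let ?J = "row P r \<inter> row P e"
  have J: "finite ?J" "w r \<in> ?J" using finP e vr by auto
  have mx: "Max ?J \<in> ?J" using Max_in[OF J(1)] J(2) by blast
  have iff: "x i \<in> ?J \<longleftrightarrow> x i \<le> Max ?J" if "i \<in> W1" for i
  proof
    assume "x i \<le> Max ?J"
    moreover have "lo \<le> x i" using PW x[OF that] by blast
    ultimately show "x i \<in> ?J" using Pleft[of r "Max ?J" "x i"] Pleft[of e "Max ?J" "x i"] mx by simp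
  qed (use J in simp)
  have "(\<exists>d\<in>W1. x d \<in> ?J \<and> x d < w r \<and> (\<forall>y\<in>W1. y < d \<longrightarrow> x y \<notin> ?J))
    \<longleftrightarrow> (\<exists>d\<in>W1. x d \<le> Max ?J \<and> x d < w r \<and> (\<forall>y\<in>W1. y < d \<longrightarrow> Max ?J < x y))"
    by (intro bex_cong refl conj_cong ball_cong imp_cong) (simp_all only: iff not_le)
  then show ?thesis unfolding istop_def by blast
qed

text \<open>Besides \<open>istop\<close>, only the condition that the entry of row e lies in a
  column of row r involves the word. If it fails, row e is longer than row r, so the common columns
  are those of row r and the other conditions are the same for all such e. Hence either all of them
  have to be subtracted or none, and their number is fixed by \<open>counts\<close>.\<close>

lemma card_tops: "card (tops w) = card (tops w1)"
proof -
  define p where "p e = (\<exists>a<w r. istop W1 w (Max (row P r \<inter> row P e)) a)" for e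
  define E where "E = {e \<in> W1. (e, w r) \<in> P \<and> p e}"
  define big where "big x = {e \<in> E. (r, x e) \<notin> P}" for x :: "int \<Rightarrow> int"
  have tops: "tops x = E - big x" if "\<And>i. i \<in> W1 \<Longrightarrow> (i, x i) \<in> P" "\<And>u a. istop W1 x u a \<longleftrightarrow> istop W1 w u a" for x
    unfolding tops_def E_def big_def p_def using tops_iff_istop[OF that(1)] that(2) by auto
  have finE: "finite E" using finW1 by (simp add: E_def)
  have "card (big w) = card (big w1)"
  proof -
    define q where "q = (\<exists>a<w r. istop W1 w (Max (row P r)) a)"
    have big: "big x = (if q then {e \<in> W1. (r, x e) \<notin> P} else {})" if x: "\<And>i. i \<in> W1 \<Longrightarrow> (i, x i) \<in> P" for x
    proof -
      have *: "(e, w r) \<in> P \<and> (p e \<longleftrightarrow> q)" if e: "e \<in> W1" "(r, x e) \<notin> P" for e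
      proof -
        have "(e, j) \<in> P" if "(r, j) \<in> P" for j
        proof -
          have "j \<le> x e" using Pleft[OF that, of "x e"] e PW x by force
          then show ?thesis using Pleft[OF x[OF e(1)], of j] PW[OF that] by simp
        qed
        then have "row P r \<inter> row P e = row P r" "(e, w r) \<in> P" using vr by auto
        then show ?thesis unfolding p_def q_def by simp
      qed
      then show ?thesis unfolding big_def E_def by auto
    qed
    have "card {e \<in> W1. (r, w e) \<notin> P} = card {e \<in> W1. (r, w1 e) \<notin> P}"
      using counts_Collect[OF finW1, of w w1 "\<lambda>j. (r, j) \<notin> P"] counts1 by simp
    moreover have "big w = (if q then {e \<in> W1. (r, w e) \<notin> P} else {})"
      by (rule big) (use v W1W in blast)
    moreover have "big w1 = (if q then {e \<in> W1. (r, w1 e) \<notin> P} else {})"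
      by (rule big) (use v1 in blast)
    ultimately show ?thesis by simp
  qed
  moreover have "big w \<subseteq> E" "big w1 \<subseteq> E" by (auto simp: big_def)
  moreover have "tops w = E - big w" using tops[of w] v W1W by auto
  moreover have "tops w1 = E - big w1" using tops[of w1] v1 top1 by auto
  ultimately show ?thesis using finE by (simp add: card_Diff_subset finite_subset)
qed

lemma maj_pairs_split: "card (maj_pairs P W w) = card (maj_pairs P1 W1 w) + card (tops w)"
proof -
  have row: "row P1 x = row P x" if "x \<in> W1" for x using that mem_P1' by auto
  have flx: "starts_descent W w J x \<longleftrightarrow> starts_descent W1 w J x" if "x \<in> W1" for J x
    using r[OF that] unfolding starts_descent_def W by auto
  have "maj_pairs P W w = maj_pairs P1 W1 w \<union> Pair r ` tops w"
  proof (intro set_eqI iffI)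
    fix t assume t: "t \<in> maj_pairs P W w"
    obtain x e where xe: "t = (x, e)" by (cases t)
    have "x < e" "e \<in> W1" using t xe r[of x] W by (auto simp: maj_pairs_def)
    show "t \<in> maj_pairs P1 W1 w \<union> Pair r ` tops w"
    proof (cases "x = r")
      case True
      then show ?thesis using t xe \<open>e \<in> W1\<close> starts_descent_iff by (auto simp: maj_pairs_def tops_def)
    next
      case False
      then show ?thesis using t xe \<open>e \<in> W1\<close> flx row mem_P1' W by (auto simp: maj_pairs_def)
    qed
  next
    fix t assume "t \<in> maj_pairs P1 W1 w \<union> Pair r ` tops w"
    then show "t \<in> maj_pairs P W w"
    proof
      assume "t \<in> maj_pairs P1 W1 w"
      then show ?thesis using flx row mem_P1' W1W by (auto simp: maj_pairs_def)
    next
      assume "t \<in> Pair r ` tops w"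
      then show ?thesis using starts_descent_iff r W by (auto simp: maj_pairs_def tops_def)
    qed
  qed
  moreover have "maj_pairs P1 W1 w \<inter> Pair r ` tops w = {}" using r_notin by (auto simp: maj_pairs_def)
  moreover have "finite (maj_pairs P1 W1 w)" by (rule finite_subset[of _ "W1 \<times> W1"]) (use finW1 in \<open>auto simp: maj_pairs_def\<close>)
  moreover have "finite (tops w)" using finW1 by (simp add: tops_def)
  ultimately show ?thesis by (simp add: card_Un_disjoint card_image inj_on_def)
qed

text \<open>The chains that gamma does not see: their upper entry lies to the right of the end of
  row r.\<close>

definition far :: "(int \<Rightarrow> int) \<Rightarrow> (int \<times> int) set" where
  "far x = {(i, e) \<in> ne_pairs P1 W1 x. (r, x i) \<notin> P}"

text \<open>If the column of the upper entry meets row r, so does that of the smaller lower entry,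
  and both 1-cells are in the Ferrers part.\<close>

lemma ne_pairs_split1:
  assumes x: "valid x" "\<And>i. i \<in> W1 \<Longrightarrow> i \<notin> V \<Longrightarrow> x i = w1 i"
  shows "card (ne_pairs P1 W1 x) = card (ne_pairs H V x) + card (far x)"
proof -
  have xP: "(i, x i) \<in> P" if "i \<in> W1" for i
    using that x v1 validD[OF x(1)] by (cases "i \<in> V") (auto simp: H_def)
  have inV: "i \<in> V \<longleftrightarrow> (r, x i) \<in> P" if "i \<in> W1" for i
    using that x validD[OF x(1)] by (cases "i \<in> V") (auto simp: H_def V_def)
  have "ne_pairs P1 W1 x = ne_pairs H V x \<union> far x"
  proof (intro set_eqI iffI)
    fix t assume t: "t \<in> ne_pairs P1 W1 x"
    obtain i e where ie: "t = (i, e)" by (cases t)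
    show "t \<in> ne_pairs H V x \<union> far x"
    proof (cases "(r, x i) \<in> P")
      case True
      moreover have "(r, x e) \<in> P" using Pleft[OF True, of "x e"] t ie PW xP by (auto simp: ne_pairs_def)
      ultimately show ?thesis using t ie inV mem_P1 by (auto simp: ne_pairs_def H_def)
    qed (use t ie in \<open>auto simp: far_def\<close>)
  next
    fix t assume "t \<in> ne_pairs H V x \<union> far x"
    then show "t \<in> ne_pairs P1 W1 x"
      using VW mem_P1' by (auto simp: far_def ne_pairs_def H_def)
  qed
  moreover have "ne_pairs H V x \<inter> far x = {}" by (auto simp: ne_pairs_def far_def H_def)
  moreover have "finite (ne_pairs P1 W1 x)" by (rule finite_subset[of _ "W1 \<times> W1"]) (use finW1 in \<open>auto simp: ne_pairs_def\<close>)
  ultimately show ?thesis by (metis card_Un_disjoint finite_Un)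
qed

text \<open>The upper entry is in a row that gamma leaves alone. It exceeds every entry that row r
  can hold, so it does not matter how gamma permutes these.\<close>

lemma far_eq:
  assumes x: "valid x" "\<And>i. i \<in> W1 \<Longrightarrow> i \<notin> V \<Longrightarrow> x i = w1 i"
  shows "far x = far w1"
proof -
  have lem: "far y \<subseteq> far z" if y: "valid y" "\<And>i. i \<in> W1 \<Longrightarrow> i \<notin> V \<Longrightarrow> y i = w1 i"
    and z: "valid z" "\<And>i. i \<in> W1 \<Longrightarrow> i \<notin> V \<Longrightarrow> z i = w1 i" for y z
  proof
    fix t assume t: "t \<in> far y"
    obtain i e where ie: "t = (i, e)" by (cases t)
    have *: "i \<in> W1" "e \<in> W1" "i < e" "(e, y i) \<in> P" "(i, y e) \<in> P" "y e < y i" "(r, y i) \<notin> P"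
      using t ie mem_P1 by (auto simp: far_def ne_pairs_def)
    have "i \<notin> V" using * validD[OF y(1)] by (auto simp: H_def)
    then have yz: "y i = z i" using * y z by simp
    have iy: "(i, y i) \<in> P" using y(2)[OF *(1) \<open>i \<notin> V\<close>] v1[OF *(1)] by simp
    have "z e < y i \<and> (i, z e) \<in> P"
    proof (cases "e \<in> V")
      case True
      then have ze: "(r, z e) \<in> P" "(e, z e) \<in> P" using validD[OF z(1)] by (auto simp: H_def)
      have "z e < y i" using Pleft[OF ze(1), of "y i"] *(7) PW[OF iy] by force
      then show ?thesis using Pleft[OF iy, of "z e"] PW ze by auto
    next
      case False
      then show ?thesis using * y z by simp
    qed
    then show "t \<in> far z" using * yz ie mem_P1' by (auto simp: far_def ne_pairs_def)
  qed
  show ?thesis using lem[OF x valid1] lem[OF valid1 _ x] by simp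
qed

lemma ne_pairs_split:
  assumes x: "valid x" "\<And>i. i \<in> W1 \<Longrightarrow> i \<notin> V \<Longrightarrow> x i = w1 i" "x r = w r"
  shows "card (ne_pairs P W x) = card (ne_pairs P1 W1 x) + card {i \<in> column H (w r). x i < w r}"
proof -
  have xP: "(i, x i) \<in> P" if "i \<in> W1" for i
    using that x v1 validD[OF x(1)] by (cases "i \<in> V") (auto simp: H_def)
  have inV: "i \<in> V" if "i \<in> W1" "x i < w r" for i
    using that x in_V[of i] by (cases "i \<in> V") auto
  let ?T = "{i \<in> column H (w r). x i < w r}"
  have "ne_pairs P W x = ne_pairs P1 W1 x \<union> Pair r ` ?T"
  proof (intro set_eqI iffI)
    fix t assume t: "t \<in> ne_pairs P W x"
    obtain i e where ie: "t = (i, e)" by (cases t)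
    have "i < e" "e \<in> W1" using t ie r[of i] W by (auto simp: ne_pairs_def)
    show "t \<in> ne_pairs P1 W1 x \<union> Pair r ` ?T"
    proof (cases "i = r")
      case True
      then show ?thesis using t ie \<open>e \<in> W1\<close> x(3) inV unfolding col_c by (auto simp: ne_pairs_def)
    next
      case False
      then show ?thesis using t ie \<open>e \<in> W1\<close> mem_P1' W by (auto simp: ne_pairs_def)
    qed
  next
    fix t assume "t \<in> ne_pairs P1 W1 x \<union> Pair r ` ?T"
    then show "t \<in> ne_pairs P W x"
    proof
      assume "t \<in> ne_pairs P1 W1 x"
      then show ?thesis using mem_P1' W1W by (auto simp: ne_pairs_def)
    next
      assume "t \<in> Pair r ` ?T"
      then obtain e where e: "t = (r, e)" "e \<in> V" "(e, w r) \<in> P" "x e < w r" unfolding col_c by auto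
      then have "(r, x e) \<in> P" using validD[OF x(1)] by (auto simp: H_def)
      then show ?thesis using e VW r W x(3) by (auto simp: ne_pairs_def)
    qed
  qed
  moreover have "ne_pairs P1 W1 x \<inter> Pair r ` ?T = {}" using r_notin by (auto simp: ne_pairs_def)
  moreover have "finite (ne_pairs P1 W1 x)" by (rule finite_subset[of _ "W1 \<times> W1"]) (use finW1 in \<open>auto simp: ne_pairs_def\<close>)
  moreover have "finite ?T" using finW1 VW unfolding col_c by (auto intro: finite_subset[of _ W1])
  ultimately show ?thesis by (simp add: card_Un_disjoint card_image inj_on_def)
qed

lemma phi_step_eq:
  assumes w2: "gamma H (w r) (graph V w1) = graph V w2" "\<And>i. i \<notin> column H (w r) \<Longrightarrow> w2 i = w1 i"
  shows "(graph W1 w1 - F1) \<union> gamma H (w r) (graph V w1) \<union> {D \<in> graph W w. fst D = r} = graph W w2"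
proof -
  have outV: "w2 i = w1 i" if "i \<notin> V" for i using w2(2)[of i] that by (auto simp: col_c)
  moreover have "(i, w1 i) \<in> F1 \<longleftrightarrow> i \<in> V" if "i \<in> W1" for i
    using mem_F1[OF r_rows] v1[OF that] that r_notin by (auto simp: V_def)
  moreover have "r \<notin> V" using VW r_notin by blast
  then have "w2 r = w r" using outV out1[OF r_notin] by simp
  ultimately show ?thesis
    unfolding w2(1) using VW W out1[OF r_notin] r_notin by (auto simp: graph_def image_iff)
qed

lemma phi_step:
  "\<exists>w2. gamma H (w r) (graph V w1) = graph V w2 \<and> (\<forall>i. i \<notin> column H (w r) \<longrightarrow> w2 i = w1 i)
    \<and> (\<forall>i\<in>W. (i, w2 i) \<in> P) \<and> w2 r = w r \<and> (\<forall>i. i \<notin> W \<longrightarrow> w2 i = w i)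
    \<and> (\<forall>u a. istop W w2 u a \<longleftrightarrow> istop W w u a) \<and> counts W w2 = counts W w
    \<and> card (ne_pairs P W w2) + card (maj_pairs P1 W1 w) = card (maj_pairs P W w) + card (ne_pairs P1 W1 w1)"
proof -
  obtain w2 where w2: "gamma H (w r) (graph V w1) = graph V w2" "valid w2"
    "\<And>i. i \<notin> column H (w r) \<Longrightarrow> w2 i = w1 i"
    "card (ne_pairs H V w2) + card {i \<in> column H (w r). w1 i < w r} = card (ne_pairs H V w1) + card (delta w1)"
    "\<And>u a. u < w r \<Longrightarrow> istop V w2 u a \<longleftrightarrow> istop V w1 u a" "col_count w2 = col_count w1"
    using gamma_props[OF valid1] by blast
  have outV: "w2 i = w1 i" if "i \<notin> V" for i using w2(3)[of i] that by (auto simp: col_c)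
  have r2: "w2 r = w r" using outV[of r] out1[OF r_notin] VW r_notin by auto
  have v2: "(i, w2 i) \<in> P" if "i \<in> W" for i
  proof (cases "i \<in> V")
    case True
    then show ?thesis using validD[OF w2(2)] by (auto simp: H_def)
  next
    case False
    then show ?thesis using that W v1 vr r2 outV by auto
  qed
  have finc: "finite (column H (w r))" using finite_subset[OF column_sub] finite_subset[OF VW finW1] by blast
  have c12: "counts (column H (w r)) w2 = counts (column H (w r)) w1"
    using w2(6) by (simp add: fun_eq_iff col_count_def counts_def)
  have "counts W1 w2 = counts W1 w1"
    by (rule counts_mono[where R = "column H (w r)"]) (use finW1 VW c12 w2(3) in \<open>auto simp: col_c\<close>)
  then have cW1: "counts W1 w2 = counts W1 w" using counts1 by simp
  have counts: "counts W w2 = counts W w"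
    by (rule counts_mono[where R = W1]) (use finW1 W cW1 r2 in auto)
  have lefts: "card {i \<in> column H (w r). w2 i < w r} = card {i \<in> column H (w r). w1 i < w r}"
    using counts_Collect[OF finc c12] .
  \<comment> \<open>If \<open>w r\<close> is at most u, it is itself the topmost such entry.
    Otherwise all entries up to u belong to rows of \<open>V\<close>, where gamma keeps
    \<open>istop\<close>.\<close>
  have top: "istop W w2 u a \<longleftrightarrow> istop W w u a" for u a
  proof (cases "w r \<le> u")
    case True
    have first: "istop W x u a \<longleftrightarrow> a = w r" if "x r = w r" for x
      using True that r W unfolding istop_def by force
    show ?thesis using first r2 by simp
  next
    case False
    then have u: "u < w r" by simp
    have "istop W w2 u a \<longleftrightarrow> istop V w2 u a"
      by (rule istop_mono_set) (use VW W1W W r2 u outV in_V in force)+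
    also have "\<dots> \<longleftrightarrow> istop V w1 u a" using w2(5)[OF u] .
    also have "\<dots> \<longleftrightarrow> istop W1 w1 u a"
      by (rule istop_mono_set[symmetric]) (use VW u in_V in force)+
    also have "\<dots> \<longleftrightarrow> istop W1 w u a" by (rule top1)
    also have "\<dots> \<longleftrightarrow> istop W w u a"
      by (rule istop_mono_set[symmetric]) (use W u in auto)
    finally show ?thesis .
  qed
  \<comment> \<open>The chains starting in the top row, one per left entry, compensate the left
    entries in the formula for gamma. What remains is \<open>delta\<close>, and
    \<open>card_tops\<close> relates it to the raise of maj.\<close>
  have "card (ne_pairs P W w2) = card (ne_pairs H V w2) + card (far w1) + card {i \<in> column H (w r). w1 i < w r}"
    using ne_pairs_split[OF w2(2) outV r2] ne_pairs_split1[OF w2(2) outV] far_eq[OF w2(2) outV] lefts by simp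
  also have "\<dots> = card (ne_pairs H V w1) + card (delta w1) + card (far w1)" using w2(4) by simp
  also have "\<dots> = card (ne_pairs P1 W1 w1) + card (tops w)"
    using ne_pairs_split1[OF valid1] delta_eq card_tops by simp
  finally have "card (ne_pairs P W w2) + card (maj_pairs P1 W1 w) = card (maj_pairs P W w) + card (ne_pairs P1 W1 w1)"
    using maj_pairs_split by simp
  moreover have "w2 i = w i" if "i \<notin> W" for i
  proof -
    have "i \<notin> W1" "i \<notin> V" using that VW W1W by blast+
    then show ?thesis using outV[of i] out1[of i] by simp
  qed
  ultimately show ?thesis using w2(1,3) v2 r2 top counts by blast
qed

end

text \<open>The top row, hence \<open>H\<close> and \<open>V\<close>, can be read off the result.\<close>

lemma phi_step_inj:
  assumes x: "\<And>i. i \<in> W \<Longrightarrow> (i, x i) \<in> P" "\<And>i. i \<in> W1 \<Longrightarrow> (i, x1 i) \<in> P" "\<And>i. i \<notin> W1 \<Longrightarrow> x1 i = x i"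
    "\<And>u a. istop W1 x1 u a \<longleftrightarrow> istop W1 x u a" "counts W1 x1 = counts W1 x"
    and y: "\<And>i. i \<in> W \<Longrightarrow> (i, y i) \<in> P" "\<And>i. i \<in> W1 \<Longrightarrow> (i, y1 i) \<in> P" "\<And>i. i \<notin> W1 \<Longrightarrow> y1 i = y i"
    "\<And>u a. istop W1 y1 u a \<longleftrightarrow> istop W1 y u a" "counts W1 y1 = counts W1 y"
    and x2: "gamma (H x1) (x r) (graph (V x1) x1) = graph (V x1) x2" "\<And>i. i \<notin> column (H x1) (x r) \<Longrightarrow> x2 i = x1 i"
    "\<And>i. i \<in> W \<Longrightarrow> (i, x2 i) \<in> P"
    and y2: "gamma (H y1) (y r) (graph (V y1) y1) = graph (V y1) y2" "\<And>i. i \<notin> column (H y1) (y r) \<Longrightarrow> y2 i = y1 i"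
    "\<And>i. i \<in> W \<Longrightarrow> (i, y2 i) \<in> P"
    and eq: "graph W x2 = graph W y2" "\<And>i. i \<notin> W \<Longrightarrow> x i = y i"
  shows "x1 = y1 \<and> x r = y r"
proof -
  \<comment> \<open>gamma keeps the rows of \<open>V\<close> inside \<open>H\<close> and leaves the
    other rows alone, so \<open>V\<close> is still the set of rows whose entry is in a column of row
    r.\<close>
  have V: "V z1 = {i \<in> W1. (r, z2 i) \<in> P}" "\<And>i. i \<notin> V z1 \<Longrightarrow> z2 i = z1 i"
    if z: "\<And>i. i \<in> W \<Longrightarrow> (i, z i) \<in> P" "\<And>i. i \<in> W1 \<Longrightarrow> (i, z1 i) \<in> P" "\<And>i. i \<notin> W1 \<Longrightarrow> z1 i = z i"
    "\<And>u a. istop W1 z1 u a \<longleftrightarrow> istop W1 z u a" "counts W1 z1 = counts W1 z"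
      "gamma (H z1) (z r) (graph (V z1) z1) = graph (V z1) z2" "\<And>i. i \<notin> column (H z1) (z r) \<Longrightarrow> z2 i = z1 i"
    for z z1 z2
  proof -
    have f: "ferrers (H z1) (V z1) lo (z r)" using ferr[OF z(1-5)] .
    interpret ferrers "H z1" "V z1" lo "z r" by (rule f)
    have va: "valid z1" using valid1[OF z(1-5)] .
    have out: "z2 i = z1 i" if "i \<notin> V z1" for i using z(7)[of i] that HW[of i "z r"] by auto
    have rP: "(r, z2 i) \<in> P" if "i \<in> V z1" for i
    proof -
      obtain z' where "graph (V z1) z2 = graph (V z1) z'" "valid z'" using gamma_props[OF va] z(6) by metis
      then have "(i, z2 i) \<in> H z1" using that validD[of z' i] by (simp add: graph_eq_iff)
      then show ?thesis using mem_H[OF z(1-5)] by blast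
    qed
    show "V z1 = {i \<in> W1. (r, z2 i) \<in> P}"
    proof (rule set_eqI)
      fix i
      show "i \<in> V z1 \<longleftrightarrow> i \<in> {i \<in> W1. (r, z2 i) \<in> P}"
        using out[of i] rP[of i] mem_V[OF z(1-5), of i] by (cases "i \<in> V z1") simp_all
    qed
    show "\<And>i. i \<notin> V z1 \<Longrightarrow> z2 i = z1 i" by (rule out)
  qed
  have Vx: "V x1 = {i \<in> W1. (r, x2 i) \<in> P}" "\<And>i. i \<notin> V x1 \<Longrightarrow> x2 i = x1 i"
    using V[OF x x2(1,2)] by blast+
  have Vy: "V y1 = {i \<in> W1. (r, y2 i) \<in> P}" "\<And>i. i \<notin> V y1 \<Longrightarrow> y2 i = y1 i"
    using V[OF y y2(1,2)] by blast+
  have e2: "x2 i = y2 i" if "i \<in> W" for i using eq(1) that by (auto simp: graph_eq_iff)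
  have VV: "V x1 = V y1" using Vx(1) Vy(1) e2 W1W by auto
  have HH: "H x1 = H y1" using mem_H[OF x] mem_H[OF y] VV by auto
  have rV: "r \<notin> V x1" "r \<notin> V y1" using r_notin VW[OF x] VW[OF y] by blast+
  have xr: "x r = y r" using e2[of r] W Vx(2)[OF rV(1)] Vy(2)[OF rV(2)] x(3)[OF r_notin] y(3)[OF r_notin] by simp
  have f: "ferrers (H x1) (V x1) lo (x r)" using ferr[OF x] .
  have "x1 = y1"
  proof (rule ferrers.gamma_inj[OF f])
    show "ferrers.valid (H x1) (V x1) x1" using valid1[OF x] .
    show "ferrers.valid (H x1) (V x1) y1" unfolding VV HH using valid1[OF y] .
    show "x1 i = y1 i" if "i \<notin> V x1" for i
    proof (cases "i \<in> W")
      case True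
      then show ?thesis using Vx(2) Vy(2) that VV e2 by metis
    next
      case False
      then show ?thesis using x(3) y(3) eq(2) W1W by (metis subsetD)
    qed
    have "graph (V x1) x2 = graph (V x1) y2"
      using e2 W1W VW[OF x] by (auto simp: graph_eq_iff)
    then show "gamma (H x1) (x r) (graph (V x1) x1) = gamma (H x1) (x r) (graph (V x1) y1)"
      using x2(1) y2(1) VV HH xr by simp
  qed
  then show ?thesis using xr by simp
qed

end

text \<open>The invariants on \<open>istop\<close> and \<open>counts\<close> are what the next row
  needs. Words are total functions, so injectivity is stated for words that agree outside
  \<open>W\<close>.\<close>

lemma phi_rows_props:
  assumes "stack P W lo" "sorted_wrt (<) rs" "set rs = W" "\<And>i. i \<in> W \<Longrightarrow> (i, w i) \<in> P"
  shows "\<exists>w'. phi_rows rs P (graph W w) = graph W w' \<and> (\<forall>i\<in>W. (i, w' i) \<in> P) \<and> (\<forall>i. i \<notin> W \<longrightarrow> w' i = w i)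
    \<and> (\<forall>u a. istop W w' u a \<longleftrightarrow> istop W w u a) \<and> counts W w' = counts W w
    \<and> card (ne_pairs P W w') = card (maj_pairs P W w)
    \<and> (\<forall>v. (\<forall>i\<in>W. (i, v i) \<in> P) \<and> (\<forall>i. i \<notin> W \<longrightarrow> v i = w i) \<and> phi_rows rs P (graph W v) = graph W w' \<longrightarrow> v = w)"
  using assms
proof (induction rs arbitrary: P W w rule: induct_list012)
  case 1
  then show ?case by (intro exI[of _ w]) (auto simp: maj_pairs_def ne_pairs_def)
next
  case (2 r)
  then have W: "W = {r}" by simp
  have "ne_pairs P {r} w = {}" "maj_pairs P {r} w = {}" by (auto simp: ne_pairs_def maj_pairs_def)
  then show ?case using 2(4) unfolding W by (intro exI[of _ w]) (auto simp: graph_eq_iff fun_eq_iff)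
next
  case (3 r r' rs)
  define W1 where "W1 = set (r' # rs)"
  define P1 where "P1 = {D \<in> P. fst D \<noteq> r}"
  interpret stack P W lo by fact
  interpret stack_top P W lo r W1 P1
    by unfold_locales (use 3 in \<open>auto simp: W1_def P1_def\<close>)
  have M1: "{D \<in> graph W x. fst D \<noteq> r} = graph W1 x" for x
    using W r_notin by (auto simp: graph_def)
  have sorted: "sorted_wrt (<) (r' # rs)" using 3 by simp
  have IH: "\<exists>w'. phi_rows (r' # rs) P1 (graph W1 x) = graph W1 w' \<and> (\<forall>i\<in>W1. (i, w' i) \<in> P1) \<and> (\<forall>i. i \<notin> W1 \<longrightarrow> w' i = x i)
    \<and> (\<forall>u a. istop W1 w' u a \<longleftrightarrow> istop W1 x u a) \<and> counts W1 w' = counts W1 x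
    \<and> card (ne_pairs P1 W1 w') = card (maj_pairs P1 W1 x)
    \<and> (\<forall>v. (\<forall>i\<in>W1. (i, v i) \<in> P1) \<and> (\<forall>i. i \<notin> W1 \<longrightarrow> v i = x i) \<and> phi_rows (r' # rs) P1 (graph W1 v) = graph W1 w' \<longrightarrow> v = x)"
    if "\<And>i. i \<in> W1 \<Longrightarrow> (i, x i) \<in> P1" for x
    using 3(2)[OF stack1 sorted W1_def[symmetric] that] .
  have step: "\<exists>x1 x2. phi_rows (r' # rs) P1 (graph W1 x) = graph W1 x1 \<and>
      (\<forall>i\<in>W1. (i, x1 i) \<in> P) \<and> (\<forall>i. i \<notin> W1 \<longrightarrow> x1 i = x i)
      \<and> (\<forall>u a. istop W1 x1 u a \<longleftrightarrow> istop W1 x u a) \<and> counts W1 x1 = counts W1 x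
      \<and> card (ne_pairs P1 W1 x1) = card (maj_pairs P1 W1 x)
      \<and> (\<forall>v. (\<forall>i\<in>W1. (i, v i) \<in> P) \<and> (\<forall>i. i \<notin> W1 \<longrightarrow> v i = x i) \<and> phi_rows (r' # rs) P1 (graph W1 v) = graph W1 x1 \<longrightarrow> v = x)
      \<and> gamma (H x1) (x r) (graph (V x1) x1) = graph (V x1) x2 \<and> (\<forall>i. i \<notin> column (H x1) (x r) \<longrightarrow> x2 i = x1 i)
      \<and> (\<forall>i\<in>W. (i, x2 i) \<in> P) \<and> x2 r = x r \<and> (\<forall>i. i \<notin> W \<longrightarrow> x2 i = x i)
      \<and> (\<forall>u a. istop W x2 u a \<longleftrightarrow> istop W x u a) \<and> counts W x2 = counts W x
      \<and> card (ne_pairs P W x2) = card (maj_pairs P W x)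
      \<and> phi_rows (r # r' # rs) P (graph W x) = graph W x2"
    if x: "\<And>i. i \<in> W \<Longrightarrow> (i, x i) \<in> P" for x
  proof -
    have xP1: "(i, x i) \<in> P1" if "i \<in> W1" for i using x that W1W mem_P1' by auto
    from IH[OF xP1] obtain x1 where x1: "phi_rows (r' # rs) P1 (graph W1 x) = graph W1 x1"
      "\<forall>i\<in>W1. (i, x1 i) \<in> P1" "\<forall>i. i \<notin> W1 \<longrightarrow> x1 i = x i"
      "\<forall>u a. istop W1 x1 u a \<longleftrightarrow> istop W1 x u a" "counts W1 x1 = counts W1 x"
      "card (ne_pairs P1 W1 x1) = card (maj_pairs P1 W1 x)"
      "\<forall>v. (\<forall>i\<in>W1. (i, v i) \<in> P1) \<and> (\<forall>i. i \<notin> W1 \<longrightarrow> v i = x i) \<and> phi_rows (r' # rs) P1 (graph W1 v) = graph W1 x1 \<longrightarrow> v = x"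
      by blast
    have x1P: "(i, x1 i) \<in> P" if "i \<in> W1" for i using x1(2) that mem_P1' by auto
    have x1': "\<And>i. i \<notin> W1 \<Longrightarrow> x1 i = x i" "\<And>u a. istop W1 x1 u a \<longleftrightarrow> istop W1 x u a" using x1 by auto
    note ctx = x x1P x1'(1) x1'(2) x1(5)
    obtain x2 where x2: "gamma (H x1) (x r) (graph (V x1) x1) = graph (V x1) x2"
      "\<And>i. i \<notin> column (H x1) (x r) \<Longrightarrow> x2 i = x1 i"
      "\<forall>i\<in>W. (i, x2 i) \<in> P" "x2 r = x r" "\<forall>i. i \<notin> W \<longrightarrow> x2 i = x i"
      "\<forall>u a. istop W x2 u a \<longleftrightarrow> istop W x u a" "counts W x2 = counts W x"
      "card (ne_pairs P W x2) + card (maj_pairs P1 W1 x) = card (maj_pairs P W x) + card (ne_pairs P1 W1 x1)"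
      using phi_step[OF ctx] by blast
    have cr: "col_at (graph W x) r = x r" using W by simp
    have G: "graph W1 x1 \<inter> F1 = graph (V x1) x1" by (rule G_eq[OF ctx])
    have Heq: "{D \<in> F1. fst D \<in> V x1} = H x1" by (rule H_eq[OF ctx])
    have "phi_rows (r # r' # rs) P (graph W x)
      = (graph W1 x1 - F1) \<union> gamma (H x1) (x r) (graph (V x1) x1) \<union> {D \<in> graph W x. fst D = r}"
      unfolding phi_rows.simps Let_def M1 P1_def[symmetric] F1_def[symmetric] x1(1) cr
        G rows_graph Heq ..
    also have "\<dots> = graph W x2" by (rule phi_step_eq[OF ctx x2(1,2)])
    finally have fin: "phi_rows (r # r' # rs) P (graph W x) = graph W x2" .
    have u: "\<forall>v. (\<forall>i\<in>W1. (i, v i) \<in> P) \<and> (\<forall>i. i \<notin> W1 \<longrightarrow> v i = x i)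
        \<and> phi_rows (r' # rs) P1 (graph W1 v) = graph W1 x1 \<longrightarrow> v = x"
      using x1(7) mem_P1' by blast
    have "card (ne_pairs P W x2) = card (maj_pairs P W x)" using x2(8) x1(6) by simp
    then show ?thesis
      by - (rule exI[of _ x1], rule exI[of _ x2], insert x1(1,3-6) u x1P x2(1-7) fin, blast)
  qed
  note w = 3(6)
  from step[OF w] obtain w1 w2 where S: "phi_rows (r' # rs) P1 (graph W1 w) = graph W1 w1"
    "\<forall>i\<in>W1. (i, w1 i) \<in> P" "\<forall>i. i \<notin> W1 \<longrightarrow> w1 i = w i"
    "\<forall>u a. istop W1 w1 u a \<longleftrightarrow> istop W1 w u a" "counts W1 w1 = counts W1 w"
    "\<forall>v. (\<forall>i\<in>W1. (i, v i) \<in> P) \<and> (\<forall>i. i \<notin> W1 \<longrightarrow> v i = w i) \<and> phi_rows (r' # rs) P1 (graph W1 v) = graph W1 w1 \<longrightarrow> v = w"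
    "gamma (H w1) (w r) (graph (V w1) w1) = graph (V w1) w2" "\<forall>i. i \<notin> column (H w1) (w r) \<longrightarrow> w2 i = w1 i"
    "\<forall>i\<in>W. (i, w2 i) \<in> P" "\<forall>i. i \<notin> W \<longrightarrow> w2 i = w i"
    "\<forall>u a. istop W w2 u a \<longleftrightarrow> istop W w u a" "counts W w2 = counts W w"
    "card (ne_pairs P W w2) = card (maj_pairs P W w)"
    "phi_rows (r # r' # rs) P (graph W w) = graph W w2" by blast
  have "v = w" if v: "\<forall>i\<in>W. (i, v i) \<in> P" "\<forall>i. i \<notin> W \<longrightarrow> v i = w i"
    "phi_rows (r # r' # rs) P (graph W v) = graph W w2" for v
  proof -
    from step[of v] v(1) obtain v1 v2 where T: "phi_rows (r' # rs) P1 (graph W1 v) = graph W1 v1"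
      "\<forall>i\<in>W1. (i, v1 i) \<in> P" "\<forall>i. i \<notin> W1 \<longrightarrow> v1 i = v i"
      "\<forall>u a. istop W1 v1 u a \<longleftrightarrow> istop W1 v u a" "counts W1 v1 = counts W1 v"
      "gamma (H v1) (v r) (graph (V v1) v1) = graph (V v1) v2" "\<forall>i. i \<notin> column (H v1) (v r) \<longrightarrow> v2 i = v1 i"
      "\<forall>i\<in>W. (i, v2 i) \<in> P" "phi_rows (r # r' # rs) P (graph W v) = graph W v2" by blast
    have e: "graph W v2 = graph W w2" using T(9) v(3) by simp
    have "v1 = w1 \<and> v r = w r"
      by (rule phi_step_inj[of v v1 w w1 v2 w2]) (use S(2-5,7-9) T(2-8) v(1,2) w e in blast)+
    then show ?thesis
      using S(6) T(1) v W1W W by (metis insert_iff subsetD)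
  qed
  then show ?case using S(9-14) by (intro exI[of _ w2]) auto
qed

lemma mem_fillings:
  assumes "finite P"
  shows "M \<in> fillings P s A \<longleftrightarrow> (\<exists>W w. M = graph W w \<and> (\<forall>i\<in>W. (i, w i) \<in> P) \<and> rows P - W = A
    \<and> (\<forall>k<length s. counts W w (sorted_list_of_set (cols P) ! k) = s ! k))"
proof
  assume M: "M \<in> fillings P s A"
  then obtain W w where w: "M = graph W w" "\<forall>i\<in>W. (i, w i) \<in> P"
    unfolding fillings_def mem_Collect_eq filling_graph_iff[OF assms] by blast
  then show "\<exists>W w. M = graph W w \<and> (\<forall>i\<in>W. (i, w i) \<in> P) \<and> rows P - W = A
    \<and> (\<forall>k<length s. counts W w (sorted_list_of_set (cols P) ! k) = s ! k)"
    using M by (intro exI[of _ W], intro exI[of _ w]) (simp add: fillings_def column_graph counts_def)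
next
  assume "\<exists>W w. M = graph W w \<and> (\<forall>i\<in>W. (i, w i) \<in> P) \<and> rows P - W = A
    \<and> (\<forall>k<length s. counts W w (sorted_list_of_set (cols P) ! k) = s ! k)"
  then show "M \<in> fillings P s A"
    unfolding fillings_def mem_Collect_eq filling_graph_iff[OF assms]
    by (force simp: column_graph counts_def)
qed

lemma phi_props:
  assumes moon: "moon_polyomino N" and left: "left_aligned N"
  shows "M \<in> fillings N s A \<Longrightarrow> phi N M \<in> fillings N s A"
    and "M \<in> fillings N s A \<Longrightarrow> maj N M = int (ne N (phi N M))"
    and "inj_on (phi N) (fillings N s A)"
proof -
  interpret moon N by unfold_locales (rule moon)
  define lo where "lo = Min (cols N)"
  have lo: "lo \<le> j" if "(i, j) \<in> N" for i j
    unfolding lo_def using Min_le[OF finite_cols[OF fin]] that mem_cols by blast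
  have lo_mem: "(i, lo) \<in> N" if "(i, j) \<in> N" for i j
  proof -
    have "i \<in> rows N" using that by (auto simp: mem_rows)
    then have "Min (row N i) = lo" using left by (simp add: left_aligned_def lo_def)
    moreover have "Min (row N i) \<in> row N i" using that fin by (intro Min_in) auto
    ultimately show ?thesis by simp
  qed
  define Q where "Q W = {D \<in> N. fst D \<in> W}" for W
  have st: "stack (Q W) W lo" if W: "\<forall>i\<in>W. (i, w i) \<in> N" for W w
  proof
    have "W \<subseteq> rows N" using W mem_rows by blast
    then show "finite W" using fin finite_rows finite_subset by blast
    show "finite (Q W)" using fin by (simp add: Q_def)
    show "i \<in> W \<and> lo \<le> j" if "(i, j) \<in> Q W" for i j using that lo by (auto simp: Q_def)
    show "(i, j') \<in> Q W" if "(i, j) \<in> Q W" "lo \<le> j'" "j' \<le> j" for i j j'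
      using that row_convex[of i lo j j'] lo_mem by (auto simp: Q_def)
    show "(i, j) \<in> Q W" if "(a, j) \<in> Q W" "(b, j) \<in> Q W" "a \<le> i" "i \<le> b" "i \<in> W" for a b i j
      using that column_convex[of a j b i] by (auto simp: Q_def)
  qed
  have majQ: "maj_pairs (Q W) W w = maj_pairs N W w" for W w
  proof -
    have row: "row (Q W) i = row N i" if "i \<in> W" for i using that by (auto simp: Q_def)
    have mem: "(i, j) \<in> Q W \<longleftrightarrow> (i, j) \<in> N" if "i \<in> W" for i j using that by (simp add: Q_def)
    show ?thesis unfolding maj_pairs_def using row mem by (auto simp del: mem_row)
  qed
  have nepQ: "ne_pairs (Q W) W w = ne_pairs N W w" for W w
    by (auto simp: ne_pairs_def Q_def)
  have memQ: "(i, j) \<in> Q W \<longleftrightarrow> (i, j) \<in> N \<and> i \<in> W" for i j W by (auto simp: Q_def)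
  have phi: "phi N (graph W w) = phi_rows (sorted_list_of_set W) (Q W) (graph W w)" for W w
    by (simp add: phi_def Q_def)
  have main: "\<exists>w'. phi N (graph W w) = graph W w' \<and> (\<forall>i\<in>W. (i, w' i) \<in> N) \<and> counts W w' = counts W w
      \<and> card (ne_pairs N W w') = card (maj_pairs N W w)
      \<and> (\<forall>v. (\<forall>i\<in>W. (i, v i) \<in> N) \<and> phi N (graph W v) = graph W w' \<longrightarrow> graph W v = graph W w)"
    if W: "\<forall>i\<in>W. (i, w i) \<in> N" for W w
  proof -
    have finW: "finite W" using stack.finW[OF st[OF W]] .
    have "\<exists>w'. phi_rows (sorted_list_of_set W) (Q W) (graph W w) = graph W w' \<and> (\<forall>i\<in>W. (i, w' i) \<in> Q W) \<and> (\<forall>i. i \<notin> W \<longrightarrow> w' i = w i)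
    \<and> (\<forall>u a. istop W w' u a \<longleftrightarrow> istop W w u a) \<and> counts W w' = counts W w
    \<and> card (ne_pairs (Q W) W w') = card (maj_pairs (Q W) W w)
    \<and> (\<forall>v. (\<forall>i\<in>W. (i, v i) \<in> Q W) \<and> (\<forall>i. i \<notin> W \<longrightarrow> v i = w i)
        \<and> phi_rows (sorted_list_of_set W) (Q W) (graph W v) = graph W w' \<longrightarrow> v = w)"
      by (rule phi_rows_props[OF st[OF W]]) (use finW W memQ in auto)
    then obtain w' where w': "phi_rows (sorted_list_of_set W) (Q W) (graph W w) = graph W w'"
      "\<forall>i\<in>W. (i, w' i) \<in> Q W" "counts W w' = counts W w" "card (ne_pairs (Q W) W w') = card (maj_pairs (Q W) W w)"
      "\<forall>v. (\<forall>i\<in>W. (i, v i) \<in> Q W) \<and> (\<forall>i. i \<notin> W \<longrightarrow> v i = w i)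
        \<and> phi_rows (sorted_list_of_set W) (Q W) (graph W v) = graph W w' \<longrightarrow> v = w"
      by blast
    have w'N: "\<forall>i\<in>W. (i, w' i) \<in> N" using w'(2) memQ by simp
    have w'c: "card (ne_pairs N W w') = card (maj_pairs N W w)" using w'(4) unfolding majQ nepQ .
    have "graph W v = graph W w" if v: "\<forall>i\<in>W. (i, v i) \<in> N" "phi N (graph W v) = graph W w'" for v
    proof -
      \<comment> \<open>Adjusted outside \<open>W\<close>, so that injectivity on words applies to
        fillings.\<close>
      define v' where "v' i = (if i \<in> W then v i else w i)" for i
      have "graph W v' = graph W v" by (simp add: graph_eq_iff v'_def)
      moreover have "v' = w"
        using w'(5)[rule_format, of v'] v calculation phi memQ by (simp add: v'_def)
      ultimately show ?thesis by simp
    qed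
    then show ?thesis using w'(1,3) w'N w'c phi by (intro exI[of _ w']) simp
  qed
  show fill: "phi N M \<in> fillings N s A" if M: "M \<in> fillings N s A"
  proof -
    from M obtain W w where w: "M = graph W w" "\<forall>i\<in>W. (i, w i) \<in> N" "rows N - W = A"
      "\<forall>k<length s. counts W w (sorted_list_of_set (cols N) ! k) = s ! k"
      unfolding mem_fillings[OF fin] by blast
    then show ?thesis unfolding mem_fillings[OF fin] using main[OF w(2)] by metis
  qed
  show "maj N M = int (ne N (phi N M))" if M: "M \<in> fillings N s A"
  proof -
    from M obtain W w where w: "M = graph W w" "\<forall>i\<in>W. (i, w i) \<in> N"
      unfolding mem_fillings[OF fin] by blast
    obtain w' where w': "phi N (graph W w) = graph W w'" "\<forall>i\<in>W. (i, w' i) \<in> N"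
      "card (ne_pairs N W w') = card (maj_pairs N W w)" using main[OF w(2)] by blast
    then show ?thesis using w maj_eq[of W w] ne_eq[of W w'] by simp
  qed
  show "inj_on (phi N) (fillings N s A)"
  proof (rule inj_onI)
    fix M M' assume M: "M \<in> fillings N s A" "M' \<in> fillings N s A" "phi N M = phi N M'"
    from M(1) obtain W w where w: "M = graph W w" "\<forall>i\<in>W. (i, w i) \<in> N"
      unfolding mem_fillings[OF fin] by blast
    from M(2) obtain W' v where v: "M' = graph W' v" "\<forall>i\<in>W'. (i, v i) \<in> N"
      unfolding mem_fillings[OF fin] by blast
    from main[OF w(2)] obtain w' where w': "phi N (graph W w) = graph W w'"
      "\<forall>v. (\<forall>i\<in>W. (i, v i) \<in> N) \<and> phi N (graph W v) = graph W w' \<longrightarrow> graph W v = graph W w" by blast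
    from main[OF v(2)] obtain v' where v': "phi N (graph W' v) = graph W' v'" by blast
    have "W = W'" using w'(1) v' M(3) w(1) v(1) by (simp add: graph_eq_iff)
    then show "M = M'" using w'(2)[rule_format, of v] v w M(3) w'(1) by auto
  qed
qed

section \<open>One step of the algorithm alpha\<close>

locale moon_step = moon +
  assumes not_left: "\<not> left_aligned P"
begin

definition l where "l = first_col P"
definition B where "B = column P l"
text \<open>The last column that contains the first one; it ends the leading rectangle.\<close>

definition z where "z = Max {j \<in> cols P. B \<subseteq> column P j}"

lemma P_ne: "P \<noteq> {}"
  using not_left by (auto simp: left_aligned_def rows_def)

lemma finc: "finite (cols P)" using fin by auto

lemma l_in: "l \<in> cols P"
proof -
  have "cols P \<noteq> {}" using P_ne by (auto simp: cols_def)
  then show ?thesis unfolding l_def first_col_def using Min_in[OF finc] by blast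
qed

lemma l_le: "(i, j) \<in> P \<Longrightarrow> l \<le> j"
  unfolding l_def first_col_def using Min_le[OF finc] mem_cols by blast

lemma B_ne: "B \<noteq> {}"
  using l_in by (auto simp: B_def mem_cols)

lemma mem_B: "i \<in> B \<longleftrightarrow> (i, l) \<in> P"
  by (simp add: B_def)

lemma z_in: "z \<in> cols P" "B \<subseteq> column P z" "j \<in> cols P \<Longrightarrow> B \<subseteq> column P j \<Longrightarrow> j \<le> z"
proof -
  let ?Z = "{j \<in> cols P. B \<subseteq> column P j}"
  have Z: "finite ?Z" "?Z \<noteq> {}" using finc l_in by (auto simp: B_def)
  show "z \<in> cols P" "B \<subseteq> column P z" using Max_in[OF Z] by (auto simp: z_def)
  show "j \<in> cols P \<Longrightarrow> B \<subseteq> column P j \<Longrightarrow> j \<le> z" using Max_ge[OF Z(1)] by (auto simp: z_def)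
qed

lemma in_rect: "i \<in> B \<Longrightarrow> l \<le> j \<Longrightarrow> j \<le> z \<Longrightarrow> (i, j) \<in> P"
  using row_convex[of i l z j] z_in(2) by (auto simp: mem_B subset_iff)

lemma l_le_z: "l \<le> z"
  using z_in(3)[OF l_in] by (simp add: B_def)

text \<open>A column with a cell outside \<open>B\<close> is not contained in the first column, so
  it contains it and lies no further right than z. Thus the rows outside \<open>B\<close> live in
  the columns l + 1 to z.\<close>

lemma outside: "(i, j) \<in> P \<Longrightarrow> i \<notin> B \<Longrightarrow> l < j \<and> j \<le> z"
proof
  assume ij: "(i, j) \<in> P" "i \<notin> B"
  show "l < j" using l_le[OF ij(1)] ij by (cases "j = l") (auto simp: mem_B)
  have "\<not> column P j \<subseteq> B" using ij by auto
  then have "B \<subseteq> column P j" using column_comparable[of j l] by (simp add: B_def)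
  then show "j \<le> z" using z_in(3) ij mem_cols by blast
qed

lemma ex_outside: "\<exists>i\<in>rows P. i \<notin> B"
proof (rule ccontr)
  assume "\<not> (\<exists>i\<in>rows P. i \<notin> B)"
  then have "Min (row P i) = l" if "i \<in> rows P" for i
    using that l_le fin by (intro Min_eqI) (auto simp: mem_B)
  then show False using not_left by (auto simp: left_aligned_def l_def first_col_def)
qed

lemma B_convex: "a \<in> B \<Longrightarrow> b \<in> B \<Longrightarrow> a \<le> i \<Longrightarrow> i \<le> b \<Longrightarrow> i \<in> B"
  using column_convex[of a l b i] by (simp add: mem_B)

lemma finB: "finite B" using fin by (auto simp: B_def)

text \<open>The order is inclusion. A rectangle with the first column has only rows of
  \<open>B\<close>, and all its columns contain \<open>B\<close>, so none is beyond z.\<close>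

lemma lead_rect_eq: "lead_rect P = B \<times> {l..z}"
  unfolding lead_rect_def
proof (rule Greatest_equality)
  have B: "B = {Min B..Max B}"
  proof (rule contiguous_eq_interval[OF finB B_ne])
    show "contiguous B" unfolding contiguous_def using B_convex by (meson atLeastAtMost_iff subsetI)
  qed
  have "B \<times> {l..z} = {Min B..Max B} \<times> {l..z}" by (rule arg_cong[OF B])
  moreover have "B \<times> {l..z} \<noteq> {}" using B_ne l_le_z by auto
  ultimately have "rectangle (B \<times> {l..z})" unfolding rectangle_def by blast
  then show "rectangle (B \<times> {l..z}) \<and> B \<times> {l..z} \<subseteq> P \<and> column P (first_col P) \<times> {first_col P} \<subseteq> B \<times> {l..z}"
    using in_rect l_le_z unfolding l_def[symmetric] B_def[symmetric] by auto
next
  fix Q assume Q: "rectangle Q \<and> Q \<subseteq> P \<and> column P (first_col P) \<times> {first_col P} \<subseteq> Q"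
  then obtain a b c d where abcd: "Q = {a..b} \<times> {c..d}" by (auto simp: rectangle_def)
  have QP: "Q \<subseteq> P" and BQ: "B \<times> {l} \<subseteq> Q" using Q unfolding l_def[symmetric] B_def[symmetric] by auto
  have lcd: "l \<in> {c..d}" using BQ B_ne unfolding abcd by auto
  have "{a..b} \<subseteq> B"
  proof
    fix i assume "i \<in> {a..b}"
    then have "(i, l) \<in> Q" using lcd abcd by auto
    then show "i \<in> B" using QP mem_B by auto
  qed
  moreover have "j \<in> {l..z}" if j: "j \<in> {c..d}" for j
  proof -
    have "B \<subseteq> {a..b}" using BQ abcd by auto
    then have BJ: "B \<subseteq> column P j"
    proof (intro subsetI)
      fix x assume "B \<subseteq> {a..b}" "x \<in> B"
      then have "(x, j) \<in> Q" using abcd j by auto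
      then show "x \<in> column P j" using QP by auto
    qed
    then have "j \<in> cols P" using B_ne mem_cols by fastforce
    then show ?thesis using z_in(3)[OF _ BJ] l_le mem_cols by force
  qed
  ultimately show "Q \<le> B \<times> {l..z}" unfolding abcd by auto
qed

lemma last_col_eq: "last_col P = z"
proof -
  have "cols (B \<times> {l..z}) = {l..z}" using B_ne by (auto simp: cols_def)
  moreover have "Max {l..z} = z" using l_le_z by (intro Max_eqI) auto
  ultimately show ?thesis unfolding last_col_def lead_rect_eq by simp
qed

abbreviation "P' \<equiv> move_column P"

text \<open>Rows of \<open>B\<close> contain all columns from l to z, so permuting these columns
  does not change them. The other rows lie in columns l + 1 to z and move one place to the
  left.\<close>

lemma mem_P': "(i, j) \<in> P' \<longleftrightarrow> (if i \<in> B then (i, j) \<in> P else (i, j + 1) \<in> P)"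
proof
  assume "(i, j) \<in> P'"
  then obtain j0 where j0: "(i, j0) \<in> P" "j = (if j0 = l then z else if l < j0 \<and> j0 \<le> z then j0 - 1 else j0)"
    unfolding move_column_def move_cell_def l_def[symmetric] last_col_eq by auto
  show "if i \<in> B then (i, j) \<in> P else (i, j + 1) \<in> P"
    using j0 in_rect[of i j] outside[OF j0(1)] l_le_z by (auto split: if_splits)
next
  assume a: "if i \<in> B then (i, j) \<in> P else (i, j + 1) \<in> P"
  define j0 where "j0 = (if i \<in> B then (if j = z then l else if j < z then j + 1 else j) else j + 1)"
  have lj: "l \<le> j" using a l_le[of i j] outside[of i "j + 1"] by (auto split: if_splits)
  have "(i, j0) \<in> P"
    using a in_rect[of i j0] l_le_z lj unfolding j0_def by (auto split: if_splits simp: mem_B)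
  moreover have "j = (if j0 = l then z else if l < j0 \<and> j0 \<le> z then j0 - 1 else j0)"
    using lj a outside[of i "j + 1"] l_le_z unfolding j0_def by (auto split: if_splits)
  ultimately show "(i, j) \<in> P'"
    unfolding move_column_def move_cell_def l_def[symmetric] last_col_eq by force
qed

lemma column_P': "column P' j = (if j < l then {} else if j < z then column P (j + 1) else if j = z then B else column P j)"
proof -
  consider "j < l" | "l \<le> j" "j < z" | "j = z" | "j > z" by linarith
  then show ?thesis
  proof cases
    case 1
    then have "(i, j) \<notin> P'" for i unfolding mem_P' using l_le[of i j] outside[of i "j + 1"] by auto
    then show ?thesis using 1 by auto
  next
    case 2
    then have "(i, j) \<in> P' \<longleftrightarrow> (i, j + 1) \<in> P" for i
      unfolding mem_P' using in_rect[of i j] in_rect[of i "j + 1"] by auto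
    then show ?thesis using 2 by auto
  next
    case 3
    then have "(i, j) \<in> P' \<longleftrightarrow> i \<in> B" for i
    proof (cases "i \<in> B")
      case True
      then show ?thesis using 3 in_rect[of i z] l_le_z by (simp add: mem_P')
    next
      case False
      then have "(i, z + 1) \<notin> P" using outside[of i "z + 1"] by auto
      then show ?thesis using 3 False by (simp add: mem_P')
    qed
    then have "column P' j = B" by (intro set_eqI) (simp only: mem_column)
    then show ?thesis using 3 l_le_z by simp
  next
    case 4
    then have "(i, j) \<in> P' \<longleftrightarrow> (i, j) \<in> P" for i
      unfolding mem_P' using outside[of i "j + 1"] outside[of i j] by auto
    then show ?thesis using 4 l_le_z by auto
  qed
qed

lemma moon_P': "moon_polyomino P'"
proof (rule moonI)
  show "finite P'" using fin by (simp add: move_column_def)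
  show "(i, j) \<in> P'" if "(i, a) \<in> P'" "(i, b) \<in> P'" "a \<le> j" "j \<le> b" for i a b j
    using that row_convex[of i a b j] row_convex[of i "a + 1" "b + 1" "j + 1"] by (auto simp: mem_P' split: if_splits)
  have *: "\<exists>k. column P' j = column P k \<or> column P' j = {}" for j
    unfolding column_P' B_def by auto
  show "column P' j \<subseteq> column P' j' \<or> column P' j' \<subseteq> column P' j" for j j'
    using *[of j] *[of j'] column_comparable by (metis empty_subsetI)
  show "(i, j) \<in> P'" if "(a, j) \<in> P'" "(b, j) \<in> P'" "a \<le> i" "i \<le> b" for a b i j
  proof -
    have "contiguous (column P k)" for k
      unfolding contiguous_def
    proof (intro ballI subsetI)
      fix a b i assume "a \<in> column P k" "b \<in> column P k" "i \<in> {a..b}"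
      then show "i \<in> column P k" using column_convex[of a k b i] by simp
    qed
    then have "contiguous (column P' j)"
      using *[of j] by (metis contiguous_def empty_iff)
    then show ?thesis using that unfolding contiguous_def by (metis atLeastAtMost_iff mem_column subsetD)
  qed
qed

lemma rows_P': "rows P' = rows P"
proof -
  have "(\<exists>j. (i, j) \<in> P') \<longleftrightarrow> (\<exists>j. (i, j) \<in> P)" for i
    unfolding mem_P' by (cases "i \<in> B") (auto, metis diff_add_cancel)
  then show ?thesis by (auto simp: mem_rows)
qed

lemma cols_iff: "j \<in> cols X \<longleftrightarrow> column X j \<noteq> {}"
  by (auto simp: mem_cols)

lemma column_in: "l \<le> j \<Longrightarrow> j \<le> z \<Longrightarrow> column P j \<noteq> {}"
  using in_rect B_ne by fastforce

lemma cols_P': "cols P' = cols P"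
proof (rule set_eqI)
  fix j
  have "column P j = {}" if "j < l" using that l_le by fastforce
  then show "j \<in> cols P' \<longleftrightarrow> j \<in> cols P"
    unfolding cols_iff column_P' using column_in[of j] column_in[of "j + 1"] B_ne by auto
qed

text \<open>Hence entry k of \<open>s\<close> belongs to column l + k. There is no gap: columns l to
  z contain \<open>B\<close>, and a cell beyond z is in a row of \<open>B\<close>, which starts at
  l.\<close>

lemma cols_interval: "cols P = {l..Max (cols P)}"
proof -
  have "j \<in> cols P" if j: "l \<le> j" "j \<le> Max (cols P)" for j
  proof -
    have "Max (cols P) \<in> cols P" using Max_in[OF finc] l_in by blast
    then obtain i where i: "(i, Max (cols P)) \<in> P" by (auto simp: mem_cols)
    show ?thesis
    proof (cases "i \<in> B")
      case True
      then show ?thesis using row_convex[OF _ i j] mem_B mem_cols by blast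
    next
      case False
      then have "j \<le> z" using outside[OF i] j by simp
      then show ?thesis using column_in j cols_iff by blast
    qed
  qed
  moreover have "l \<le> j \<and> j \<le> Max (cols P)" if "j \<in> cols P" for j
    using that l_le Max_ge[OF finc that] mem_cols by blast
  ultimately show ?thesis by (meson atLeastAtMost_iff equalityI subsetI)
qed

end

section \<open>Termination of alpha\<close>

definition gap_set :: "cell set \<Rightarrow> (int \<times> int) set" where
  "gap_set X = {(i, j). i \<in> rows X \<and> j \<in> cols X \<and> (\<forall>k. (i, k) \<in> X \<longrightarrow> j < k)}"

context moon_step
begin

text \<open>The measure counts the cells missing to the left of the rows. Rows of \<open>B\<close>
  stay and the others move left by one; there are others because the shape is not
  left-aligned.\<close>

lemma gap_less: "card (gap_set P') < card (gap_set P)"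
proof (rule psubset_card_mono)
  have "gap_set P \<subseteq> rows P \<times> cols P" by (auto simp: gap_set_def)
  then show "finite (gap_set P)" using fin finc by (meson finite_SigmaI finite_rows finite_subset)
  have sub: "gap_set P' \<subseteq> gap_set P"
  proof (clarsimp simp: gap_set_def rows_P' cols_P')
    fix i j k assume a: "\<forall>k. (i, k) \<in> P' \<longrightarrow> j < k" "(i, k) \<in> P"
    show "j < k"
    proof (cases "i \<in> B")
      case True
      then show ?thesis using a mem_P' by auto
    next
      case False
      then have "j < k - 1" using a mem_P'[of i "k - 1"] by auto
      then show ?thesis by simp
    qed
  qed
  obtain i where i: "i \<in> rows P" "i \<notin> B" using ex_outside by blast
  define m where "m = Min (row P i)"
  have m: "m \<in> row P i" "\<And>k. k \<in> row P i \<Longrightarrow> m \<le> k"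
  proof -
    have fr: "finite (row P i)" "row P i \<noteq> {}" using i fin by (auto simp: mem_rows)
    show "m \<in> row P i" "\<And>k. k \<in> row P i \<Longrightarrow> m \<le> k"
      unfolding m_def using Min_in[OF fr] Min_le[OF fr(1)] by blast+
  qed
  then have "l < m" "m \<le> z" using outside[of i m] i by auto
  then have "m - 1 \<in> cols P" using column_in[of "m - 1"] by (simp add: cols_iff)
  moreover have "m - 1 < k" if "(i, k) \<in> P" for k using m(2)[of k] that by simp
  ultimately have "(i, m - 1) \<in> gap_set P" using i by (auto simp: gap_set_def)
  moreover have "(i, m - 1) \<in> P'" using i m(1) by (simp add: mem_P')
  then have "(i, m - 1) \<notin> gap_set P'" by (auto simp: gap_set_def)
  ultimately show "gap_set P' \<subset> gap_set P" using sub by blast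
qed

end

lemma run_alpha_unfold:
  "run_alpha upd P x = (if left_aligned P then (P, x) else run_alpha upd (move_column P) (upd P x))"
  unfolding run_alpha_def by (subst while_unfold) simp

section \<open>Rearrangements of a rectangle that keep a subword\<close>

text \<open>What \<open>\<tau>\<close> and \<open>g\<close> have in common; the shift by one comes from the relabelling of the columns.\<close>

definition reshuffle :: "int \<Rightarrow> int \<Rightarrow> int set \<Rightarrow> (int \<Rightarrow> int) \<Rightarrow> (int \<Rightarrow> int) \<Rightarrow> bool" where
  "reshuffle l z Q w u \<longleftrightarrow> (\<forall>i\<in>Q. w i \<in> {l..z} \<and> u i \<in> {l..z})
     \<and> map w (sorted_list_of_set {i \<in> Q. w i \<noteq> l}) = map (\<lambda>i. u i + 1) (sorted_list_of_set {i \<in> Q. u i \<noteq> z})"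

lemma sorted_lists_iso:
  fixes A B :: "int set"
  assumes "finite A" "finite B" and eq: "map f (sorted_list_of_set A) = map g (sorted_list_of_set B)"
  shows "\<exists>\<theta>. bij_betw \<theta> A B \<and> (\<forall>i\<in>A. \<forall>j\<in>A. i < j \<longrightarrow> \<theta> i < \<theta> j) \<and> (\<forall>i\<in>A. g (\<theta> i) = f i)"
proof -
  let ?xs = "sorted_list_of_set A" and ?ys = "sorted_list_of_set B"
  have len: "length ?xs = length ?ys" using map_eq_imp_length_eq[OF eq] .
  define \<theta> where "\<theta> i = the (map_of (zip ?xs ?ys) i)" for i
  have th: "\<theta> (?xs ! k) = ?ys ! k" if "k < length ?xs" for k
    using that len by (simp add: \<theta>_def map_of_zip_nth)
  have xs: "\<exists>k<length ?xs. i = ?xs ! k" if "i \<in> A" for i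
    using that assms(1) by (metis in_set_conv_nth set_sorted_list_of_set)
  have mono: "\<theta> i < \<theta> j" if "i \<in> A" "j \<in> A" "i < j" for i j
  proof -
    obtain k where k: "k < length ?xs" "i = ?xs ! k" using xs[OF \<open>i \<in> A\<close>] by blast
    obtain m where m: "m < length ?xs" "j = ?xs ! m" using xs[OF \<open>j \<in> A\<close>] by blast
    have "sorted_wrt (<) ?xs" "sorted_wrt (<) ?ys" by simp_all
    have "k < m"
    proof (rule ccontr)
      assume "\<not> k < m"
      then have "?xs ! m \<le> ?xs ! k" using k by (auto intro: sorted_nth_mono)
      then show False using k m that by simp
    qed
    then have "?ys ! k < ?ys ! m"
      using m len \<open>sorted_wrt (<) ?ys\<close> by (auto simp: sorted_wrt_iff_nth_less)
    then show ?thesis using k m th by simp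
  qed
  have "\<theta> ` A = B"
  proof (intro equalityI subsetI)
    fix y assume "y \<in> \<theta> ` A"
    then obtain k where "k < length ?xs" "y = ?ys ! k" using xs th by force
    then show "y \<in> B" using len assms(2) by (metis nth_mem set_sorted_list_of_set)
  next
    fix y assume "y \<in> B"
    then obtain k where k: "k < length ?ys" "y = ?ys ! k" using assms(2) by (metis in_set_conv_nth set_sorted_list_of_set)
    then have "?xs ! k \<in> A" using len assms(1) by (metis nth_mem set_sorted_list_of_set)
    then show "y \<in> \<theta> ` A" using th k len by (metis image_eqI)
  qed
  moreover have "inj_on \<theta> A" using mono by (metis inj_onI linorder_neq_iff order_less_irrefl)
  moreover have "g (\<theta> i) = f i" if iA: "i \<in> A" for i
  proof -
    obtain k where k: "k < length ?xs" "i = ?xs ! k" using xs[OF iA] by blast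
    then show ?thesis using th eq len by (metis nth_map)
  qed
  ultimately show ?thesis using mono by (auto simp: bij_betw_def)
qed

lemma reshuffle_theta:
  assumes "finite Q" "reshuffle l z Q w u"
  obtains \<theta> where "bij_betw \<theta> {i \<in> Q. w i \<noteq> l} {i \<in> Q. u i \<noteq> z}"
    "\<And>i j. i \<in> Q \<Longrightarrow> w i \<noteq> l \<Longrightarrow> j \<in> Q \<Longrightarrow> w j \<noteq> l \<Longrightarrow> i < j \<Longrightarrow> \<theta> i < \<theta> j"
    "\<And>i. i \<in> Q \<Longrightarrow> w i \<noteq> l \<Longrightarrow> u (\<theta> i) = w i - 1"
proof -
  obtain \<theta> where "bij_betw \<theta> {i \<in> Q. w i \<noteq> l} {i \<in> Q. u i \<noteq> z}"
    "\<forall>i\<in>{i \<in> Q. w i \<noteq> l}. \<forall>j\<in>{i \<in> Q. w i \<noteq> l}. i < j \<longrightarrow> \<theta> i < \<theta> j"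
    "\<forall>i\<in>{i \<in> Q. w i \<noteq> l}. u (\<theta> i) + 1 = w i"
    using sorted_lists_iso[of "{i \<in> Q. w i \<noteq> l}" "{i \<in> Q. u i \<noteq> z}" w "\<lambda>i. u i + 1"] assms
    by (auto simp: reshuffle_def)
  then show ?thesis by (intro that[of \<theta>]) force+
qed

lemma reshuffle_card:
  assumes "finite Q" "reshuffle l z Q w u"
  shows "card {i \<in> Q. w i = l} = card {i \<in> Q. u i = z}"
proof -
  have "card {i \<in> Q. w i \<noteq> l} = card {i \<in> Q. u i \<noteq> z}"
    using assms map_eq_imp_length_eq unfolding reshuffle_def by fastforce
  moreover have *: "card Q = card {i \<in> Q. x i = a} + card {i \<in> Q. x i \<noteq> a}" for x :: "int \<Rightarrow> int" and a
  proof -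
    have "Q = {i \<in> Q. x i = a} \<union> {i \<in> Q. x i \<noteq> a}" by auto
    then show ?thesis using card_Un_disjoint[of "{i \<in> Q. x i = a}" "{i \<in> Q. x i \<noteq> a}"] assms(1) by force
  qed
  ultimately show ?thesis using *[of w l] *[of u z] by linarith
qed

lemma reshuffle_counts:
  assumes "finite Q" "reshuffle l z Q w u" "l \<le> j" "j < z"
  shows "card {i \<in> Q. u i = j} = card {i \<in> Q. w i = j + 1}"
proof -
  obtain \<theta> where th: "bij_betw \<theta> {i \<in> Q. w i \<noteq> l} {i \<in> Q. u i \<noteq> z}"
    "\<And>i j. i \<in> Q \<Longrightarrow> w i \<noteq> l \<Longrightarrow> j \<in> Q \<Longrightarrow> w j \<noteq> l \<Longrightarrow> i < j \<Longrightarrow> \<theta> i < \<theta> j"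
    "\<And>i. i \<in> Q \<Longrightarrow> w i \<noteq> l \<Longrightarrow> u (\<theta> i) = w i - 1"
    by (rule reshuffle_theta[OF assms(1,2)], rule that; blast)
  have "bij_betw \<theta> {i \<in> Q. w i = j + 1} {i \<in> Q. u i = j}"
    unfolding bij_betw_def
  proof
    show "inj_on \<theta> {i \<in> Q. w i = j + 1}"
      using th(1) by (rule inj_on_subset[OF bij_betw_imp_inj_on]) (use assms in auto)
    show "\<theta> ` {i \<in> Q. w i = j + 1} = {i \<in> Q. u i = j}"
    proof (intro equalityI subsetI)
      fix y assume "y \<in> \<theta> ` {i \<in> Q. w i = j + 1}"
      then obtain i where i: "y = \<theta> i" "i \<in> Q" "w i = j + 1" by blast
      then have "y \<in> {i \<in> Q. u i \<noteq> z}" using bij_betwE[OF th(1)] assms by auto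
      then show "y \<in> {i \<in> Q. u i = j}" using i th(3)[of i] assms by auto
    next
      fix y assume y: "y \<in> {i \<in> Q. u i = j}"
      then have "y \<in> {i \<in> Q. u i \<noteq> z}" using assms by auto
      then obtain i where i: "i \<in> Q" "w i \<noteq> l" "y = \<theta> i" using th(1) unfolding bij_betw_def by blast
      then show "y \<in> \<theta> ` {i \<in> Q. w i = j + 1}" using th(3)[of i] y by auto
    qed
  qed
  then have "card {i \<in> Q. w i = j + 1} = card {i \<in> Q. u i = j}" by (rule bij_betw_same_card)
  then show ?thesis by simp
qed

text \<open>All entries in the relevant columns are in rows of \<open>D\<close> and
  \<open>D'\<close>, so the order isomorphism between these rows finds the same first entry.\<close>

lemma starts_descent_transfer:
  assumes bij: "bij_betw \<Theta> D D'" and D: "D \<subseteq> W" "D' \<subseteq> W'"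
    and mono: "\<And>i j. i \<in> D \<Longrightarrow> j \<in> D \<Longrightarrow> \<Theta> i < \<Theta> j \<longleftrightarrow> i < j"
    and w': "\<And>i. i \<in> D \<Longrightarrow> w' (\<Theta> i) = w i - 1"
    and J: "\<And>i. i \<in> W \<Longrightarrow> w i \<in> J \<Longrightarrow> i \<in> D" "\<And>i. i \<in> W' \<Longrightarrow> w' i \<in> J' \<Longrightarrow> i \<in> D'"
      "\<And>i. i \<in> D \<Longrightarrow> w i \<in> J \<longleftrightarrow> w i - 1 \<in> J'"
    and r: "r \<in> D"
  shows "starts_descent W w J r \<longleftrightarrow> starts_descent W' w' J' (\<Theta> r)"
proof -
  have D': "i \<in> D \<Longrightarrow> \<Theta> i \<in> D'" "y \<in> D' \<Longrightarrow> \<exists>i\<in>D. y = \<Theta> i" for i y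
    using bij unfolding bij_betw_def by blast+
  have none: "(\<forall>x\<in>W. r < x \<and> x < d \<longrightarrow> w x \<notin> J) \<longleftrightarrow> (\<forall>x\<in>W'. \<Theta> r < x \<and> x < \<Theta> d \<longrightarrow> w' x \<notin> J')" if d: "d \<in> D" for d
  proof (intro iffI ballI impI notI)
    fix x assume "\<forall>x\<in>W. r < x \<and> x < d \<longrightarrow> w x \<notin> J" "x \<in> W'" "\<Theta> r < x \<and> x < \<Theta> d" "w' x \<in> J'"
    moreover from this obtain y where "y \<in> D" "x = \<Theta> y" using J(2) D' by blast
    ultimately show False using mono[OF r] mono[OF _ d] w' J(3) D by auto
  next
    fix x assume a: "\<forall>x\<in>W'. \<Theta> r < x \<and> x < \<Theta> d \<longrightarrow> w' x \<notin> J'" "x \<in> W" "r < x \<and> x < d" "w x \<in> J"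
    then have x: "x \<in> D" using J(1) by blast
    then have "\<Theta> x \<in> W'" "\<Theta> r < \<Theta> x \<and> \<Theta> x < \<Theta> d" "w' (\<Theta> x) \<in> J'"
      using D' D(2) mono[OF r x] mono[OF x d] a w' J(3) by auto
    then show False using a by blast
  qed
  show ?thesis
  proof
    assume "starts_descent W w J r"
    then obtain d where d: "d \<in> W" "r < d" "w d \<in> J" "w d < w r" "\<forall>x\<in>W. r < x \<and> x < d \<longrightarrow> w x \<notin> J"
      unfolding starts_descent_def by blast
    then have dD: "d \<in> D" using J(1) by blast
    show "starts_descent W' w' J' (\<Theta> r)" unfolding starts_descent_def
      by (rule bexI[of _ "\<Theta> d"]) (use d dD none[OF dD] mono[OF r dD] w' J(3) r D' D in auto)
  next
    assume "starts_descent W' w' J' (\<Theta> r)"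
    then obtain d' where d': "d' \<in> W'" "\<Theta> r < d'" "w' d' \<in> J'" "w' d' < w' (\<Theta> r)"
      "\<forall>x\<in>W'. \<Theta> r < x \<and> x < d' \<longrightarrow> w' x \<notin> J'"
      unfolding starts_descent_def by blast
    then obtain d where dD: "d \<in> D" "d' = \<Theta> d" using J(2) D' by blast
    show "starts_descent W w J r" unfolding starts_descent_def
      by (rule bexI[of _ d]) (use d' dD none[OF dD(1)] mono[OF r dD(1)] w' J(3) r D in auto)
  qed
qed

section \<open>Rows and pairs of rows under one step\<close>

locale moon_shuf = moon_step +
  fixes W :: "int set" and w u :: "int \<Rightarrow> int"
  assumes WP: "\<And>i. i \<in> W \<Longrightarrow> (i, w i) \<in> P"
    and sh: "reshuffle l z {i \<in> W. i \<in> B \<and> w i \<le> z} w u"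
begin

definition Q where "Q = {i \<in> W. i \<in> B \<and> w i \<le> z}"

text \<open>A row of \<open>B\<close> outside \<open>Q\<close> has its 1-cell to the right of z,
  where columns keep their labels. A row outside \<open>B\<close> has it in the columns l + 1 to z,
  which are relabelled.\<close>

definition w' where "w' i = (if i \<in> Q then u i else if i \<in> B then w i else w i - 1)"

lemma finW: "finite W"
proof (rule finite_subset)
  show "W \<subseteq> rows P" using WP mem_rows by blast
qed (use fin in auto)

lemma finQ: "finite Q" using finW by (simp add: Q_def)

lemma shQ: "reshuffle l z Q w u" using sh by (simp add: Q_def)

lemma Q_sub: "i \<in> Q \<Longrightarrow> i \<in> W \<and> i \<in> B \<and> l \<le> w i \<and> w i \<le> z"
  using WP l_le by (auto simp: Q_def)

lemma uQ: "i \<in> Q \<Longrightarrow> l \<le> u i \<and> u i \<le> z"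
  using shQ by (auto simp: reshuffle_def)

lemma not_Q: "i \<in> W \<Longrightarrow> i \<in> B \<Longrightarrow> i \<notin> Q \<Longrightarrow> z < w i"
  by (auto simp: Q_def)

lemma not_B: "i \<in> W \<Longrightarrow> i \<notin> B \<Longrightarrow> l < w i \<and> w i \<le> z"
  using outside WP by blast

lemma w'_Q: "i \<in> Q \<Longrightarrow> w' i = u i" by (simp add: w'_def)
lemma w'_B: "i \<in> B \<Longrightarrow> i \<notin> Q \<Longrightarrow> w' i = w i" by (simp add: w'_def)
lemma w'_out: "i \<notin> B \<Longrightarrow> w' i = w i - 1" using Q_sub by (auto simp: w'_def)

lemma w'P': "i \<in> W \<Longrightarrow> (i, w' i) \<in> P'"
  using in_rect[of i "u i"] uQ[of i] WP[of i] w'_out[of i] w'_Q[of i] w'_B[of i] Q_sub[of i] unfolding mem_P'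
  by (cases "i \<in> Q"; cases "i \<in> B") auto

lemma counts_w':
  "l \<le> j \<Longrightarrow> j < z \<Longrightarrow> counts W w' j = counts W w (j + 1)"
  "counts W w' z = counts W w l"
  "z < j \<Longrightarrow> counts W w' j = counts W w j"
proof -
  assume j: "l \<le> j" "j < z"
  have "{i \<in> W. w' i = j} = {i \<in> Q. u i = j} \<union> {i \<in> W - B. w i = j + 1}"
    using j Q_sub not_Q by (force simp: w'_def)
  moreover have "{i \<in> W. w i = j + 1} = {i \<in> Q. w i = j + 1} \<union> {i \<in> W - B. w i = j + 1}"
    using j by (auto simp: Q_def)
  moreover have "card ({i \<in> Q. u i = j} \<union> {i \<in> W - B. w i = j + 1})
    = card {i \<in> Q. u i = j} + card {i \<in> W - B. w i = j + 1}"
    by (rule card_Un_disjoint) (use finQ finW Q_sub in auto)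
  moreover have "card ({i \<in> Q. w i = j + 1} \<union> {i \<in> W - B. w i = j + 1})
    = card {i \<in> Q. w i = j + 1} + card {i \<in> W - B. w i = j + 1}"
    by (rule card_Un_disjoint) (use finQ finW Q_sub in auto)
  ultimately show "counts W w' j = counts W w (j + 1)"
    using reshuffle_counts[OF finQ shQ j] by (simp add: counts_def)
next
  have "{i \<in> W. w' i = z} = {i \<in> Q. u i = z}"
  proof (intro set_eqI iffI)
    fix i assume i: "i \<in> {i \<in> W. w' i = z}"
    then show "i \<in> {i \<in> Q. u i = z}"
      using not_Q[of i] not_B[of i] w'_out[of i] w'_Q[of i] w'_B[of i] by (cases "i \<in> Q"; cases "i \<in> B") auto
  qed (use Q_sub w'_Q in auto)
  moreover have "{i \<in> W. w i = l} = {i \<in> Q. w i = l}"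
    using not_Q not_B Q_sub l_le_z by force
  ultimately show "counts W w' z = counts W w l" using reshuffle_card[OF finQ shQ] by (simp add: counts_def)
next
  assume j: "z < j"
  have "{i \<in> W. w' i = j} = {i \<in> W. w i = j}"
  proof (intro set_eqI iffI)
    fix i assume i: "i \<in> {i \<in> W. w' i = j}"
    then show "i \<in> {i \<in> W. w i = j}"
      using not_Q[of i] not_B[of i] w'_out[of i] w'_Q[of i] w'_B[of i] uQ[of i] j by (cases "i \<in> Q"; cases "i \<in> B") auto
  next
    fix i assume i: "i \<in> {i \<in> W. w i = j}"
    then show "i \<in> {i \<in> W. w' i = j}"
      using not_B[of i] w'_B[of i] Q_sub[of i] j by (cases "i \<in> Q"; cases "i \<in> B") auto
  qed
  then show "counts W w' j = counts W w j" by (simp add: counts_def)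
qed

lemma M_Int: "graph W w \<inter> lead_rect P = graph Q w"
  unfolding lead_rect_eq using l_le[OF WP] by (auto simp: Q_def)

lemma replace_eq:
  assumes "T l z (graph Q w) = graph Q u"
  shows "replace_rect T P (graph W w) = graph W w'"
proof -
  have "move_cell l z ` (graph W w - lead_rect P) = graph (W - Q) w'"
  proof -
    have "(i, w i) \<in> lead_rect P \<longleftrightarrow> i \<in> Q" if "i \<in> W" for i
      using l_le[OF WP[OF that]] that by (simp add: lead_rect_eq Q_def)
    then have "graph W w - lead_rect P = graph (W - Q) w" by (auto simp: graph_def)
    moreover have "move_cell l z (i, w i) = (i, w' i)" if "i \<in> W - Q" for i
      using that not_Q[of i] not_B[of i] w'_out[of i] w'_B[of i] l_le_z by (cases "i \<in> B") (auto simp: move_cell_def)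
    ultimately show ?thesis by (simp add: graph_def image_image)
  qed
  moreover have "graph W w' = graph (W - Q) w' \<union> graph Q u"
    using Q_sub w'_Q by (auto simp: graph_def)
  ultimately show ?thesis
    unfolding replace_rect_def Let_def l_def[symmetric] last_col_eq M_Int assms by simp
qed

text \<open>The rows of the kept entries, inside and outside the leading rectangle;
  \<open>Dm'\<close> is the same after the step.\<close>

definition Dm where "Dm = {i \<in> W. l < w i \<and> w i \<le> z}"
definition Dm' where "Dm' = {i \<in> W. l \<le> w' i \<and> w' i < z}"

text \<open>Inside the rectangle this is the bijection given by \<open>reshuffle\<close>, outside
  \<open>B\<close> the identity. It is monotone because \<open>B\<close> is an interval: rows of
  \<open>B\<close> go to rows of \<open>B\<close>, so they stay on the same side of every other
  row.\<close>

lemma Theta_ex: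
  "\<exists>\<Theta>. bij_betw \<Theta> Dm Dm' \<and> (\<forall>i\<in>Dm. \<forall>j\<in>Dm. \<Theta> i < \<Theta> j \<longleftrightarrow> i < j)
    \<and> (\<forall>i\<in>Dm. w' (\<Theta> i) = w i - 1) \<and> (\<forall>i\<in>Dm. \<Theta> i \<in> B \<longleftrightarrow> i \<in> B) \<and> (\<forall>i. i \<notin> B \<longrightarrow> \<Theta> i = i)"
proof -
  obtain \<theta> where th: "bij_betw \<theta> {i \<in> Q. w i \<noteq> l} {i \<in> Q. u i \<noteq> z}"
    "\<And>i j. i \<in> Q \<Longrightarrow> w i \<noteq> l \<Longrightarrow> j \<in> Q \<Longrightarrow> w j \<noteq> l \<Longrightarrow> i < j \<Longrightarrow> \<theta> i < \<theta> j"
    "\<And>i. i \<in> Q \<Longrightarrow> w i \<noteq> l \<Longrightarrow> u (\<theta> i) = w i - 1"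
    by (rule reshuffle_theta[OF finQ shQ], rule that; blast)
  define \<Theta> where "\<Theta> i = (if i \<in> Q then \<theta> i else i)" for i
  have Dm_iff: "i \<in> Dm \<longleftrightarrow> (i \<in> Q \<and> w i \<noteq> l) \<or> (i \<in> W \<and> i \<notin> B)" for i
    using Q_sub[of i] not_Q[of i] not_B[of i] by (cases "i \<in> Q"; cases "i \<in> B") (auto simp: Dm_def)
  have Dm'_iff: "i \<in> Dm' \<longleftrightarrow> (i \<in> Q \<and> u i \<noteq> z) \<or> (i \<in> W \<and> i \<notin> B)" for i
    using Q_sub[of i] not_Q[of i] not_B[of i] uQ[of i] w'_out[of i] w'_Q[of i] w'_B[of i]
    by (cases "i \<in> Q"; cases "i \<in> B") (auto simp: Dm'_def)
  have thQ: "\<theta> i \<in> Q" "u (\<theta> i) \<noteq> z" if "i \<in> Q" "w i \<noteq> l" for i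
    using bij_betwE[OF th(1)] that by auto
  have inB: "\<Theta> i \<in> B \<longleftrightarrow> i \<in> B" if "i \<in> Dm" for i
    using that thQ[of i] Q_sub[of "\<theta> i"] Q_sub[of i] unfolding Dm_iff \<Theta>_def by auto
  have less: "\<Theta> i < \<Theta> j" if ij: "i \<in> Dm" "j \<in> Dm" "i < j" for i j
  proof -
    consider "i \<in> Q" "j \<in> Q" | "i \<in> Q" "j \<notin> Q" | "i \<notin> Q" "j \<in> Q" | "i \<notin> Q" "j \<notin> Q" by blast
    then show ?thesis
    proof cases
      case 1
      then show ?thesis using ij Q_sub th(2)[of i j] by (auto simp: \<Theta>_def Dm_iff)
    next
      case 2
      then have j: "j \<notin> B" and i: "w i \<noteq> l" using ij Q_sub by (auto simp: Dm_iff)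
      show ?thesis
      proof (rule ccontr)
        assume "\<not> \<Theta> i < \<Theta> j"
        then have "j \<le> \<theta> i" using 2 by (simp add: \<Theta>_def)
        then show False using B_convex[of i "\<theta> i" j] thQ[OF 2(1) i] Q_sub 2 ij j by auto
      qed
    next
      case 3
      then have i: "i \<notin> B" and j: "w j \<noteq> l" using ij Q_sub by (auto simp: Dm_iff)
      show ?thesis
      proof (rule ccontr)
        assume "\<not> \<Theta> i < \<Theta> j"
        then have "\<theta> j \<le> i" using 3 by (simp add: \<Theta>_def)
        then show False using B_convex[of "\<theta> j" j i] thQ[OF 3(2) j] Q_sub 3 ij i by auto
      qed
    qed (use ij in \<open>simp add: \<Theta>_def\<close>)
  qed
  have mono: "\<Theta> i < \<Theta> j \<longleftrightarrow> i < j" if "i \<in> Dm" "j \<in> Dm" for i j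
    using less[of i j] less[of j i] that by (cases i j rule: linorder_cases) auto
  have "\<Theta> ` Dm = Dm'"
  proof (intro equalityI subsetI)
    fix y assume "y \<in> \<Theta> ` Dm"
    then show "y \<in> Dm'" using thQ Q_sub by (auto simp: \<Theta>_def Dm_iff Dm'_iff)
  next
    fix y assume y: "y \<in> Dm'"
    show "y \<in> \<Theta> ` Dm"
    proof (cases "y \<in> B")
      case True
      then have "y \<in> {i \<in> Q. u i \<noteq> z}" using y by (auto simp: Dm'_iff)
      then obtain i where "i \<in> Q" "w i \<noteq> l" "y = \<theta> i" using th(1) unfolding bij_betw_def by blast
      then show ?thesis by (intro image_eqI[of _ _ i]) (auto simp: \<Theta>_def Dm_iff)
    next
      case False
      then show ?thesis using y Q_sub by (intro image_eqI[of _ _ y]) (auto simp: \<Theta>_def Dm_iff Dm'_iff)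
    qed
  qed
  moreover have "inj_on \<Theta> Dm" using less by (metis inj_onI linorder_neq_iff order_less_irrefl)
  moreover have "w' (\<Theta> i) = w i - 1" if "i \<in> Dm" for i
    using that th(3)[of i] thQ[of i] w'_Q[of "\<theta> i"] w'_out[of i] by (auto simp: Dm_iff \<Theta>_def dest: Q_sub)
  moreover have "\<Theta> i = i" if "i \<notin> B" for i using that Q_sub by (auto simp: \<Theta>_def)
  ultimately show ?thesis using mono inB unfolding bij_betw_def by (intro exI[of _ \<Theta>]) blast
qed

definition \<Theta> where "\<Theta> = (SOME t. bij_betw t Dm Dm' \<and> (\<forall>i\<in>Dm. \<forall>j\<in>Dm. t i < t j \<longleftrightarrow> i < j)
    \<and> (\<forall>i\<in>Dm. w' (t i) = w i - 1) \<and> (\<forall>i\<in>Dm. t i \<in> B \<longleftrightarrow> i \<in> B) \<and> (\<forall>i. i \<notin> B \<longrightarrow> t i = i))"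

lemma Theta:
  "bij_betw \<Theta> Dm Dm'" "\<And>i j. i \<in> Dm \<Longrightarrow> j \<in> Dm \<Longrightarrow> \<Theta> i < \<Theta> j \<longleftrightarrow> i < j"
  "\<And>i. i \<in> Dm \<Longrightarrow> w' (\<Theta> i) = w i - 1" "\<And>i. i \<in> Dm \<Longrightarrow> \<Theta> i \<in> B \<longleftrightarrow> i \<in> B"
  "\<And>i. i \<notin> B \<Longrightarrow> \<Theta> i = i"
  using someI_ex[OF Theta_ex] unfolding \<Theta>_def[symmetric] by blast+

text \<open>By the corner conditions both entries lie in columns of the row outside
  \<open>B\<close>, and these are among l + 1 to z.\<close>

lemma pair_Dm:
  assumes "r \<in> W" "e \<in> W" "(e, w r) \<in> P" "(r, w e) \<in> P" "\<not> (r \<in> B \<and> e \<in> B)"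
  shows "r \<in> Dm \<and> e \<in> Dm"
proof -
  have "l < w r \<and> w r \<le> z" "l < w e \<and> w e \<le> z"
    using assms outside[of e "w r"] outside[of r "w e"] not_B by blast+
  then show ?thesis using assms by (simp add: Dm_def)
qed

lemma pair_Dm':
  assumes "r \<in> W" "e \<in> W" "(e, w' r) \<in> P'" "(r, w' e) \<in> P'" "\<not> (r \<in> B \<and> e \<in> B)"
  shows "r \<in> Dm' \<and> e \<in> Dm'"
proof -
  have *: "l \<le> j \<and> j < z" if "(i, j) \<in> P'" "i \<notin> B" for i j using that outside[of i "j + 1"] by (simp add: mem_P')
  have "l \<le> w' r \<and> w' r < z" "l \<le> w' e \<and> w' e < z"
    using assms *[of e "w' r"] *[of r "w' e"] *[OF w'P'] by blast+
  then show ?thesis using assms by (simp add: Dm'_def)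
qed

lemma shift:
  assumes "i \<in> Dm" "l < a" "a \<le> z"
  shows "(\<Theta> i, a - 1) \<in> P' \<longleftrightarrow> (i, a) \<in> P"
proof (cases "i \<in> B")
  case True
  then show ?thesis
    using assms Theta(4)[of i] in_rect[of i a] in_rect[of "\<Theta> i" "a - 1"] by (simp add: mem_P')
next
  case False
  then show ?thesis using Theta(5)[of i] by (simp add: mem_P')
qed

lemma Theta_mem: "i \<in> Dm \<Longrightarrow> \<Theta> i \<in> Dm'" "y \<in> Dm' \<Longrightarrow> \<exists>i\<in>Dm. y = \<Theta> i"
  using Theta(1) unfolding bij_betw_def by blast+

text \<open>The common scheme for ne and maj, with \<open>C\<close> and \<open>C'\<close> as the
  condition that distinguishes them. Pairs with a row outside \<open>B\<close> correspond under
  \<open>\<Theta>\<close>; pairs inside \<open>B\<close> are left to the assumption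
  \<open>BB\<close>.\<close>

lemma pair_bij:
  assumes C: "\<And>r e. r \<in> Dm \<Longrightarrow> e \<in> Dm \<Longrightarrow> \<not> (r \<in> B \<and> e \<in> B) \<Longrightarrow> C r e \<longleftrightarrow> C' (\<Theta> r) (\<Theta> e)"
    and S: "S = {(r, e). r \<in> W \<and> e \<in> W \<and> r < e \<and> (e, w r) \<in> P \<and> (r, w e) \<in> P \<and> C r e}"
    and S': "S' = {(r, e). r \<in> W \<and> e \<in> W \<and> r < e \<and> (e, w' r) \<in> P' \<and> (r, w' e) \<in> P' \<and> C' r e}"
    and BB: "card (S \<inter> B \<times> B) = card (S' \<inter> B \<times> B)"
  shows "card S = card S'"
proof -
  have mem: "(r, e) \<in> S \<longleftrightarrow> (\<Theta> r, \<Theta> e) \<in> S'" if "r \<in> Dm" "e \<in> Dm" "\<not> (r \<in> B \<and> e \<in> B)" for r e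
  proof -
    have "r \<in> W" "e \<in> W" "\<Theta> r \<in> W" "\<Theta> e \<in> W" "l < w r" "w r \<le> z" "l < w e" "w e \<le> z"
      using that Theta_mem(1)[of r] Theta_mem(1)[of e] by (auto simp: Dm_def Dm'_def)
    then show ?thesis
      using shift[of e "w r"] shift[of r "w e"] Theta(2,3) C that by (simp add: S S')
  qed
  have "bij_betw (map_prod \<Theta> \<Theta>) (S - B \<times> B) (S' - B \<times> B)"
    unfolding bij_betw_def
  proof
    have in_Dm: "r \<in> Dm" "e \<in> Dm" if "(r, e) \<in> S - B \<times> B" for r e
      using pair_Dm[of r e] that by (auto simp: S)
    have "inj_on (map_prod \<Theta> \<Theta>) (Dm \<times> Dm)"
      using Theta(1) by (intro map_prod_inj_on) (auto simp: bij_betw_def)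
    then show "inj_on (map_prod \<Theta> \<Theta>) (S - B \<times> B)"
      by (rule inj_on_subset) (use in_Dm in force)
    show "map_prod \<Theta> \<Theta> ` (S - B \<times> B) = S' - B \<times> B"
    proof (intro equalityI subsetI)
      fix t assume "t \<in> map_prod \<Theta> \<Theta> ` (S - B \<times> B)"
      then obtain r e where re: "t = (\<Theta> r, \<Theta> e)" "(r, e) \<in> S" "\<not> (r \<in> B \<and> e \<in> B)" by auto
      then have "r \<in> Dm" "e \<in> Dm" using in_Dm by auto
      then show "t \<in> S' - B \<times> B" using re mem[of r e] Theta(4) by auto
    next
      fix t assume t: "t \<in> S' - B \<times> B"
      obtain r' e' where t': "t = (r', e')" by (cases t)
      then have "r' \<in> Dm'" "e' \<in> Dm'" using pair_Dm'[of r' e'] t by (auto simp: S')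
      then obtain r e where re: "r \<in> Dm" "e \<in> Dm" "r' = \<Theta> r" "e' = \<Theta> e" using Theta_mem(2) by blast
      then have "\<not> (r \<in> B \<and> e \<in> B)" using t t' Theta(4) by auto
      then have "(r, e) \<in> S - B \<times> B" using mem[of r e] t t' re by auto
      then show "t \<in> map_prod \<Theta> \<Theta> ` (S - B \<times> B)" using t' re by (metis image_eqI map_prod_simp)
    qed
  qed
  then have eq: "card (S - B \<times> B) = card (S' - B \<times> B)" by (rule bij_betw_same_card)
  have "S \<subseteq> W \<times> W" "S' \<subseteq> W \<times> W" by (auto simp: S S')
  then have "finite S" "finite S'" using finW by (meson finite_SigmaI finite_subset)+
  then have "card X = card (X \<inter> B \<times> B) + card (X - B \<times> B)" if "X = S \<or> X = S'" for X
    using that card_Int_Diff[of X "B \<times> B"] by blast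
  then show ?thesis using eq BB by metis
qed

text \<open>The columns l to z contain \<open>B\<close>, so moving an entry among them does not
  affect corners in rows of \<open>B\<close>.\<close>

lemma rect_iff:
  assumes "i \<in> W" "i \<in> B" "x \<in> B"
  shows "(x, w' i) \<in> P \<longleftrightarrow> (x, w i) \<in> P"
  using in_rect[OF assms(3), of "u i"] in_rect[OF assms(3), of "w i"] uQ[of i] Q_sub[of i] w'_Q[of i] w'_B[of i] assms
  by (cases "i \<in> Q") auto

lemma row_P'_B: "i \<in> B \<Longrightarrow> row P' i = row P i"
  by (auto simp: mem_P')

text \<open>Inside \<open>B\<close>: an entry smaller than one of the rectangle is in the rectangle
  too, so these pairs are the inversions of \<open>Q\<close>. If the upper entry is to the right of
  z, it exceeds all entries of the rectangle before and after, and the set \<open>Y\<close> of such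
  pairs stays the same.\<close>

lemma card_nep_eq:
  assumes inv: "card {(r, e) \<in> Q \<times> Q. r < e \<and> w e < w r} = card {(r, e) \<in> Q \<times> Q. r < e \<and> u e < u r}"
  shows "card (ne_pairs P W w) = card (ne_pairs P' W w')"
proof (rule pair_bij[of "\<lambda>r e. w e < w r" "\<lambda>r e. w' e < w' r"])
  let ?X = "{(r, e) \<in> Q \<times> Q. r < e \<and> w e < w r}" and ?X' = "{(r, e) \<in> Q \<times> Q. r < e \<and> u e < u r}"
  define Y where "Y = {(r, e). r \<in> W \<and> e \<in> W \<and> r \<in> B \<and> e \<in> B \<and> r \<notin> Q \<and> r < e \<and> (e, w r) \<in> P \<and> (r, w e) \<in> P \<and> w e < w r}"
  have finY: "finite Y" by (rule finite_subset[of _ "W \<times> W"]) (use finW in \<open>auto simp: Y_def\<close>)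
  have eQ: "e \<in> Q" if "e \<in> W" "e \<in> B" "w e < w r \<or> w' e < w' r" "r \<in> Q" for e r
    using that not_Q[of e] Q_sub[of r] uQ[of r] w'_Q[of r] w'_B[of e] by fastforce
  have X: "ne_pairs P W w \<inter> B \<times> B = ?X \<union> Y"
  proof (intro set_eqI iffI)
    fix t assume t: "t \<in> ne_pairs P W w \<inter> B \<times> B"
    then show "t \<in> ?X \<union> Y" using eQ by (cases "fst t \<in> Q") (auto simp: ne_pairs_def Y_def)
  next
    fix t assume "t \<in> ?X \<union> Y"
    then show "t \<in> ne_pairs P W w \<inter> B \<times> B"
      using Q_sub in_rect by (auto simp: ne_pairs_def Y_def)
  qed
  have X': "ne_pairs P' W w' \<inter> B \<times> B = ?X' \<union> Y"
  proof (intro set_eqI iffI)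
    fix t assume t: "t \<in> ne_pairs P' W w' \<inter> B \<times> B"
    obtain r e where re: "t = (r, e)" by (cases t)
    have h: "r \<in> W" "e \<in> W" "r \<in> B" "e \<in> B" "r < e" "w' e < w' r" "(e, w r) \<in> P" "(r, w e) \<in> P"
      using t re rect_iff by (auto simp: ne_pairs_def mem_P')
    show "t \<in> ?X' \<union> Y"
    proof (cases "r \<in> Q")
      case True
      then show ?thesis using h eQ[of e r] re w'_Q by auto
    next
      case False
      then have "w e < w r" using h not_Q[of r] w'_B[of r] w'_B[of e] Q_sub[of e] by (cases "e \<in> Q") auto
      then show ?thesis using h False re by (auto simp: Y_def)
    qed
  next
    fix t assume t: "t \<in> ?X' \<union> Y"
    obtain r e where re: "t = (r, e)" by (cases t)
    show "t \<in> ne_pairs P' W w' \<inter> B \<times> B"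
    proof (cases "t \<in> ?X'")
      case True
      then show ?thesis using re Q_sub uQ w'_Q in_rect by (auto simp: ne_pairs_def mem_P')
    next
      case False
      then have h: "r \<in> W" "e \<in> W" "r \<in> B" "e \<in> B" "r \<notin> Q" "r < e" "(e, w r) \<in> P" "(r, w e) \<in> P" "w e < w r"
        using t re by (auto simp: Y_def)
      have "w' e < w' r" using h not_Q[of r] w'_B[of r] w'_B[of e] w'_Q[of e] uQ[of e] by (cases "e \<in> Q") auto
      then show ?thesis using h re rect_iff by (auto simp: ne_pairs_def mem_P')
    qed
  qed
  have fin: "finite ?X" "finite ?X'" by (rule finite_subset[of _ "Q \<times> Q"]; use finQ in auto)+
  have "card (?X \<union> Y) = card ?X + card Y" "card (?X' \<union> Y) = card ?X' + card Y"
    by (rule card_Un_disjoint; use fin finY in \<open>auto simp: Y_def\<close>)+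
  then show "card (ne_pairs P W w \<inter> B \<times> B) = card (ne_pairs P' W w' \<inter> B \<times> B)" unfolding X X' using inv by simp
next
  show "w e < w r \<longleftrightarrow> w' (\<Theta> e) < w' (\<Theta> r)" if "r \<in> Dm" "e \<in> Dm" for r e
    using Theta(3) that by simp
qed (auto simp: ne_pairs_def)

text \<open>Used in both directions between \<open>w\<close> and \<open>w'\<close>. The first row d
  with an entry in \<open>J\<close> is not below e, so all rows that matter lie in the interval
  \<open>B\<close>.\<close>

lemma starts_descent_local:
  assumes "r \<in> B" "e \<in> B" "e \<in> W" "r < e" "x e \<in> J"
    and J: "\<And>i. i \<in> W \<Longrightarrow> i \<in> B \<Longrightarrow> y i \<in> J \<longleftrightarrow> x i \<in> J"
    and cmp: "\<And>d. d \<in> W \<Longrightarrow> d \<in> B \<Longrightarrow> r < d \<Longrightarrow> x d \<in> J \<Longrightarrow> (\<And>i. i \<in> W \<Longrightarrow> r < i \<Longrightarrow> i < d \<Longrightarrow> x i \<notin> J) \<Longrightarrow> x d < x r \<Longrightarrow> y d < y r"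
    and starts_descent: "starts_descent W x J r"
  shows "starts_descent W y J r"
proof -
  obtain d where d: "d \<in> W" "r < d" "x d \<in> J" "x d < x r" "\<forall>i\<in>W. r < i \<and> i < d \<longrightarrow> x i \<notin> J"
    using starts_descent unfolding starts_descent_def by blast
  have "d \<le> e" using d(5) assms(3-5) by force
  then have inB: "i \<in> B" if "r < i" "i \<le> d" for i using B_convex[OF assms(1,2), of i] that by simp
  have "y d < y r" using cmp[of d] d inB by auto
  moreover have "y d \<in> J" using J[of d] d inB by auto
  moreover have "y i \<notin> J" if "i \<in> W" "r < i" "i < d" for i using J[of i] d that inB[of i] by auto
  ultimately show ?thesis unfolding starts_descent_def using d by blast
qed

text \<open>For two rows of \<open>B\<close> the common columns include l to z, so no row of
  \<open>Q\<close> lies strictly between r and the next entry in these columns. If both ends are in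
  \<open>Q\<close>, they are neighbours there and the hypothesis applies; otherwise an entry to the
  right of z is involved and the comparison does not change.\<close>

lemma card_majp_eq:
  assumes des: "\<And>r d. r \<in> Q \<Longrightarrow> d \<in> Q \<Longrightarrow> r < d \<Longrightarrow> (\<And>x. x \<in> Q \<Longrightarrow> \<not> (r < x \<and> x < d)) \<Longrightarrow> w d < w r \<longleftrightarrow> u d < u r"
  shows "card (maj_pairs P W w) = card (maj_pairs P' W w')"
proof (rule pair_bij[of "\<lambda>r e. starts_descent W w (row P r \<inter> row P e) r" "\<lambda>r e. starts_descent W w' (row P' r \<inter> row P' e) r"])
  have starts_descent: "starts_descent W w (row P r \<inter> row P e) r \<longleftrightarrow> starts_descent W w' (row P r \<inter> row P e) r"
    if re: "r \<in> W" "e \<in> W" "r \<in> B" "e \<in> B" "r < e" "(r, w e) \<in> P" for r e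
  proof -
    let ?J = "row P r \<inter> row P e"
    have J: "w' i \<in> ?J \<longleftrightarrow> w i \<in> ?J" if "i \<in> W" "i \<in> B" for i
      using rect_iff[OF that] re by simp
    have e: "w e \<in> ?J" using re WP by simp
    have QJ: "w i \<in> ?J" if "i \<in> Q" for i using Q_sub[OF that] in_rect re by simp
    have cmp: "w d < w r \<longleftrightarrow> w' d < w' r"
      if d: "d \<in> W" "d \<in> B" "r < d" "\<And>i. i \<in> W \<Longrightarrow> r < i \<Longrightarrow> i < d \<Longrightarrow> w i \<notin> ?J" for d
    proof (cases "r \<in> Q \<and> d \<in> Q")
      case True
      have "\<not> (r < x \<and> x < d)" if "x \<in> Q" for x using d(4)[of x] QJ[OF that] Q_sub[OF that] by blast
      then have "w d < w r \<longleftrightarrow> u d < u r" using True d(3) by (intro des) auto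
      then show ?thesis using True w'_Q by simp
    next
      case False
      then show ?thesis
        using not_Q[of r] not_Q[of d] Q_sub[of r] Q_sub[of d] uQ[of r] uQ[of d] w'_Q[of r] w'_Q[of d] w'_B[of r] w'_B[of d] d(1-3) re(1-5)
        by (cases "r \<in> Q"; cases "d \<in> Q") auto
    qed
    show ?thesis
    proof
      assume f: "starts_descent W w ?J r"
      show "starts_descent W w' ?J r"
        by (rule starts_descent_local[OF re(3,4,2,5) e J _ f]) (use cmp in blast)+
    next
      assume f: "starts_descent W w' ?J r"
      have e': "w' e \<in> ?J" using J e re by blast
      show "starts_descent W w ?J r"
      proof (rule starts_descent_local[OF re(3,4,2,5) e' _ _ f])
        fix d assume d: "d \<in> W" "d \<in> B" "r < d" "w' d \<in> ?J" "\<And>i. i \<in> W \<Longrightarrow> r < i \<Longrightarrow> i < d \<Longrightarrow> w' i \<notin> ?J" "w' d < w' r"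
        have "w i \<notin> ?J" if "i \<in> W" "r < i" "i < d" for i
        proof -
          have "i \<in> B" using B_convex[OF re(3) d(2), of i] that by simp
          then show ?thesis using d(5)[OF that] J[OF that(1)] by blast
        qed
        then show "w d < w r" using cmp[OF d(1-3)] d(6) by blast
      qed (use J in blast)
    qed
  qed
  have "maj_pairs P W w \<inter> B \<times> B = maj_pairs P' W w' \<inter> B \<times> B"
  proof (intro set_eqI)
    fix t :: "int \<times> int"
    obtain r e where t: "t = (r, e)" by (cases t)
    show "t \<in> maj_pairs P W w \<inter> B \<times> B \<longleftrightarrow> t \<in> maj_pairs P' W w' \<inter> B \<times> B"
      using starts_descent[of r e] rect_iff[of r e] rect_iff[of e r] row_P'_B[of r] row_P'_B[of e]
      unfolding t maj_pairs_def by (auto simp: mem_P' simp del: mem_row)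
  qed
  then show "card (maj_pairs P W w \<inter> B \<times> B) = card (maj_pairs P' W w' \<inter> B \<times> B)" by simp
next
  fix r e assume re: "r \<in> Dm" "e \<in> Dm" "\<not> (r \<in> B \<and> e \<in> B)"
  \<comment> \<open>One of the two rows is outside \<open>B\<close>, which confines the common
    columns.\<close>
  have ab: "l < a \<and> a \<le> z" if "a \<in> row P r \<inter> row P e" for a
    using that re(3) outside[of r a] outside[of e a] by auto
  have nB: "\<not> (\<Theta> r \<in> B \<and> \<Theta> e \<in> B)" using re Theta(4) by blast
  have ab': "l \<le> a \<and> a < z" if "a \<in> row P' (\<Theta> r) \<inter> row P' (\<Theta> e)" for a
    using that nB outside[of "\<Theta> r" "a + 1"] outside[of "\<Theta> e" "a + 1"] by (auto simp: mem_P' split: if_splits)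
  show "starts_descent W w (row P r \<inter> row P e) r \<longleftrightarrow> starts_descent W w' (row P' (\<Theta> r) \<inter> row P' (\<Theta> e)) (\<Theta> r)"
  proof (rule starts_descent_transfer[where D = Dm and D' = Dm'])
    show "bij_betw \<Theta> Dm Dm'" "r \<in> Dm" by (rule Theta(1), rule re(1))
    show "\<Theta> i < \<Theta> j \<longleftrightarrow> i < j" if "i \<in> Dm" "j \<in> Dm" for i j by (rule Theta(2)[OF that])
    show "w' (\<Theta> i) = w i - 1" if "i \<in> Dm" for i by (rule Theta(3)[OF that])
    show "Dm \<subseteq> W" "Dm' \<subseteq> W" by (auto simp: Dm_def Dm'_def)
    show "i \<in> Dm" if "i \<in> W" "w i \<in> row P r \<inter> row P e" for i using that ab by (simp add: Dm_def)
    show "i \<in> Dm'" if "i \<in> W" "w' i \<in> row P' (\<Theta> r) \<inter> row P' (\<Theta> e)" for i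
      using that ab' by (simp add: Dm'_def)
    show "w i \<in> row P r \<inter> row P e \<longleftrightarrow> w i - 1 \<in> row P' (\<Theta> r) \<inter> row P' (\<Theta> e)" if "i \<in> Dm" for i
      using that shift[OF re(1), of "w i"] shift[OF re(2), of "w i"] by (simp add: Dm_def)
  qed
qed (auto simp: maj_pairs_def)

end

section \<open>The transformation tau on words\<close>

fun descent_word :: "int list \<Rightarrow> bool list" where
  "descent_word [] = []"
| "descent_word [x] = []"
| "descent_word (x # y # xs) = (y < x) # descent_word (y # xs)"

lemma descent_word_append:
  "descent_word (xs @ ys) = descent_word xs @ (if xs = [] \<or> ys = [] then [] else [hd ys < last xs]) @ descent_word ys"
proof (induction xs rule: descent_word.induct)
  case (2 x)
  then show ?case by (cases ys) auto
qed auto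

lemma descent_word_nth: "Suc k < length xs \<Longrightarrow> descent_word xs ! k = (xs ! Suc k < xs ! k)"
proof (induction xs arbitrary: k rule: descent_word.induct)
  case (3 x y xs)
  then show ?case by (cases k) auto
qed auto

lemma descent_word_sorted: "sorted xs \<Longrightarrow> descent_word xs = replicate (length xs - 1) False"
  by (induction xs rule: descent_word.induct) auto

lemma descent_word_desc: "sorted_wrt (>) xs \<Longrightarrow> descent_word xs = replicate (length xs - 1) True"
  by (induction xs rule: descent_word.induct) auto

text \<open>One pass of the loop in \<open>\<tau>\<close>: the last \<open>l\<close> is removed and a \<open>Z\<close> is inserted.\<close>

inductive tau_word :: "int \<Rightarrow> int \<Rightarrow> int list \<Rightarrow> int list \<Rightarrow> bool" for l Z where
  up: "l \<notin> set (asc @ post) \<Longrightarrow> sorted (l # asc) \<Longrightarrow> (post \<noteq> [] \<Longrightarrow> hd post < last (l # asc)) \<Longrightarrow>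
    pre = [] \<or> last pre = l \<or> (asc \<noteq> [] \<and> hd asc < last pre) \<Longrightarrow>
    tau_word l Z (pre @ l # asc @ post) (pre @ asc @ Z # post)"
| down: "l \<notin> set (ds @ suf) \<Longrightarrow> ds \<noteq> [] \<Longrightarrow> sorted_wrt (>) ds \<Longrightarrow> (pre \<noteq> [] \<Longrightarrow> last pre \<le> hd ds) \<Longrightarrow>
    suf = [] \<or> last ds \<le> hd suf \<Longrightarrow>
    tau_word l Z (pre @ ds @ l # suf) (pre @ Z # ds @ suf)"

text \<open>Every \<open>Z\<close> comes after the last \<open>l\<close>. Hence the inserted
  \<open>Z\<close> can be taken for the first one in the result, which makes a pass
  reversible.\<close>

definition tau_word_inv :: "int \<Rightarrow> int \<Rightarrow> int list \<Rightarrow> bool" where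
  "tau_word_inv l Z xs \<longleftrightarrow> l < Z \<and> set xs \<subseteq> {l..Z} \<and> (\<forall>pre suf. xs = pre @ l # suf \<longrightarrow> Z \<notin> set pre)"

lemma tau_word_filter: "tau_word l Z xs ys \<Longrightarrow> filter (\<lambda>a. a \<noteq> l \<and> a \<noteq> Z) ys = filter (\<lambda>a. a \<noteq> l \<and> a \<noteq> Z) xs"
  by (induction rule: tau_word.induct) auto

lemma tau_word_count: "tau_word l Z xs ys \<Longrightarrow> l < Z \<Longrightarrow> count_list ys Z = Suc (count_list xs Z)"
  by (induction rule: tau_word.induct) auto

lemma tau_word_inv:
  assumes "tau_word l Z xs ys" "tau_word_inv l Z xs"
  shows "tau_word_inv l Z ys"
proof -
  have lZ: "l < Z" and sub: "set xs \<subseteq> {l..Z}" using assms(2) by (auto simp: tau_word_inv_def)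
  have Zpre: "Z \<notin> set p" if "xs = p @ l # s" for p s using assms(2) that by (auto simp: tau_word_inv_def)
  \<comment> \<open>In both cases the result has no \<open>l\<close> after some prefix q of the part
    before the removed \<open>l\<close>. So only letters of q can precede an \<open>l\<close> of the
    result.\<close>
  have main: "\<exists>p. (\<exists>s. xs = p @ l # s) \<and> (\<exists>q r. p = q @ r \<and> (\<exists>t. ys = q @ t \<and> l \<notin> set t))"
    using assms(1)
  proof cases
    case (up asc post pre)
    then have "xs = pre @ l # (asc @ post) \<and> ys = pre @ (asc @ Z # post) \<and> l \<notin> set (asc @ Z # post)"
      using lZ by auto
    moreover have "pre = pre @ []" by simp
    ultimately show ?thesis by blast
  next
    case (down ds suf pre)
    then have "xs = (pre @ ds) @ l # suf \<and> ys = pre @ (Z # ds @ suf) \<and> l \<notin> set (Z # ds @ suf)"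
      using lZ by auto
    then show ?thesis by blast
  qed
  then obtain p s q r t where h: "xs = p @ l # s" "p = q @ r" "ys = q @ t" "l \<notin> set t" by blast
  have "Z \<notin> set pre" if "ys = pre @ l # suf" for pre suf
  proof -
    have eq: "q @ t = pre @ l # suf" using that h by simp
    have "length pre < length q"
    proof (rule ccontr)
      assume "\<not> length pre < length q"
      then have "(pre @ l # suf) ! length pre = t ! (length pre - length q)"
        unfolding eq[symmetric] by (simp add: nth_append)
      moreover have "length pre - length q < length t"
        using arg_cong[OF eq, of length] \<open>\<not> length pre < length q\<close> by simp
      ultimately show False using h(4) nth_mem by fastforce
    qed
    then have "pre = take (length pre) q" using eq
      by (metis append_eq_append_conv_if append_take_drop_id less_imp_le_nat take_all_iff append_eq_conv_conj not_less)
    then have "set pre \<subseteq> set p" using h(2) by (metis set_append set_take_subset sup.coboundedI1)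
    then show ?thesis using Zpre[OF h(1)] by blast
  qed
  moreover have "set ys \<subseteq> {l..Z}" using assms(1) sub lZ by cases auto
  ultimately show ?thesis using lZ by (auto simp: tau_word_inv_def)
qed

text \<open>In the first case a weakly increasing block is replaced by one of equal length, in the
  second a strictly decreasing one. The side conditions keep the comparisons at the two borders of
  the block.\<close>

lemma tau_word_dl:
  assumes "tau_word l Z xs ys" "tau_word_inv l Z xs"
  shows "descent_word ys = descent_word xs"
  using assms(1)
proof cases
  case (up asc post pre)
  have lZ: "l < Z" and sub: "set xs \<subseteq> {l..Z}" using assms(2) by (auto simp: tau_word_inv_def)
  have "sorted (asc @ [Z])" using up sub by (auto simp: sorted_append)
  then have 1: "descent_word (l # asc) = descent_word (asc @ [Z])" using up descent_word_sorted by (metis length_append_singleton length_Cons)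
  have 2: "hd (asc @ [Z]) < last pre \<longleftrightarrow> l < last pre" if "pre \<noteq> []"
  proof -
    have "last pre \<in> set xs" using that up by simp
    then have "l \<le> last pre" "last pre \<le> Z" using sub by auto
    moreover have "l < hd asc" if "asc \<noteq> []" using up that by (cases asc) auto
    ultimately show ?thesis using up that lZ by (cases "asc = []") auto
  qed
  have 3: "hd post < last (l # asc) \<and> hd post < Z" if "post \<noteq> []"
  proof -
    have "hd post < last (l # asc)" using up that by blast
    moreover have "last (l # asc) \<le> Z" using up sub lZ by (cases asc rule: rev_cases) auto
    ultimately show ?thesis by simp
  qed
  have "descent_word xs = descent_word (pre @ (l # asc) @ post)" using up by simp
  also have "\<dots> = descent_word pre @ (if pre = [] then [] else [l < last pre]) @ descent_word (l # asc) @ (if post = [] then [] else [True]) @ descent_word post"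
    using 3 unfolding descent_word_append by auto
  also have "\<dots> = descent_word (pre @ (asc @ [Z]) @ post)"
  proof -
    have "hd (asc @ Z # post) = hd (asc @ [Z])" by (cases asc) auto
    then show ?thesis using 1 2 3 unfolding descent_word_append[of pre] descent_word_append[of "asc @ [Z]"] by auto
  qed
  finally show ?thesis using up by simp
next
  case (down ds suf pre)
  have lZ: "l < Z" and sub: "set xs \<subseteq> {l..Z}" using assms(2) by (auto simp: tau_word_inv_def)
  have "xs = (pre @ ds) @ l # suf" using down by simp
  then have Z: "Z \<notin> set (pre @ ds)" using assms(2) unfolding tau_word_inv_def by blast
  have ds: "l < a" "a < Z" if "a \<in> set ds" for a
  proof -
    have "a \<in> {l..Z}" "a \<noteq> l" "a \<noteq> Z" using that sub Z down by auto
    then show "l < a" "a < Z" by auto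
  qed
  have "sorted_wrt (>) (ds @ [l])" "sorted_wrt (>) (Z # ds)" using down ds by (auto simp: sorted_wrt_append)
  then have 1: "descent_word (ds @ [l]) = descent_word (Z # ds)" using descent_word_desc by (metis length_append_singleton length_Cons)
  have 2: "\<not> hd ds < last pre \<and> \<not> Z < last pre" if "pre \<noteq> []"
  proof -
    have "last pre \<in> set xs" using that down by simp
    then have "last pre \<le> Z" using sub by auto
    then show ?thesis using down that by auto
  qed
  have 3: "\<not> hd suf < l \<and> \<not> hd suf < last ds" if "suf \<noteq> []"
  proof -
    have "hd suf \<in> set xs" using that down by simp
    then have "l \<le> hd suf" using sub by auto
    then show ?thesis using down that by auto
  qed
  have "descent_word xs = descent_word (pre @ (ds @ [l]) @ suf)" using down by simp
  also have "\<dots> = descent_word pre @ (if pre = [] then [] else [False]) @ descent_word (ds @ [l]) @ (if suf = [] then [] else [False]) @ descent_word suf"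
    using 2 3 down unfolding descent_word_append[of pre] descent_word_append[of "ds @ [l]"] by auto
  also have "\<dots> = descent_word (pre @ (Z # ds) @ suf)"
    using 1 2 3 down unfolding descent_word_append[of pre] descent_word_append[of "Z # ds"] by auto
  finally show ?thesis using down by simp
qed

text \<open>The new \<open>Z\<close> is the first one in the result, and what surrounds it tells which case applied.\<close>

lemma tau_word_undo:
  assumes "tau_word l Z xs ys" "tau_word_inv l Z xs"
  shows "\<exists>A C. ys = A @ Z # C \<and> Z \<notin> set A \<and>
     (if C = [] \<or> hd C = Z \<or> (A \<noteq> [] \<and> hd C < last A)
      then \<exists>pre asc. A = pre @ asc \<and> xs = pre @ l # asc @ C \<and> sorted asc \<and> l \<notin> set asc \<and>
        (pre = [] \<or> last pre = l \<or> (asc \<noteq> [] \<and> hd asc < last pre))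
      else \<exists>ds suf. C = ds @ suf \<and> xs = A @ ds @ l # suf \<and> ds \<noteq> [] \<and> sorted_wrt (>) ds \<and> (suf = [] \<or> last ds \<le> hd suf))"
  using assms(1)
proof cases
  case (up asc post pre)
  have lZ: "l < Z" and sub: "set xs \<subseteq> {l..Z}" using assms(2) by (auto simp: tau_word_inv_def)
  \<comment> \<open>The block \<open>asc\<close> may end in letters \<open>Z\<close> from earlier
    passes. The new one follows them, but equal letters commute, so it may be regarded as the
    first.\<close>
  define a1 where "a1 = takeWhile (\<lambda>a. a \<noteq> Z) asc"
  define a2 where "a2 = dropWhile (\<lambda>a. a \<noteq> Z) asc"
  have asc: "asc = a1 @ a2" by (simp add: a1_def a2_def)
  have Za1: "Z \<notin> set a1" by (auto simp: a1_def dest: set_takeWhileD)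
  have a2: "a = Z" if "a \<in> set a2" for a
  proof -
    have "a2 \<noteq> []" using that by auto
    then have "hd a2 = Z" using hd_dropWhile[of "\<lambda>a. a \<noteq> Z" asc] unfolding a2_def by auto
    moreover have "sorted a2" using up asc by (simp add: sorted_append)
    ultimately have "Z \<le> a" using that by (cases a2) auto
    moreover have "a \<le> Z" using that up asc sub by auto
    ultimately show ?thesis by simp
  qed
  then have rep: "a2 = replicate (length a2) Z" by (simp add: replicate_eqI)
  have a2Z: "a2 @ Z # post = Z # a2 @ post"
    by (subst (1 2) rep) (metis append_Cons append_assoc append_Nil replicate_append_same)
  define A C where "A = pre @ a1" and "C = a2 @ post"
  have ys: "ys = A @ Z # C" using up asc a2Z by (simp add: A_def C_def)
  have "xs = pre @ l # (asc @ post)" using up by simp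
  then have "Z \<notin> set pre" using assms(2) unfolding tau_word_inv_def by blast
  then have ZA: "Z \<notin> set A" using Za1 by (simp add: A_def)
  have cond: "C = [] \<or> hd C = Z \<or> (A \<noteq> [] \<and> hd C < last A)"
  proof (cases "a2 = []")
    case True
    show ?thesis
    proof (cases "post = []")
      case False
      then have lt: "hd post < last (l # asc)" using up by blast
      have "l \<le> hd post" using up False sub by (cases post) auto
      then have "asc \<noteq> []" using lt by auto
      then show ?thesis using True asc lt False by (simp add: A_def C_def)
    qed (simp add: True C_def)
  next
    case False
    then have "hd a2 = Z" using a2 by simp
    then show ?thesis using False by (simp add: C_def)
  qed
  have "pre = [] \<or> last pre = l \<or> (a1 \<noteq> [] \<and> hd a1 < last pre)"
  proof (cases "pre = [] \<or> last pre = l")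
    case False
    then have h: "asc \<noteq> []" "hd asc < last pre" using up by auto
    moreover have "last pre \<in> set xs" using False up by simp
    then have "last pre \<le> Z" using sub by auto
    ultimately have "hd asc \<noteq> Z" by simp
    then have "a1 \<noteq> [] \<and> hd a1 = hd asc" using h unfolding a1_def by (cases asc) auto
    then show ?thesis using h by simp
  qed auto
  moreover have "sorted a1" "l \<notin> set a1" using up asc by (auto simp: sorted_append)
  moreover have "xs = pre @ l # a1 @ C" using up asc by (simp add: C_def)
  ultimately have "\<exists>pre asc. A = pre @ asc \<and> xs = pre @ l # asc @ C \<and> sorted asc \<and> l \<notin> set asc \<and>
        (pre = [] \<or> last pre = l \<or> (asc \<noteq> [] \<and> hd asc < last pre))" using A_def by blast
  then show ?thesis using ys ZA cond by - (rule exI[of _ A], rule exI[of _ C], simp)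
next
  case (down ds suf pre)
  have "xs = (pre @ ds) @ l # suf" using down by simp
  then have Z: "Z \<notin> set (pre @ ds)" using assms(2) unfolding tau_word_inv_def by blast
  \<comment> \<open>The letter after the new \<open>Z\<close> is the first of \<open>ds\<close>. It
    precedes an \<open>l\<close>, so it is not \<open>Z\<close>, and it is not smaller than the last
    letter of \<open>pre\<close>.\<close>
  then have nc: "(ds @ suf = [] \<or> hd (ds @ suf) = Z \<or> (pre \<noteq> [] \<and> hd (ds @ suf) < last pre)) = False"
    using down by (cases ds) auto
  have "\<exists>ds' suf'. ds @ suf = ds' @ suf' \<and> xs = pre @ ds' @ l # suf' \<and> ds' \<noteq> []
      \<and> sorted_wrt (>) ds' \<and> (suf' = [] \<or> last ds' \<le> hd suf')" using down by blast
  moreover have "ys = pre @ Z # (ds @ suf)" "Z \<notin> set pre" using down Z by auto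
  ultimately show ?thesis by - (rule exI[of _ pre], rule exI[of _ "ds @ suf"], simp only: nc if_False, blast)
qed

lemma tau_word_inj:
  assumes "tau_word l Z xs ys" "tau_word_inv l Z xs" "tau_word l Z xs' ys" "tau_word_inv l Z xs'"
  shows "xs = xs'"
proof -
  obtain A C where AC: "ys = A @ Z # C" "Z \<notin> set A" and 1:
     "if C = [] \<or> hd C = Z \<or> (A \<noteq> [] \<and> hd C < last A)
      then \<exists>pre asc. A = pre @ asc \<and> xs = pre @ l # asc @ C \<and> sorted asc \<and> l \<notin> set asc \<and>
        (pre = [] \<or> last pre = l \<or> (asc \<noteq> [] \<and> hd asc < last pre))
      else \<exists>ds suf. C = ds @ suf \<and> xs = A @ ds @ l # suf \<and> ds \<noteq> [] \<and> sorted_wrt (>) ds \<and> (suf = [] \<or> last ds \<le> hd suf)"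
    using tau_word_undo[OF assms(1,2)] by blast
  obtain A' C' where AC': "ys = A' @ Z # C'" "Z \<notin> set A'" and 2:
     "if C' = [] \<or> hd C' = Z \<or> (A' \<noteq> [] \<and> hd C' < last A')
      then \<exists>pre asc. A' = pre @ asc \<and> xs' = pre @ l # asc @ C' \<and> sorted asc \<and> l \<notin> set asc \<and>
        (pre = [] \<or> last pre = l \<or> (asc \<noteq> [] \<and> hd asc < last pre))
      else \<exists>ds suf. C' = ds @ suf \<and> xs' = A' @ ds @ l # suf \<and> ds \<noteq> [] \<and> sorted_wrt (>) ds \<and> (suf = [] \<or> last ds \<le> hd suf)"
    using tau_word_undo[OF assms(3,4)] by blast
  have tw: "takeWhile (\<lambda>a. a \<noteq> Z) (X @ Z # Y) = X" if "Z \<notin> set X" for X Y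
    using that by (induction X) auto
  have "A' = A" using tw[OF AC(2), of C] tw[OF AC'(2), of C'] AC(1) AC'(1) by simp
  then have eq: "A' = A" "C' = C" using AC(1) AC'(1) by auto
  show ?thesis
  proof (cases "C = [] \<or> hd C = Z \<or> (A \<noteq> [] \<and> hd C < last A)")
    case True
    obtain p a where pa: "A = p @ a" "xs = p @ l # a @ C" "sorted a" "l \<notin> set a"
      "p = [] \<or> last p = l \<or> (a \<noteq> [] \<and> hd a < last p)" using 1 True by auto
    obtain p' a' where pa': "A = p' @ a'" "xs' = p' @ l # a' @ C" "sorted a'" "l \<notin> set a'"
      "p' = [] \<or> last p' = l \<or> (a' \<noteq> [] \<and> hd a' < last p')" using 2 True unfolding eq by auto
    \<comment> \<open>Two possible places for \<open>l\<close>: the letters d between them belong to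
      a sorted block without \<open>l\<close>, yet the condition on the longer prefix wants the next
      letter to be smaller than the last one of d.\<close>
    have no: False if h: "p @ a = p' @ a'" "length p < length p'" "sorted a" "l \<notin> set a"
      "p' = [] \<or> last p' = l \<or> (a' \<noteq> [] \<and> hd a' < last p')" for p a p' a' :: "int list"
    proof -
      obtain d where d: "p' = p @ d" "a = d @ a'" "d \<noteq> []"
        using h(1,2) by (auto simp: append_eq_append_conv2)
      have "last p' = last d" "last d \<in> set a" using d by auto
      then have "a' \<noteq> []" "hd a' < last d" using h d by auto
      moreover have "last d \<le> hd a'" using h(3) d calculation by (auto simp: sorted_append)
      ultimately show False by simp
    qed
    have "\<not> length p < length p'" "\<not> length p' < length p"
      using no[of p a p' a'] no[of p' a' p a] pa pa' by metis+
    then have "p = p'" using pa(1) pa'(1) by (metis append_eq_append_conv linorder_neqE_nat)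
    then show ?thesis using pa pa' by simp
  next
    case False
    obtain d s where ds: "C = d @ s" "xs = A @ d @ l # s" "d \<noteq> []" "sorted_wrt (>) d" "s = [] \<or> last d \<le> hd s"
      using 1 False by auto
    obtain d' s' where ds': "C = d' @ s'" "xs' = A @ d' @ l # s'" "d' \<noteq> []" "sorted_wrt (>) d'" "s' = [] \<or> last d' \<le> hd s'"
      using 2 False unfolding eq by auto
    \<comment> \<open>Here the shorter run would have to be followed by a letter that is at least
      its last one, while the longer run goes on decreasing.\<close>
    have no: False if h: "d @ s = d' @ s'" "length d < length d'" "d \<noteq> []" "sorted_wrt (>) d'" "s = [] \<or> last d \<le> hd s" for d s d' s' :: "int list"
    proof -
      obtain e where e: "d' = d @ e" "s = e @ s'" "e \<noteq> []"
        using h(1,2) by (auto simp: append_eq_append_conv2)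
      then have "hd e < last d" using h(3,4) by (simp add: sorted_wrt_append)
      then show False using h(5) e by simp
    qed
    have "\<not> length d < length d'" "\<not> length d' < length d"
      using no[of d s d' s'] no[of d' s' d s] ds ds' by metis+
    then have "d = d'" using ds(1) ds'(1) by (metis append_eq_append_conv linorder_neqE_nat)
    then show ?thesis using ds ds' by simp
  qed
qed

section \<open>The transformation tau on fillings\<close>

lemma chain_prefix_append:
  "\<exists>ys. xs = chain_prefix r xs @ ys \<and> (xs \<noteq> [] \<longrightarrow> chain_prefix r xs \<noteq> [] \<and> hd (chain_prefix r xs) = hd xs)
    \<and> successively r (chain_prefix r xs) \<and> (xs \<noteq> [] \<and> ys \<noteq> [] \<longrightarrow> \<not> r (last (chain_prefix r xs)) (hd ys))"
proof (induction r xs rule: chain_prefix.induct)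
  case (3 r x y xs)
  show ?case
  proof (cases "r x y")
    case True
    then obtain ys where ys: "y # xs = chain_prefix r (y # xs) @ ys" "chain_prefix r (y # xs) \<noteq> []"
      "hd (chain_prefix r (y # xs)) = y" "successively r (chain_prefix r (y # xs))"
      "ys \<noteq> [] \<longrightarrow> \<not> r (last (chain_prefix r (y # xs))) (hd ys)" using 3 by auto
    then have "successively r (x # chain_prefix r (y # xs))" using True by (cases "chain_prefix r (y # xs)") auto
    then show ?thesis using True ys by (intro exI[of _ ys]) auto
  qed auto
qed auto

lemma map_chain_prefix:
  "(\<And>x y. x \<in> set xs \<Longrightarrow> y \<in> set xs \<Longrightarrow> r' x y \<longleftrightarrow> r (f x) (f y)) \<Longrightarrow> map f (chain_prefix r' xs) = chain_prefix r (map f xs)"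
  by (induction r' xs rule: chain_prefix.induct) auto

lemma set_zip_map: "set (zip xs (map f xs)) = (\<lambda>x. (x, f x)) ` set xs"
  by (induction xs) auto

lemma push_along_graph:
  assumes "distinct ds" "set ds \<subseteq> W" "ds \<noteq> []"
  shows "\<exists>w2. push_along z ds (graph W w) = graph W w2 \<and> map w2 ds = tl (map w ds) @ [z] \<and> (\<forall>i. i \<notin> set ds \<longrightarrow> w2 i = w i)"
proof -
  let ?vs = "tl (map w ds) @ [z]"
  have len: "length ?vs = length ds" using assms(3) by simp
  define w2 where "w2 i = (if i \<in> set ds then the (map_of (zip ds ?vs) i) else w i)" for i
  have m: "map w2 ds = ?vs"
  proof (rule nth_equalityI)
    fix k assume "k < length (map w2 ds)"
    then have k: "k < length ds" by simp
    have "map_of (zip ds ?vs) (ds ! k) = Some (?vs ! k)"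
      by (rule map_of_zip_nth) (use len assms k in auto)
    then show "map w2 ds ! k = ?vs ! k" using k by (simp add: w2_def)
  qed (use len in simp)
  have cm: "map (col_at (graph W w)) ds = map w ds" using assms(2) by auto
  have "set (zip ds ?vs) = graph (set ds) w2"
    unfolding m[symmetric] graph_def by (rule set_zip_map)
  then have "push_along z ds (graph W w) = graph W w2"
    unfolding push_along_def cm using assms(2) by (auto simp: graph_def w2_def)
  then show ?thesis using m by (intro exI[of _ w2]) (auto simp: w2_def)
qed

lemma Max_sorted: "sorted_wrt (<) xs \<Longrightarrow> xs \<noteq> [] \<Longrightarrow> Max (set xs) = (last xs :: int)"
  by (cases xs rule: rev_cases) (auto intro!: Max_eqI simp: sorted_wrt_append less_imp_le)

lemma sorted_list_of_set_set: "sorted_wrt (<) xs \<Longrightarrow> sorted_list_of_set (set xs) = (xs :: int list)"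
  by (intro strict_sorted_equal) auto

lemma filter_last_nth:
  assumes "xs \<noteq> []" "Q (last xs)"
  shows "filter Q xs \<noteq> [] \<and> last (filter Q xs) = last xs"
  using assms by (cases xs rule: rev_cases) auto

text \<open>Row c is the lowest one with letter \<open>l\<close>. The last conclusion says that the
  other letters \<open>l\<close> keep their rows, as the following passes require.\<close>

lemma tau_step_graph:
  assumes ws: "ws = wp @ c # wsuf" "sorted_wrt (<) ws" and W: "W = set ws"
    and l: "w c = l" "l \<notin> w ` set wsuf" and lZ: "l < Z" "\<And>i. i \<in> W \<Longrightarrow> l \<le> w i \<and> w i \<le> Z"
    and c': "c' = (let ps = filter (\<lambda>i. w i = l) wp in if ps = [] then None else Some (last ps))"
  shows "\<exists>w2. tau_step Z c' c (graph W w) = graph W w2 \<and> tau_word l Z (map w ws) (map w2 ws)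
    \<and> filter (\<lambda>i. w2 i = l) ws = filter (\<lambda>i. w i = l) wp"
proof -
  have dist: "distinct ws" using ws(2) strict_sorted_iff by blast
  have less: "\<And>i. i \<in> set wp \<Longrightarrow> i < c" "\<And>i. i \<in> set wsuf \<Longrightarrow> c < i"
    using ws by (auto simp: sorted_wrt_append)
  have sp: "sorted_wrt (<) wp" "sorted_wrt (<) wsuf" using ws by (auto simp: sorted_wrt_append)
  have a: "row_above (graph W w) c = (if wp = [] then None else Some (last wp))"
  proof -
    have U: "{i \<in> W. i < c} = set wp" using W ws(1) less by force
    have "Max (set wp) = last wp" if "wp \<noteq> []"
      using that sp(1) by (rule Max_sorted[rotated])
    then show ?thesis by (simp add: row_above_def U)
  qed
  have b: "row_below (graph W w) c = (if wsuf = [] then None else Some (hd wsuf))"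
  proof -
    have U: "{i \<in> W. c < i} = set wsuf" using W ws(1) less by force
    have "Min (set wsuf) = hd wsuf" if "wsuf \<noteq> []"
      using that sp(2) by (cases wsuf) (auto intro!: Min_eqI)
    then show ?thesis by (simp add: row_below_def U)
  qed
  \<comment> \<open>If the row directly above c has letter \<open>l\<close>, it is the last such row
    above c, which is \<open>c'\<close>.\<close>
  have cond_c': "(row_above (graph W w) c = None \<or> row_above (graph W w) c = c') \<longleftrightarrow> wp = [] \<or> w (last wp) = l"
  proof (cases "wp = [] \<or> w (last wp) = l")
    case True
    then show ?thesis unfolding a c' using filter_last_nth[of wp "\<lambda>i. w i = l"] by (auto simp: Let_def)
  next
    case False
    let ?ps = "filter (\<lambda>i. w i = l) wp"
    have "w (last ?ps) = l" if "?ps \<noteq> []" using last_in_set[OF that] by auto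
    then show ?thesis unfolding a c' using False by (auto simp: Let_def)
  qed
  have colW: "col_at (graph W w) i = w i" if "i \<in> W" for i using that by simp
  have dW: "set wp \<subseteq> W" "c \<in> W" "set wsuf \<subseteq> W" using W ws by auto
  have lpost: "w i \<noteq> l" if "i \<in> set wsuf" for i using l(2) that by blast
  show ?thesis
  proof (cases "wp = [] \<or> w (last wp) = l \<or> (wsuf \<noteq> [] \<and> w (hd wsuf) < w (last wp))")
    case True
    define ds where "ds = ascents_down (graph W w) c"
    have srt: "sorted_list_of_set {i \<in> W. c \<le> i} = c # wsuf"
    proof -
      have "{i \<in> W. c \<le> i} = set (c # wsuf)" using W ws(1) less by force
      moreover have "sorted_wrt (<) (c # wsuf)" using ws by (auto simp: sorted_wrt_append)
      ultimately show ?thesis using sorted_list_of_set_set by metis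
    qed
    have ds': "ds = chain_prefix (\<lambda>x y. col_at (graph W w) x \<le> col_at (graph W w) y) (c # wsuf)"
      unfolding ds_def ascents_down_def rows_graph srt ..
    obtain post where post: "c # wsuf = ds @ post" "ds \<noteq> []" "hd ds = c"
      using chain_prefix_append[of "c # wsuf" "\<lambda>x y. col_at (graph W w) x \<le> col_at (graph W w) y"] unfolding ds' by auto
    obtain ds1 where ds1: "ds = c # ds1" using post by (cases ds) auto
    have suf: "wsuf = ds1 @ post" using post ds1 by simp
    have cw: "col_at (graph W w) i = w i" if "i \<in> set (c # wsuf)" for i using that dW by auto
    have mds: "map w ds = chain_prefix (\<le>) (map w (c # wsuf))"
      unfolding ds' by (rule map_chain_prefix) (simp only: cw)
    obtain mp where mp: "map w (c # wsuf) = map w ds @ mp" "successively (\<le>) (map w ds)"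
      "mp \<noteq> [] \<longrightarrow> \<not> last (map w ds) \<le> hd mp"
      using chain_prefix_append[of "map w (c # wsuf)" "(\<le>)"] unfolding mds by auto
    have "mp = map w post" using mp(1) post(1) by simp
    then have mx: "w (hd post) < last (map w ds)" if "post \<noteq> []" using mp(3) that by (simp add: hd_map)
    have sorted: "sorted (map w ds)" using mp(2) successively_conv_sorted_wrt[of "(\<le>)" "map w ds"] by (simp add: transp_def)
    \<comment> \<open>This includes case (a): with no row below, the chain of ascents consists of c
      alone.\<close>
    have act: "tau_step Z c' c (graph W w) = push_along Z ds (graph W w)"
    proof (cases "wsuf = []")
      case nil: True
      then have "ds = [c]" using ds1 suf by simp
      moreover have "wp = [] \<or> w (last wp) = l" using True nil by simp
      ultimately show ?thesis unfolding tau_step_def Let_def using cond_c' b nil by (simp add: ds_def)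
    next
      case False
      show ?thesis
      proof (cases "wp = [] \<or> w (last wp) = l")
        case True
        then show ?thesis unfolding tau_step_def Let_def using cond_c' b False by (simp add: ds_def)
      next
        case F: False
        then have "w (hd wsuf) < w (last wp)" using True by simp
        moreover have "hd wsuf \<in> W" "last wp \<in> W" using F False dW by auto
        ultimately show ?thesis unfolding tau_step_def Let_def using cond_c' b a F False by (simp add: ds_def)
      qed
    qed
    have "distinct ds" "set ds \<subseteq> W" using dist ws(1) suf ds1 W by auto
    then obtain w2 where w2: "push_along Z ds (graph W w) = graph W w2" "map w2 ds = tl (map w ds) @ [Z]"
      "\<And>i. i \<notin> set ds \<Longrightarrow> w2 i = w i" using push_along_graph post(2) by blast
    have wps: "map w2 wp = map w wp" "map w2 post = map w post"
    proof -
      have "set wp \<inter> set ds = {}" "set post \<inter> set ds = {}" using dist ws(1) suf ds1 by auto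
      then show "map w2 wp = map w wp" "map w2 post = map w post" by (auto intro!: w2(3))
    qed
    have m1: "map w ws = map w wp @ l # map w ds1 @ map w post" using ws(1) suf l(1) by simp
    have m2: "map w2 ws = map w wp @ map w ds1 @ Z # map w post"
    proof -
      have "map w2 ws = map w2 wp @ map w2 ds @ map w2 post" using ws(1) suf ds1 by simp
      then show ?thesis using w2(2) wps ds1 by simp
    qed
    have "tau_word l Z (map w ws) (map w2 ws)"
      unfolding m1 m2
    proof (rule tau_word.up)
      show "l \<notin> set (map w ds1 @ map w post)" using l(2) suf by auto
      show "sorted (l # map w ds1)" using sorted ds1 l(1) by simp
      show "hd (map w post) < last (l # map w ds1)" if "map w post \<noteq> []"
        using mx that ds1 l(1) by (simp add: hd_map)
      show "map w wp = [] \<or> last (map w wp) = l \<or> (map w ds1 \<noteq> [] \<and> hd (map w ds1) < last (map w wp))"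
      proof (cases "wp = [] \<or> w (last wp) = l")
        case False
        then have h: "wsuf \<noteq> []" "w (hd wsuf) < w (last wp)" using True by auto
        \<comment> \<open>Otherwise the next entry would be smaller than \<open>l\<close>, the least
          possible one.\<close>
        have "ds1 \<noteq> []"
        proof
          assume "ds1 = []"
          then have "post = wsuf" "w (hd post) < l" using suf mx h ds1 l(1) by auto
          moreover have "hd wsuf \<in> W" using h(1) dW(3) hd_in_set by blast
          ultimately show False using lZ(2)[of "hd wsuf"] by simp
        qed
        then show ?thesis using h suf False by (simp add: last_map hd_map)
      qed (auto simp: last_map)
    qed
    moreover have "filter (\<lambda>i. w2 i = l) ws = filter (\<lambda>i. w i = l) wp"
    proof -
      have "w2 i = w i" if "i \<in> set wp" for i using wps(1) that by simp
      then have 1: "filter (\<lambda>i. w2 i = l) wp = filter (\<lambda>i. w i = l) wp" by (intro filter_cong) auto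
      have "set (map w2 (c # wsuf)) = set (map w ds1 @ Z # map w post)"
        using w2(2) wps(2) ds1 suf by (metis (no_types, lifting) append.assoc append_Cons append_Nil list.sel(3) list.simps(9) map_append post(1))
      then have "l \<notin> set (map w2 (c # wsuf))" using l(2) suf lZ(1) by auto
      then have "filter (\<lambda>i. w2 i = l) (c # wsuf) = []" by (auto simp: filter_empty_conv)
      then show ?thesis using 1 ws(1) by simp
    qed
    ultimately show ?thesis using w2(1) act by auto
  next
    case False
    then have wpne: "wp \<noteq> []" "w (last wp) \<noteq> l" and cnd: "wsuf = [] \<or> w (last wp) \<le> w (hd wsuf)" by auto
    define ds where "ds = descents_up (graph W w) c"
    have srt: "sorted_list_of_set {i \<in> W. i \<le> c} = wp @ [c]"
    proof -
      have "{i \<in> W. i \<le> c} = set (wp @ [c])" using W ws(1) less by force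
      moreover have "sorted_wrt (<) (wp @ [c])" using ws by (auto simp: sorted_wrt_append)
      ultimately show ?thesis using sorted_list_of_set_set by metis
    qed
    have ds': "ds = chain_prefix (\<lambda>x y. col_at (graph W w) x < col_at (graph W w) y) (c # rev wp)"
      unfolding ds_def descents_up_def rows_graph srt by simp
    obtain post where post: "c # rev wp = ds @ post" "ds \<noteq> []" "hd ds = c"
      using chain_prefix_append[of "c # rev wp" "\<lambda>x y. col_at (graph W w) x < col_at (graph W w) y"] unfolding ds' by auto
    obtain ds1 where ds1: "ds = c # ds1" using post by (cases ds) auto
    have pre: "wp = rev post @ rev ds1" using post ds1 by (metis append_Cons list.inject rev_append rev_rev_ident)
    have cw: "col_at (graph W w) i = w i" if "i \<in> set (c # rev wp)" for i using that dW by auto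
    have mds: "map w ds = chain_prefix (<) (map w (c # rev wp))"
      unfolding ds' by (rule map_chain_prefix) (simp only: cw)
    obtain mp where mp: "map w (c # rev wp) = map w ds @ mp" "successively (<) (map w ds)"
      "mp \<noteq> [] \<longrightarrow> \<not> last (map w ds) < hd mp"
      using chain_prefix_append[of "map w (c # rev wp)" "(<)"] unfolding mds by auto
    have "mp = map w post" using mp(1) post(1) by simp
    then have mx: "w (hd post) \<le> last (map w ds)" if "post \<noteq> []" using mp(3) that by (simp add: hd_map)
    have sorted: "sorted_wrt (<) (map w ds)" using mp(2) successively_conv_sorted_wrt[of "(<)" "map w ds"] by (simp add: transp_def)
    have ds1ne: "ds1 \<noteq> []"
    proof
      assume "ds1 = []"
      then have "post = rev wp" using pre by simp
      then have "w (last wp) \<le> l" using mx wpne \<open>ds1 = []\<close> ds1 l(1) by (simp add: hd_rev)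
      moreover have "last wp \<in> W" using wpne(1) dW(1) last_in_set by blast
      ultimately show False using lZ(2)[of "last wp"] wpne(2) by simp
    qed
    have act: "tau_step Z c' c (graph W w) = push_along Z ds (graph W w)"
    proof -
      have n: "\<not> (row_above (graph W w) c = None \<or> row_above (graph W w) c = c')" using cond_c' wpne by simp
      have "\<not> (row_above (graph W w) c \<noteq> None \<and> row_below (graph W w) c \<noteq> None
        \<and> col_at (graph W w) (the (row_below (graph W w) c)) < col_at (graph W w) (the (row_above (graph W w) c)))"
      proof (cases "wsuf = []")
        case False
        then have "hd wsuf \<in> W" "last wp \<in> W" using wpne dW by auto
        then show ?thesis using a b cnd False wpne by simp
      qed (simp add: b)
      then show ?thesis unfolding tau_step_def Let_def ds_def using n by auto
    qed
    have "distinct ds" "set ds \<subseteq> W" using dist ws(1) pre ds1 W by auto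
    then obtain w2 where w2: "push_along Z ds (graph W w) = graph W w2" "map w2 ds = tl (map w ds) @ [Z]"
      "\<And>i. i \<notin> set ds \<Longrightarrow> w2 i = w i" using push_along_graph post(2) by blast
    have wps: "map w2 post = map w post" "map w2 wsuf = map w wsuf"
    proof -
      have "set wsuf \<inter> set ds = {}" "set post \<inter> set ds = {}" using dist ws(1) pre ds1 by auto
      then show "map w2 post = map w post" "map w2 wsuf = map w wsuf" by (auto intro!: w2(3))
    qed
    have m1: "map w ws = map w (rev post) @ map w (rev ds1) @ l # map w wsuf" using ws(1) pre l(1) by simp
    have m2: "map w2 ws = map w (rev post) @ Z # map w (rev ds1) @ map w wsuf"
    proof -
      have "map w2 ws = rev (map w2 post) @ rev (map w2 ds) @ map w2 wsuf" using ws(1) pre ds1 by (simp add: rev_map)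
      moreover have "map w2 ds = map w ds1 @ [Z]" using w2(2) ds1 by simp
      ultimately have "map w2 ws = rev (map w post) @ rev (map w ds1 @ [Z]) @ map w wsuf"
        using wps by (simp only:)
      then show ?thesis by (simp add: rev_map)
    qed
    have srt1: "sorted_wrt (<) (map w ds1)" "\<And>a. a \<in> set (map w ds1) \<Longrightarrow> l < a" using sorted ds1 l(1) by auto
    have ld: "l \<notin> set (map w ds1)" using srt1(2) by blast
    have lastds: "last (rev ds1) = hd ds1" "last wp = hd ds1" "hd (rev ds1) = last ds1"
      using ds1ne pre by (auto simp: last_rev hd_rev)
    have "tau_word l Z (map w ws) (map w2 ws)"
      unfolding m1 m2
    proof (rule tau_word.down)
      show "l \<notin> set (map w (rev ds1) @ map w wsuf)" using l(2) ld by auto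
      show "map w (rev ds1) \<noteq> []" using ds1ne by simp
      show "sorted_wrt (>) (map w (rev ds1))" using srt1(1) by (simp add: rev_map[symmetric] sorted_wrt_rev)
      show "last (map w (rev post)) \<le> hd (map w (rev ds1))" if "map w (rev post) \<noteq> []"
        using mx that ds1 ds1ne lastds by (simp add: last_map hd_map last_rev)
      show "map w wsuf = [] \<or> last (map w (rev ds1)) \<le> hd (map w wsuf)"
        using cnd ds1ne lastds by (cases "wsuf = []") (auto simp: last_map hd_map)
    qed
    moreover have "filter (\<lambda>i. w2 i = l) ws = filter (\<lambda>i. w i = l) wp"
    proof -
      have "w2 i = w i" if "i \<in> set post" for i using wps(1) that by simp
      then have 1: "filter (\<lambda>i. w2 i = l) (rev post) = filter (\<lambda>i. w i = l) (rev post)" by (intro filter_cong) auto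
      have 2: "filter (\<lambda>i. w i = l) (rev ds1) = []" using ld by (auto simp: filter_empty_conv)
      have "set (map w2 ds) = set (map w ds1 @ [Z])" using w2(2) ds1 by simp
      then have "l \<notin> set (map w2 ds)" using ld lZ(1) by auto
      then have 3: "filter (\<lambda>i. w2 i = l) (rev ds1 @ [c]) = []" using ds1 by (auto simp: filter_empty_conv)
      have "w2 i = w i" if "i \<in> set wsuf" for i using wps(2) that by simp
      then have 4: "filter (\<lambda>i. w2 i = l) wsuf = []" using lpost by (auto simp: filter_empty_conv)
      have "ws = rev post @ (rev ds1 @ [c]) @ wsuf" using ws(1) pre by simp
      then have "filter (\<lambda>i. w2 i = l) ws = filter (\<lambda>i. w i = l) (rev post)"
        using 1 3 4 by (simp only: filter_append append_Nil append_Nil2)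
      then show ?thesis using pre 2 by simp
    qed
    ultimately show ?thesis using w2(1) act by auto
  qed
qed

text \<open>\<open>tau\<close> fixes the list \<open>cs\<close> before the loop. Since a pass leaves
  the higher letters \<open>l\<close> in their rows, the first j elements of \<open>cs\<close>
  remain the current rows of \<open>l\<close>.\<close>

lemma tau_fold:
  assumes ws: "sorted_wrt (<) ws" "W = set ws" and lZ: "l < Z"
    and j: "j \<le> length cs" "filter (\<lambda>i. w i = l) ws = take j cs"
    and inv: "tau_word_inv l Z (map w ws)"
  shows "\<exists>w2. fold (\<lambda>r. tau_step Z (if r = 0 then None else Some (cs ! (r - 1))) (cs ! r)) (rev [0..<j]) (graph W w)
      = graph W w2 \<and> (tau_word l Z ^^ j) (map w ws) (map w2 ws) \<and> tau_word_inv l Z (map w2 ws) \<and> l \<notin> w2 ` W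
      \<and> descent_word (map w2 ws) = descent_word (map w ws)"
  using j inv
proof (induction j arbitrary: w)
  case 0
  then show ?case using ws(2) by (intro exI[of _ w]) (auto simp: filter_empty_conv)
next
  case (Suc j)
  have tk: "take (Suc j) cs = take j cs @ [cs ! j]" using Suc.prems(1) by (simp add: take_Suc_conv_app_nth)
  define c where "c = cs ! j"
  have "c \<in> set (filter (\<lambda>i. w i = l) ws)" unfolding Suc.prems(2) tk c_def by simp
  then have "\<exists>x\<in>set ws. w x = l" by auto
  then obtain wp x wsuf where sp: "ws = wp @ x # wsuf" "w x = l" "\<forall>i\<in>set wsuf. w i \<noteq> l"
    using split_list_last_prop[of ws "\<lambda>i. w i = l"] by metis
  have "filter (\<lambda>i. w i = l) ws = filter (\<lambda>i. w i = l) wp @ [x]"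
    using sp by (auto simp: filter_empty_conv)
  then have fw: "filter (\<lambda>i. w i = l) wp = take j cs" and x: "x = c"
    using Suc.prems(2) unfolding tk c_def by auto
  have c': "(if j = 0 then None else Some (cs ! (j - 1)))
    = (let ps = filter (\<lambda>i. w i = l) wp in if ps = [] then None else Some (last ps))"
    unfolding fw Let_def using Suc.prems(1) by (cases j) (auto simp: take_Suc_conv_app_nth)
  have rng: "l \<le> w i \<and> w i \<le> Z" if "i \<in> W" for i
    using Suc.prems(3) that ws(2) by (auto simp: tau_word_inv_def)
  have lsuf: "l \<notin> w ` set wsuf" using sp(3) by auto
  obtain w1 where w1: "tau_step Z (if j = 0 then None else Some (cs ! (j - 1))) c (graph W w) = graph W w1"
    "tau_word l Z (map w ws) (map w1 ws)" "filter (\<lambda>i. w1 i = l) ws = filter (\<lambda>i. w i = l) wp"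
    using tau_step_graph[OF sp(1)[unfolded x] ws(1,2) sp(2)[unfolded x] lsuf lZ _ c'] rng by blast
  obtain w2 where w2: "fold (\<lambda>r. tau_step Z (if r = 0 then None else Some (cs ! (r - 1))) (cs ! r)) (rev [0..<j]) (graph W w1)
      = graph W w2" "(tau_word l Z ^^ j) (map w1 ws) (map w2 ws)" "tau_word_inv l Z (map w2 ws)" "l \<notin> w2 ` W"
      "descent_word (map w2 ws) = descent_word (map w1 ws)"
    using Suc.IH[of w1] Suc.prems(1) w1(3) fw tau_word_inv[OF w1(2) Suc.prems(3)] by auto
  have "(tau_word l Z ^^ Suc j) (map w ws) (map w2 ws)" using relpowp_Suc_I2[OF w1(2) w2(2)] .
  moreover have "fold (\<lambda>r. tau_step Z (if r = 0 then None else Some (cs ! (r - 1))) (cs ! r)) (rev [0..<Suc j]) (graph W w)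
    = graph W w2"
    using w1(1) w2(1) by (simp add: c_def)
  ultimately show ?case using w2 tau_word_dl[OF w1(2) Suc.prems(3)] by (intro exI[of _ w2]) simp
qed

text \<open>Each pass adds one \<open>Z\<close>, so the number of passes shows in the result and
  injectivity for a fixed number suffices.\<close>

lemma relpowp_tst:
  assumes "(tau_word l Z ^^ k) xs ys" "tau_word_inv l Z xs"
  shows "filter (\<lambda>a. a \<noteq> l \<and> a \<noteq> Z) ys = filter (\<lambda>a. a \<noteq> l \<and> a \<noteq> Z) xs"
    and "count_list ys Z = k + count_list xs Z"
    and "(tau_word l Z ^^ k) xs' ys \<Longrightarrow> tau_word_inv l Z xs' \<Longrightarrow> xs' = xs"
proof -
  have "filter (\<lambda>a. a \<noteq> l \<and> a \<noteq> Z) ys = filter (\<lambda>a. a \<noteq> l \<and> a \<noteq> Z) xs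
    \<and> count_list ys Z = k + count_list xs Z \<and> (\<forall>xs'. (tau_word l Z ^^ k) xs' ys \<longrightarrow> tau_word_inv l Z xs' \<longrightarrow> xs' = xs)"
    using assms
  proof (induction k arbitrary: xs)
    case (Suc k)
    then obtain m where m: "tau_word l Z xs m" "(tau_word l Z ^^ k) m ys" by (metis relpowp_Suc_D2)
    note inv = tau_word_inv[OF m(1) Suc.prems(2)]
    note IH = Suc.IH[OF m(2) inv]
    have "xs' = xs" if t: "(tau_word l Z ^^ Suc k) xs' ys" "tau_word_inv l Z xs'" for xs'
    proof -
      obtain m' where m': "tau_word l Z xs' m'" "(tau_word l Z ^^ k) m' ys" using relpowp_Suc_D2[OF t(1)] by blast
      then have "m' = m" using IH tau_word_inv[OF m'(1) that(2)] by blast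
      then show ?thesis using tau_word_inj[OF m'(1) that(2), of xs] m(1) Suc.prems(2) by simp
    qed
    then show ?case
      using IH tau_word_filter[OF m(1)] tau_word_count[OF m(1)] Suc.prems(2) by (auto simp: tau_word_inv_def)
  qed auto
  then show "filter (\<lambda>a. a \<noteq> l \<and> a \<noteq> Z) ys = filter (\<lambda>a. a \<noteq> l \<and> a \<noteq> Z) xs"
    "count_list ys Z = k + count_list xs Z"
    "(tau_word l Z ^^ k) xs' ys \<Longrightarrow> tau_word_inv l Z xs' \<Longrightarrow> xs' = xs" by blast+
qed

lemma tau_graph:
  assumes fin: "finite Q" and w: "\<And>i. i \<in> Q \<Longrightarrow> l \<le> w i \<and> w i \<le> z" and lz: "l \<le> z"
  shows "\<exists>v k. tau l z (graph Q w) = graph Q (\<lambda>i. v i - 1)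
    \<and> (tau_word l (z + 1) ^^ k) (map w (sorted_list_of_set Q)) (map v (sorted_list_of_set Q))
    \<and> tau_word_inv l (z + 1) (map w (sorted_list_of_set Q))
    \<and> (\<forall>i\<in>Q. l < v i \<and> v i \<le> z + 1) \<and> descent_word (map v (sorted_list_of_set Q)) = descent_word (map w (sorted_list_of_set Q))"
proof -
  let ?ws = "sorted_list_of_set Q"
  have ws: "sorted_wrt (<) ?ws" "Q = set ?ws" using fin by auto
  have inv: "tau_word_inv l (z + 1) (map w ?ws)"
    unfolding tau_word_inv_def
  proof (intro conjI allI impI)
    have lt: "a \<le> z" "l \<le> a" if "a \<in> set (map w ?ws)" for a using that w fin by auto
    show "l < z + 1" using lz by simp
    show "set (map w ?ws) \<subseteq> {l..z + 1}" using lt by fastforce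
    show "z + 1 \<notin> set pre" if "map w ?ws = pre @ l # suf" for pre suf
      using lt(1)[of "z + 1"] that by auto
  qed
  define cs where "cs = sorted_list_of_set (column (graph Q w) l)"
  have cs: "filter (\<lambda>i. w i = l) ?ws = cs"
  proof -
    have "sorted_wrt (<) (filter (\<lambda>i. w i = l) ?ws)" by (simp add: sorted_wrt_filter)
    moreover have "set (filter (\<lambda>i. w i = l) ?ws) = column (graph Q w) l" using fin by (auto simp: column_graph)
    ultimately show ?thesis unfolding cs_def using sorted_list_of_set_set by metis
  qed
  have lz1: "l < z + 1" using lz by simp
  have tk: "filter (\<lambda>i. w i = l) ?ws = take (length cs) cs" using cs by simp
  obtain v where v: "fold (\<lambda>r. tau_step (z + 1) (if r = 0 then None else Some (cs ! (r - 1))) (cs ! r)) (rev [0..<length cs]) (graph Q w)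
      = graph Q v" "(tau_word l (z + 1) ^^ length cs) (map w ?ws) (map v ?ws)" "tau_word_inv l (z + 1) (map v ?ws)" "l \<notin> v ` Q"
      "descent_word (map v ?ws) = descent_word (map w ?ws)"
    using tau_fold[OF ws lz1 order_refl tk inv] by blast
  have "tau l z (graph Q w) = (\<lambda>(i, j). (i, j - 1)) ` {C \<in> graph Q v. snd C \<noteq> l}"
    unfolding tau_def Let_def cs_def[symmetric] v(1) ..
  also have "{C \<in> graph Q v. snd C \<noteq> l} = graph Q v" using v(4) by (auto simp: graph_def)
  also have "(\<lambda>(i, j). (i, j - 1)) ` graph Q v = graph Q (\<lambda>i. v i - 1)" by (auto simp: graph_def image_image)
  finally have t: "tau l z (graph Q w) = graph Q (\<lambda>i. v i - 1)" .
  have "l < v i \<and> v i \<le> z + 1" if "i \<in> Q" for i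
  proof -
    have "v i \<in> set (map v ?ws)" using that fin by simp
    then have "l \<le> v i" "v i \<le> z + 1" using v(3) by (auto simp: tau_word_inv_def)
    moreover have "v i \<noteq> l" using v(4) that by auto
    ultimately show ?thesis by simp
  qed
  then show ?thesis using t v(2,5) inv by blast
qed

lemma sorted_list_filter:
  "finite Q \<Longrightarrow> sorted_list_of_set {i \<in> Q. R i} = filter R (sorted_list_of_set (Q :: int set))"
  by (rule strict_sorted_equal) (auto simp: sorted_wrt_filter)

lemma tau_props:
  assumes fin: "finite Q" and w: "\<And>i. i \<in> Q \<Longrightarrow> l \<le> w i \<and> w i \<le> z" and lz: "l \<le> z"
  shows "\<exists>u. tau l z (graph Q w) = graph Q u \<and> (\<forall>i\<in>Q. l \<le> u i \<and> u i \<le> z)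
     \<and> map w (sorted_list_of_set {i \<in> Q. w i \<noteq> l}) = map (\<lambda>i. u i + 1) (sorted_list_of_set {i \<in> Q. u i \<noteq> z})
     \<and> (\<forall>r\<in>Q. \<forall>d\<in>Q. r < d \<and> (\<forall>x\<in>Q. \<not> (r < x \<and> x < d)) \<longrightarrow> (w d < w r \<longleftrightarrow> u d < u r))"
proof -
  let ?ws = "sorted_list_of_set Q"
  obtain v k where v: "tau l z (graph Q w) = graph Q (\<lambda>i. v i - 1)"
    "(tau_word l (z + 1) ^^ k) (map w ?ws) (map v ?ws)" "tau_word_inv l (z + 1) (map w ?ws)"
    "\<forall>i\<in>Q. l < v i \<and> v i \<le> z + 1" "descent_word (map v ?ws) = descent_word (map w ?ws)"
    using tau_graph[of Q l w z, OF fin _ lz] w by blast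
  have "filter (\<lambda>a. a \<noteq> l \<and> a \<noteq> z + 1) (map v ?ws) = filter (\<lambda>a. a \<noteq> l \<and> a \<noteq> z + 1) (map w ?ws)"
    using relpowp_tst(1)[OF v(2,3)] .
  moreover have "filter (\<lambda>a. a \<noteq> l \<and> a \<noteq> z + 1) (map v ?ws) = map v (filter (\<lambda>i. v i \<noteq> z + 1) ?ws)"
    unfolding filter_map o_def using v(4) fin by (intro arg_cong[where f = "map v"] filter_cong) auto
  moreover have "filter (\<lambda>a. a \<noteq> l \<and> a \<noteq> z + 1) (map w ?ws) = map w (filter (\<lambda>i. w i \<noteq> l) ?ws)"
    unfolding filter_map o_def using w fin by (intro arg_cong[where f = "map w"] filter_cong) fastforce+
  ultimately have "map w (sorted_list_of_set {i \<in> Q. w i \<noteq> l}) = map v (sorted_list_of_set {i \<in> Q. v i \<noteq> z + 1})"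
    using fin by (simp add: sorted_list_filter)
  moreover have "{i \<in> Q. v i - 1 \<noteq> z} = {i \<in> Q. v i \<noteq> z + 1}" by auto
  moreover have "w d < w r \<longleftrightarrow> v d < v r" if rd: "r \<in> Q" "d \<in> Q" "r < d" "\<forall>x\<in>Q. \<not> (r < x \<and> x < d)" for r d
  proof -
    obtain m where m: "m < length ?ws" "r = ?ws ! m" using rd(1) fin by (metis in_set_conv_nth set_sorted_list_of_set)
    obtain n where n: "n < length ?ws" "d = ?ws ! n" using rd(2) fin by (metis in_set_conv_nth set_sorted_list_of_set)
    have mono: "?ws ! a < ?ws ! b" if "a < b" "b < length ?ws" for a b
      using that strict_sorted_list_of_set[of Q] by (simp add: sorted_wrt_iff_nth_less)
    have "m < n" using mono[of n m] m n rd(3) by (cases m n rule: linorder_cases) auto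
    moreover have "\<not> Suc m < n"
    proof
      assume "Suc m < n"
      moreover from this have "?ws ! Suc m \<in> set ?ws" using n(1) by (intro nth_mem) simp
      ultimately have "?ws ! Suc m \<in> Q" "r < ?ws ! Suc m" "?ws ! Suc m < d"
        using n m mono[of m "Suc m"] mono[of "Suc m" n] fin by simp_all
      then show False using rd(4) by blast
    qed
    ultimately have nm: "n = Suc m" by simp
    have "descent_word (map w ?ws) ! m = (w d < w r)" "descent_word (map v ?ws) ! m = (v d < v r)"
      using n m nm by (simp_all add: descent_word_nth)
    then show ?thesis using v(5) by simp
  qed
  ultimately show ?thesis using v(1,4) by (intro exI[of _ "\<lambda>i. v i - 1"]) auto
qed

lemma tau_inj:
  assumes fin: "finite Q" and w: "\<And>i. i \<in> Q \<Longrightarrow> l \<le> w i \<and> w i \<le> z" and lz: "l \<le> z"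
    and w': "\<And>i. i \<in> Q \<Longrightarrow> l \<le> w' i \<and> w' i \<le> z"
    and eq: "tau l z (graph Q w) = tau l z (graph Q w')" and i: "i \<in> Q"
  shows "w i = w' i"
proof -
  let ?ws = "sorted_list_of_set Q"
  obtain v k where v: "tau l z (graph Q w) = graph Q (\<lambda>i. v i - 1)"
    "(tau_word l (z + 1) ^^ k) (map w ?ws) (map v ?ws)" "tau_word_inv l (z + 1) (map w ?ws)"
    using tau_graph[of Q l w z, OF fin _ lz] w by blast
  obtain v' k' where v': "tau l z (graph Q w') = graph Q (\<lambda>i. v' i - 1)"
    "(tau_word l (z + 1) ^^ k') (map w' ?ws) (map v' ?ws)" "tau_word_inv l (z + 1) (map w' ?ws)"
    using tau_graph[of Q l w' z, OF fin _ lz] w' by blast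
  have "v i = v' i" if "i \<in> Q" for i using v(1) v'(1) eq that by (simp add: graph_eq_iff)
  then have vv: "map v ?ws = map v' ?ws" using fin by simp
  have "count_list (map w ?ws) (z + 1) = 0" "count_list (map w' ?ws) (z + 1) = 0"
    using w w' fin by (fastforce simp: count_list_0_iff)+
  then have "k = k'" using relpowp_tst(2)[OF v(2,3)] relpowp_tst(2)[OF v'(2,3)] vv by simp
  then have "map w' ?ws = map w ?ws" using relpowp_tst(3)[OF v(2,3), of "map w' ?ws"] v' vv by simp
  then show ?thesis using fin i by simp
qed

section \<open>The map g on a rectangle\<close>

lemma ex_fun_map: "distinct xs \<Longrightarrow> length vs = length xs \<Longrightarrow> \<exists>f. map f xs = vs"
proof -
  assume "distinct xs" "length vs = length xs"
  then have "map (\<lambda>x. the (map_of (zip xs vs) x)) xs = vs"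
    by (intro nth_equalityI) (auto simp: map_of_zip_nth)
  then show ?thesis by blast
qed

lemma card_less_nth:
  fixes Q :: "int set"
  assumes "finite Q" "k < card Q"
  shows "card {x \<in> Q. x < sorted_list_of_set Q ! k} = k"
proof -
  let ?ws = "sorted_list_of_set Q"
  have lt: "a < b \<Longrightarrow> b < length ?ws \<Longrightarrow> ?ws ! a < ?ws ! b" for a b
    using strict_sorted_list_of_set[of Q] by (simp add: sorted_wrt_iff_nth_less)
  have "{x \<in> Q. x < ?ws ! k} = (!) ?ws ` {..<k}"
  proof (intro equalityI subsetI)
    fix x assume x: "x \<in> {x \<in> Q. x < ?ws ! k}"
    then have "x \<in> set ?ws" using assms by simp
    then obtain m where m: "m < length ?ws" "x = ?ws ! m" unfolding in_set_conv_nth by blast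
    then have "m < k" using lt[of k m] x by (cases m k rule: linorder_cases) auto
    then show "x \<in> (!) ?ws ` {..<k}" using m by blast
  next
    fix x assume "x \<in> (!) ?ws ` {..<k}"
    then obtain m where m: "m < k" "x = ?ws ! m" by blast
    then have "m < length ?ws" using assms by simp
    then have "x \<in> set ?ws" unfolding m(2) by (rule nth_mem)
    then show "x \<in> {x \<in> Q. x < ?ws ! k}" using m lt[of m k] assms by simp
  qed
  moreover have "inj_on ((!) ?ws) {..<k}"
    using assms by (intro inj_on_nth) auto
  ultimately show ?thesis by (simp add: card_image)
qed

text \<open>The order-reversing bijection of \<open>Q\<close> onto itself.\<close>

definition mirror :: "int set \<Rightarrow> int \<Rightarrow> int" where
  "mirror Q i = sorted_list_of_set Q ! (card Q - 1 - card {x \<in> Q. x < i})"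

lemma mirror_nth: "finite Q \<Longrightarrow> k < card Q \<Longrightarrow> mirror Q (sorted_list_of_set Q ! k) = sorted_list_of_set Q ! (card Q - 1 - k)"
  unfolding mirror_def by (simp add: card_less_nth)

lemma mem_nth: "finite Q \<Longrightarrow> i \<in> (Q :: int set) \<Longrightarrow> \<exists>k<card Q. i = sorted_list_of_set Q ! k"
  by (metis in_set_conv_nth length_sorted_list_of_set set_sorted_list_of_set)

lemma nth_mem': "finite Q \<Longrightarrow> k < card Q \<Longrightarrow> sorted_list_of_set Q ! k \<in> (Q :: int set)"
  by (metis length_sorted_list_of_set nth_mem set_sorted_list_of_set)

lemma mirror_mem: "finite Q \<Longrightarrow> i \<in> Q \<Longrightarrow> mirror Q i \<in> Q"
proof -
  assume Q: "finite Q" "i \<in> Q"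
  then obtain k where "k < card Q" "i = sorted_list_of_set Q ! k" using mem_nth by blast
  then show ?thesis using mirror_nth[OF Q(1)] nth_mem'[OF Q(1), of "card Q - 1 - k"] by simp
qed

lemma mirror_rv: "finite Q \<Longrightarrow> i \<in> Q \<Longrightarrow> mirror Q (mirror Q i) = i"
proof -
  assume Q: "finite Q" "i \<in> Q"
  then obtain k where "k < card Q" "i = sorted_list_of_set Q ! k" using mem_nth by blast
  then show ?thesis using mirror_nth[OF Q(1)] by simp
qed

lemma mirror_less: "finite Q \<Longrightarrow> i \<in> Q \<Longrightarrow> j \<in> Q \<Longrightarrow> mirror Q i < mirror Q j \<longleftrightarrow> j < i"
proof -
  assume Q: "finite Q" "i \<in> Q" "j \<in> Q"
  obtain k where k: "k < card Q" "i = sorted_list_of_set Q ! k" using mem_nth Q by blast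
  obtain m where m: "m < card Q" "j = sorted_list_of_set Q ! m" using mem_nth Q by blast
  have lt: "sorted_list_of_set Q ! a < sorted_list_of_set Q ! b \<longleftrightarrow> a < b" if "a < card Q" "b < card Q" for a b
  proof -
    have lt: "a < b \<Longrightarrow> b < card Q \<Longrightarrow> sorted_list_of_set Q ! a < sorted_list_of_set Q ! b" for a b
      using strict_sorted_list_of_set[of Q] by (simp add: sorted_wrt_iff_nth_less)
    show ?thesis using lt[of a b] lt[of b a] that by (cases a b rule: linorder_cases) auto
  qed
  show ?thesis using mirror_nth[OF Q(1)] k m lt by simp linarith
qed

lemma mirror_image:
  assumes "finite Q" "K \<subseteq> Q"
  shows "mirror Q ` K \<subseteq> Q" "card (mirror Q ` K) = card K" "mirror Q ` mirror Q ` K = K" "mirror Q ` (Q - K) = Q - mirror Q ` K"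
proof -
  show "mirror Q ` K \<subseteq> Q" using mirror_mem[OF assms(1)] assms(2) by blast
  have inj: "inj_on (mirror Q) Q" by (metis assms(1) inj_onI mirror_rv)
  then show "card (mirror Q ` K) = card K" using assms(2) by (metis card_image inj_on_subset)
  show "mirror Q ` mirror Q ` K = K" using mirror_rv[OF assms(1)] assms(2) by (force simp: image_image)
  have "mirror Q ` Q = Q" using mirror_mem[OF assms(1)] mirror_rv[OF assms(1)] by (metis image_iff subsetI subset_antisym)
  then show "mirror Q ` (Q - K) = Q - mirror Q ` K" using inj assms(2) by (metis inj_on_image_set_diff Diff_subset)
qed

text \<open>Reversing \<open>Q\<close> sends what lies above a row of \<open>K\<close> to what lies
  below its image, so the mirror image is a solution. It is the only one, as the condition fixes how
  many rows of \<open>Q\<close> lie below each of its rows.\<close>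

lemma g_last_rows_eq:
  assumes fin: "finite Q" and K: "K \<subseteq> Q"
  shows "g_last_rows Q K = mirror Q ` K"
  unfolding g_last_rows_def
proof (rule the_equality)
  have finK: "finite K" using fin K finite_subset by blast
  note im = mirror_image[OF fin K]
  have "sorted_list_of_set (mirror Q ` K) = rev (map (mirror Q) (sorted_list_of_set K))"
  proof (rule strict_sorted_equal)
    have "sorted_wrt (\<lambda>x y. mirror Q y < mirror Q x) (sorted_list_of_set K)"
      by (rule sorted_wrt_mono_rel[OF _ strict_sorted_list_of_set]) (use mirror_less[OF fin] K finK in auto)
    then show "sorted_wrt (<) (rev (map (mirror Q) (sorted_list_of_set K)))"
      by (simp add: sorted_wrt_rev sorted_wrt_map)
  qed (use finK in auto)
  then have rev: "rev (sorted_list_of_set (mirror Q ` K)) = map (mirror Q) (sorted_list_of_set K)" by simp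
  have "card {x \<in> Q - mirror Q ` K. rev (sorted_list_of_set (mirror Q ` K)) ! i < x}
      = card {x \<in> Q - K. x < sorted_list_of_set K ! i}" if i: "i < card K" for i
  proof -
    let ?k = "sorted_list_of_set K ! i"
    have k: "?k \<in> Q" using nth_mem'[OF finK i] K by blast
    have "{x \<in> Q - mirror Q ` K. mirror Q ?k < x} = mirror Q ` {x \<in> Q - K. x < ?k}"
    proof (intro equalityI subsetI)
      fix x assume x: "x \<in> {x \<in> Q - mirror Q ` K. mirror Q ?k < x}"
      then obtain y where y: "y \<in> Q - K" "x = mirror Q y" using im(4) by blast
      then show "x \<in> mirror Q ` {x \<in> Q - K. x < ?k}" using x mirror_less[OF fin k, of y] by auto
    next
      fix x assume "x \<in> mirror Q ` {x \<in> Q - K. x < ?k}"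
      then obtain y where y: "y \<in> Q - K" "x = mirror Q y" "y < ?k" by blast
      then have "x \<in> Q - mirror Q ` K" using im(4) by blast
      then show "x \<in> {x \<in> Q - mirror Q ` K. mirror Q ?k < x}" using y mirror_less[OF fin k, of y] by auto
    qed
    moreover have "card (mirror Q ` {x \<in> Q - K. x < ?k}) = card {x \<in> Q - K. x < ?k}"
      by (rule mirror_image(2)[OF fin]) auto
    ultimately show ?thesis unfolding rev using i by simp
  qed
  then have Z: "mirror Q ` K \<subseteq> Q \<and> card (mirror Q ` K) = card K \<and>
    (\<forall>i<card K. card {x \<in> Q - mirror Q ` K. rev (sorted_list_of_set (mirror Q ` K)) ! i < x}
      = card {x \<in> Q - K. x < sorted_list_of_set K ! i})" using im(1,2) by blast
  then show "mirror Q ` K \<subseteq> Q \<and> card (mirror Q ` K) = card K \<and>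
    (\<forall>i<card K. card {x \<in> Q - mirror Q ` K. rev (sorted_list_of_set (mirror Q ` K)) ! i < x}
      = card {x \<in> Q - K. x < sorted_list_of_set K ! i})" .
  fix X assume X: "X \<subseteq> Q \<and> card X = card K \<and>
    (\<forall>i<card K. card {x \<in> Q - X. rev (sorted_list_of_set X) ! i < x} = card {x \<in> Q - K. x < sorted_list_of_set K ! i})"
  let ?l = "\<lambda>i. card {x \<in> Q - K. x < sorted_list_of_set K ! i}"
  \<comment> \<open>Counting from 0 at the bottom, below row i of \<open>Y\<close> lie the
    prescribed number of rows outside \<open>Y\<close> and the i rows of \<open>Y\<close> counted
    before.\<close>
  have key: "card {x \<in> Q. rev (sorted_list_of_set Y) ! i < x} = ?l i + i"
    if Y: "Y \<subseteq> Q \<and> card Y = card K \<and> (\<forall>i<card K. card {x \<in> Q - Y. rev (sorted_list_of_set Y) ! i < x} = ?l i)"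
      and i: "i < card K" for Y i
  proof -
    let ?ys = "sorted_list_of_set Y" and ?a = "rev (sorted_list_of_set Y) ! i"
    have finY: "finite Y" using Y fin finite_subset by blast
    let ?k = "card Y - 1 - i"
    have ik: "?k < card Y" using i Y by simp
    have a: "?a = ?ys ! ?k" using i Y by (simp add: rev_nth)
    have "card {x \<in> Y. x < ?ys ! ?k} = ?k" using card_less_nth[OF finY ik] .
    moreover have "Y = insert (?ys ! ?k) ({x \<in> Y. x < ?ys ! ?k} \<union> {x \<in> Y. ?ys ! ?k < x})"
      using nth_mem'[OF finY ik] by auto
    then have "card Y = Suc (card ({x \<in> Y. x < ?ys ! ?k} \<union> {x \<in> Y. ?ys ! ?k < x}))"
      using finY by (metis (no_types, lifting) Un_iff card_insert_disjoint finite_Un finite_insert mem_Collect_eq order_less_irrefl)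
    moreover have "card ({x \<in> Y. x < ?ys ! ?k} \<union> {x \<in> Y. ?ys ! ?k < x}) = card {x \<in> Y. x < ?ys ! ?k} + card {x \<in> Y. ?ys ! ?k < x}"
      by (rule card_Un_disjoint) (use finY in auto)
    ultimately have "card {x \<in> Y. ?a < x} = i" unfolding a using ik i Y by linarith
    moreover have "{x \<in> Q. ?a < x} = {x \<in> Q - Y. ?a < x} \<union> {x \<in> Y. ?a < x}" using Y by auto
    moreover have "card ({x \<in> Q - Y. ?a < x} \<union> {x \<in> Y. ?a < x}) = card {x \<in> Q - Y. ?a < x} + card {x \<in> Y. ?a < x}"
      by (rule card_Un_disjoint) (use fin finY in auto)
    ultimately show ?thesis using Y i by simp
  qed
  have above: "a = b" if "a \<in> Q" "b \<in> Q" "card {x \<in> Q. a < x} = card {x \<in> Q. b < x}" for a b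
  proof -
    have less: "card {x \<in> Q. y < x} < card {x \<in> Q. x' < x}" if "x' < y" "y \<in> Q" for x' y
      by (rule psubset_card_mono) (use fin that in auto)
    show ?thesis using less[of a b] less[of b a] that by (cases a b rule: linorder_cases) auto
  qed
  have finX: "finite X" "finite (mirror Q ` K)" using X Z fin finite_subset by blast+
  have "rev (sorted_list_of_set X) = rev (sorted_list_of_set (mirror Q ` K))"
  proof (rule nth_equalityI)
    show "length (rev (sorted_list_of_set X)) = length (rev (sorted_list_of_set (mirror Q ` K)))"
      using X Z by simp
    fix i assume "i < length (rev (sorted_list_of_set X))"
    then have i: "i < card K" using X by simp
    have "rev (sorted_list_of_set X) ! i \<in> set (rev (sorted_list_of_set X))"
      "rev (sorted_list_of_set (mirror Q ` K)) ! i \<in> set (rev (sorted_list_of_set (mirror Q ` K)))"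
      using i X Z by (intro nth_mem; simp)+
    then show "rev (sorted_list_of_set X) ! i = rev (sorted_list_of_set (mirror Q ` K)) ! i"
      using key[OF X i] key[OF Z i] X Z finX by (intro above) auto
  qed
  then show "X = mirror Q ` K" using finX by (metis rev_rev_ident set_sorted_list_of_set)
qed

lemma g_rect_graph:
  assumes fin: "finite Q" and w: "\<And>i. i \<in> Q \<Longrightarrow> l \<le> w i \<and> w i \<le> z" and lz: "l \<le> z"
  shows "\<exists>u. g_rect l z (graph Q w) = graph Q u \<and> reshuffle l z Q w u \<and> {i \<in> Q. u i = z} = mirror Q ` {i \<in> Q. w i = l}"
proof -
  let ?K = "{i \<in> Q. w i = l}"
  let ?K' = "mirror Q ` ?K"
  have K: "?K \<subseteq> Q" by auto
  note im = mirror_image[OF fin K]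
  have A: "Q - ?K = {i \<in> Q. w i \<noteq> l}" by auto
  let ?A = "sorted_list_of_set (Q - ?K)" and ?A' = "sorted_list_of_set (Q - ?K')"
  have len: "length ?A' = length ?A" using im fin by (simp add: card_Diff_subset finite_subset)
  obtain f where f: "map f ?A' = map (\<lambda>i. w i - 1) ?A"
    using ex_fun_map[of ?A' "map (\<lambda>i. w i - 1) ?A"] len by auto
  define u where "u i = (if i \<in> ?K' then z else f i)" for i
  have mu: "map u ?A' = map (\<lambda>i. w i - 1) ?A"
    unfolding f[symmetric] using fin by (auto simp: u_def)
  have uA: "l \<le> u i \<and> u i < z" if "i \<in> Q - ?K'" for i
  proof -
    have "u i \<in> set (map u ?A')" using that fin by simp
    then obtain j where "j \<in> Q - ?K" "u i = w j - 1" unfolding mu using fin by auto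
    then show ?thesis using w[of j] by auto
  qed
  have uz: "{i \<in> Q. u i = z} = ?K'"
  proof (intro equalityI subsetI)
    fix i assume "i \<in> {i \<in> Q. u i = z}"
    then show "i \<in> ?K'" using uA[of i] by auto
  qed (use im(1) in \<open>auto simp: u_def\<close>)
  have A': "Q - ?K' = {i \<in> Q. u i \<noteq> z}" using uz by auto
  have "reshuffle l z Q w u"
    unfolding reshuffle_def
  proof
    show "\<forall>i\<in>Q. w i \<in> {l..z} \<and> u i \<in> {l..z}"
    proof
      fix i assume i: "i \<in> Q"
      show "w i \<in> {l..z} \<and> u i \<in> {l..z}" using w[OF i] uA[of i] i lz by (cases "i \<in> ?K'") (auto simp: u_def)
    qed
    have "map (\<lambda>i. u i + 1) ?A' = map (\<lambda>a. a + 1) (map u ?A')" by simp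
    also have "\<dots> = map w ?A" unfolding mu by simp
    finally show "map w (sorted_list_of_set {i \<in> Q. w i \<noteq> l}) = map (\<lambda>i. u i + 1) (sorted_list_of_set {i \<in> Q. u i \<noteq> z})"
      unfolding A[symmetric] A'[symmetric] by simp
  qed
  moreover have "g_rect l z (graph Q w) = graph Q u"
  proof -
    have E: "map (\<lambda>i. col_at (graph Q w) i - 1) ?A = map (\<lambda>i. w i - 1) ?A" using fin by auto
    have "g_rect l z (graph Q w) = ?K' \<times> {z} \<union> set (zip ?A' (map u ?A'))"
      unfolding g_rect_def Let_def rows_graph column_graph g_last_rows_eq[OF fin K] E mu by (rule refl)
    also have "\<dots> = graph Q u"
    proof -
      have X: "X \<times> {z} \<union> graph (Q - X) u = graph Q u" if "X \<subseteq> Q" "\<And>i. i \<in> X \<Longrightarrow> u i = z" for X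
        using that by (auto simp: graph_def)
      have "set ?A' = Q - ?K'" using fin by simp
      then have "set (zip ?A' (map u ?A')) = graph (Q - ?K') u" unfolding set_zip_map graph_def by simp
      then show ?thesis using X[OF im(1)] by (simp add: u_def)
    qed
    finally show ?thesis .
  qed
  ultimately show ?thesis using uz by blast
qed

text \<open>Inversions among kept entries correspond under \<open>\<theta>\<close>. An entry in
  column l is least and is inverted with the kept entries above it; one in column z is greatest and
  is inverted with those below it. \<open>mirror\<close> interchanges these two situations.\<close>

lemma g_inversions:
  assumes fin: "finite Q" and sh: "reshuffle l z Q w u" and K: "{i \<in> Q. u i = z} = mirror Q ` {i \<in> Q. w i = l}"
  shows "card {(r, e) \<in> Q \<times> Q. r < e \<and> w e < w r} = card {(r, e) \<in> Q \<times> Q. r < e \<and> u e < u r}"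
proof -
  have rng: "l \<le> w i \<and> w i \<le> z \<and> l \<le> u i \<and> u i \<le> z" if "i \<in> Q" for i using sh that by (auto simp: reshuffle_def)
  obtain \<theta> where th: "bij_betw \<theta> {i \<in> Q. w i \<noteq> l} {i \<in> Q. u i \<noteq> z}"
    "\<And>i j. i \<in> Q \<Longrightarrow> w i \<noteq> l \<Longrightarrow> j \<in> Q \<Longrightarrow> w j \<noteq> l \<Longrightarrow> i < j \<Longrightarrow> \<theta> i < \<theta> j"
    "\<And>i. i \<in> Q \<Longrightarrow> w i \<noteq> l \<Longrightarrow> u (\<theta> i) = w i - 1"
    by (rule reshuffle_theta[OF fin sh], rule that; blast)
  let ?A = "{i \<in> Q. w i \<noteq> l}" and ?A' = "{i \<in> Q. u i \<noteq> z}" and ?K = "{i \<in> Q. w i = l}" and ?K' = "{i \<in> Q. u i = z}"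
  define X1 where "X1 = {(r, e) \<in> ?A \<times> ?A. r < e \<and> w e < w r}"
  define X2 where "X2 = {(r, e) \<in> ?A \<times> ?K. r < e}"
  define Y1 where "Y1 = {(r, e) \<in> ?A' \<times> ?A'. r < e \<and> u e < u r}"
  define Y2 where "Y2 = {(r, e) \<in> ?K' \<times> ?A'. r < e}"
  have less: "\<theta> i < \<theta> j \<longleftrightarrow> i < j" if "i \<in> ?A" "j \<in> ?A" for i j
    using th(2)[of i j] th(2)[of j i] that by (cases i j rule: linorder_cases) auto
  have "bij_betw (map_prod \<theta> \<theta>) X1 Y1"
    unfolding bij_betw_def
  proof
    have "inj_on (map_prod \<theta> \<theta>) (?A \<times> ?A)"
      using th(1) by (intro map_prod_inj_on) (auto simp: bij_betw_def)
    then show "inj_on (map_prod \<theta> \<theta>) X1" by (rule inj_on_subset) (auto simp: X1_def)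
    show "map_prod \<theta> \<theta> ` X1 = Y1"
    proof (intro equalityI subsetI)
      fix t assume "t \<in> map_prod \<theta> \<theta> ` X1"
      then obtain r e where re: "t = (\<theta> r, \<theta> e)" "r \<in> ?A" "e \<in> ?A" "r < e" "w e < w r" by (auto simp: X1_def)
      then have "\<theta> r \<in> ?A'" "\<theta> e \<in> ?A'" using bij_betwE[OF th(1)] by blast+
      then show "t \<in> Y1" using re less th(3)[of r] th(3)[of e] by (auto simp: Y1_def)
    next
      fix t assume "t \<in> Y1"
      then obtain r' e' where t: "t = (r', e')" "r' \<in> ?A'" "e' \<in> ?A'" "r' < e'" "u e' < u r'" by (auto simp: Y1_def)
      obtain r where r: "r \<in> ?A" "r' = \<theta> r" using t(2) th(1) unfolding bij_betw_def by blast
      obtain e where e: "e \<in> ?A" "e' = \<theta> e" using t(3) th(1) unfolding bij_betw_def by blast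
      have "(r, e) \<in> X1" using t r e less[OF r(1) e(1)] th(3)[of r] th(3)[of e] by (auto simp: X1_def)
      then show "t \<in> map_prod \<theta> \<theta> ` X1" using t(1) r(2) e(2) by (metis image_eqI map_prod_simp)
    qed
  qed
  then have c1: "card X1 = card Y1" by (rule bij_betw_same_card)
  have rvK: "mirror Q i \<in> ?K'" if "i \<in> ?K" for i unfolding K using that by blast
  have rvK': "mirror Q i \<in> ?K" if "i \<in> ?K'" for i
  proof -
    obtain j where j: "j \<in> ?K" "i = mirror Q j" using \<open>i \<in> ?K'\<close> unfolding K by blast
    then have "mirror Q i = j" using mirror_rv[OF fin, of j] by simp
    then show ?thesis using j by simp
  qed
  have rvA: "mirror Q i \<in> ?A'" if "i \<in> ?A" for i
  proof -
    have "mirror Q i \<in> Q" using that mirror_mem[OF fin] by blast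
    moreover have "mirror Q i \<notin> ?K'" using rvK'[of "mirror Q i"] mirror_rv[OF fin, of i] that by auto
    ultimately show ?thesis by blast
  qed
  have rvA': "mirror Q i \<in> ?A" if "i \<in> ?A'" for i
  proof -
    have "mirror Q i \<in> Q" using that mirror_mem[OF fin] by blast
    moreover have "mirror Q i \<notin> ?K" using rvK[of "mirror Q i"] mirror_rv[OF fin, of i] that by auto
    ultimately show ?thesis by blast
  qed
  have "bij_betw (\<lambda>(r, e). (mirror Q e, mirror Q r)) X2 Y2"
  proof (rule bij_betw_byWitness[where f' = "\<lambda>(r, e). (mirror Q e, mirror Q r)"])
    show "\<forall>a\<in>X2. (\<lambda>(r, e). (mirror Q e, mirror Q r)) ((\<lambda>(r, e). (mirror Q e, mirror Q r)) a) = a"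
      using mirror_rv[OF fin] by (auto simp: X2_def)
    show "\<forall>a\<in>Y2. (\<lambda>(r, e). (mirror Q e, mirror Q r)) ((\<lambda>(r, e). (mirror Q e, mirror Q r)) a) = a"
      using mirror_rv[OF fin] by (auto simp: Y2_def)
    show "(\<lambda>(r, e). (mirror Q e, mirror Q r)) ` X2 \<subseteq> Y2"
    proof
      fix t assume "t \<in> (\<lambda>(r, e). (mirror Q e, mirror Q r)) ` X2"
      then obtain r e where "t = (mirror Q e, mirror Q r)" "r \<in> ?A" "e \<in> ?K" "r < e" by (auto simp: X2_def)
      then show "t \<in> Y2" using rvA[of r] rvK[of e] mirror_less[OF fin, of e r] by (simp add: Y2_def)
    qed
    show "(\<lambda>(r, e). (mirror Q e, mirror Q r)) ` Y2 \<subseteq> X2"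
    proof
      fix t assume "t \<in> (\<lambda>(r, e). (mirror Q e, mirror Q r)) ` Y2"
      then obtain r e where "t = (mirror Q e, mirror Q r)" "r \<in> ?K'" "e \<in> ?A'" "r < e" by (auto simp: Y2_def)
      then show "t \<in> X2" using rvA'[of e] rvK'[of r] mirror_less[OF fin, of e r] by (simp add: X2_def)
    qed
  qed
  then have c2: "card X2 = card Y2" by (rule bij_betw_same_card)
  have "w e < w r \<longleftrightarrow> w r \<noteq> l \<and> (w e = l \<or> w e \<noteq> l \<and> w e < w r)"
    "u e < u r \<longleftrightarrow> u e \<noteq> z \<and> (u r = z \<or> u r \<noteq> z \<and> u e < u r)" if "r \<in> Q" "e \<in> Q" for r e
    using rng[of r] rng[of e] that by auto
  then have "{(r, e) \<in> Q \<times> Q. r < e \<and> w e < w r} = X1 \<union> X2" "{(r, e) \<in> Q \<times> Q. r < e \<and> u e < u r} = Y1 \<union> Y2"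
    unfolding X1_def X2_def Y1_def Y2_def by blast+
  moreover have "finite (Q \<times> Q)" using fin by simp
  then have "finite X1" "finite X2" "finite Y1" "finite Y2"
    by (rule rev_finite_subset; auto simp: X1_def X2_def Y1_def Y2_def)+
  then have "card (X1 \<union> X2) = card X1 + card X2" "card (Y1 \<union> Y2) = card Y1 + card Y2"
    by (intro card_Un_disjoint; auto simp: X1_def X2_def Y1_def Y2_def)+
  ultimately show ?thesis using c1 c2 by simp
qed

text \<open>As \<open>mirror\<close> is an involution, the rows of the first column are the mirror
  image of those of the last; the other entries are shifted back in order.\<close>

lemma g_rect_surj:
  assumes fin: "finite Q" and u: "\<And>i. i \<in> Q \<Longrightarrow> l \<le> u i \<and> u i \<le> z" and lz: "l \<le> z"
  shows "\<exists>w. (\<forall>i\<in>Q. l \<le> w i \<and> w i \<le> z) \<and> g_rect l z (graph Q w) = graph Q u"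
proof -
  let ?K' = "{i \<in> Q. u i = z}"
  have K': "?K' \<subseteq> Q" by auto
  define K where "K = mirror Q ` ?K'"
  note im = mirror_image[OF fin K']
  have KQ: "K \<subseteq> Q" "mirror Q ` K = ?K'" using im by (auto simp: K_def)
  let ?A = "sorted_list_of_set (Q - K)" and ?A' = "sorted_list_of_set (Q - ?K')"
  have len: "length ?A' = length ?A" using im fin K' by (simp add: card_Diff_subset finite_subset K_def)
  obtain f where f: "map f ?A = map (\<lambda>i. u i + 1) ?A'"
    using ex_fun_map[of ?A "map (\<lambda>i. u i + 1) ?A'"] len by auto
  define w where "w i = (if i \<in> K then l else f i)" for i
  have mw: "map w ?A = map (\<lambda>i. u i + 1) ?A'" unfolding f[symmetric] using fin by (auto simp: w_def)
  have wA: "l < w i \<and> w i \<le> z" if "i \<in> Q - K" for i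
  proof -
    have "w i \<in> set (map w ?A)" using that fin by simp
    then obtain j where "j \<in> Q - ?K'" "w i = u j + 1" unfolding mw using fin by auto
    then show ?thesis using u[of j] by auto
  qed
  have wl: "{i \<in> Q. w i = l} = K"
  proof (intro equalityI subsetI)
    fix i assume "i \<in> {i \<in> Q. w i = l}"
    then show "i \<in> K" using wA[of i] by auto
  qed (use KQ in \<open>auto simp: w_def\<close>)
  have w: "l \<le> w i \<and> w i \<le> z" if "i \<in> Q" for i using wA[of i] that lz by (cases "i \<in> K") (auto simp: w_def)
  obtain u2 where u2: "g_rect l z (graph Q w) = graph Q u2" "reshuffle l z Q w u2" "{i \<in> Q. u2 i = z} = mirror Q ` {i \<in> Q. w i = l}"
    using g_rect_graph[OF fin _ lz, of w] w by blast
  have eqK: "{i \<in> Q. u2 i = z} = ?K'" using u2(3) wl KQ(2) by simp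
  have s1: "{i \<in> Q. w i \<noteq> l} = Q - K" "{i \<in> Q. u2 i \<noteq> z} = Q - ?K'" using wl eqK by auto
  have "map w ?A = map (\<lambda>i. u2 i + 1) ?A'" using u2(2) unfolding reshuffle_def s1 by blast
  then have "map (\<lambda>i. u2 i + 1) ?A' = map (\<lambda>i. u i + 1) ?A'" using mw by (rule trans[OF sym])
  then have "u2 i = u i" if "i \<in> Q - ?K'" for i using that fin by (simp add: map_eq_conv)
  moreover have "u2 i = u i" if "i \<in> ?K'" for i using that eqK by auto
  ultimately have "graph Q u2 = graph Q u" unfolding graph_eq_iff by blast
  then show ?thesis using w u2(1) by auto
qed

lemma g_rect_inj:
  assumes fin: "finite Q" and w: "\<And>i. i \<in> Q \<Longrightarrow> l \<le> w i \<and> w i \<le> z" and lz: "l \<le> z"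
    and w': "\<And>i. i \<in> Q \<Longrightarrow> l \<le> w' i \<and> w' i \<le> z"
    and eq: "g_rect l z (graph Q w) = g_rect l z (graph Q w')" and i: "i \<in> Q"
  shows "w i = w' i"
proof -
  obtain u where u: "g_rect l z (graph Q w) = graph Q u" "reshuffle l z Q w u" "{i \<in> Q. u i = z} = mirror Q ` {i \<in> Q. w i = l}"
    using g_rect_graph[OF fin _ lz, of w] w by blast
  obtain v where v: "g_rect l z (graph Q w') = graph Q v" "reshuffle l z Q w' v" "{i \<in> Q. v i = z} = mirror Q ` {i \<in> Q. w' i = l}"
    using g_rect_graph[OF fin _ lz, of w'] w' by blast
  have uv: "u i = v i" if "i \<in> Q" for i using u(1) v(1) eq that by (simp add: graph_eq_iff)
  have Kuv: "{i \<in> Q. u i = z} = {i \<in> Q. v i = z}" "{i \<in> Q. u i \<noteq> z} = {i \<in> Q. v i \<noteq> z}" using uv by auto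
  have "mirror Q ` {i \<in> Q. w i = l} = mirror Q ` {i \<in> Q. w' i = l}" using u(3) v(3) Kuv(1) by (metis (no_types))
  then have "mirror Q ` mirror Q ` {i \<in> Q. w i = l} = mirror Q ` mirror Q ` {i \<in> Q. w' i = l}" by (rule arg_cong)
  moreover have "mirror Q ` mirror Q ` {i \<in> Q. w i = l} = {i \<in> Q. w i = l}"
    "mirror Q ` mirror Q ` {i \<in> Q. w' i = l} = {i \<in> Q. w' i = l}" by (rule mirror_image(3)[OF fin]; blast)+
  ultimately have KK: "{i \<in> Q. w i = l} = {i \<in> Q. w' i = l}" by (simp only:)
  then have AA: "{i \<in> Q. w i \<noteq> l} = {i \<in> Q. w' i \<noteq> l}" by auto
  have "map (\<lambda>i. u i + 1) (sorted_list_of_set {i \<in> Q. v i \<noteq> z}) = map (\<lambda>i. v i + 1) (sorted_list_of_set {i \<in> Q. v i \<noteq> z})"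
    using uv fin by simp
  then have "map w (sorted_list_of_set {i \<in> Q. w i \<noteq> l}) = map w' (sorted_list_of_set {i \<in> Q. w i \<noteq> l})"
    using u(2) v(2) Kuv(2) AA unfolding reshuffle_def by simp
  then have "w j = w' j" if "j \<in> {i \<in> Q. w i \<noteq> l}" for j using that fin by (simp add: map_eq_conv)
  moreover have "w' i = l" if "w i = l"
  proof -
    have "i \<in> {i \<in> Q. w' i = l}" using that i KK by blast
    then show ?thesis by simp
  qed
  ultimately show ?thesis using i by (cases "w i = l") auto
qed

section \<open>Running the algorithm alpha\<close>

lemma nth_move_entry:
  assumes "s \<noteq> []" "0 < card (cols (lead_rect P))" "card (cols (lead_rect P)) \<le> length s"
  shows "length (move_entry P s) = length s"
    and "k < length s \<Longrightarrow> move_entry P s ! k =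
      (if k < card (cols (lead_rect P)) - 1 then s ! Suc k
       else if k = card (cols (lead_rect P)) - 1 then s ! 0 else s ! k)"
  using assms by (auto simp: move_entry_def Let_def nth_append nth_tl hd_conv_nth min_def)

lemma nth_sorted_interval:
  assumes "k < nat (b - a + 1)"
  shows "sorted_list_of_set {a..b} ! k = a + int k"
proof -
  have "sorted_list_of_set {a..b} = [a..b]"
    by (metis set_upto distinct_upto sorted_list_of_set.idem_if_sorted_distinct sorted_upto)
  then show ?thesis using assms by (simp add: nth_upto)
qed

context moon_shuf
begin

text \<open>The rows of the leading rectangle are visible after the step, which injectivity
  uses.\<close>

lemma Q_eq: "Q = {i \<in> W. i \<in> B \<and> w' i \<le> z}"
proof (rule set_eqI)
  fix i show "i \<in> Q \<longleftrightarrow> i \<in> {i \<in> W. i \<in> B \<and> w' i \<le> z}"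
    using Q_sub[of i] uQ[of i] not_Q[of i] w'_Q[of i] w'_B[of i] by (cases "i \<in> Q") auto
qed

text \<open>Column l + k of the new shape carries the count of the old column l +
  \<open>p k\<close>, and \<open>move_entry\<close> permutes \<open>s\<close> by the same
  \<open>p\<close>. The converse direction serves surjectivity.\<close>

lemma counts_iff:
  assumes len: "length s = card (cols P)"
  shows "(\<forall>k<length (move_entry P s). counts W w' (sorted_list_of_set (cols P') ! k) = move_entry P s ! k)
    \<longleftrightarrow> (\<forall>k<length s. counts W w (sorted_list_of_set (cols P) ! k) = s ! k)"
proof -
  define m where "m = Max (cols P)"
  have cm: "cols P = {l..m}" using cols_interval by (simp add: m_def)
  have zm: "z \<le> m" using z_in(1) cm by simp
  have cl: "card (cols (lead_rect P)) = nat (z - l + 1)"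
  proof -
    have "cols (lead_rect P) = {l..z}" using B_ne by (auto simp: lead_rect_eq cols_def)
    then show ?thesis by simp
  qed
  have ls: "length s = nat (m - l + 1)" using len by (simp add: cm)
  define d where "d = nat (z - l)"
  have d: "int d = z - l" using l_le_z by (simp add: d_def)
  have cd: "card (cols (lead_rect P)) = Suc d" using d cl by simp
  have descent_word: "d < length s" using d ls zm by simp
  have s0: "s \<noteq> []" using descent_word by auto
  have mv: "length (move_entry P s) = length s"
    "k < length s \<Longrightarrow> move_entry P s ! k = (if k < d then s ! Suc k else if k = d then s ! 0 else s ! k)" for k
    using s0 nth_move_entry[of s P] s0 cd descent_word by simp_all
  have nth: "sorted_list_of_set (cols P) ! k = l + int k" if "k < length s" for k
    unfolding cm by (rule nth_sorted_interval) (use that ls in simp)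
  have c: "counts W w' (l + int k) = counts W w (l + int (if k < d then Suc k else if k = d then 0 else k))" for k
    using counts_w'(1)[of "l + int k"] counts_w'(2) counts_w'(3)[of "l + int k"] d
    by (cases k d rule: linorder_cases) (simp_all add: algebra_simps)
  define p where "p k = (if k < d then Suc k else if k = d then 0 else k)" for k
  have p: "p k < length s" if "k < length s" for k using that descent_word s0 by (simp add: p_def)
  have p': "\<exists>k<length s. p k = k'" if "k' < length s" for k'
  proof -
    consider "k' = 0" | "0 < k'" "k' \<le> d" | "d < k'" by linarith
    then show ?thesis
    proof cases
      case 1
      then show ?thesis using descent_word by (intro exI[of _ d]) (simp add: p_def)
    next
      case 2
      then show ?thesis using descent_word by (intro exI[of _ "k' - 1"]) (simp add: p_def)
    next
      case 3
      then show ?thesis using that by (intro exI[of _ k']) (simp add: p_def)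
    qed
  qed
  have "move_entry P s ! k = s ! p k" if "k < length s" for k using mv(2)[OF that] by (simp add: p_def)
  moreover have "counts W w' (l + int k) = counts W w (l + int (p k))" for k using c by (simp add: p_def)
  ultimately have "(\<forall>k<length (move_entry P s). counts W w' (sorted_list_of_set (cols P') ! k) = move_entry P s ! k)
    \<longleftrightarrow> (\<forall>k<length s. counts W w (l + int (p k)) = s ! p k)"
    using nth by (simp add: mv cols_P')
  also have "\<dots> \<longleftrightarrow> (\<forall>k<length s. counts W w (l + int k) = s ! k)" using p p' by metis
  finally show ?thesis using nth by simp
qed

end

context moon_step
begin

lemma length_move_entry:
  assumes len: "length s = card (cols P)"
  shows "length (move_entry P s) = card (cols P')"
proof -
  have "cols (lead_rect P) = {l..z}" using B_ne by (auto simp: lead_rect_eq cols_def)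
  moreover have "{l..z} \<subseteq> cols P" using cols_interval z_in(1)
    by (metis atLeastAtMost_iff atLeastatMost_subset_iff order_refl)
  ultimately have "cols (lead_rect P) \<subseteq> cols P" "cols (lead_rect P) \<noteq> {}" using l_le_z by auto
  then have "0 < card (cols (lead_rect P))" "card (cols (lead_rect P)) \<le> card (cols P)"
    using finc card_mono finite_subset card_gt_0_iff by metis+
  then show ?thesis using nth_move_entry(1)[of s P] len by (force simp: cols_P')
qed

end

text \<open>What a step of alpha requires of the map on the leading rectangle. \<open>R\<close> is
  the property that keeps the statistic: descents in neighbouring rows for \<open>tau\<close>, the
  number of inversions for \<open>g_rect\<close>.\<close>

definition rect_map :: "(int \<Rightarrow> int \<Rightarrow> cell set \<Rightarrow> cell set) \<Rightarrow> (int set \<Rightarrow> (int \<Rightarrow> int) \<Rightarrow> (int \<Rightarrow> int) \<Rightarrow> bool) \<Rightarrow> bool" where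
  "rect_map T R \<longleftrightarrow> (\<forall>l z Q w. finite Q \<longrightarrow> l \<le> z \<longrightarrow> (\<forall>i\<in>Q. l \<le> w i \<and> w i \<le> z) \<longrightarrow>
     (\<exists>u. T l z (graph Q w) = graph Q u \<and> reshuffle l z Q w u \<and> R Q w u) \<and>
     (\<forall>v. (\<forall>i\<in>Q. l \<le> v i \<and> v i \<le> z) \<longrightarrow> T l z (graph Q w) = T l z (graph Q v) \<longrightarrow> (\<forall>i\<in>Q. w i = v i)))"

definition rect_surj :: "(int \<Rightarrow> int \<Rightarrow> cell set \<Rightarrow> cell set) \<Rightarrow> bool" where
  "rect_surj T \<longleftrightarrow> (\<forall>l z Q u. finite Q \<longrightarrow> l \<le> z \<longrightarrow> (\<forall>i\<in>Q. l \<le> u i \<and> u i \<le> z) \<longrightarrow>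
     (\<exists>w. (\<forall>i\<in>Q. l \<le> w i \<and> w i \<le> z) \<and> T l z (graph Q w) = graph Q u))"

lemma rect_surjD:
  assumes "rect_surj T" "finite Q" "l \<le> z" "\<forall>i\<in>Q. l \<le> u i \<and> u i \<le> z"
  shows "\<exists>w. (\<forall>i\<in>Q. l \<le> w i \<and> w i \<le> z) \<and> T l z (graph Q w) = graph Q u"
  using assms unfolding rect_surj_def by metis

lemma rect_mapD:
  assumes "rect_map T R" "finite Q" "l \<le> z" "\<forall>i\<in>Q. l \<le> w i \<and> w i \<le> z"
  shows "\<exists>u. T l z (graph Q w) = graph Q u \<and> reshuffle l z Q w u \<and> R Q w u"
    and "\<forall>i\<in>Q. l \<le> v i \<and> v i \<le> z \<Longrightarrow> T l z (graph Q w) = T l z (graph Q v) \<Longrightarrow> i \<in> Q \<Longrightarrow> w i = v i"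
  using assms unfolding rect_map_def by blast+

context moon_step
begin

lemma lead_filling:
  assumes "\<forall>i\<in>W. (i, w i) \<in> P"
  shows "finite {i \<in> W. i \<in> B \<and> w i \<le> z}" "\<forall>i\<in>{i \<in> W. i \<in> B \<and> w i \<le> z}. l \<le> w i \<and> w i \<le> z"
  using finB l_le assms by auto

lemma step_graph:
  assumes T: "rect_map T R" and w: "\<forall>i\<in>W. (i, w i) \<in> P"
  shows "\<exists>u. moon_shuf P W w u \<and> T l z (graph (moon_shuf.Q P W w) w) = graph (moon_shuf.Q P W w) u
    \<and> R (moon_shuf.Q P W w) w u \<and> replace_rect T P (graph W w) = graph W (moon_shuf.w' P W w u)"
proof -
  obtain u where u: "T l z (graph {i \<in> W. i \<in> B \<and> w i \<le> z} w) = graph {i \<in> W. i \<in> B \<and> w i \<le> z} u"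
    "reshuffle l z {i \<in> W. i \<in> B \<and> w i \<le> z} w u" "R {i \<in> W. i \<in> B \<and> w i \<le> z} w u"
    using rect_mapD(1)[OF T lead_filling(1) l_le_z lead_filling(2)] w by blast
  interpret ms: moon_shuf P W w u by unfold_locales (use w u in auto)
  show ?thesis
    using u ms.replace_eq[of T] ms.moon_shuf_axioms unfolding ms.Q_def[symmetric] by blast
qed

lemma step_fillings:
  assumes T: "rect_map T R" and len: "length s = card (cols P)" and M: "M \<in> fillings P s A"
  shows "replace_rect T P M \<in> fillings P' (move_entry P s) A"
proof -
  obtain W w where w: "M = graph W w" "\<forall>i\<in>W. (i, w i) \<in> P" "rows P - W = A"
    "\<forall>k<length s. counts W w (sorted_list_of_set (cols P) ! k) = s ! k"
    using M unfolding mem_fillings[OF fin] by blast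
  obtain u where u: "moon_shuf P W w u" "replace_rect T P (graph W w) = graph W (moon_shuf.w' P W w u)"
    using step_graph[OF T w(2)] by blast
  interpret ms: moon_shuf P W w u by fact
  have "finite P'" using moon_P' by (simp add: moon_polyomino_def)
  then show ?thesis
    unfolding mem_fillings[OF \<open>finite P'\<close>]
    using w u(2) ms.w'P' ms.counts_iff[OF len] rows_P' by metis
qed

text \<open>The result shows \<open>Q\<close> and the image of the rectangle. Injectivity of
  \<open>T\<close> recovers the entries in it, and the others are shifted by a known amount.\<close>

lemma step_inj:
  assumes T: "rect_map T R" and M: "M \<in> fillings P s A" "M' \<in> fillings P s A"
    and eq: "replace_rect T P M = replace_rect T P M'"
  shows "M = M'"
proof -
  obtain W w where w: "M = graph W w" "\<forall>i\<in>W. (i, w i) \<in> P" using M(1) unfolding mem_fillings[OF fin] by blast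
  obtain X v where v: "M' = graph X v" "\<forall>i\<in>X. (i, v i) \<in> P" using M(2) unfolding mem_fillings[OF fin] by blast
  obtain u where u: "moon_shuf P W w u" "T l z (graph (moon_shuf.Q P W w) w) = graph (moon_shuf.Q P W w) u"
    "replace_rect T P (graph W w) = graph W (moon_shuf.w' P W w u)"
    using step_graph[OF T w(2)] by blast
  obtain y where y: "moon_shuf P X v y" "T l z (graph (moon_shuf.Q P X v) v) = graph (moon_shuf.Q P X v) y"
    "replace_rect T P (graph X v) = graph X (moon_shuf.w' P X v y)"
    using step_graph[OF T v(2)] by blast
  interpret ms: moon_shuf P W w u by fact
  interpret mv: moon_shuf P X v y by fact
  have "graph W ms.w' = graph X mv.w'" using eq unfolding w(1) v(1) u(3) y(3) .
  then have gr: "W = X \<and> (\<forall>i\<in>W. ms.w' i = mv.w' i)" by (rule graph_eq_iff[THEN iffD1])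
  then have WX: "W = X" by blast
  have wv: "ms.w' i = mv.w' i" if "i \<in> W" for i using gr that by blast
  have QQ: "ms.Q = mv.Q" unfolding ms.Q_eq mv.Q_eq using wv WX by auto
  have "graph ms.Q u = graph mv.Q y"
    unfolding graph_eq_iff using QQ wv ms.w'_Q mv.w'_Q ms.Q_sub by metis
  then have TT: "T l z (graph ms.Q w) = T l z (graph ms.Q v)" using u(2) y(2) QQ by simp
  have wQ: "\<forall>i\<in>ms.Q. l \<le> w i \<and> w i \<le> z" "\<forall>i\<in>ms.Q. l \<le> v i \<and> v i \<le> z"
    using ms.Q_sub mv.Q_sub QQ by auto
  have "w i = v i" if i: "i \<in> W" for i
  proof (cases "i \<in> ms.Q")
    case True
    show ?thesis by (rule rect_mapD(2)[OF T ms.finQ l_le_z wQ(1) wQ(2) TT True])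
  next
    case False
    then show ?thesis using wv[OF i] QQ ms.w'_B[of i] mv.w'_B[of i] ms.w'_out[of i] mv.w'_out[of i]
      by (cases "i \<in> B") auto
  qed
  then show ?thesis using w(1) v(1) WX by (simp add: graph_eq_iff)
qed

lemma step_surj:
  assumes T: "rect_map T R" "rect_surj T" and len: "length s = card (cols P)"
    and M: "M \<in> fillings P' (move_entry P s) A"
  shows "M \<in> replace_rect T P ` fillings P s A"
proof -
  have finP': "finite P'" using moon_P' by (simp add: moon_polyomino_def)
  obtain W x where x: "M = graph W x" "\<forall>i\<in>W. (i, x i) \<in> P'" "rows P' - W = A"
    "\<forall>k<length (move_entry P s). counts W x (sorted_list_of_set (cols P') ! k) = move_entry P s ! k"
    using M unfolding mem_fillings[OF finP'] by blast
  define Q where "Q = {i \<in> W. i \<in> B \<and> x i \<le> z}"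
  have finQ: "finite Q" using finB by (simp add: Q_def)
  have xQ: "\<forall>i\<in>Q. l \<le> x i \<and> x i \<le> z"
  proof
    fix i assume "i \<in> Q"
    then show "l \<le> x i \<and> x i \<le> z" using x(2) mem_P'[of i "x i"] l_le[of i "x i"] by (simp add: Q_def)
  qed
  obtain w0 where w0: "\<forall>i\<in>Q. l \<le> w0 i \<and> w0 i \<le> z" "T l z (graph Q w0) = graph Q x"
    using rect_surjD[OF T(2) finQ l_le_z xQ] by blast
  \<comment> \<open>A preimage in the rectangle, combined with the inverse of the relabelling
    elsewhere.\<close>
  define w where "w i = (if i \<in> Q then w0 i else if i \<in> B then x i else x i + 1)" for i
  have wP: "\<forall>i\<in>W. (i, w i) \<in> P"
  proof
    fix i assume i: "i \<in> W"
    show "(i, w i) \<in> P"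
      using x(2)[rule_format, OF i] mem_P'[of i "x i"] in_rect[of i "w0 i"] w0(1)
      by (cases "i \<in> Q"; cases "i \<in> B") (auto simp: w_def Q_def)
  qed
  have Q: "{i \<in> W. i \<in> B \<and> w i \<le> z} = Q"
    using w0(1) by (auto simp: w_def Q_def)
  obtain u where u: "moon_shuf P W w u" "T l z (graph (moon_shuf.Q P W w) w) = graph (moon_shuf.Q P W w) u"
    "replace_rect T P (graph W w) = graph W (moon_shuf.w' P W w u)"
    using step_graph[OF T(1) wP] by blast
  interpret ms: moon_shuf P W w u by fact
  have QQ: "ms.Q = Q" using Q by (simp add: ms.Q_def)
  have "graph Q w = graph Q w0" by (simp add: graph_eq_iff w_def)
  then have "graph Q u = graph Q x" using w0(2) u(2) QQ by simp
  then have ux: "u i = x i" if "i \<in> Q" for i using that by (simp add: graph_eq_iff)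
  have "ms.w' i = x i" if "i \<in> W" for i
    using ux QQ ms.w'_Q[of i] ms.w'_B[of i] ms.w'_out[of i] ms.Q_sub[of i]
    by (cases "i \<in> Q"; cases "i \<in> B") (auto simp: w_def)
  then have g: "graph W ms.w' = graph W x" by (simp add: graph_eq_iff)
  have col_count: "counts W x = counts W ms.w'"
  proof
    fix j
    have "{i \<in> W. x i = j} = {i \<in> W. ms.w' i = j}" using \<open>\<And>i. i \<in> W \<Longrightarrow> ms.w' i = x i\<close> by auto
    then show "counts W x j = counts W ms.w' j" by (simp add: counts_def)
  qed
  have "\<forall>k<length s. counts W w (sorted_list_of_set (cols P) ! k) = s ! k"
    using x(4) ms.counts_iff[OF len] col_count by simp
  moreover have "rows P - W = A" using x(3) rows_P' by simp
  ultimately have "graph W w \<in> fillings P s A" unfolding mem_fillings[OF fin] using wP by blast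
  then show ?thesis using x(1) u(3) g by (metis imageI)
qed

end

text \<open>To be used with maj for f and with ne for g; surjectivity is conditional because it is
  wanted for g.\<close>

lemma run_alpha_props:
  assumes T: "rect_map T R"
    and stat: "\<And>P W w u. moon_shuf P W w u \<Longrightarrow> R (moon_shuf.Q P W w) w u \<Longrightarrow>
      stat P (graph W w) = stat (move_column P) (graph W (moon_shuf.w' P W w u))"
  shows "moon_polyomino P \<Longrightarrow> length s = card (cols P) \<Longrightarrow> (N, s') = alpha P s \<Longrightarrow>
    F = (\<lambda>M. snd (run_alpha (replace_rect T) P M)) \<Longrightarrow>
    moon_polyomino N \<and> left_aligned N \<and> F ` fillings P s A \<subseteq> fillings N s' A
    \<and> inj_on F (fillings P s A) \<and> (\<forall>M\<in>fillings P s A. stat P M = stat N (F M))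
    \<and> (rect_surj T \<longrightarrow> fillings N s' A \<subseteq> F ` fillings P s A)"
proof (induction "card (gap_set P)" arbitrary: P s F rule: less_induct)
  case less
  show ?case
  proof (cases "left_aligned P")
    case True
    then have "N = P" "s' = s" "F = (\<lambda>M. M)"
      using less.prems(3,4) unfolding alpha_def by (simp_all add: run_alpha_unfold[where P = P])
    then show ?thesis using less.prems(1) True by simp
  next
    case False
    interpret moon P by unfold_locales (rule less.prems(1))
    interpret st: moon_step P by unfold_locales (rule False)
    let ?P = "move_column P" and ?s = "move_entry P s"
    let ?S = "replace_rect T P" and ?F = "\<lambda>M. snd (run_alpha (replace_rect T) (move_column P) M)"
    have F: "F = (\<lambda>M. ?F (?S M))"
      using less.prems(4) False by (simp add: run_alpha_unfold[where P = P])
    have a: "(N, s') = alpha ?P ?s"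
      using less.prems(3) False unfolding alpha_def by (simp add: run_alpha_unfold[where P = P])
    have IH: "moon_polyomino N \<and> left_aligned N \<and> ?F ` fillings ?P ?s A \<subseteq> fillings N s' A
      \<and> inj_on ?F (fillings ?P ?s A) \<and> (\<forall>M\<in>fillings ?P ?s A. stat ?P M = stat N (?F M))
      \<and> (rect_surj T \<longrightarrow> fillings N s' A \<subseteq> ?F ` fillings ?P ?s A)"
      by (rule less.hyps[OF st.gap_less st.moon_P' st.length_move_entry[OF less.prems(2)] a refl])
    have S: "?S M \<in> fillings ?P ?s A" if "M \<in> fillings P s A" for M
      using st.step_fillings[OF T less.prems(2) that] .
    have inj: "inj_on F (fillings P s A)"
    proof (rule inj_onI)
      fix M M' assume M: "M \<in> fillings P s A" "M' \<in> fillings P s A" "F M = F M'"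
      then have "?S M = ?S M'" using IH S unfolding F by (meson inj_onD)
      then show "M = M'" using st.step_inj[OF T M(1,2)] by blast
    qed
    have st1: "stat P M = stat ?P (?S M)" if M: "M \<in> fillings P s A" for M
    proof -
      obtain W w where w: "M = graph W w" "\<forall>i\<in>W. (i, w i) \<in> P" using M unfolding mem_fillings[OF fin] by blast
      show ?thesis using st.step_graph[OF T w(2)] stat w(1) by metis
    qed
    have sub: "F ` fillings P s A \<subseteq> fillings N s' A" using IH S unfolding F by blast
    have eq: "stat P M = stat N (F M)" if "M \<in> fillings P s A" for M
      using st1[OF that] S[OF that] IH unfolding F by simp
    have sup: "fillings N s' A \<subseteq> F ` fillings P s A" if surj: "rect_surj T"
    proof
      fix M assume M: "M \<in> fillings N s' A"
      have "fillings N s' A \<subseteq> ?F ` fillings ?P ?s A" using IH surj by argo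
      then have "M \<in> ?F ` fillings ?P ?s A" using M by (rule subsetD)
      then obtain M1 where M1: "M1 \<in> fillings ?P ?s A" "M = ?F M1" by (rule imageE)
      then obtain M0 where "M0 \<in> fillings P s A" "M1 = ?S M0"
        using st.step_surj[OF T surj less.prems(2) M1(1)] by blast
      then show "M \<in> F ` fillings P s A" using M1(2) unfolding F by blast
    qed
    have "moon_polyomino N" "left_aligned N" using IH by argo+
    then show ?thesis using sub inj eq sup by (intro conjI ballI impI)
  qed
qed

lemma rect_map_tau:
  "rect_map tau (\<lambda>Q w u. \<forall>r\<in>Q. \<forall>d\<in>Q. r < d \<and> (\<forall>x\<in>Q. \<not> (r < x \<and> x < d)) \<longrightarrow> (w d < w r \<longleftrightarrow> u d < u r))"
  (is "rect_map tau ?R")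
  unfolding rect_map_def
proof (intro allI impI conjI ballI)
  fix l z :: int and Q :: "int set" and w :: "int \<Rightarrow> int"
  assume a: "finite Q" "l \<le> z" "\<forall>i\<in>Q. l \<le> w i \<and> w i \<le> z"
  obtain u where u: "tau l z (graph Q w) = graph Q u" "\<forall>i\<in>Q. l \<le> u i \<and> u i \<le> z"
    "map w (sorted_list_of_set {i \<in> Q. w i \<noteq> l}) = map (\<lambda>i. u i + 1) (sorted_list_of_set {i \<in> Q. u i \<noteq> z})"
    "?R Q w u"
    using tau_props[of Q l w z] a by blast
  then show "\<exists>u. tau l z (graph Q w) = graph Q u \<and> reshuffle l z Q w u \<and> ?R Q w u"
    using a(3) by (intro exI[of _ u]) (simp add: reshuffle_def)
  show "w i = v i" if "\<forall>i\<in>Q. l \<le> v i \<and> v i \<le> z" "tau l z (graph Q w) = tau l z (graph Q v)" "i \<in> Q" for v i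
    using tau_inj[of Q l w z v i] a that by blast
qed

lemma rect_map_g_rect:
  "rect_map g_rect (\<lambda>Q w u. card {(r, e) \<in> Q \<times> Q. r < e \<and> w e < w r} = card {(r, e) \<in> Q \<times> Q. r < e \<and> u e < u r})"
  (is "rect_map g_rect ?R")
  unfolding rect_map_def
proof (intro allI impI conjI ballI)
  fix l z :: int and Q :: "int set" and w :: "int \<Rightarrow> int"
  assume a: "finite Q" "l \<le> z" "\<forall>i\<in>Q. l \<le> w i \<and> w i \<le> z"
  show "\<exists>u. g_rect l z (graph Q w) = graph Q u \<and> reshuffle l z Q w u \<and> ?R Q w u"
    using g_rect_graph[of Q l w z] g_inversions[of Q l z w] a by blast
  show "w i = v i" if "\<forall>i\<in>Q. l \<le> v i \<and> v i \<le> z" "g_rect l z (graph Q w) = g_rect l z (graph Q v)" "i \<in> Q" for v i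
    using g_rect_inj[of Q l w z v i] a that by blast
qed

lemma rect_surj_g_rect: "rect_surj g_rect"
  unfolding rect_surj_def using g_rect_surj by blast

section \<open>The maps f and g and their statistics\<close>

lemma f_map_props:
  assumes "moon_polyomino P" "length s = card (cols P)" "(N, s') = alpha P s"
  shows "moon_polyomino N" "left_aligned N" "f_map P ` fillings P s A \<subseteq> fillings N s' A"
    "inj_on (f_map P) (fillings P s A)" "M \<in> fillings P s A \<Longrightarrow> maj P M = maj N (f_map P M)"
proof -
  have stat: "maj P (graph W w) = maj (move_column P) (graph W (moon_shuf.w' P W w u))"
    if ms: "moon_shuf P W w u" and R: "\<forall>r\<in>moon_shuf.Q P W w. \<forall>d\<in>moon_shuf.Q P W w.
      r < d \<and> (\<forall>x\<in>moon_shuf.Q P W w. \<not> (r < x \<and> x < d)) \<longrightarrow> (w d < w r \<longleftrightarrow> u d < u r)" for P W w u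
  proof -
    interpret ms: moon_shuf P W w u by (rule ms)
    interpret P': moon ms.P' by (rule moon.intro[OF ms.moon_P'])
    have "card (maj_pairs P W w) = card (maj_pairs ms.P' W ms.w')" by (rule ms.card_majp_eq) (use R in blast)
    then show ?thesis using ms.maj_eq[of W w] P'.maj_eq[of W ms.w'] ms.WP ms.w'P' by simp
  qed
  have "f_map P = (\<lambda>M. snd (run_alpha (replace_rect tau) P M))" by (simp add: fun_eq_iff f_map_def)
  note props = run_alpha_props[OF rect_map_tau stat assms this, of A]
  show "moon_polyomino N" "left_aligned N" "f_map P ` fillings P s A \<subseteq> fillings N s' A"
    "inj_on (f_map P) (fillings P s A)" "M \<in> fillings P s A \<Longrightarrow> maj P M = maj N (f_map P M)"
    using props by simp_all
qed

lemma g_map_props: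
  assumes "moon_polyomino P" "length s = card (cols P)" "(N, s') = alpha P s"
  shows "bij_betw (g_map P) (fillings P s A) (fillings N s' A)"
    and "M \<in> fillings P s A \<Longrightarrow> ne P M = ne N (g_map P M)"
proof -
  have stat: "ne P (graph W w) = ne (move_column P) (graph W (moon_shuf.w' P W w u))"
    if ms: "moon_shuf P W w u"
      and R: "card {(r, e) \<in> moon_shuf.Q P W w \<times> moon_shuf.Q P W w. r < e \<and> w e < w r}
        = card {(r, e) \<in> moon_shuf.Q P W w \<times> moon_shuf.Q P W w. r < e \<and> u e < u r}" for P W w u
  proof -
    interpret ms: moon_shuf P W w u by (rule ms)
    interpret P': moon ms.P' by (rule moon.intro[OF ms.moon_P'])
    show ?thesis using ms.card_nep_eq[OF R] ms.ne_eq[of W w] P'.ne_eq[of W ms.w'] ms.WP ms.w'P' by simp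
  qed
  have "g_map P = (\<lambda>M. snd (run_alpha (replace_rect g_rect) P M))" by (simp add: fun_eq_iff g_map_def)
  note props = run_alpha_props[OF rect_map_g_rect stat assms this, of A]
  show "bij_betw (g_map P) (fillings P s A) (fillings N s' A)"
    "M \<in> fillings P s A \<Longrightarrow> ne P M = ne N (g_map P M)"
    using props rect_surj_g_rect by (auto simp: bij_betw_def)
qed

section \<open>Composition of the maps\<close>

lemma finite_fillings: "finite P \<Longrightarrow> finite (fillings P s A)"
  by (rule finite_subset[of _ "Pow P"]) (auto simp: fillings_def filling_def)

theorem theorem5p11:
  fixes P N :: "(int \<times> int) set"
    and s s' :: "nat list"
    and A :: "int set"
    and psi :: "(int \<times> int) set \<Rightarrow> (int \<times> int) set"
  assumes "moon_polyomino P"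
    and "length s = card (cols P)"
    and "A \<subseteq> rows P"
    and "(N, s') = alpha P s"
    and "psi = inv_into (fillings P s A) (g_map P) \<circ> phi N \<circ> f_map P"
  shows "moon_polyomino N \<and> left_aligned N
    \<and> f_map P ` fillings P s A \<subseteq> fillings N s' A
    \<and> bij_betw (g_map P) (fillings P s A) (fillings N s' A)
    \<and> phi N ` fillings N s' A \<subseteq> fillings N s' A
    \<and> bij_betw psi (fillings P s A) (fillings P s A)
    \<and> (\<forall>M\<in>fillings P s A. maj P M = int (ne P (psi M)))"
proof -
  let ?F = "fillings P s A" and ?G = "fillings N s' A"
  note f = f_map_props[OF assms(1,2,4)]
  note g = g_map_props[OF assms(1,2,4)]
  note ph = phi_props[OF f(1,2)]
  have phi: "phi N ` ?G \<subseteq> ?G" using ph(1) by blast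
  have psi: "psi M \<in> ?F" "g_map P (psi M) = phi N (f_map P M)" if "M \<in> ?F" for M
  proof -
    have "phi N (f_map P M) \<in> ?G" using f(3)[of A] phi that by blast
    then have "phi N (f_map P M) \<in> g_map P ` ?F" using g(1)[of A] by (simp add: bij_betw_def)
    then show "psi M \<in> ?F" "g_map P (psi M) = phi N (f_map P M)"
      unfolding assms(5) by (simp_all add: inv_into_into f_inv_into_f)
  qed
  \<comment> \<open>g after psi is \<open>phi\<close> after f, and the latter two are
    injective.\<close>
  have "inj_on psi ?F"
  proof (rule inj_onI)
    fix M M' assume M: "M \<in> ?F" "M' \<in> ?F" "psi M = psi M'"
    then have "phi N (f_map P M) = phi N (f_map P M')" using psi(2) by metis
    then have "f_map P M = f_map P M'" using ph(3) f(3)[of A] M by (meson image_subset_iff inj_onD)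
    then show "M = M'" using f(4)[of A] M by (meson inj_onD)
  qed
  moreover have "finite ?F" using assms(1) by (intro finite_fillings) (simp add: moon_polyomino_def)
  moreover have "psi ` ?F \<subseteq> ?F" using psi(1) by blast
  ultimately have bij: "bij_betw psi ?F ?F" by (simp add: bij_betw_def endo_inj_surj)
  have "maj P M = int (ne P (psi M))" if M: "M \<in> ?F" for M
  proof -
    have "maj P M = maj N (f_map P M)" using f(5) M .
    also have "\<dots> = int (ne N (phi N (f_map P M)))" using f(3)[of A] M by (intro ph(2)) blast
    also have "\<dots> = int (ne P (psi M))" using psi(2)[OF M] g(2)[OF psi(1)[OF M]] by simp
    finally show ?thesis .
  qed
  then show ?thesis using f(1,2,3) g(1) phi bij by blast
qed

end
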